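(* Let $p\in(1,\infty)$, $s\in(-1,1)$ and $\alpha=\frac{d-1}{p}-s$. The scaled Neumann–Poincaré operator $\widetilde{\mathbb K}^*_\alpha=\mathcal M_\alpha\widetilde K^*_\Gamma\mathcal M_\alpha^{-1}$ admits the explicit block-Toeplitz representation $$\widetilde{\mathbb K}^*_\alpha=\begin{pmatrix}\tilde K^*_0&r^{-\alpha}\tilde K^*_{-1}&r^{-2\alpha}\tilde K^*_{-2}&\cdots\\ r^{\alpha}\tilde K^*_1&\tilde K^*_0&r^{-\alpha}\tilde K^*_{-1}&\cdots\\ r^{2\alpha}\tilde K^*_2&r^{\alpha}\tilde K^*_1&\tilde K^*_0&\cdots\\ \vdots&\vdots&\vdots&\ddots\end{pmatrix},$$ that is, its blocks are $(\widetilde{\mathbb K}^*_\alpha)_{j,k}=r^{(j-k)\alpha}\tilde K^*_{j-k}$ for $j,k\ge0$, where $\tilde K^*_m:W^{s,p}_0(\Gamma_0)\to W^{s,p}_0(\Gamma_0)$, $m\in\mathbb Z$, is given by $$(\tilde K^*_m\psi)(\tilde x)=P_{0,0}\Bigl(\int_{\Gamma_0}\frac{\partial G}{\partial\nu_{\tilde x}}(\eta_m(\tilde x),\tilde y)\psi(\tilde y)\,d\sigma_0(\tilde y)\Bigr).$$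
   Context: Geometry. Let $d\in\{2,3\}$, $r\in(0,1)$, and let $\Omega_0\subset\mathbb R^d$ be a bounded connected domain with $C^\infty$ boundary $\Gamma_0=\partial\Omega_0$ and $0\notin\overline{\Omega_0}$. Put $\Omega_j=r^j\Omega_0$ and assume $\overline{\Omega_j}\cap\overline{\Omega_k}=\emptyset$ for $j\neq k$ ($j,k\ge0$). Put $\Gamma_j=r^j\Gamma_0$ and $\Gamma=\bigcup_{j\ge0}\Gamma_j$, with surface measure $\sigma$ ($\sigma_0$ on $\Gamma_0$), and let $\nu_x$ be the unit normal at $x\in\Gamma_j$ pointing out of $\Omega_j$. For $m\in\mathbb Z$ let $\eta_m(x)=r^mx$. Fundamental solution. $G(x,y)=\frac1{2\pi}\log|x-y|$ if $d=2$ and $G(x,y)=-\frac1{4\pi}|x-y|^{-1}$ if $d=3$. The expression $\frac{\partial G}{\partial\nu_{\tilde x}}(\eta_m(\tilde x),\tilde y)$ means $\nu_{\tilde x}\cdot(\nabla_1G)(\eta_m(\tilde x),\tilde y)$, with $\nabla_1$ the gradient in the first variable. Function spaces. For $\Sigma=\Gamma$ or $\Sigma=\Gamma_j$: $W^{0,p}(\Sigma)=L^p(\Sigma)$; for $s\in(0,1)$, $\|\varphi\|_{W^{s,p}(\Sigma)}^p=\|\varphi\|_{L^p(\Sigma)}^p+\int_\Sigma\int_\Sigma\frac{|\varphi(x)-\varphi(y)|^p}{|x-y|^{d-1+sp}}d\sigma(x)d\sigma(y)$; for $s\in(-1,0)$, $W^{s,p}(\Sigma)$ is the dual of $W^{-s,p'}(\Sigma)$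 for the $L^2$ pairing, $1/p+1/p'=1$. $W^{s,p}_0(\Gamma)$ is the subspace of $\varphi$ with $\int_{\Gamma_j}\varphi\,d\sigma=0$ for all $j$; $W^{s,p}_0(\Gamma_j)$ is the subspace of $W^{s,p}(\Gamma_j)$ with zero integral over $\Gamma_j$ (integrals are duality pairings with indicator functions when $s<0$). $\ell^p(\mathbb N,X)$ denotes $X$-valued $p$-summable sequences indexed by $j\ge0$. Operators. $K^*_\Gamma\varphi(x)=\sum_{j\ge0}\int_{\Gamma_j}\frac{\partial G}{\partial\nu_x}(x,y)\varphi(y)\,d\sigma(y)$ (by duality/continuous extension when $s<0$). $P_{0,j}\varphi_j=\varphi_j-\frac1{|\Gamma_j|}\int_{\Gamma_j}\varphi_j\,d\sigma$ on each $\Gamma_j$; $P_0$ acts as $P_{0,j}$ on each component; $\widetilde K^*_\Gamma=P_0K^*_\Gamma P_0$, which is the restriction of $K^*_\Gamma$ to $W^{s,p}_0(\Gamma)$. Rescaling map. $\mathcal M_\alpha:W^{s,p}_0(\Gamma)\to\ell^p(\mathbb N,W^{s,p}_0(\Gamma_0))$ is the isomorphism $(\mathcal M_\alpha\varphi)_j=r^{j\alpha}\,\varphi|_{\Gamma_j}\circ\eta_j$ (restriction and pullback by duality when $s<0$). The $(j,k)$ block of an operator on the sequence space is the operator on $W^{s,p}_0(\Gamma_0)$ sending $\psi$ to the $j$-th component of the image of the sequence with $\psi$ in position $k$ and zeros elsewhere. *)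

theory Defs
  imports "HOL-Analysis.Analysis"
begin

text \<open>
  Normalised \<open>n\<close>-dimensional Hausdorff measure on Borel sets. On a hypersurface of a
  \<open>d\<close>-dimensional space the case \<open>n = d - 1\<close> is the surface measure. Boundedness of the
  covering sets is required because \<^const>\<open>diameter\<close> is only meaningful for bounded sets.
\<close>

definition hausdorff_premeasure :: "nat \<Rightarrow> real \<Rightarrow> 'a::metric_space set \<Rightarrow> ennreal" where
  "hausdorff_premeasure n \<delta> A =
     (INF C \<in> {C :: nat \<Rightarrow> 'a set. A \<subseteq> (\<Union>i. C i) \<and> (\<forall>i. bounded (C i) \<and> diameter (C i) \<le> \<delta>)}.
        (\<Sum>i. ennreal (unit_ball_vol (real n) * (diameter (C i) / 2) ^ n)))"

definition hausdorff_outer :: "nat \<Rightarrow> 'a::metric_space set \<Rightarrow> ennreal" where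
  "hausdorff_outer n A = (SUP \<delta> \<in> {0<..}. hausdorff_premeasure n \<delta> A)"

definition surf :: "'a::euclidean_space measure" where
  "surf = measure_of UNIV (sets borel) (hausdorff_outer (DIM('a) - 1))"

definition grad :: "('a::real_inner \<Rightarrow> real) \<Rightarrow> 'a \<Rightarrow> 'a" where
  "grad f x = (THE D. GDERIV f x :> D)"

primrec Ck_on :: "nat \<Rightarrow> ('a::euclidean_space \<Rightarrow> real) \<Rightarrow> 'a set \<Rightarrow> bool" where
  "Ck_on 0 f U \<longleftrightarrow> continuous_on U f"
| "Ck_on (Suc k) f U \<longleftrightarrow>
     (\<forall>x\<in>U. f differentiable (at x)) \<and>
     (\<forall>b\<in>Basis. Ck_on k (\<lambda>x. frechet_derivative f (at x) b) U)"

text \<open>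
  A \<open>C\<^sup>\<infinity>\<close> defining function of \<open>\<Omega>\<close> near a boundary point \<open>p\<close>. Since the gradient does not
  vanish, the boundary of an open \<open>\<Omega>\<close> inside \<open>U\<close> is the hypersurface \<open>\<rho> = 0\<close>.
\<close>

definition local_defining_function ::
    "'a::euclidean_space set \<Rightarrow> 'a \<Rightarrow> 'a set \<Rightarrow> ('a \<Rightarrow> real) \<Rightarrow> bool" where
  "local_defining_function \<Omega> p U \<rho> \<longleftrightarrow>
     open U \<and> p \<in> U \<and> (\<forall>k. Ck_on k \<rho> U) \<and> (\<forall>x\<in>U. grad \<rho> x \<noteq> 0) \<and>
     \<Omega> \<inter> U = {x \<in> U. \<rho> x < 0}"

definition smooth_boundary :: "'a::euclidean_space set \<Rightarrow> bool" where
  "smooth_boundary \<Omega> \<longleftrightarrow> (\<forall>p\<in>frontier \<Omega>. \<exists>U \<rho>. local_defining_function \<Omega> p U \<rho>)"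

definition outer_normal :: "'a::euclidean_space set \<Rightarrow> 'a \<Rightarrow> 'a" where
  "outer_normal \<Omega> x =
     (THE n. \<exists>U \<rho>. local_defining_function \<Omega> x U \<rho> \<and> n = grad \<rho> x /\<^sub>R norm (grad \<rho> x))"

definition eta :: "real \<Rightarrow> int \<Rightarrow> 'a::euclidean_space \<Rightarrow> 'a" where
  "eta r m x = (r powi m) *\<^sub>R x"

definition Omega :: "real \<Rightarrow> 'a::euclidean_space set \<Rightarrow> nat \<Rightarrow> 'a set" where
  "Omega r \<Omega>\<^sub>0 j = eta r (int j) ` \<Omega>\<^sub>0"

definition Gam :: "real \<Rightarrow> 'a::euclidean_space set \<Rightarrow> nat \<Rightarrow> 'a set" where
  "Gam r \<Omega>\<^sub>0 j = eta r (int j) ` frontier \<Omega>\<^sub>0"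

definition Gamma_union :: "real \<Rightarrow> 'a::euclidean_space set \<Rightarrow> 'a set" where
  "Gamma_union r \<Omega>\<^sub>0 = (\<Union>j. Gam r \<Omega>\<^sub>0 j)"

definition component_index :: "real \<Rightarrow> 'a::euclidean_space set \<Rightarrow> 'a \<Rightarrow> nat" where
  "component_index r \<Omega>\<^sub>0 x = (THE j. x \<in> Gam r \<Omega>\<^sub>0 j)"

definition nu :: "real \<Rightarrow> 'a::euclidean_space set \<Rightarrow> 'a \<Rightarrow> 'a" where
  "nu r \<Omega>\<^sub>0 x = outer_normal (Omega r \<Omega>\<^sub>0 (component_index r \<Omega>\<^sub>0 x)) x"

definition admissible_geometry :: "real \<Rightarrow> 'a::euclidean_space set \<Rightarrow> bool" where
  "admissible_geometry r \<Omega>\<^sub>0 \<longleftrightarrow>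
     0 < r \<and> r < 1 \<and>
     open \<Omega>\<^sub>0 \<and> connected \<Omega>\<^sub>0 \<and> bounded \<Omega>\<^sub>0 \<and> \<Omega>\<^sub>0 \<noteq> {} \<and> smooth_boundary \<Omega>\<^sub>0 \<and>
     0 \<notin> closure \<Omega>\<^sub>0 \<and>
     (\<forall>j k. j \<noteq> k \<longrightarrow> closure (Omega r \<Omega>\<^sub>0 j) \<inter> closure (Omega r \<Omega>\<^sub>0 k) = {})"

text \<open>The \<open>else\<close> branch is the three-dimensional formula; only dimensions 2 and 3 are used.\<close>

definition G :: "'a::euclidean_space \<Rightarrow> 'a \<Rightarrow> real" where
  "G x y = (if DIM('a) = 2 then 1 / (2 * pi) * ln (norm (x - y))
            else - 1 / (4 * pi) * inverse (norm (x - y)))"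

definition grad1_G :: "'a::euclidean_space \<Rightarrow> 'a \<Rightarrow> 'a" where
  "grad1_G x y = grad (\<lambda>z. G z y) x"

text \<open>
  For \<open>0 \<le> s < 1\<close> elements are represented by complex-valued Borel functions vanishing off
  \<open>S\<close> (not by almost-everywhere classes). For \<open>-1 < s < 0\<close> elements are bounded linear
  functionals on the space with exponents \<open>-s\<close> and \<open>p / (p - 1)\<close>, for the bilinear pairing
  \<open>\<integral> f g d\<sigma>\<close>; they are \<^const>\<open>extensional\<close> on that space.
\<close>

definition sobolev_energy ::
    "real \<Rightarrow> real \<Rightarrow> 'a::euclidean_space set \<Rightarrow> ('a \<Rightarrow> complex) \<Rightarrow> ennreal" where
  "sobolev_energy s p S \<phi> =
     (\<integral>\<^sup>+x\<in>S. ennreal (norm (\<phi> x) powr p) \<partial>surf) +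
     (if s = 0 then 0 else
       (\<integral>\<^sup>+x\<in>S. (\<integral>\<^sup>+y\<in>S. ennreal (norm (\<phi> x - \<phi> y) powr p /
            norm (x - y) powr (real DIM('a) - 1 + s * p)) \<partial>surf) \<partial>surf))"

definition sobolev_norm ::
    "real \<Rightarrow> real \<Rightarrow> 'a::euclidean_space set \<Rightarrow> ('a \<Rightarrow> complex) \<Rightarrow> real" where
  "sobolev_norm s p S \<phi> = enn2real (sobolev_energy s p S \<phi>) powr (1 / p)"

definition W :: "real \<Rightarrow> real \<Rightarrow> 'a::euclidean_space set \<Rightarrow> ('a \<Rightarrow> complex) set" where
  "W s p S = {\<phi>. \<phi> \<in> borel_measurable borel \<and> (\<forall>x. x \<notin> S \<longrightarrow> \<phi> x = 0) \<and>
                 sobolev_energy s p S \<phi> < \<infinity>}"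

definition conj_exp :: "real \<Rightarrow> real" where
  "conj_exp p = p / (p - 1)"

text \<open>The predual of the space of order \<open>s < 0\<close>.\<close>

abbreviation W_test :: "real \<Rightarrow> real \<Rightarrow> 'a::euclidean_space set \<Rightarrow> ('a \<Rightarrow> complex) set" where
  "W_test s p S \<equiv> W (- s) (conj_exp p) S"

definition W_neg ::
    "real \<Rightarrow> real \<Rightarrow> 'a::euclidean_space set \<Rightarrow> (('a \<Rightarrow> complex) \<Rightarrow> complex) set" where
  "W_neg s p S = {\<Phi>. \<Phi> \<in> extensional (W_test s p S) \<and>
     (\<forall>g\<in>W_test s p S. \<forall>h\<in>W_test s p S. \<Phi> (\<lambda>x. g x + h x) = \<Phi> g + \<Phi> h) \<and>
     (\<forall>c. \<forall>g\<in>W_test s p S. \<Phi> (\<lambda>x. c * g x) = c * \<Phi> g) \<and>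
     (\<exists>B. \<forall>g\<in>W_test s p S. norm (\<Phi> g) \<le> B * sobolev_norm (- s) (conj_exp p) S g)}"

definition dual_norm ::
    "real \<Rightarrow> real \<Rightarrow> 'a::euclidean_space set \<Rightarrow> (('a \<Rightarrow> complex) \<Rightarrow> complex) \<Rightarrow> real" where
  "dual_norm s p S \<Phi> =
     Sup {norm (\<Phi> g) | g. g \<in> W_test s p S \<and> sobolev_norm (- s) (conj_exp p) S g \<le> 1}"

definition W0_comp :: "real \<Rightarrow> real \<Rightarrow> 'a::euclidean_space set \<Rightarrow> ('a \<Rightarrow> complex) set" where
  "W0_comp s p S = {\<phi> \<in> W s p S. (LINT x:S|surf. \<phi> x) = 0}"

definition W0 :: "real \<Rightarrow> real \<Rightarrow> real \<Rightarrow> 'a::euclidean_space set \<Rightarrow> ('a \<Rightarrow> complex) set" where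
  "W0 s p r \<Omega>\<^sub>0 =
     {\<phi> \<in> W s p (Gamma_union r \<Omega>\<^sub>0). \<forall>j. (LINT x:Gam r \<Omega>\<^sub>0 j|surf. \<phi> x) = 0}"

definition W0_neg_comp ::
    "real \<Rightarrow> real \<Rightarrow> 'a::euclidean_space set \<Rightarrow> (('a \<Rightarrow> complex) \<Rightarrow> complex) set" where
  "W0_neg_comp s p S = {\<Phi> \<in> W_neg s p S. \<Phi> (indicator S) = 0}"

definition W0_neg ::
    "real \<Rightarrow> real \<Rightarrow> real \<Rightarrow> 'a::euclidean_space set \<Rightarrow> (('a \<Rightarrow> complex) \<Rightarrow> complex) set" where
  "W0_neg s p r \<Omega>\<^sub>0 =
     {\<Phi> \<in> W_neg s p (Gamma_union r \<Omega>\<^sub>0). \<forall>j. \<Phi> (indicator (Gam r \<Omega>\<^sub>0 j)) = 0}"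

definition P0_comp :: "'a::euclidean_space set \<Rightarrow> ('a \<Rightarrow> complex) \<Rightarrow> 'a \<Rightarrow> complex" where
  "P0_comp S \<phi> x = (if x \<in> S then \<phi> x - (1 / measure surf S) *\<^sub>R (LINT y:S|surf. \<phi> y) else 0)"

definition P0 ::
    "real \<Rightarrow> 'a::euclidean_space set \<Rightarrow> ('a \<Rightarrow> complex) \<Rightarrow> 'a \<Rightarrow> complex" where
  "P0 r \<Omega>\<^sub>0 \<phi> x =
     (if x \<in> Gamma_union r \<Omega>\<^sub>0 then P0_comp (Gam r \<Omega>\<^sub>0 (component_index r \<Omega>\<^sub>0 x)) \<phi> x else 0)"

definition NP_adj ::
    "real \<Rightarrow> 'a::euclidean_space set \<Rightarrow> ('a \<Rightarrow> complex) \<Rightarrow> 'a \<Rightarrow> complex" where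
  "NP_adj r \<Omega>\<^sub>0 \<phi> x =
     (if x \<in> Gamma_union r \<Omega>\<^sub>0
      then (\<Sum>j. (LINT y:Gam r \<Omega>\<^sub>0 j|surf. (nu r \<Omega>\<^sub>0 x \<bullet> grad1_G x y) *\<^sub>R \<phi> y)) else 0)"

text \<open>The \<open>L\<^sup>2\<close>-transpose of \<^const>\<open>NP_adj\<close>: same kernel, integrated in its first variable.\<close>

definition NP ::
    "real \<Rightarrow> 'a::euclidean_space set \<Rightarrow> ('a \<Rightarrow> complex) \<Rightarrow> 'a \<Rightarrow> complex" where
  "NP r \<Omega>\<^sub>0 g y =
     (if y \<in> Gamma_union r \<Omega>\<^sub>0
      then (\<Sum>j. (LINT x:Gam r \<Omega>\<^sub>0 j|surf. (nu r \<Omega>\<^sub>0 x \<bullet> grad1_G x y) *\<^sub>R g x)) else 0)"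

definition NP_adj_tilde ::
    "real \<Rightarrow> 'a::euclidean_space set \<Rightarrow> ('a \<Rightarrow> complex) \<Rightarrow> 'a \<Rightarrow> complex" where
  "NP_adj_tilde r \<Omega>\<^sub>0 \<phi> = P0 r \<Omega>\<^sub>0 (NP_adj r \<Omega>\<^sub>0 (P0 r \<Omega>\<^sub>0 \<phi>))"

definition rescale ::
    "real \<Rightarrow> real \<Rightarrow> 'a::euclidean_space set \<Rightarrow> ('a \<Rightarrow> complex) \<Rightarrow> nat \<Rightarrow> 'a \<Rightarrow> complex" where
  "rescale \<alpha> r \<Omega>\<^sub>0 \<phi> j x =
     (if x \<in> frontier \<Omega>\<^sub>0 then (r powr (real j * \<alpha>)) *\<^sub>R \<phi> (eta r (int j) x) else 0)"

definition K_int ::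
    "real \<Rightarrow> 'a::euclidean_space set \<Rightarrow> int \<Rightarrow> ('a \<Rightarrow> complex) \<Rightarrow> 'a \<Rightarrow> complex" where
  "K_int r \<Omega>\<^sub>0 m \<psi> x =
     (if x \<in> frontier \<Omega>\<^sub>0
      then (LINT y:frontier \<Omega>\<^sub>0|surf. (outer_normal \<Omega>\<^sub>0 x \<bullet> grad1_G (eta r m x) y) *\<^sub>R \<psi> y) else 0)"

definition K_tilde ::
    "real \<Rightarrow> 'a::euclidean_space set \<Rightarrow> int \<Rightarrow> ('a \<Rightarrow> complex) \<Rightarrow> 'a \<Rightarrow> complex" where
  "K_tilde r \<Omega>\<^sub>0 m \<psi> = P0_comp (frontier \<Omega>\<^sub>0) (K_int r \<Omega>\<^sub>0 m \<psi>)"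

text \<open>The \<open>L\<^sup>2\<close>-transpose of \<^const>\<open>K_int\<close>.\<close>

definition K_int_transpose ::
    "real \<Rightarrow> 'a::euclidean_space set \<Rightarrow> int \<Rightarrow> ('a \<Rightarrow> complex) \<Rightarrow> 'a \<Rightarrow> complex" where
  "K_int_transpose r \<Omega>\<^sub>0 m h y =
     (if y \<in> frontier \<Omega>\<^sub>0
      then (LINT x:frontier \<Omega>\<^sub>0|surf. (outer_normal \<Omega>\<^sub>0 x \<bullet> grad1_G (eta r m x) y) *\<^sub>R h x) else 0)"

text \<open>
  The projections are symmetric for the \<open>L\<^sup>2\<close> pairing, so they act on functionals by
  \<open>\<langle>P\<^sub>0 \<Phi>, g\<rangle> = \<langle>\<Phi>, P\<^sub>0 g\<rangle>\<close>.
\<close>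

definition P0_neg ::
    "real \<Rightarrow> real \<Rightarrow> real \<Rightarrow> 'a::euclidean_space set \<Rightarrow>
     (('a \<Rightarrow> complex) \<Rightarrow> complex) \<Rightarrow> ('a \<Rightarrow> complex) \<Rightarrow> complex" where
  "P0_neg s p r \<Omega>\<^sub>0 \<Phi> = (\<lambda>g \<in> W_test s p (Gamma_union r \<Omega>\<^sub>0). \<Phi> (P0 r \<Omega>\<^sub>0 g))"

definition P0_neg_comp ::
    "real \<Rightarrow> real \<Rightarrow> 'a::euclidean_space set \<Rightarrow>
     (('a \<Rightarrow> complex) \<Rightarrow> complex) \<Rightarrow> ('a \<Rightarrow> complex) \<Rightarrow> complex" where
  "P0_neg_comp s p S \<Phi> = (\<lambda>h \<in> W_test s p S. \<Phi> (P0_comp S h))"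

definition NP_adj_neg ::
    "real \<Rightarrow> real \<Rightarrow> real \<Rightarrow> 'a::euclidean_space set \<Rightarrow>
     (('a \<Rightarrow> complex) \<Rightarrow> complex) \<Rightarrow> ('a \<Rightarrow> complex) \<Rightarrow> complex" where
  "NP_adj_neg s p r \<Omega>\<^sub>0 \<Phi> = (\<lambda>g \<in> W_test s p (Gamma_union r \<Omega>\<^sub>0). \<Phi> (NP r \<Omega>\<^sub>0 g))"

definition NP_adj_tilde_neg ::
    "real \<Rightarrow> real \<Rightarrow> real \<Rightarrow> 'a::euclidean_space set \<Rightarrow>
     (('a \<Rightarrow> complex) \<Rightarrow> complex) \<Rightarrow> ('a \<Rightarrow> complex) \<Rightarrow> complex" where
  "NP_adj_tilde_neg s p r \<Omega>\<^sub>0 \<Phi> =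
     P0_neg s p r \<Omega>\<^sub>0 (NP_adj_neg s p r \<Omega>\<^sub>0 (P0_neg s p r \<Omega>\<^sub>0 \<Phi>))"

text \<open>
  Substituting \<open>x = eta r j x'\<close> in the pairing of the pulled-back \<open>\<phi>\<close> with \<open>h\<close> over the
  reference surface produces the Jacobian factor \<open>r powr (- j * (d - 1))\<close>.
\<close>

definition rescale_neg ::
    "real \<Rightarrow> real \<Rightarrow> real \<Rightarrow> real \<Rightarrow> 'a::euclidean_space set \<Rightarrow>
     (('a \<Rightarrow> complex) \<Rightarrow> complex) \<Rightarrow> nat \<Rightarrow> ('a \<Rightarrow> complex) \<Rightarrow> complex" where
  "rescale_neg s p \<alpha> r \<Omega>\<^sub>0 \<Phi> j =
     (\<lambda>h \<in> W_test s p (frontier \<Omega>\<^sub>0).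
        (r powr (real j * \<alpha>) * r powr (- real j * (real DIM('a) - 1))) *\<^sub>R
        \<Phi> (\<lambda>x. if x \<in> Gam r \<Omega>\<^sub>0 j then h (eta r (- int j) x) else 0))"

definition K_int_neg ::
    "real \<Rightarrow> real \<Rightarrow> real \<Rightarrow> 'a::euclidean_space set \<Rightarrow> int \<Rightarrow>
     (('a \<Rightarrow> complex) \<Rightarrow> complex) \<Rightarrow> ('a \<Rightarrow> complex) \<Rightarrow> complex" where
  "K_int_neg s p r \<Omega>\<^sub>0 m \<Psi> =
     (\<lambda>h \<in> W_test s p (frontier \<Omega>\<^sub>0). \<Psi> (K_int_transpose r \<Omega>\<^sub>0 m h))"

definition K_tilde_neg ::
    "real \<Rightarrow> real \<Rightarrow> real \<Rightarrow> 'a::euclidean_space set \<Rightarrow> int \<Rightarrow>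
     (('a \<Rightarrow> complex) \<Rightarrow> complex) \<Rightarrow> ('a \<Rightarrow> complex) \<Rightarrow> complex" where
  "K_tilde_neg s p r \<Omega>\<^sub>0 m \<Psi> = P0_neg_comp s p (frontier \<Omega>\<^sub>0) (K_int_neg s p r \<Omega>\<^sub>0 m \<Psi>)"

definition ell :: "real \<Rightarrow> 'x set \<Rightarrow> ('x \<Rightarrow> real) \<Rightarrow> (nat \<Rightarrow> 'x) set" where
  "ell p X N = {f. (\<forall>j. f j \<in> X) \<and> summable (\<lambda>j. N (f j) powr p)}"

text \<open>\<open>z\<close> is the zero element of the component space.\<close>

definition block :: "'x \<Rightarrow> ((nat \<Rightarrow> 'x) \<Rightarrow> nat \<Rightarrow> 'x) \<Rightarrow> nat \<Rightarrow> nat \<Rightarrow> 'x \<Rightarrow> 'x" where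
  "block z T j k \<psi> = T ((\<lambda>i. z)(k := \<psi>)) j"

definition scaled_NP ::
    "real \<Rightarrow> real \<Rightarrow> real \<Rightarrow> real \<Rightarrow> 'a::euclidean_space set \<Rightarrow>
     (nat \<Rightarrow> 'a \<Rightarrow> complex) \<Rightarrow> nat \<Rightarrow> 'a \<Rightarrow> complex" where
  "scaled_NP s p \<alpha> r \<Omega>\<^sub>0 =
     (\<lambda>f \<in> ell p (W0_comp s p (frontier \<Omega>\<^sub>0)) (sobolev_norm s p (frontier \<Omega>\<^sub>0)).
        rescale \<alpha> r \<Omega>\<^sub>0 (NP_adj_tilde r \<Omega>\<^sub>0 (inv_into (W0 s p r \<Omega>\<^sub>0) (rescale \<alpha> r \<Omega>\<^sub>0) f)))"

definition scaled_NP_neg ::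
    "real \<Rightarrow> real \<Rightarrow> real \<Rightarrow> real \<Rightarrow> 'a::euclidean_space set \<Rightarrow>
     (nat \<Rightarrow> ('a \<Rightarrow> complex) \<Rightarrow> complex) \<Rightarrow> nat \<Rightarrow> ('a \<Rightarrow> complex) \<Rightarrow> complex" where
  "scaled_NP_neg s p \<alpha> r \<Omega>\<^sub>0 =
     (\<lambda>f \<in> ell p (W0_neg_comp s p (frontier \<Omega>\<^sub>0)) (dual_norm s p (frontier \<Omega>\<^sub>0)).
        rescale_neg s p \<alpha> r \<Omega>\<^sub>0
          (NP_adj_tilde_neg s p r \<Omega>\<^sub>0
            (inv_into (W0_neg s p r \<Omega>\<^sub>0) (rescale_neg s p \<alpha> r \<Omega>\<^sub>0) f)))"

definition zero_neg ::
    "real \<Rightarrow> real \<Rightarrow> 'a::euclidean_space set \<Rightarrow> ('a \<Rightarrow> complex) \<Rightarrow> complex" where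
  "zero_neg s p S = (\<lambda>h \<in> W_test s p S. 0)"

end

theory Submission
  imports Defs
begin

text \<open>
  The surface measure scales with the factor \<open>c\<^sup>d\<^sup>-\<^sup>1\<close> under \<open>x \<mapsto> c x\<close>, the gradient of \<open>G\<close> is homogeneous of
  degree \<open>-(d - 1)\<close> and the normals are invariant, so after rescaling the interaction of the
  components \<open>j\<close> and \<open>k\<close> depends on \<open>j - k\<close> only. What needs work is that everything acts on the Sobolev
  spaces. On a smooth surface the balls of radius \<open>R\<close> have measure \<open>O(R\<^sup>d\<^sup>-\<^sup>1)\<close> and the tangent plane
  approximates to second order, so the kernel of the diagonal block is \<open>O(|x - y|\<^sup>2\<^sup>-\<^sup>d)\<close>, with a matching
  bound for its differences, and Schur's test gives the smoothness gain. For \<open>s < 0\<close> the operators are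
  transposes; a functional on the union is evaluated by splitting a test function into its components,
  and the tails of this splitting vanish because the projected potential of a single component decays
  fast enough near \<open>0\<close>.
\<close>

subsection \<open>Hausdorff measure\<close>

text \<open>Two conventions of the definitions shape the work. First, elements of the spaces are
  genuine functions and integrals are total: \<open>grad1_G\<close> is unspecified on the diagonal,
  a divergent Bochner integral is 0, and \<open>surf\<close> is the Hausdorff measure only once
  countable additivity on Borel sets is known. Hence the kernel is replaced by the field
  \<open>newton_field\<close>, which alters it at one null point, and additivity of the transposed
  operators is established almost everywhere, so that boundedness of a functional is needed to
  identify functions that agree almost everywhere. Second, functionals are extensional: for negative
  order an operator has a meaningful value only after its argument has been shown to lie in the test
  space. Mapping properties are therefore needed even for identities that are formally a change of
  variables. All estimates rest on an upper growth bound for the measure of balls, which holds on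
  the whole union with a single constant; boundaries of measure zero are carried along as a
  degenerate case.\<close>

definition covers_below :: "real \<Rightarrow> 'a::metric_space set \<Rightarrow> (nat \<Rightarrow> 'a set) set" where
  "covers_below \<delta> A = {C. A \<subseteq> (\<Union>i. C i) \<and> (\<forall>i. bounded (C i) \<and> diameter (C i) \<le> \<delta>)}"

definition hcost :: "nat \<Rightarrow> 'a::metric_space set \<Rightarrow> ennreal" where
  "hcost n A = ennreal (unit_ball_vol (real n) * (diameter A / 2) ^ n)"

lemma hausdorff_premeasure_alt:
  "hausdorff_premeasure n \<delta> A = (INF C \<in> covers_below \<delta> A. \<Sum>i. hcost n (C i))"
  unfolding hausdorff_premeasure_def covers_below_def hcost_def ..

text \<open>For \<open>n = 0\<close> the empty set would cost 1, since \<open>0 ^ 0 = 1\<close>.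
  Padding a cover with empty sets is free only for positive \<open>n\<close>.\<close>

lemma hcost_empty [simp]: "0 < n \<Longrightarrow> hcost n {} = 0"
  by (simp add: hcost_def)

lemma hausdorff_premeasure_le:
  "C \<in> covers_below \<delta> A \<Longrightarrow> hausdorff_premeasure n \<delta> A \<le> (\<Sum>i. hcost n (C i))"
  unfolding hausdorff_premeasure_alt by (rule INF_lower)

lemma hausdorff_premeasure_mono:
  "A \<subseteq> B \<Longrightarrow> hausdorff_premeasure n \<delta> A \<le> hausdorff_premeasure n \<delta> B"
  unfolding hausdorff_premeasure_alt
  by (rule INF_superset_mono) (auto simp: covers_below_def)

lemma hausdorff_premeasure_antimono:
  "\<delta> \<le> \<delta>' \<Longrightarrow> hausdorff_premeasure n \<delta>' A \<le> hausdorff_premeasure n \<delta> A"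
  unfolding hausdorff_premeasure_alt
  by (rule INF_superset_mono) (auto simp: covers_below_def intro: order_trans)

lemma hausdorff_premeasure_empty:
  "0 < n \<Longrightarrow> 0 < \<delta> \<Longrightarrow> hausdorff_premeasure n \<delta> {} = 0"
  using hausdorff_premeasure_le[of "\<lambda>_. {}" \<delta> "{}" n]
  by (simp add: covers_below_def)

text \<open>Near-optimal covers of the pieces, with errors \<open>e * (1/2) ^ Suc i\<close>, are
  merged into one sequence through the pairing of natural numbers.\<close>

lemma hausdorff_premeasure_UN:
  fixes A :: "nat \<Rightarrow> 'a::metric_space set"
  shows "hausdorff_premeasure n \<delta> (\<Union>i. A i) \<le> (\<Sum>i. hausdorff_premeasure n \<delta> (A i))"
proof (rule ennreal_le_epsilon)
  fix e :: real assume e: "0 < e" and fin: "(\<Sum>i. hausdorff_premeasure n \<delta> (A i)) < top"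
  \<comment> \<open>Strictness comes from finiteness: only a finite premeasure is increased by
    adding a positive number.\<close>
  have "hausdorff_premeasure n \<delta> (A i) < hausdorff_premeasure n \<delta> (A i) + ennreal (e * (1/2)^Suc i)" for i
    using e fin by (auto simp add: less_top dest!: ennreal_suminf_lessD)
  then have "\<exists>C. C \<in> covers_below \<delta> (A i) \<and>
      (\<Sum>j. hcost n (C j)) < hausdorff_premeasure n \<delta> (A i) + ennreal (e * (1/2)^Suc i)" for i
    unfolding hausdorff_premeasure_alt INF_less_iff by auto
  then obtain B where B: "\<And>i. B i \<in> covers_below \<delta> (A i)"
    and Ble: "\<And>i. (\<Sum>j. hcost n (B i j)) < hausdorff_premeasure n \<delta> (A i) + ennreal (e * (1/2)^Suc i)"
    by metis
  define C where "C = case_prod B o prod_decode"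
  have "(\<Union>i. A i) \<subseteq> (\<Union>i. C i)"
  proof
    fix x assume "x \<in> (\<Union>i. A i)"
    then obtain i j where "x \<in> B i j" using B unfolding covers_below_def by blast
    then have "x \<in> C (prod_encode (i, j))" by (simp add: C_def)
    then show "x \<in> (\<Union>i. C i)" by blast
  qed
  then have "C \<in> covers_below \<delta> (\<Union>i. A i)"
    using B by (auto simp: covers_below_def C_def split: prod.splits)
  then have "hausdorff_premeasure n \<delta> (\<Union>i. A i) \<le> (\<Sum>i. hcost n (C i))"
    by (rule hausdorff_premeasure_le)
  also have "\<dots> = (\<Sum>k. (\<lambda>p. hcost n (case_prod B p)) (prod_decode k))"
    by (simp add: C_def comp_def)
  also have "\<dots> = (\<Sum>i. \<Sum>j. hcost n (B i j))"
    by (rule suminf_ennreal_2dimen) auto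
  also have "\<dots> \<le> (\<Sum>i. hausdorff_premeasure n \<delta> (A i) + ennreal (e * (1/2)^Suc i))"
    by (intro suminf_le allI less_imp_le[OF Ble]) auto
  also have "\<dots> = (\<Sum>i. hausdorff_premeasure n \<delta> (A i)) + (\<Sum>i. ennreal e * ennreal ((1/2) ^ Suc i))"
    using e by (subst suminf_add[symmetric])
      (auto simp del: ennreal_suminf_cmult simp add: ennreal_mult[symmetric])
  also have "\<dots> = (\<Sum>i. hausdorff_premeasure n \<delta> (A i)) + e"
    unfolding ennreal_suminf_cmult
    by (subst suminf_ennreal_eq[OF zero_le_power power_half_series]) auto
  finally show "hausdorff_premeasure n \<delta> (\<Union>i. A i) \<le> (\<Sum>i. hausdorff_premeasure n \<delta> (A i)) + e" .
qed

lemma hausdorff_premeasure_le_outer: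
  "0 < \<delta> \<Longrightarrow> hausdorff_premeasure n \<delta> A \<le> hausdorff_outer n A"
  unfolding hausdorff_outer_def by (rule SUP_upper) auto

lemma hausdorff_outer_least:
  "(\<And>\<delta>. 0 < \<delta> \<Longrightarrow> hausdorff_premeasure n \<delta> A \<le> c) \<Longrightarrow> hausdorff_outer n A \<le> c"
  unfolding hausdorff_outer_def by (rule SUP_least) auto

lemma hausdorff_outer_mono: "A \<subseteq> B \<Longrightarrow> hausdorff_outer n A \<le> hausdorff_outer n B"
  by (intro hausdorff_outer_least)
     (blast intro: order_trans hausdorff_premeasure_mono hausdorff_premeasure_le_outer)

lemma hausdorff_outer_empty: "0 < n \<Longrightarrow> hausdorff_outer n {} = 0"
  using hausdorff_outer_least[of n "{}" 0] hausdorff_premeasure_empty[of n] by auto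

lemma hausdorff_outer_UN:
  fixes A :: "nat \<Rightarrow> 'a::metric_space set"
  shows "hausdorff_outer n (\<Union>i. A i) \<le> (\<Sum>i. hausdorff_outer n (A i))"
proof (rule hausdorff_outer_least)
  fix \<delta> :: real assume "0 < \<delta>"
  then show "hausdorff_premeasure n \<delta> (\<Union>i. A i) \<le> (\<Sum>i. hausdorff_outer n (A i))"
    by (intro order_trans[OF hausdorff_premeasure_UN] suminf_le hausdorff_premeasure_le_outer) auto
qed

lemma hausdorff_outer_space: "0 < n \<Longrightarrow> outer_measure_space UNIV (hausdorff_outer n)"
  by (simp add: outer_measure_space_def positive_def hausdorff_outer_empty increasing_def
      hausdorff_outer_mono countably_subadditive_def hausdorff_outer_UN)

lemma hausdorff_outer_Un:
  assumes n: "0 < n"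
  shows "hausdorff_outer n (A \<union> B) \<le> hausdorff_outer n A + hausdorff_outer n B"
proof -
  have "hausdorff_outer n (\<Union>i. (\<lambda>i::nat. if i = 0 then A else if i = 1 then B else {}) i)
    \<le> (\<Sum>i. hausdorff_outer n ((\<lambda>i::nat. if i = 0 then A else if i = 1 then B else {}) i))"
    by (rule hausdorff_outer_UN)
  also have "\<dots> = (\<Sum>i\<in>{0,1}. hausdorff_outer n ((\<lambda>i::nat. if i = 0 then A else if i = 1 then B else {}) i))"
    by (rule suminf_finite) (auto simp: hausdorff_outer_empty n)
  also have "(\<Union>i. (\<lambda>i::nat. if i = 0 then A else if i = 1 then B else {}) i) = A \<union> B"
    by (auto split: if_splits)
  finally show ?thesis by simp
qed

text \<open>A covering set of diameter below \<open>d\<close> cannot meet both \<open>A\<close> and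
  \<open>B\<close>, so every fine cover of the union splits into two families without common
  nonempty members, one for each set.\<close>

lemma hausdorff_outer_separated:
  fixes A B :: "'a::metric_space set"
  assumes n: "0 < n" and d: "0 < d" "\<And>x y. x \<in> A \<Longrightarrow> y \<in> B \<Longrightarrow> d \<le> dist x y"
  shows "hausdorff_outer n A + hausdorff_outer n B \<le> hausdorff_outer n (A \<union> B)"
proof -
  have *: "hausdorff_premeasure n \<delta> A + hausdorff_premeasure n \<delta> B \<le> hausdorff_premeasure n \<delta> (A \<union> B)"
    if \<delta>: "0 < \<delta>" "\<delta> < d" for \<delta>
    unfolding hausdorff_premeasure_alt[of n \<delta> "A \<union> B"]
  proof (rule INF_greatest)
    fix C assume C: "C \<in> covers_below \<delta> (A \<union> B)"
    define CA where "CA i = (if C i \<inter> A \<noteq> {} then C i else {})" for i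
    define CB where "CB i = (if C i \<inter> B \<noteq> {} then C i else {})" for i
    have "CA \<in> covers_below \<delta> A" "CB \<in> covers_below \<delta> B"
      using C \<delta> unfolding covers_below_def CA_def CB_def by fastforce+
    then have "hausdorff_premeasure n \<delta> A + hausdorff_premeasure n \<delta> B
        \<le> (\<Sum>i. hcost n (CA i)) + (\<Sum>i. hcost n (CB i))"
      by (intro add_mono hausdorff_premeasure_le)
    also have "\<dots> = (\<Sum>i. hcost n (CA i) + hcost n (CB i))"
      by (rule suminf_add) auto
    also have "\<dots> \<le> (\<Sum>i. hcost n (C i))"
    proof (intro suminf_le)
      fix i
      have "CA i = {} \<or> CB i = {}"
      proof (rule ccontr)
        assume "\<not> ?thesis"
        then obtain x y where xy: "x \<in> C i \<inter> A" "y \<in> C i \<inter> B" by (auto simp: CA_def CB_def split: if_splits)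
        then have "dist x y \<le> diameter (C i)" using C
          by (intro diameter_bounded_bound) (auto simp: covers_below_def)
        also have "\<dots> \<le> \<delta>" using C by (auto simp: covers_below_def)
        finally show False using d(2)[of x y] xy \<delta> by auto
      qed
      then show "hcost n (CA i) + hcost n (CB i) \<le> hcost n (C i)"
        using n by (auto simp: CA_def CB_def split: if_splits)
    qed auto
    finally show "hausdorff_premeasure n \<delta> A + hausdorff_premeasure n \<delta> B \<le> (\<Sum>i. hcost n (C i))" .
  qed
  \<comment> \<open>Supremum and sum may be exchanged because both premeasures grow as the mesh
    shrinks, so the family is directed.\<close>
  have "hausdorff_outer n A + hausdorff_outer n B
    = (SUP \<delta>\<in>{0<..}. hausdorff_premeasure n \<delta> A + hausdorff_premeasure n \<delta> B)"
    unfolding hausdorff_outer_def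
  proof (rule SUP_add_directed_ennreal[symmetric])
    fix i j :: real assume "i \<in> {0<..}" "j \<in> {0<..}"
    then show "\<exists>k\<in>{0<..}. hausdorff_premeasure n i A + hausdorff_premeasure n j B
        \<le> hausdorff_premeasure n k A + hausdorff_premeasure n k B"
      by (intro bexI[of _ "min i j"] add_mono hausdorff_premeasure_antimono) auto
  qed
  also have "\<dots> \<le> hausdorff_outer n (A \<union> B)"
  proof (rule SUP_least)
    fix \<delta> :: real assume "\<delta> \<in> {0<..}"
    then have pos: "0 < min \<delta> (d / 2)" "min \<delta> (d/2) < d" using d by auto
    have "hausdorff_premeasure n \<delta> A + hausdorff_premeasure n \<delta> B \<le>
      hausdorff_premeasure n (min \<delta> (d/2)) A + hausdorff_premeasure n (min \<delta> (d/2)) B"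
      by (intro add_mono hausdorff_premeasure_antimono) auto
    also have "\<dots> \<le> hausdorff_premeasure n (min \<delta> (d/2)) (A \<union> B)" by (rule *[OF pos])
    also have "\<dots> \<le> hausdorff_outer n (A \<union> B)" by (rule hausdorff_premeasure_le_outer[OF pos(1)])
    finally show "hausdorff_premeasure n \<delta> A + hausdorff_premeasure n \<delta> B \<le> hausdorff_outer n (A \<union> B)" .
  qed
  finally show ?thesis .
qed

text \<open>Pairwise distances suffice: the last set is separated from the union of the finitely
  many earlier ones by the minimum of its distances to them.\<close>

lemma hausdorff_outer_separated_sum:
  fixes R :: "nat \<Rightarrow> 'a::metric_space set"
  assumes n: "0 < n"
    and sep: "\<And>i j. i < j \<Longrightarrow> \<exists>d>0. \<forall>x\<in>R i. \<forall>y\<in>R j. d \<le> dist x y"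
  shows "(\<Sum>i<k. hausdorff_outer n (R i)) \<le> hausdorff_outer n (\<Union>i<k. R i)"
proof (induction k)
  case (Suc k)
  have "\<forall>i. \<exists>d. i < k \<longrightarrow> (d > 0 \<and> (\<forall>x\<in>R i. \<forall>y\<in>R k. d \<le> dist x y))" using sep by metis
  then obtain d where d: "\<And>i. i < k \<Longrightarrow> d i > 0" "\<And>i x y. i < k \<Longrightarrow> x \<in> R i \<Longrightarrow> y \<in> R k \<Longrightarrow> d i \<le> dist x y"
    by metis
  have "hausdorff_outer n (\<Union>i<k. R i) + hausdorff_outer n (R k) \<le> hausdorff_outer n ((\<Union>i<k. R i) \<union> R k)"
  proof (rule hausdorff_outer_separated[OF n])
    \<comment> \<open>The inserted 1 keeps the minimum defined when there are no earlier
      sets.\<close>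
    show "0 < Min (insert 1 (d ` {..<k}))" using d(1) by (subst Min_gr_iff) auto
    fix x y assume "x \<in> (\<Union>i<k. R i)" "y \<in> R k"
    then obtain i where "i < k" "x \<in> R i" by auto
    then show "Min (insert 1 (d ` {..<k})) \<le> dist x y"
      using d(2)[of i x y] \<open>y \<in> R k\<close> by (intro order_trans[OF Min_le[of _ "d i"]]) auto
  qed
  also have "(\<Union>i<k. R i) \<union> R k = (\<Union>i<Suc k. R i)" by (auto simp: lessThan_Suc)
  finally show ?case using Suc by (auto intro: order_trans[OF add_right_mono])
qed (simp add: hausdorff_outer_empty n)

text \<open>Caratheodory's criterion: the shells at distance about \<open>1/k\<close> from \<open>F\<close> with indices of the
  same parity are separated, so their measures are summable and the points of \<open>A\<close> close to \<open>F\<close>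
  contribute little.\<close>

lemma hausdorff_outer_closed_split:
  fixes F :: "'a::metric_space set"
  assumes n: "0 < n" and F: "closed F"
  shows "hausdorff_outer n (A \<inter> F) + hausdorff_outer n (A - F) \<le> hausdorff_outer n A"
proof (cases "F = {} \<or> hausdorff_outer n A = \<infinity>")
  case True
  then show ?thesis by (auto simp: hausdorff_outer_empty n)
next
  case False
  then have ne: "F \<noteq> {}" and fin: "hausdorff_outer n A < \<infinity>" by (auto simp: top.not_eq_extremum)
  define Ak where "Ak k = {x \<in> A. 1 / real (Suc k) \<le> infdist x F}" for k
  define R where "R k = {x \<in> A. 1 / real (Suc (Suc k)) \<le> infdist x F \<and> infdist x F < 1 / real (Suc k)}" for k
  have sep: "\<exists>d>0. \<forall>x\<in>R j. \<forall>y\<in>R i. d \<le> dist x y" if "Suc i < j" for i j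
  proof (intro exI conjI ballI)
    have "1 / real (Suc j) < 1 / real (Suc (Suc i))" using that by (intro divide_strict_left_mono) auto
    then show "0 < 1 / real (Suc (Suc i)) - 1 / real (Suc j)" by simp
    fix x y assume "x \<in> R j" "y \<in> R i"
    then have "1 / real (Suc (Suc i)) - 1 / real (Suc j) \<le> infdist y F - infdist x F" by (auto simp: R_def)
    also have "\<dots> \<le> dist x y" using infdist_triangle[of y F x] by (simp add: dist_commute)
    finally show "1 / real (Suc (Suc i)) - 1 / real (Suc j) \<le> dist x y" .
  qed
  have bd: "(\<Sum>i<k. hausdorff_outer n (R (2*i+c))) \<le> hausdorff_outer n A" for c k :: nat
  proof -
    have "(\<Sum>i<k. hausdorff_outer n (R (2*i+c))) \<le> hausdorff_outer n (\<Union>i<k. R (2*i+c))"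
    proof (rule hausdorff_outer_separated_sum[OF n])
      fix i j :: nat assume "i < j"
      then have "Suc (2*i+c) < 2*j+c" by auto
      from sep[OF this] show "\<exists>d>0. \<forall>x\<in>R (2*i+c). \<forall>y\<in>R (2*j+c). d \<le> dist x y"
        by (metis dist_commute)
    qed
    also have "\<dots> \<le> hausdorff_outer n A" by (rule hausdorff_outer_mono) (auto simp: R_def)
    finally show ?thesis .
  qed
  have sum_le: "(\<Sum>i<k. hausdorff_outer n (R i)) \<le> 2 * hausdorff_outer n A" for k
  proof -
    have "{..<k} \<subseteq> (\<lambda>i. 2*i+0) ` {..<k} \<union> (\<lambda>i. 2*i+1) ` {..<k}"
    proof
      fix i assume "i \<in> {..<k}"
      moreover have "i = 2 * (i div 2) + 0 \<or> i = 2 * (i div 2) + 1" by arith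
      moreover have "i div 2 \<le> i" by arith
      ultimately show "i \<in> (\<lambda>i. 2*i+0) ` {..<k} \<union> (\<lambda>i. 2*i+1) ` {..<k}"
        by (metis (no_types, lifting) UnCI image_iff lessThan_iff order_le_less_trans)
    qed
    then have "(\<Sum>i<k. hausdorff_outer n (R i)) \<le>
        (\<Sum>i\<in>(\<lambda>i. 2*i+0) ` {..<k} \<union> (\<lambda>i. 2*i+1) ` {..<k}. hausdorff_outer n (R i))"
      by (intro sum_mono2) auto
    also have "\<dots> = (\<Sum>i\<in>(\<lambda>i. 2*i+0) ` {..<k}. hausdorff_outer n (R i)) + (\<Sum>i\<in>(\<lambda>i. 2*i+1) ` {..<k}. hausdorff_outer n (R i))"
      by (rule sum.union_disjoint) (auto, presburger)
    also have "\<dots> = (\<Sum>i<k. hausdorff_outer n (R (2*i+0))) + (\<Sum>i<k. hausdorff_outer n (R (2*i+1)))"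
      by (subst (1 2) sum.reindex) (auto simp: inj_on_def)
    also have "\<dots> \<le> hausdorff_outer n A + hausdorff_outer n A"
      by (intro add_mono bd)
    finally show ?thesis by (simp add: mult_2)
  qed
  have summ: "(\<Sum>i. hausdorff_outer n (R i)) \<noteq> \<infinity>"
  proof -
    have "(\<Sum>i. hausdorff_outer n (R i)) \<le> 2 * hausdorff_outer n A"
      using sum_le by (intro suminf_le_const) auto
    also have "\<dots> < \<infinity>" using fin by (simp add: ennreal_mult_less_top)
    finally show ?thesis by simp
  qed
  have sub: "A - F \<subseteq> Ak k \<union> (\<Union>i. R (i + k))" for k
  proof
    fix x assume x: "x \<in> A - F"
    then have pos: "0 < infdist x F" using infdist_pos_not_in_closed[OF F ne, of x] by auto
    show "x \<in> Ak k \<union> (\<Union>i. R (i + k))"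
    proof (cases "x \<in> Ak k")
      case False
      then have lt: "infdist x F < 1 / real (Suc k)" using x by (auto simp: Ak_def)
      obtain N where "inverse (real (Suc N)) < infdist x F" using reals_Archimedean[OF pos] by auto
      then have ex: "\<exists>N. 1 / real (Suc N) \<le> infdist x F" by (auto simp: inverse_eq_divide intro: less_imp_le)
      define N where "N = (LEAST N. 1 / real (Suc N) \<le> infdist x F)"
      have N: "1 / real (Suc N) \<le> infdist x F" unfolding N_def using ex by (rule LeastI_ex)
      have less: "\<And>m. m < N \<Longrightarrow> infdist x F < 1 / real (Suc m)"
        unfolding N_def using not_less_Least by fastforce
      have "k < N"
      proof (rule ccontr)
        assume "\<not> k < N"
        then have "1 / real (Suc k) \<le> 1 / real (Suc N)" by (simp add: field_simps)
        then show False using N lt by linarith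
      qed
      \<comment> \<open>The least \<open>N\<close> with
        \<open>1 / real (Suc N) \<le> infdist x F\<close> puts \<open>x\<close> into the shell with
        index \<open>N - 1\<close>, because shell \<open>k\<close> reaches from
        \<open>1 / real (Suc (Suc k))\<close> to \<open>1 / real (Suc k)\<close>.\<close>
      then have "x \<in> R ((N - 1 - k) + k)" using N less[of "N - 1"] x by (auto simp: R_def)
      then show ?thesis by blast
    qed auto
  qed
  have le: "hausdorff_outer n (A \<inter> F) + hausdorff_outer n (A - F) \<le> hausdorff_outer n A + (\<Sum>i. hausdorff_outer n (R (i + k)))" for k
  proof -
    have "hausdorff_outer n (A - F) \<le> hausdorff_outer n (Ak k \<union> (\<Union>i. R (i + k)))"
      by (rule hausdorff_outer_mono[OF sub])
    also have "\<dots> \<le> hausdorff_outer n (Ak k) + hausdorff_outer n (\<Union>i. R (i + k))"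
      by (rule hausdorff_outer_Un[OF n])
    also have "\<dots> \<le> hausdorff_outer n (Ak k) + (\<Sum>i. hausdorff_outer n (R (i + k)))"
      by (intro add_left_mono hausdorff_outer_UN)
    finally have 1: "hausdorff_outer n (A - F) \<le> \<dots>" .
    have "hausdorff_outer n (A \<inter> F) + hausdorff_outer n (Ak k) \<le> hausdorff_outer n (A \<inter> F \<union> Ak k)"
    proof (rule hausdorff_outer_separated[OF n])
      show "0 < 1 / real (Suc k)" by simp
      fix x y assume "x \<in> A \<inter> F" "y \<in> Ak k"
      then show "1 / real (Suc k) \<le> dist x y"
        using infdist_le[of x F y] by (auto simp: Ak_def dist_commute)
    qed
    also have "\<dots> \<le> hausdorff_outer n A" by (rule hausdorff_outer_mono) (auto simp: Ak_def)
    finally have 2: "hausdorff_outer n (A \<inter> F) + hausdorff_outer n (Ak k) \<le> hausdorff_outer n A" .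
    have "hausdorff_outer n (A \<inter> F) + hausdorff_outer n (A - F)
        \<le> (hausdorff_outer n (A \<inter> F) + hausdorff_outer n (Ak k)) + (\<Sum>i. hausdorff_outer n (R (i + k)))"
      unfolding add.assoc by (rule add_left_mono[OF 1])
    then show ?thesis using add_right_mono[OF 2] by (rule order_trans)
  qed
  have tail: "(\<lambda>k. \<Sum>i. hausdorff_outer n (R (i + k))) \<longlonglongrightarrow> 0"
  proof -
    have f: "hausdorff_outer n (R i) \<noteq> \<infinity>" for i
      using fin hausdorff_outer_mono[of "R i" A n] by (auto simp: R_def top_unique)
    define r where "r i = enn2real (hausdorff_outer n (R i))" for i
    have r: "hausdorff_outer n (R i) = ennreal (r i)" "0 \<le> r i" for i
      using f[of i] by (auto simp: r_def less_top)
    have sr: "summable r" using summ by (intro summable_suminf_not_top) (auto simp: r)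
    have "(\<Sum>i. hausdorff_outer n (R (i + k))) = ennreal (\<Sum>i. r (i + k))" for k
      unfolding r using sr r(2) by (intro suminf_ennreal2) (auto simp: summable_ignore_initial_segment)
    moreover have "(\<lambda>k. \<Sum>i. r (i + k)) \<longlonglongrightarrow> 0" by (rule suminf_exist_split2[OF sr])
    ultimately show ?thesis using tendsto_ennrealI by fastforce
  qed
  have "(\<lambda>k. hausdorff_outer n A + (\<Sum>i. hausdorff_outer n (R (i + k)))) \<longlonglongrightarrow> hausdorff_outer n A + 0"
    by (intro tendsto_add tendsto_const tail)
  then show ?thesis
    by (intro LIMSEQ_le_const[of _ "hausdorff_outer n A"]) (auto intro: le)
qed

text \<open>The sets that split every set additively form a sigma-algebra; it contains the closed
  sets by \<open>hausdorff_outer_closed_split\<close> and hence all Borel sets.\<close>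

lemma hausdorff_outer_measure_space:
  assumes n: "0 < n"
  shows "measure_space UNIV (sets (borel :: 'a::metric_space measure)) (hausdorff_outer n)"
proof -
  interpret S: sigma_algebra UNIV "UNIV :: 'a set set" using sigma_algebra_Pow[of "UNIV :: 'a set"] by simp
  let ?L = "lambda_system UNIV UNIV (hausdorff_outer n :: 'a set \<Rightarrow> _)"
  have L: "measure_space UNIV ?L (hausdorff_outer n)"
    using S.caratheodory_lemma[OF hausdorff_outer_space[OF n]] .
  then have sL: "sigma_algebra UNIV ?L" by (simp add: measure_space_def)
  have closed: "F \<in> ?L" if "closed F" for F
  proof -
    have "hausdorff_outer n (F \<inter> A) + hausdorff_outer n ((UNIV - F) \<inter> A) = hausdorff_outer n A" for A
    proof (rule antisym)
      have eq: "F \<inter> A = A \<inter> F" "(UNIV - F) \<inter> A = A - F" by auto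
      show "hausdorff_outer n (F \<inter> A) + hausdorff_outer n ((UNIV - F) \<inter> A) \<le> hausdorff_outer n A"
        unfolding eq by (rule hausdorff_outer_closed_split[OF n that])
      have "hausdorff_outer n A = hausdorff_outer n (F \<inter> A \<union> (UNIV - F) \<inter> A)"
        by (rule arg_cong[where f = "hausdorff_outer n"]) auto
      also have "\<dots> \<le> hausdorff_outer n (F \<inter> A) + hausdorff_outer n ((UNIV - F) \<inter> A)"
        by (rule hausdorff_outer_Un[OF n])
      finally show "hausdorff_outer n A \<le> hausdorff_outer n (F \<inter> A) + hausdorff_outer n ((UNIV - F) \<inter> A)" .
    qed
    then show ?thesis by (simp add: lambda_system_def)
  qed
  have "sets (borel :: 'a measure) = sigma_sets UNIV {S. closed S}"
    unfolding borel_eq_closed by (rule sets_measure_of) auto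
  also have "\<dots> \<subseteq> ?L"
    using closed by (intro sigma_algebra.sigma_sets_subset[OF sL]) auto
  finally show ?thesis
    using measure_down[OF L] sets.sigma_algebra_axioms[of "borel :: 'a measure"] by auto
qed

section \<open>The surface measure and its behaviour under dilations\<close>

lemma sets_surf [simp, measurable_cong]: "sets surf = sets borel"
  unfolding surf_def using sets.sets_measure_of_eq[of borel] by simp

lemma space_surf [simp]: "space surf = UNIV"
  unfolding surf_def by (simp add: space_measure_of_conv)

text \<open>\<open>measure_of\<close> keeps the given set function only if that function is a
  measure on the generated sigma-algebra and is the zero measure otherwise. The dimension bound
  makes the exponent positive.\<close>

lemma emeasure_surf:
  assumes "2 \<le> DIM('a::euclidean_space)" and A: "A \<in> sets borel"
  shows "emeasure surf A = hausdorff_outer (DIM('a) - 1) (A :: 'a set)"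
proof -
  have "measure_space UNIV (sets (borel :: 'a measure)) (hausdorff_outer (DIM('a) - 1))"
    by (rule hausdorff_outer_measure_space) (use assms in auto)
  then show ?thesis unfolding surf_def
    using A sets.sigma_sets_eq[of "borel :: 'a measure"]
    by (intro emeasure_measure_of_sigma) (auto simp: measure_space_def)
qed

lemma hausdorff_premeasure_scale_le:
  fixes A :: "'a::real_normed_vector set"
  assumes c: "0 < c" and \<delta>: "0 < \<delta>"
  shows "hausdorff_premeasure n (c * \<delta>) ((*\<^sub>R) c ` A) \<le> ennreal (c ^ n) * hausdorff_premeasure n \<delta> A"
proof -
  have diam: "diameter ((*\<^sub>R) c ` B) \<le> c * diameter B" if "bounded B" for B :: "'a set"
  proof (rule diameter_le)
    show "(*\<^sub>R) c ` B \<noteq> {} \<or> 0 \<le> c * diameter B" using c diameter_ge_0[OF that] by auto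
    fix x y assume "x \<in> (*\<^sub>R) c ` B" "y \<in> (*\<^sub>R) c ` B"
    then obtain a b where ab: "a \<in> B" "b \<in> B" "x = c *\<^sub>R a" "y = c *\<^sub>R b" by auto
    have "norm (x - y) = c * dist a b" using ab c
      by (simp add: dist_norm scaleR_right_diff_distrib[symmetric])
    also have "\<dots> \<le> c * diameter B" using ab that c by (intro mult_left_mono diameter_bounded_bound) auto
    finally show "norm (x - y) \<le> c * diameter B" .
  qed
  have cost: "hcost n ((*\<^sub>R) c ` B) \<le> ennreal (c ^ n) * hcost n B" if "bounded B" for B :: "'a set"
  proof -
    have "(diameter ((*\<^sub>R) c ` B) / 2) ^ n \<le> (c * (diameter B / 2)) ^ n"
      using diam[OF that] diameter_ge_0[OF bounded_scaling[OF that, of c]] by (intro power_mono) auto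
    then have "unit_ball_vol (real n) * (diameter ((*\<^sub>R) c ` B) / 2) ^ n
        \<le> unit_ball_vol (real n) * (c * (diameter B / 2)) ^ n"
      by (rule mult_left_mono) simp
    also have "\<dots> = c ^ n * (unit_ball_vol (real n) * (diameter B / 2) ^ n)"
      by (simp only: power_mult_distrib mult_ac)
    finally show ?thesis unfolding hcost_def using c diameter_ge_0[OF that]
      by (subst ennreal_mult[symmetric]) (auto intro!: ennreal_leI)
  qed
  have bound: "hausdorff_premeasure n (c * \<delta>) ((*\<^sub>R) c ` A) \<le> ennreal (c ^ n) * (\<Sum>i. hcost n (C i))"
    if C: "C \<in> covers_below \<delta> A" for C
  proof -
    have "(\<lambda>i. (*\<^sub>R) c ` C i) \<in> covers_below (c * \<delta>) ((*\<^sub>R) c ` A)"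
      unfolding covers_below_def
    proof (intro CollectI conjI allI)
      show "(*\<^sub>R) c ` A \<subseteq> (\<Union>i. (*\<^sub>R) c ` C i)" using C by (simp add: covers_below_def image_UN[symmetric] image_mono)
      fix i have b: "bounded (C i)" "diameter (C i) \<le> \<delta>" using C by (auto simp: covers_below_def)
      show "bounded ((*\<^sub>R) c ` C i)" using bounded_scaling[OF b(1)] .
      show "diameter ((*\<^sub>R) c ` C i) \<le> c * \<delta>"
        using diam[OF b(1)] mult_left_mono[OF b(2), of c] c by linarith
    qed
    then have "hausdorff_premeasure n (c * \<delta>) ((*\<^sub>R) c ` A) \<le> (\<Sum>i. hcost n ((*\<^sub>R) c ` C i))"
      by (rule hausdorff_premeasure_le)
    also have "\<dots> \<le> (\<Sum>i. ennreal (c ^ n) * hcost n (C i))"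
      using C by (intro suminf_le cost) (auto simp: covers_below_def)
    finally show ?thesis by simp
  qed
  \<comment> \<open>The constant is moved to the left side, so that the right side is the bare cost
    of a cover and the infimum over covers can be taken.\<close>
  have le: "ennreal ((1 / c) ^ n) * hausdorff_premeasure n (c * \<delta>) ((*\<^sub>R) c ` A) \<le> (\<Sum>i. hcost n (C i))"
    if C: "C \<in> covers_below \<delta> A" for C
  proof -
    have "ennreal ((1 / c) ^ n) * hausdorff_premeasure n (c * \<delta>) ((*\<^sub>R) c ` A)
        \<le> ennreal ((1 / c) ^ n) * (ennreal (c ^ n) * (\<Sum>i. hcost n (C i)))"
      by (intro mult_left_mono bound[OF C]) simp
    then show ?thesis
      using c by (simp add: mult.assoc[symmetric] ennreal_mult[symmetric] power_mult_distrib[symmetric])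
  qed
  have "ennreal ((1 / c) ^ n) * hausdorff_premeasure n (c * \<delta>) ((*\<^sub>R) c ` A) \<le> hausdorff_premeasure n \<delta> A"
    unfolding hausdorff_premeasure_alt[of n \<delta> A] by (rule INF_greatest) (rule le)
  then have "ennreal (c ^ n) * (ennreal ((1 / c) ^ n) * hausdorff_premeasure n (c * \<delta>) ((*\<^sub>R) c ` A))
      \<le> ennreal (c ^ n) * hausdorff_premeasure n \<delta> A"
    by (rule mult_left_mono) simp
  then show ?thesis
    using c by (simp add: mult.assoc[symmetric] ennreal_mult[symmetric] power_mult_distrib[symmetric])
qed

lemma hausdorff_outer_scale_le:
  fixes A :: "'a::real_normed_vector set"
  assumes c: "0 < c"
  shows "hausdorff_outer n ((*\<^sub>R) c ` A) \<le> ennreal (c ^ n) * hausdorff_outer n A"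
proof (rule hausdorff_outer_least)
  fix \<delta> :: real assume \<delta>: "0 < \<delta>"
  have "hausdorff_premeasure n (c * (\<delta> / c)) ((*\<^sub>R) c ` A) \<le> ennreal (c ^ n) * hausdorff_premeasure n (\<delta> / c) A"
    by (rule hausdorff_premeasure_scale_le) (use c \<delta> in auto)
  also have "\<dots> \<le> ennreal (c ^ n) * hausdorff_outer n A"
    by (intro mult_left_mono hausdorff_premeasure_le_outer) (use c \<delta> in auto)
  finally show "hausdorff_premeasure n \<delta> ((*\<^sub>R) c ` A) \<le> ennreal (c ^ n) * hausdorff_outer n A"
    using c by simp
qed

text \<open>The reverse inequality is the same estimate applied to the dilation by
  \<open>1 / c\<close>.\<close>

lemma hausdorff_outer_scale:
  fixes A :: "'a::real_normed_vector set"
  assumes c: "0 < c"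
  shows "hausdorff_outer n ((*\<^sub>R) c ` A) = ennreal (c ^ n) * hausdorff_outer n A"
proof (rule antisym)
  have "A = (*\<^sub>R) (1 / c) ` (*\<^sub>R) c ` A" using c by (simp add: image_image)
  then have "hausdorff_outer n A \<le> ennreal ((1 / c) ^ n) * hausdorff_outer n ((*\<^sub>R) c ` A)"
    using hausdorff_outer_scale_le[of "1 / c" n "(*\<^sub>R) c ` A"] c by simp
  then have "ennreal (c ^ n) * hausdorff_outer n A \<le> ennreal (c ^ n) * (ennreal ((1 / c) ^ n) * hausdorff_outer n ((*\<^sub>R) c ` A))"
    by (rule mult_left_mono) simp
  also have "\<dots> = hausdorff_outer n ((*\<^sub>R) c ` A)"
    using c by (simp add: mult.assoc[symmetric] ennreal_mult[symmetric] power_mult_distrib[symmetric])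
  finally show "ennreal (c ^ n) * hausdorff_outer n A \<le> hausdorff_outer n ((*\<^sub>R) c ` A)" .
qed (rule hausdorff_outer_scale_le[OF c])

text \<open>Written as the image of a weighted measure, the scaling law passes to both kinds of
  integral through the change of variables for \<open>distr\<close> and
  \<open>density\<close>.\<close>

lemma surf_eq_distr_scale:
  assumes dim: "2 \<le> DIM('a::euclidean_space)" and c: "0 < c"
  shows "(surf :: 'a measure) = distr (density surf (\<lambda>_. ennreal (c ^ (DIM('a) - 1)))) borel ((*\<^sub>R) c)"
    (is "_ = distr ?D _ _")
proof (rule measure_eqI)
  fix A assume "A \<in> sets (surf :: 'a measure)"
  then have A: "A \<in> sets borel" by simp
  have vA: "(*\<^sub>R) c -` A \<in> sets borel"
    using measurable_sets[of "(*\<^sub>R) c" borel borel A] A by simp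
  have "(*\<^sub>R) c ` ((*\<^sub>R) c -` A) = A"
    by (rule surj_image_vimage_eq) (use c in \<open>auto intro!: surjI[of _ "(*\<^sub>R) (1 / c)"]\<close>)
  then have "emeasure surf A = hausdorff_outer (DIM('a) - 1) ((*\<^sub>R) c ` ((*\<^sub>R) c -` A))"
    using emeasure_surf[OF dim A] by (simp only:)
  also have "\<dots> = ennreal (c ^ (DIM('a) - 1)) * emeasure surf ((*\<^sub>R) c -` A)"
    by (simp only: hausdorff_outer_scale[OF c] emeasure_surf[OF dim vA])
  also have "\<dots> = emeasure (distr ?D borel ((*\<^sub>R) c)) A"
    using A vA by (subst emeasure_distr) (auto simp: emeasure_density_const)
  finally show "emeasure surf A = emeasure (distr ?D borel ((*\<^sub>R) c)) A" .
qed simp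

lemma nn_integral_surf_scale:
  assumes dim: "2 \<le> DIM('a::euclidean_space)" and c: "0 < c" and S: "S \<in> sets borel"
    and f: "f \<in> borel_measurable borel"
  shows "(\<integral>\<^sup>+x\<in>(*\<^sub>R) c ` S. f x \<partial>surf) =
    ennreal (c ^ (DIM('a) - 1)) * (\<integral>\<^sup>+x\<in>S. f (c *\<^sub>R x) \<partial>(surf :: 'a measure))"
proof -
  have im: "(*\<^sub>R) c ` S = (*\<^sub>R) (1 / c) -` S"
    using c by (auto simp: image_iff intro!: bexI[of _ "(1 / c) *\<^sub>R _"])
  have S': "(*\<^sub>R) c ` S \<in> sets borel"
    unfolding im using measurable_sets[of "(*\<^sub>R) (1 / c)" borel borel S] S by simp
  have [measurable]: "(*\<^sub>R) c \<in> borel_measurable (borel :: 'a measure)" by simp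
  note f[measurable] S[measurable] S'[measurable]
  have ind: "indicator ((*\<^sub>R) c ` S) (c *\<^sub>R x) = (indicator S x :: ennreal)" for x
    using c by (auto simp: indicator_def)
  have "(\<integral>\<^sup>+x\<in>(*\<^sub>R) c ` S. f x \<partial>surf) =
      (\<integral>\<^sup>+x. f x * indicator ((*\<^sub>R) c ` S) x \<partial>distr (density surf (\<lambda>_. ennreal (c ^ (DIM('a) - 1)))) borel ((*\<^sub>R) c))"
    by (subst surf_eq_distr_scale[OF dim c]) (rule refl)
  also have "\<dots> = (\<integral>\<^sup>+x. f (c *\<^sub>R x) * indicator S x \<partial>density surf (\<lambda>_. ennreal (c ^ (DIM('a) - 1))))"
    by (subst nn_integral_distr) (auto simp: ind)
  also have "\<dots> = ennreal (c ^ (DIM('a) - 1)) * (\<integral>\<^sup>+x\<in>S. f (c *\<^sub>R x) \<partial>surf)"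
    by (subst nn_integral_density) (auto simp: nn_integral_cmult)
  finally show ?thesis .
qed

lemma set_integral_surf_scale:
  fixes f :: "'a::euclidean_space \<Rightarrow> complex"
  assumes dim: "2 \<le> DIM('a)" and c: "0 < c" and S: "S \<in> sets borel"
    and f: "f \<in> borel_measurable borel"
  shows "(LINT x:(*\<^sub>R) c ` S|surf. f x) = (c ^ (DIM('a) - 1)) *\<^sub>R (LINT x:S|surf. f (c *\<^sub>R x))"
proof -
  have im: "(*\<^sub>R) c ` S = (*\<^sub>R) (1 / c) -` S"
    using c by (auto simp: image_iff intro!: bexI[of _ "(1 / c) *\<^sub>R _"])
  have S': "(*\<^sub>R) c ` S \<in> sets borel"
    unfolding im using measurable_sets[of "(*\<^sub>R) (1 / c)" borel borel S] S by simp
  have [measurable]: "(*\<^sub>R) c \<in> borel_measurable (borel :: 'a measure)" by simp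
  note f[measurable] S[measurable] S'[measurable]
  have ind: "indicator ((*\<^sub>R) c ` S) (c *\<^sub>R x) = (indicator S x :: real)" for x
    using c by (auto simp: indicator_def)
  have "(LINT x:(*\<^sub>R) c ` S|surf. f x) =
      (LINT x|distr (density surf (\<lambda>_. ennreal (c ^ (DIM('a) - 1)))) borel ((*\<^sub>R) c). indicator ((*\<^sub>R) c ` S) x *\<^sub>R f x)"
    unfolding set_lebesgue_integral_def by (subst surf_eq_distr_scale[OF dim c]) (rule refl)
  also have "\<dots> = (LINT x|density surf (\<lambda>_. ennreal (c ^ (DIM('a) - 1))). indicator S x *\<^sub>R f (c *\<^sub>R x))"
    by (subst integral_distr) (auto simp: ind)
  also have "\<dots> = (c ^ (DIM('a) - 1)) *\<^sub>R (LINT x:S|surf. f (c *\<^sub>R x))"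
    unfolding set_lebesgue_integral_def
    by (subst integral_density) (use c in \<open>auto simp flip: scaleR_scaleR\<close>)
  finally show ?thesis .
qed

section \<open>Measure of Lipschitz graphs in balls\<close>

lemma hausdorff_outer_finite_cover:
  fixes C :: "'i \<Rightarrow> 'a::metric_space set"
  assumes n: "0 < n" and I: "finite I" and A: "A \<subseteq> (\<Union>i\<in>I. C i)"
    and C: "\<And>i. i \<in> I \<Longrightarrow> bounded (C i)" "\<And>i. i \<in> I \<Longrightarrow> diameter (C i) \<le> \<delta>" and \<delta>: "0 \<le> \<delta>"
  shows "hausdorff_premeasure n \<delta> A \<le> ennreal (real (card I) * (unit_ball_vol (real n) * (\<delta> / 2) ^ n))"
proof -
  obtain e where e: "bij_betw e {..<card I} I" using ex_bij_betw_nat_finite[OF I] by (auto simp: atLeast0LessThan)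
  define D where "D k = (if k < card I then C (e k) else {})" for k
  have eI: "k < card I \<Longrightarrow> e k \<in> I" for k using e by (auto simp: bij_betw_def)
  have "D \<in> covers_below \<delta> A"
    unfolding covers_below_def
  proof (intro CollectI conjI allI)
    show "A \<subseteq> (\<Union>i. D i)"
    proof
      fix x assume "x \<in> A"
      then obtain i where "i \<in> I" "x \<in> C i" using A by blast
      then obtain k where "k < card I" "e k = i" using bij_betw_imp_surj_on[OF e] by (metis imageE lessThan_iff)
      then have "x \<in> D k" using \<open>x \<in> C i\<close> by (simp add: D_def)
      then show "x \<in> (\<Union>i. D i)" by blast
    qed
  qed (use C eI \<delta> in \<open>auto simp: D_def\<close>)
  then have "hausdorff_premeasure n \<delta> A \<le> (\<Sum>k. hcost n (D k))" by (rule hausdorff_premeasure_le)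
  also have "\<dots> = (\<Sum>k<card I. hcost n (D k))"
    by (rule suminf_finite) (auto simp: D_def n)
  also have "\<dots> \<le> (\<Sum>k<card I. ennreal (unit_ball_vol (real n) * (\<delta> / 2) ^ n))"
    unfolding hcost_def
    by (intro sum_mono ennreal_leI mult_left_mono power_mono divide_right_mono)
       (auto simp: D_def C eI diameter_ge_0)
  also have "\<dots> = ennreal (real (card I) * (unit_ball_vol (real n) * (\<delta> / 2) ^ n))"
    using \<delta> by (simp add: ennreal_mult ennreal_of_nat_eq_real_of_nat)
  finally show ?thesis .
qed

text \<open>A set on which one coordinate is controlled by the others is covered at scale \<open>R / N\<close> by
  \<open>(2 N + 1) ^ n\<close> cells, indexed by the rounded values of the other coordinates.\<close>

lemma hausdorff_outer_graph_ball:
  fixes T :: "'a::euclidean_space set"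
  assumes dim: "2 \<le> DIM('a)" and b: "b \<in> Basis" and L: "0 \<le> L"
    and T: "\<And>x y. x \<in> T \<Longrightarrow> y \<in> T \<Longrightarrow> norm (x - y) \<le> L * (\<Sum>i\<in>Basis - {b}. \<bar>(x - y) \<bullet> i\<bar>)"
  shows "\<exists>A\<ge>0. \<forall>z. \<forall>R>0. hausdorff_outer (DIM('a) - 1) (T \<inter> cball z R) \<le> ennreal (A * R ^ (DIM('a) - 1))"
proof (intro exI conjI allI impI)
  let ?n = "DIM('a) - 1"
  have n: "0 < ?n" using dim by auto
  define K where "K = (L + 1) * real ?n"
  have K: "0 < K" using n L by (simp add: K_def)
  let ?A = "unit_ball_vol (real ?n) * (3 * K / 2) ^ ?n"
  show "0 \<le> ?A" using K by simp
  fix z :: 'a and R :: real assume R: "0 < R"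
  show "hausdorff_outer ?n (T \<inter> cball z R) \<le> ennreal (?A * R ^ ?n)"
  proof (rule hausdorff_outer_least)
    fix \<delta> :: real assume \<delta>: "0 < \<delta>"
    obtain N :: nat where N: "K * R / \<delta> < real N" using reals_Archimedean2 by blast
    have "0 < K * R / \<delta>" using K R \<delta> by simp
    then have N0: "0 < N" using N by (intro Nat.gr0I) auto
    have small: "K * R / N \<le> \<delta>" using N \<delta> N0 by (simp add: field_simps)
    let ?I = "PiE (Basis - {b} :: 'a set) (\<lambda>_. {- int N..int N})"
    define C where "C f = {x \<in> T \<inter> cball z R. \<forall>i\<in>Basis - {b}. \<lfloor>real N * ((x - z) \<bullet> i) / R\<rfloor> = f i}" for f :: "'a \<Rightarrow> int"
    have dC: "norm (x - y) \<le> K * R / N" if "x \<in> C f" "y \<in> C f" for x y f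
    proof -
      have "\<bar>(x - y) \<bullet> i\<bar> \<le> R / N" if i: "i \<in> Basis - {b}" for i
      proof -
        have "\<lfloor>real N * ((x - z) \<bullet> i) / R\<rfloor> = \<lfloor>real N * ((y - z) \<bullet> i) / R\<rfloor>"
          using i \<open>x \<in> C f\<close> \<open>y \<in> C f\<close> by (auto simp: C_def)
        then have "\<bar>real N * ((x - z) \<bullet> i) / R - real N * ((y - z) \<bullet> i) / R\<bar> \<le> 1" by linarith
        also have "real N * ((x - z) \<bullet> i) / R - real N * ((y - z) \<bullet> i) / R = ((x - y) \<bullet> i) * (real N / R)"
          using R by (simp add: inner_diff_left diff_divide_distrib[symmetric] algebra_simps)
        finally show ?thesis using R N0 by (simp add: abs_mult field_simps)
      qed
      then have "(\<Sum>i\<in>Basis - {b}. \<bar>(x - y) \<bullet> i\<bar>) \<le> (\<Sum>i\<in>Basis - {b}. R / N)" by (rule sum_mono)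
      also have "\<dots> = real ?n * (R / N)" using b by (simp add: card_Diff_singleton)
      finally have s: "(\<Sum>i\<in>Basis - {b}. \<bar>(x - y) \<bullet> i\<bar>) \<le> real ?n * (R / N)" .
      have "norm (x - y) \<le> L * (\<Sum>i\<in>Basis - {b}. \<bar>(x - y) \<bullet> i\<bar>)" using that by (intro T) (auto simp: C_def)
      also have "\<dots> \<le> (L + 1) * (real ?n * (R / N))"
        using s L by (intro mult_mono) (auto intro!: sum_nonneg)
      finally show ?thesis by (simp add: K_def)
    qed
    have bC: "bounded (C f)" for f by (rule bounded_subset[of "cball z R"]) (auto simp: C_def)
    have "hausdorff_premeasure ?n (K * R / N) (T \<inter> cball z R) \<le>
        ennreal (real (card ?I) * (unit_ball_vol (real ?n) * (K * R / N / 2) ^ ?n))"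
    proof (rule hausdorff_outer_finite_cover[OF n, where C = C])
      show "finite ?I" by (intro finite_PiE) auto
      show "T \<inter> cball z R \<subseteq> (\<Union>f\<in>?I. C f)"
      proof
        fix x assume x: "x \<in> T \<inter> cball z R"
        let ?f = "\<lambda>i\<in>Basis - {b}. \<lfloor>real N * ((x - z) \<bullet> i) / R\<rfloor>"
        have "\<lfloor>real N * ((x - z) \<bullet> i) / R\<rfloor> \<in> {- int N..int N}" if "i \<in> Basis" for i
        proof -
          have "\<bar>(x - z) \<bullet> i\<bar> \<le> R" using x Basis_le_norm[OF that, of "x - z"] by (auto simp: dist_norm norm_minus_commute)
          then have "\<bar>(x - z) \<bullet> i / R\<bar> \<le> 1" using R by simp
          then have "\<bar>real N * ((x - z) \<bullet> i / R)\<bar> \<le> real N" 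
            using mult_left_mono[of "\<bar>(x - z) \<bullet> i / R\<bar>" 1 "real N"] by (simp add: abs_mult)
          then have "\<bar>real N * ((x - z) \<bullet> i) / R\<bar> \<le> real N" by simp
          then have "- real N \<le> real N * ((x - z) \<bullet> i) / R" "real N * ((x - z) \<bullet> i) / R \<le> real N"
            unfolding abs_le_iff by linarith+
          then show ?thesis by (auto simp: le_floor_iff intro: floor_le_iff[THEN iffD2])
        qed
        then have "?f \<in> ?I" by auto
        moreover have "x \<in> C ?f" using x by (auto simp: C_def)
        ultimately show "x \<in> (\<Union>f\<in>?I. C f)" by blast
      qed
      show "diameter (C f) \<le> K * R / N" for f
        using K R by (intro diameter_le dC) auto
      show "0 \<le> K * R / N" using K R by simp
    qed (rule bC)
    also have "\<dots> \<le> ennreal (?A * R ^ ?n)"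
    proof (rule ennreal_leI)
      have card: "card ?I = (2 * N + 1) ^ ?n" using b by (subst card_PiE) (auto simp: card_Diff_singleton nat_add_distrib nat_mult_distrib)
      then have "real (card ?I) * (unit_ball_vol (real ?n) * (K * R / N / 2) ^ ?n)
        = unit_ball_vol (real ?n) * (real (2 * N + 1) * (K * R / N / 2)) ^ ?n"
        unfolding card of_nat_power power_mult_distrib by (simp only: mult_ac)
      \<comment> \<open>Since \<open>2 * N + 1 \<le> 3 * N\<close>, the number of cells cancels the
        cell size and the bound no longer depends on the mesh.\<close>
      also have "\<dots> \<le> unit_ball_vol (real ?n) * (3 * real N * (K * R / N / 2)) ^ ?n"
        using K R N0 by (intro mult_left_mono power_mono mult_right_mono) auto
      also have "3 * real N * (K * R / N / 2) = (3 * K / 2) * R" using N0 by simp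
      also have "unit_ball_vol (real ?n) * (3 * K / 2 * R) ^ ?n = ?A * R ^ ?n"
        by (simp only: power_mult_distrib[of "3 * K / 2" R] mult.assoc)
      finally show "real (card ?I) * (unit_ball_vol (real ?n) * (K * R / N / 2) ^ ?n) \<le> ?A * R ^ ?n" .
    qed
    finally show "hausdorff_premeasure ?n \<delta> (T \<inter> cball z R) \<le> ennreal (?A * R ^ ?n)"
      using hausdorff_premeasure_antimono[OF small, of ?n "T \<inter> cball z R"] by (rule order_trans[rotated])
  qed
qed

subsection \<open>Potential estimates on upper regular sets\<close>

lemma powr_add_le:
  fixes a b q :: real
  assumes "0 \<le> a" "0 \<le> b" "0 \<le> q"
  shows "(a + b) powr q \<le> 2 powr q * (a powr q + b powr q)"
proof -
  have "(a + b) powr q \<le> (2 * max a b) powr q" using assms by (intro powr_mono2) auto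
  also have "\<dots> = 2 powr q * max a b powr q" using assms by (simp add: powr_mult)
  also have "max a b powr q \<le> a powr q + b powr q" by (cases "a \<le> b") (auto simp: max_def)
  finally show ?thesis by simp
qed

lemma norm_diff_powr_le:
  fixes a b :: "'b::real_normed_vector"
  assumes "0 \<le> q"
  shows "norm (a - b) powr q \<le> 2 powr q * (norm a powr q + norm b powr q)"
proof -
  have "norm (a - b) powr q \<le> (norm a + norm b) powr q"
    using assms norm_triangle_ineq4[of a b] by (intro powr_mono2) auto
  also have "\<dots> \<le> 2 powr q * (norm a powr q + norm b powr q)" by (intro powr_add_le) (use assms in auto)
  finally show ?thesis .
qed

lemma half_powr_less_one: "0 < a \<Longrightarrow> (1 / 2 :: real) powr a < 1"
  using powr_less_mono2[of a "1 / 2" 1] by simp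

lemma ennreal_le_suminf: "f i \<le> (\<Sum>i. f i)" for f :: "nat \<Rightarrow> ennreal"
  using sum_le_suminf[OF summableI, of "{i}" f] by simp

text \<open>Young's inequality for \<open>g / \<tau>\<close> and 1. The free parameter replaces a
  division by norms: it is optimised after integration.\<close>

lemma young_scaled:
  fixes g \<tau> q :: real
  assumes "0 \<le> g" "0 < \<tau>" "1 < q"
  shows "g \<le> g powr q / (q * \<tau> powr (q - 1)) + (1 - 1 / q) * \<tau>"
proof -
  have "1 / q + 1 / (q / (q - 1)) = 1" using assms by (simp add: field_simps)
  then have "(g / \<tau>) * 1 \<le> (g / \<tau>) powr q / q + 1 powr (q / (q - 1)) / (q / (q - 1))"
    using assms by (intro Youngs_inequality) auto
  then have "\<tau> * (g / \<tau>) \<le> \<tau> * (g powr q / \<tau> powr q / q + (q - 1) / q)"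
    using assms by (intro mult_left_mono) (auto simp: powr_divide)
  also have "\<dots> = g powr q / (q * (\<tau> powr q / \<tau>)) + (1 - 1 / q) * \<tau>"
    using assms by (simp add: field_simps)
  also have "\<tau> powr q / \<tau> = \<tau> powr (q - 1)" using assms by (simp add: powr_diff)
  finally show ?thesis using assms by simp
qed

text \<open>Hoelder's inequality for a weight of total mass at most \<open>c\<close>, obtained by
  integrating \<open>young_scaled\<close> and choosing the parameter afterwards. The number
  \<open>U\<close> only has to lie below the weighted integral, so that the norm of a Bochner
  integral can take its place.\<close>

lemma nn_integral_jensen_powr:
  fixes w g :: "'a \<Rightarrow> real"
  assumes q: "1 < q" and c: "0 < c" and U: "0 \<le> U"
    and m [measurable]: "w \<in> borel_measurable M" "g \<in> borel_measurable M"
    and w: "\<And>x. x \<in> space M \<Longrightarrow> 0 \<le> w x" and g: "\<And>x. x \<in> space M \<Longrightarrow> 0 \<le> g x"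
    and wc: "(\<integral>\<^sup>+x. ennreal (w x) \<partial>M) \<le> ennreal c"
    and Ule: "ennreal U \<le> (\<integral>\<^sup>+x. ennreal (w x * g x) \<partial>M)"
  shows "ennreal (U powr q) \<le> ennreal (c powr (q - 1)) * (\<integral>\<^sup>+x. ennreal (w x * g x powr q) \<partial>M)"
proof (cases "(\<integral>\<^sup>+x. ennreal (w x * g x powr q) \<partial>M) = \<infinity>")
  case True
  then show ?thesis using c by (simp add: ennreal_mult_top)
next
  case False
  define i where "i = enn2real (\<integral>\<^sup>+x. ennreal (w x * g x powr q) \<partial>M)"
  have i: "(\<integral>\<^sup>+x. ennreal (w x * g x powr q) \<partial>M) = ennreal i" "0 \<le> i"
    using False by (auto simp: i_def less_top)
  \<comment> \<open>The integral \<open>i\<close> may vanish, so a positive \<open>j\<close> above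
    it is used and the excess is removed at the end.\<close>
  have key: "U powr q \<le> c powr (q - 1) * j" if j: "i \<le> j" "0 < j" for j
  proof -
    define t where "t = j / c"
    \<comment> \<open>This value minimises the right-hand side of the integrated Young
      inequality.\<close>
    define \<tau> where "\<tau> = t powr (1 / q)"
    have t: "0 < t" using j c by (simp add: t_def)
    then have l: "0 < \<tau>" by (simp add: \<tau>_def)
    have "ennreal U \<le> (\<integral>\<^sup>+x. ennreal (w x * g x) \<partial>M)" by (rule Ule)
    also have "\<dots> \<le> (\<integral>\<^sup>+x. ennreal (1 / (q * \<tau> powr (q - 1))) * ennreal (w x * g x powr q) + ennreal ((1 - 1 / q) * \<tau>) * ennreal (w x) \<partial>M)"
    proof (rule nn_integral_mono)
      fix x assume x: "x \<in> space M"
      have "w x * g x \<le> w x * (g x powr q / (q * \<tau> powr (q - 1)) + (1 - 1 / q) * \<tau>)"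
        using w[OF x] g[OF x] l q by (intro mult_left_mono young_scaled) auto
      also have "\<dots> = (1 / (q * \<tau> powr (q - 1))) * (w x * g x powr q) + ((1 - 1 / q) * \<tau>) * w x"
        by (simp add: field_simps)
      finally show "ennreal (w x * g x) \<le> ennreal (1 / (q * \<tau> powr (q - 1))) * ennreal (w x * g x powr q) + ennreal ((1 - 1 / q) * \<tau>) * ennreal (w x)"
        using q l w[OF x] by (simp flip: ennreal_mult ennreal_plus add: ennreal_leI)
    qed
    also have "\<dots> = ennreal (1 / (q * \<tau> powr (q - 1))) * ennreal i + ennreal ((1 - 1 / q) * \<tau>) * (\<integral>\<^sup>+x. ennreal (w x) \<partial>M)"
      by (simp add: nn_integral_add nn_integral_cmult i)
    also have "\<dots> \<le> ennreal (1 / (q * \<tau> powr (q - 1))) * ennreal j + ennreal ((1 - 1 / q) * \<tau>) * ennreal c"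
      using j by (intro add_mono mult_left_mono wc ennreal_leI) auto
    also have "\<dots> = ennreal (j / (q * \<tau> powr (q - 1)) + (1 - 1 / q) * \<tau> * c)"
      using q l j c by (simp flip: ennreal_mult ennreal_plus)
    finally have "U \<le> j / (q * \<tau> powr (q - 1)) + (1 - 1 / q) * \<tau> * c"
      using q l j c by (subst (asm) ennreal_le_iff) auto
    also have "j / (q * \<tau> powr (q - 1)) = c * t powr (1 / q) / q"
    proof -
      have "\<tau> powr (q - 1) = t powr ((1 / q) * (q - 1))" by (simp add: \<tau>_def powr_powr)
      also have "(1 / q) * (q - 1) = 1 - 1 / q" using q by (simp add: field_simps)
      also have "t powr (1 - 1 / q) = t / t powr (1 / q)" using t by (simp add: powr_diff)
      finally have e: "\<tau> powr (q - 1) = t / t powr (1 / q)" .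
      have "j = c * t" using c by (simp add: t_def)
      then show ?thesis using t q by (simp add: e)
    qed
    also have "c * t powr (1 / q) / q + (1 - 1 / q) * \<tau> * c = c * t powr (1 / q)"
      using q by (simp add: \<tau>_def field_simps)
    finally have "U powr q \<le> (c * t powr (1 / q)) powr q" using U q by (intro powr_mono2) auto
    also have "\<dots> = c powr q * t" using c t q by (simp add: powr_mult powr_powr)
    also have "\<dots> = c powr (q - 1) * j" using c by (simp add: t_def powr_diff)
    finally show ?thesis .
  qed
  have "U powr q \<le> c powr (q - 1) * i"
  proof (rule field_le_epsilon)
    fix e :: real assume e: "0 < e"
    have cp: "0 < c powr (q - 1)" using c by simp
    have "U powr q \<le> c powr (q - 1) * (i + e / c powr (q - 1))"
      by (rule key) (use e cp i in \<open>auto intro!: add_nonneg_pos\<close>)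
    then show "U powr q \<le> c powr (q - 1) * i + e" using cp c by (simp add: distrib_left)
  qed
  then show ?thesis by (simp add: i ennreal_mult[symmetric] ennreal_leI)
qed

text \<open>The upper half of Ahlfors regularity, together with a bounded diameter. It survives for
  a union of components shrinking to a point. The exponent is real because it is combined with
  fractional orders.\<close>

locale upper_regular = finite_measure M
  for M :: "'a::euclidean_space measure" +
  fixes n A D :: real
  assumes n: "0 < n" and A: "0 \<le> A" and D: "0 < D"
    and id_measurable [measurable]: "(\<lambda>x. x) \<in> borel_measurable M"
    and reg: "\<And>x R. 0 < R \<Longrightarrow> emeasure M {y \<in> space M. norm (x - y) \<le> R} \<le> ennreal (A * R powr n)"
    and diam: "\<And>x y. x \<in> space M \<Longrightarrow> y \<in> space M \<Longrightarrow> norm (x - y) \<le> D"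
begin

sublocale pair_sigma_finite M M ..

definition energy :: "real \<Rightarrow> real \<Rightarrow> ('a \<Rightarrow> complex) \<Rightarrow> ennreal" where
  "energy \<sigma> q \<phi> = (\<integral>\<^sup>+x. ennreal (norm (\<phi> x) powr q) \<partial>M) +
     (if \<sigma> = 0 then 0 else
       (\<integral>\<^sup>+x. (\<integral>\<^sup>+y. ennreal (norm (\<phi> x - \<phi> y) powr q / norm (x - y) powr (n + \<sigma> * q)) \<partial>M) \<partial>M))"

lemma norm_diff_pair_measurable [measurable]:
  "(\<lambda>p. norm (fst p - snd p)) \<in> borel_measurable (M \<Otimes>\<^sub>M M)"
proof -
  have [measurable]: "(\<lambda>p. fst p) \<in> borel_measurable (M \<Otimes>\<^sub>M M)"
    using measurable_compose[OF measurable_fst id_measurable] .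
  have [measurable]: "(\<lambda>p. snd p) \<in> borel_measurable (M \<Otimes>\<^sub>M M)"
    using measurable_compose[OF measurable_snd id_measurable] .
  show ?thesis by measurable
qed

lemma norm_diff_pair_measurable' [measurable]:
  "(\<lambda>(x, y). norm (x - y)) \<in> borel_measurable (M \<Otimes>\<^sub>M M)"
  using norm_diff_pair_measurable by (simp add: case_prod_beta')

section \<open>Riesz potentials under a growth bound on balls\<close>

lemma dyadic_near:
  assumes d: "0 < d" "d \<le> D"
  obtains i :: nat where "D * (1/2) ^ Suc i < d" "d \<le> D * (1/2) ^ i"
proof -
  obtain N :: nat where N: "(1/2) ^ N < d / D" using d D real_arch_pow_inv[of "d / D" "1/2"] by auto
  define j where "j = (LEAST j. D * (1/2) ^ j < d)"
  have ex: "D * (1/2) ^ N < d" using N D by (simp add: field_simps)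
  have j: "D * (1/2) ^ j < d" unfolding j_def using ex by (rule LeastI)
  have "j \<noteq> 0" using j d by (intro notI) auto
  then obtain i where i: "j = Suc i" using not0_implies_Suc by blast
  have "\<not> D * (1/2) ^ i < d" using not_less_Least[of i "\<lambda>j. D * (1/2) ^ j < d"] i unfolding j_def by auto
  then show thesis using that[of i] j i by auto
qed

text \<open>Dyadic shells around \<open>x\<close>: the shell of radius \<open>D * (1/2) ^ i\<close>
  contributes a multiple of its radius to the power \<open>n - \<beta>\<close>, which gives a
  geometric series. Negative \<open>\<beta>\<close> may occur in the applications, hence the
  absolute value in the constant.\<close>

lemma riesz_near:
  assumes \<beta>: "\<beta> < n"
  shows "\<exists>C>0. \<forall>x\<in>space M. (\<integral>\<^sup>+y. ennreal (norm (x - y) powr (- \<beta>)) \<partial>M) \<le> ennreal C"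
proof -
  define c where "c i = 2 powr \<bar>\<beta>\<bar> * (D * (1/2) ^ i) powr (- \<beta>)" for i :: nat
  define \<rho> where "\<rho> = (1/2::real) powr (n - \<beta>)"
  have c0: "0 \<le> c i" for i by (simp add: c_def)
  have \<rho>: "0 \<le> \<rho>" "\<rho> < 1" using \<beta> by (auto simp: \<rho>_def intro: half_powr_less_one)
  define C where "C = 2 powr \<bar>\<beta>\<bar> * A * D powr (n - \<beta>)"
  have C: "0 \<le> C" using A by (simp add: C_def)
  have "(\<integral>\<^sup>+y. ennreal (norm (x - y) powr (- \<beta>)) \<partial>M) \<le> ennreal (C * (1 / (1 - \<rho>)))" if x: "x \<in> space M" for x
  proof -
    have "(\<integral>\<^sup>+y. ennreal (norm (x - y) powr (- \<beta>)) \<partial>M) \<le>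
      (\<integral>\<^sup>+y. (\<Sum>i. ennreal (c i) * indicator {y \<in> space M. norm (x - y) \<le> D * (1/2) ^ i} y) \<partial>M)"
    proof (rule nn_integral_mono)
      fix y assume y: "y \<in> space M"
      show "ennreal (norm (x - y) powr (- \<beta>)) \<le> (\<Sum>i. ennreal (c i) * indicator {y \<in> space M. norm (x - y) \<le> D * (1/2) ^ i} y)"
      \<comment> \<open>On the diagonal \<open>0 powr (- \<beta>) = 0\<close>, so the singular point
        contributes nothing.\<close>
      proof (cases "x = y")
        case False
        then have d: "0 < norm (x - y)" "norm (x - y) \<le> D" using diam[OF x y] by auto
        obtain i :: nat where i: "D * (1/2) ^ Suc i < norm (x - y)" "norm (x - y) \<le> D * (1/2) ^ i"
          using dyadic_near[OF d] .
        have "norm (x - y) powr (- \<beta>) \<le> c i"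
        proof (cases "\<beta> \<ge> 0")
          case True
          have "norm (x - y) powr (- \<beta>) \<le> (D * (1/2) ^ i / 2) powr (- \<beta>)"
            using i True D by (intro powr_mono2') auto
          also have "\<dots> = c i"
          proof -
            have "(d / 2) powr (- \<beta>) = 2 powr \<beta> * d powr (- \<beta>)" if "0 < d" for d :: real
              using that by (simp add: powr_divide powr_minus field_simps)
            from this[of "D * (1/2) ^ i"] show ?thesis using D True by (simp add: c_def)
          qed
          finally show ?thesis .
        next
          case False
          have "norm (x - y) powr (- \<beta>) \<le> (D * (1/2) ^ i) powr (- \<beta>)"
            using i False by (intro powr_mono2) auto
          also have "\<dots> \<le> 2 powr \<bar>\<beta>\<bar> * (D * (1/2) ^ i) powr (- \<beta>)"
            using mult_right_mono[of 1 "2 powr \<bar>\<beta>\<bar>" "(D * (1/2) ^ i) powr (- \<beta>)"] by (simp add: ge_one_powr_ge_zero)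
          finally show ?thesis by (simp add: c_def)
        qed
        then have "ennreal (norm (x - y) powr (- \<beta>)) \<le> ennreal (c i) * indicator {y \<in> space M. norm (x - y) \<le> D * (1/2) ^ i} y"
          using i y by (simp add: ennreal_leI)
        also have "\<dots> \<le> (\<Sum>i. ennreal (c i) * indicator {y \<in> space M. norm (x - y) \<le> D * (1/2) ^ i} y)"
          by (rule ennreal_le_suminf)
        finally show ?thesis .
      qed simp
    qed
    also have "\<dots> = (\<Sum>i. \<integral>\<^sup>+y. ennreal (c i) * indicator {y \<in> space M. norm (x - y) \<le> D * (1/2) ^ i} y \<partial>M)"
      by (rule nn_integral_suminf) measurable
    also have "\<dots> = (\<Sum>i. ennreal (c i) * emeasure M {y \<in> space M. norm (x - y) \<le> D * (1/2) ^ i})"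
      by (intro suminf_cong nn_integral_cmult_indicator) measurable
    also have "\<dots> \<le> (\<Sum>i. ennreal (C * \<rho> ^ i))"
    proof (intro suminf_le)
      fix i
      have "ennreal (c i) * emeasure M {y \<in> space M. norm (x - y) \<le> D * (1/2) ^ i} \<le> ennreal (c i) * ennreal (A * (D * (1/2) ^ i) powr n)"
        using D by (intro mult_left_mono reg) auto
      also have "\<dots> = ennreal (c i * (A * (D * (1/2) ^ i) powr n))"
        using c0 A by (simp add: ennreal_mult)
      also have "c i * (A * (D * (1/2) ^ i) powr n) = 2 powr \<bar>\<beta>\<bar> * A * (D * (1/2) ^ i) powr (n - \<beta>)"
        using D by (simp add: c_def powr_diff powr_minus field_simps)
      also have "\<dots> = C * \<rho> ^ i"
        using D by (simp add: C_def \<rho>_def powr_mult powr_power powr_powr mult.commute flip: powr_realpow)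
      finally show "ennreal (c i) * emeasure M {y \<in> space M. norm (x - y) \<le> D * (1/2) ^ i} \<le> ennreal (C * \<rho> ^ i)" .
    qed auto
    also have "\<dots> = ennreal (\<Sum>i. C * \<rho> ^ i)"
      using \<rho> C by (intro suminf_ennreal2 summable_mult summable_geometric) auto
    also have "(\<Sum>i. C * \<rho> ^ i) = C * (1 / (1 - \<rho>))"
      using \<rho> by (subst suminf_mult) (auto simp: suminf_geometric)
    finally show ?thesis .
  qed
  moreover have "C * (1 / (1 - \<rho>)) \<le> C * (1 / (1 - \<rho>)) + 1" by simp
  ultimately have "\<forall>x\<in>space M. (\<integral>\<^sup>+y. ennreal (norm (x - y) powr (- \<beta>)) \<partial>M) \<le> ennreal (C * (1 / (1 - \<rho>)) + 1)"
    by (meson ennreal_leI order_trans)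
  moreover have "0 < C * (1 / (1 - \<rho>)) + 1" using C \<rho> by (intro add_nonneg_pos) auto
  ultimately show ?thesis by blast
qed

lemma dyadic_far:
  fixes \<rho> d :: real
  assumes "0 < \<rho>" "\<rho> \<le> d"
  obtains i :: nat where "\<rho> * 2 ^ i \<le> d" "d \<le> \<rho> * 2 ^ Suc i"
proof -
  obtain N :: nat where N: "d / \<rho> < 2 ^ N" using real_arch_pow[of 2 "d / \<rho>"] by auto
  define j where "j = (LEAST j. d < \<rho> * 2 ^ j)"
  have ex: "d < \<rho> * 2 ^ N" using N assms by (simp add: field_simps)
  have j: "d < \<rho> * 2 ^ j" unfolding j_def using ex by (rule LeastI)
  have "j \<noteq> 0" using j assms by (intro notI) auto
  then obtain i where i: "j = Suc i" using not0_implies_Suc by blast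
  have "\<not> d < \<rho> * 2 ^ i" using not_less_Least[of i "\<lambda>j. d < \<rho> * 2 ^ j"] i unfolding j_def by auto
  then show thesis using that[of i] j i by auto
qed

text \<open>The counterpart with shells growing outwards from radius \<open>\<rho>\<close>. The
  extra decay \<open>a\<close> makes the series converge, and the constant depends neither on
  \<open>x\<close> nor on \<open>\<rho>\<close>.\<close>

lemma riesz_far:
  assumes a: "0 < a"
  shows "\<exists>C\<ge>0. \<forall>x. \<forall>\<rho>>0. (\<integral>\<^sup>+y. ennreal (norm (x - y) powr (- (n + a))) * indicator {y. \<rho> \<le> norm (x - y)} y \<partial>M) \<le> ennreal (C * \<rho> powr (- a))"
proof -
  define r where "r = (2::real) powr (- a)"
  have r: "0 \<le> r" "r < 1" using a powr_less_mono[of "- a" 0 2] by (auto simp: r_def)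
  define C where "C = A * 2 powr n * (1 / (1 - r))"
  have C: "0 \<le> C" using A r by (simp add: C_def)
  have "(\<integral>\<^sup>+y. ennreal (norm (x - y) powr (- (n + a))) * indicator {y. \<rho> \<le> norm (x - y)} y \<partial>M) \<le> ennreal (C * \<rho> powr (- a))"
    if \<rho>: "0 < \<rho>" for x \<rho>
  proof -
    define c where "c i = (\<rho> * 2 ^ i) powr (- (n + a))" for i :: nat
    have "(\<integral>\<^sup>+y. ennreal (norm (x - y) powr (- (n + a))) * indicator {y. \<rho> \<le> norm (x - y)} y \<partial>M) \<le>
      (\<integral>\<^sup>+y. (\<Sum>i. ennreal (c i) * indicator {y \<in> space M. norm (x - y) \<le> \<rho> * 2 ^ Suc i} y) \<partial>M)"
    proof (rule nn_integral_mono)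
      fix y assume y: "y \<in> space M"
      show "ennreal (norm (x - y) powr (- (n + a))) * indicator {y. \<rho> \<le> norm (x - y)} y \<le> (\<Sum>i. ennreal (c i) * indicator {y \<in> space M. norm (x - y) \<le> \<rho> * 2 ^ Suc i} y)"
      proof (cases "\<rho> \<le> norm (x - y)")
        case True
        obtain i :: nat where i: "\<rho> * 2 ^ i \<le> norm (x - y)" "norm (x - y) \<le> \<rho> * 2 ^ Suc i"
          using dyadic_far[OF \<rho> True] .
        have "norm (x - y) powr (- (n + a)) \<le> c i"
          unfolding c_def using i \<rho> n a by (intro powr_mono2') auto
        then have "ennreal (norm (x - y) powr (- (n + a))) * indicator {y. \<rho> \<le> norm (x - y)} y
            \<le> ennreal (c i) * indicator {y \<in> space M. norm (x - y) \<le> \<rho> * 2 ^ Suc i} y"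
          using i y True by (simp add: ennreal_leI)
        also have "\<dots> \<le> (\<Sum>i. ennreal (c i) * indicator {y \<in> space M. norm (x - y) \<le> \<rho> * 2 ^ Suc i} y)"
          by (rule ennreal_le_suminf)
        finally show ?thesis .
      qed simp
    qed
    also have "\<dots> = (\<Sum>i. \<integral>\<^sup>+y. ennreal (c i) * indicator {y \<in> space M. norm (x - y) \<le> \<rho> * 2 ^ Suc i} y \<partial>M)"
      by (rule nn_integral_suminf) measurable
    also have "\<dots> = (\<Sum>i. ennreal (c i) * emeasure M {y \<in> space M. norm (x - y) \<le> \<rho> * 2 ^ Suc i})"
      by (intro suminf_cong nn_integral_cmult_indicator) measurable
    also have "\<dots> \<le> (\<Sum>i. ennreal (A * 2 powr n * \<rho> powr (- a) * r ^ i))"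
    proof (intro suminf_le)
      fix i
      have "ennreal (c i) * emeasure M {y \<in> space M. norm (x - y) \<le> \<rho> * 2 ^ Suc i} \<le> ennreal (c i) * ennreal (A * (\<rho> * 2 ^ Suc i) powr n)"
        using \<rho> by (intro mult_left_mono reg) auto
      also have "\<dots> = ennreal (c i * (A * (\<rho> * 2 ^ Suc i) powr n))"
        using A by (simp add: ennreal_mult c_def)
      also have "c i * (A * (\<rho> * 2 ^ Suc i) powr n) = A * 2 powr n * (\<rho> * 2 ^ i) powr (- a)"
      proof -
        have "e powr (- (n + a)) * (A * (e * 2) powr n) = A * 2 powr n * e powr (- a)" if "0 < e" for e
          using that by (simp add: powr_mult powr_add powr_diff powr_minus field_simps)
        from this[of "\<rho> * 2 ^ i"] show ?thesis using \<rho> by (simp add: c_def mult_ac)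
      qed
      also have "\<dots> = A * 2 powr n * \<rho> powr (- a) * r ^ i"
        using \<rho> by (simp add: r_def powr_mult powr_power powr_powr mult.commute flip: powr_realpow)
      finally show "ennreal (c i) * emeasure M {y \<in> space M. norm (x - y) \<le> \<rho> * 2 ^ Suc i} \<le> ennreal (A * 2 powr n * \<rho> powr (- a) * r ^ i)" .
    qed auto
    also have "\<dots> = ennreal (\<Sum>i. A * 2 powr n * \<rho> powr (- a) * r ^ i)"
      using r A by (intro suminf_ennreal2 summable_mult summable_geometric) auto
    also have "(\<Sum>i. A * 2 powr n * \<rho> powr (- a) * r ^ i) = C * \<rho> powr (- a)"
      using r by (subst suminf_mult) (auto simp: suminf_geometric C_def)
    finally show ?thesis .
  qed
  then show ?thesis using C by blast
qed

text \<open>One half of Schur's test: by Tonelli and the symmetry of the kernel the integration in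
  \<open>x\<close> can be carried out first.\<close>

lemma riesz_potential_bound:
  assumes b: "b < n"
  shows "\<exists>C>0. \<forall>g\<in>borel_measurable M.
    (\<integral>\<^sup>+x. (\<integral>\<^sup>+y. ennreal (norm (x - y) powr (- b)) * g y \<partial>M) \<partial>M) \<le> ennreal C * (\<integral>\<^sup>+y. g y \<partial>M)"
proof -
  obtain C where C: "0 < C" "\<And>x. x \<in> space M \<Longrightarrow> (\<integral>\<^sup>+y. ennreal (norm (x - y) powr (- b)) \<partial>M) \<le> ennreal C"
    using riesz_near[OF b] by blast
  have "(\<integral>\<^sup>+x. (\<integral>\<^sup>+y. ennreal (norm (x - y) powr (- b)) * g y \<partial>M) \<partial>M) \<le> ennreal C * (\<integral>\<^sup>+y. g y \<partial>M)"
    if g [measurable]: "g \<in> borel_measurable M" for g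
  proof -
    have "(\<integral>\<^sup>+x. (\<integral>\<^sup>+y. ennreal (norm (x - y) powr (- b)) * g y \<partial>M) \<partial>M)
        = (\<integral>\<^sup>+y. (\<integral>\<^sup>+x. ennreal (norm (x - y) powr (- b)) * g y \<partial>M) \<partial>M)"
      by (rule Fubini'[symmetric]) measurable
    also have "\<dots> = (\<integral>\<^sup>+y. (\<integral>\<^sup>+x. ennreal (norm (y - x) powr (- b)) \<partial>M) * g y \<partial>M)"
      by (subst nn_integral_multc[symmetric]) (auto simp: norm_minus_commute)
    also have "\<dots> \<le> (\<integral>\<^sup>+y. ennreal C * g y \<partial>M)"
      by (intro nn_integral_mono mult_right_mono C) auto
    also have "\<dots> = ennreal C * (\<integral>\<^sup>+y. g y \<partial>M)" by (simp add: nn_integral_cmult)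
    finally show ?thesis .
  qed
  then show ?thesis using C by blast
qed

text \<open>Interpolated Hoelder condition on a weakly singular kernel: it is exactly what makes the operator
  gain any smoothness \<open>\<sigma> < \<theta>\<close>, independently of the smoothness of \<open>f\<close>.\<close>

lemma weakly_singular_energy:
  fixes k :: "'a \<Rightarrow> 'a \<Rightarrow> real"
  assumes q: "1 < q" and \<sigma>: "0 \<le> \<sigma>" "\<sigma> < \<theta>" and b: "b < n" and K: "0 < K"
    and k [measurable]: "(\<lambda>(x, y). k x y) \<in> borel_measurable (M \<Otimes>\<^sub>M M)"
    and k1: "\<And>x y. x \<in> space M \<Longrightarrow> y \<in> space M \<Longrightarrow> \<bar>k x y\<bar> \<le> K * norm (x - y) powr (- b)"
    and k2: "\<And>x x' y. x \<in> space M \<Longrightarrow> x' \<in> space M \<Longrightarrow> y \<in> space M \<Longrightarrow>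
      \<bar>k x y - k x' y\<bar> \<le> K * norm (x - x') powr \<theta> * (norm (x - y) powr (- b) + norm (x' - y) powr (- b))"
  shows "\<exists>C\<ge>0. \<forall>f\<in>borel_measurable M.
    energy \<sigma> q (\<lambda>x. LINT y|M. k x y *\<^sub>R f y) \<le> ennreal C * (\<integral>\<^sup>+y. ennreal (norm (f y) powr q) \<partial>M)"
proof -
  obtain C0 where C0: "0 < C0" "\<And>x. x \<in> space M \<Longrightarrow> (\<integral>\<^sup>+y. ennreal (norm (x - y) powr (- b)) \<partial>M) \<le> ennreal C0"
    using riesz_near[OF b] by blast
  obtain C1 where C1: "0 < C1" "\<And>g. g\<in>borel_measurable M \<Longrightarrow>
    (\<integral>\<^sup>+x. (\<integral>\<^sup>+y. ennreal (norm (x - y) powr (- b)) * g y \<partial>M) \<partial>M) \<le> ennreal C1 * (\<integral>\<^sup>+y. g y \<partial>M)"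
    using riesz_potential_bound[OF b] by blast
  \<comment> \<open>The Hoelder factor contributes the exponent \<open>\<theta> * q\<close> and the
    energy weight \<open>- (n + \<sigma> * q)\<close>; together they give \<open>- \<beta>\<close>.
    It is integrable because \<open>\<sigma> < \<theta>\<close>.\<close>
  define \<beta> where "\<beta> = n - (\<theta> - \<sigma>) * q"
  have "\<beta> < n" using q \<sigma> by (simp add: \<beta>_def)
  then obtain C2 where C2: "0 < C2" "\<And>x. x \<in> space M \<Longrightarrow> (\<integral>\<^sup>+y. ennreal (norm (x - y) powr (- \<beta>)) \<partial>M) \<le> ennreal C2"
    using riesz_near by blast
  define Cp where "Cp = (2 * K * C0) powr (q - 1) * K"
  have Cp: "0 < Cp" using K C0 by (simp add: Cp_def)
  define CL where "CL = (K * C0) powr (q - 1) * K"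
  have CL: "0 < CL" using K C0 by (simp add: CL_def)
  have main: "energy \<sigma> q (\<lambda>x. LINT y|M. k x y *\<^sub>R f y) \<le> ennreal (CL * C1 + 2 * Cp * C2 * C1) * (\<integral>\<^sup>+y. ennreal (norm (f y) powr q) \<partial>M)"
    if f [measurable]: "f \<in> borel_measurable M" for f :: "'a \<Rightarrow> complex"
  proof -
    define u where "u x = (LINT y|M. k x y *\<^sub>R f y)" for x
    \<comment> \<open>\<open>V\<close> is the potential of the \<open>q\<close>-th power of
      \<open>f\<close>. It controls both \<open>u\<close> and its increments pointwise, and its
      integral is controlled by that of the \<open>q\<close>-th power alone.\<close>
    define V where "V x = (\<integral>\<^sup>+y. ennreal (norm (x - y) powr (- b)) * ennreal (norm (f y) powr q) \<partial>M)" for x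
    have Vm [measurable]: "V \<in> borel_measurable M" unfolding V_def by measurable
    have um [measurable]: "u \<in> borel_measurable M" unfolding u_def by measurable
    have kx [measurable]: "x \<in> space M \<Longrightarrow> k x \<in> borel_measurable M" for x
      using measurable_Pair2[OF k] by simp
    have IV: "(\<integral>\<^sup>+x. V x \<partial>M) \<le> ennreal C1 * (\<integral>\<^sup>+y. ennreal (norm (f y) powr q) \<partial>M)"
      unfolding V_def by (rule C1(2)) measurable
    have uV: "ennreal (norm (u x) powr q) \<le> ennreal CL * V x" if x: "x \<in> space M" for x
    proof -
      have "ennreal (norm (u x)) \<le> (\<integral>\<^sup>+y. ennreal (K * norm (x - y) powr (- b) * norm (f y)) \<partial>M)"
      \<comment> \<open>A divergent Bochner integral is 0, so the estimate is trivial in that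
        case.\<close>
      proof (cases "integrable M (\<lambda>y. k x y *\<^sub>R f y)")
        case True
        have "ennreal (norm (u x)) \<le> (\<integral>\<^sup>+y. ennreal (norm (k x y *\<^sub>R f y)) \<partial>M)"
          unfolding u_def by (rule integral_norm_bound_ennreal[OF True])
        also have "\<dots> \<le> (\<integral>\<^sup>+y. ennreal (K * norm (x - y) powr (- b) * norm (f y)) \<partial>M)"
          using k1[OF x] by (intro nn_integral_mono ennreal_leI) (auto intro!: mult_right_mono)
        finally show ?thesis .
      qed (simp add: u_def not_integrable_integral_eq)
      moreover have "(\<integral>\<^sup>+y. ennreal (K * norm (x - y) powr (- b)) \<partial>M) \<le> ennreal (K * C0)"
        using C0(2)[OF x] K C0(1) by (simp add: ennreal_mult nn_integral_cmult mult_left_mono)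
      ultimately have "ennreal (norm (u x) powr q) \<le> ennreal ((K * C0) powr (q - 1)) *
          (\<integral>\<^sup>+y. ennreal (K * norm (x - y) powr (- b) * norm (f y) powr q) \<partial>M)"
        using q K C0 by (intro nn_integral_jensen_powr) auto
      also have "(\<integral>\<^sup>+y. ennreal (K * norm (x - y) powr (- b) * norm (f y) powr q) \<partial>M) = ennreal K * V x"
        using K by (simp add: V_def ennreal_mult nn_integral_cmult mult.assoc)
      finally show ?thesis using K by (simp add: CL_def ennreal_mult mult.assoc)
    qed
    have intg: "integrable M (\<lambda>y. k x y *\<^sub>R f y)" if x: "x \<in> space M" and fin: "V x < \<infinity>" for x
    proof (rule integrableI_bounded)
      show "(\<lambda>y. k x y *\<^sub>R f y) \<in> borel_measurable M" using x by measurable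
      have pt: "t \<le> 1 + t powr q" if "0 \<le> t" for t :: real
      proof (cases "t \<le> 1")
        case False
        then have "t powr 1 \<le> t powr q" using q by (intro powr_mono) auto
        then show ?thesis using False by simp
      qed (use that in \<open>auto intro: add_increasing2\<close>)
      have "(\<integral>\<^sup>+y. ennreal (norm (k x y *\<^sub>R f y)) \<partial>M) \<le>
         (\<integral>\<^sup>+y. ennreal K * (ennreal (norm (x - y) powr (- b)) + ennreal (norm (x - y) powr (- b)) * ennreal (norm (f y) powr q)) \<partial>M)"
      proof (rule nn_integral_mono)
        fix y assume y: "y \<in> space M"
        have "norm (k x y *\<^sub>R f y) \<le> (K * norm (x - y) powr (- b)) * (1 + norm (f y) powr q)"
          using k1[OF x y] pt[of "norm (f y)"] K by (auto intro!: mult_mono)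
        also have "\<dots> = K * (norm (x - y) powr (- b) + norm (x - y) powr (- b) * norm (f y) powr q)"
          by (simp add: algebra_simps)
        finally show "ennreal (norm (k x y *\<^sub>R f y)) \<le> ennreal K * (ennreal (norm (x - y) powr (- b)) + ennreal (norm (x - y) powr (- b)) * ennreal (norm (f y) powr q))"
          using K by (simp flip: ennreal_mult ennreal_plus add: ennreal_leI)
      qed
      also have "\<dots> = ennreal K * ((\<integral>\<^sup>+y. ennreal (norm (x - y) powr (- b)) \<partial>M) + V x)"
        by (simp add: nn_integral_cmult nn_integral_add V_def)
      also have "\<dots> < \<infinity>" using C0(2)[OF x] fin
        by (auto simp: ennreal_mult_less_top ennreal_add_less_top intro: le_less_trans)
      finally show "(\<integral>\<^sup>+y. ennreal (norm (k x y *\<^sub>R f y)) \<partial>M) < \<infinity>" .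
    qed
    have diff: "ennreal (norm (u x - u x') powr q) \<le> ennreal (Cp * norm (x - x') powr (\<theta> * q)) * (V x + V x')"
      if x: "x \<in> space M" and x': "x' \<in> space M" for x x'
    proof (cases "x = x'")
      case False
      show ?thesis
      proof (cases "V x + V x' = \<infinity>")
        case True
        show ?thesis unfolding True using Cp False by (simp add: ennreal_mult_top)
      next
        case fin: False
        define d where "d = norm (x - x') powr \<theta>"
        have d: "0 < d" using False by (simp add: d_def)
        have int: "integrable M (\<lambda>y. k x y *\<^sub>R f y)" "integrable M (\<lambda>y. k x' y *\<^sub>R f y)"
          using fin by (auto intro!: intg x x' simp: less_top)
        \<comment> \<open>Jensen's inequality is applied with this weight. Its mass is of order
          \<open>d\<close>, which enters with exponent \<open>q - 1\<close>; one more factor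
          \<open>d\<close> inside the weighted integral completes it to
          \<open>d powr q\<close>.\<close>
        define w where "w y = K * d * (norm (x - y) powr (- b) + norm (x' - y) powr (- b))" for y
        have "u x - u x' = (LINT y|M. (k x y - k x' y) *\<^sub>R f y)"
          unfolding u_def by (subst Bochner_Integration.integral_diff[symmetric, OF int]) (simp add: scaleR_left_diff_distrib)
        then have "ennreal (norm (u x - u x')) \<le> (\<integral>\<^sup>+y. ennreal (norm ((k x y - k x' y) *\<^sub>R f y)) \<partial>M)"
          using Bochner_Integration.integrable_diff[OF int]
          by (simp only: scaleR_left_diff_distrib) (rule integral_norm_bound_ennreal)
        also have "\<dots> \<le> (\<integral>\<^sup>+y. ennreal (w y * norm (f y)) \<partial>M)"
          using k2[OF x x'] by (intro nn_integral_mono ennreal_leI) (auto intro!: mult_right_mono simp: w_def d_def)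
        finally have U: "ennreal (norm (u x - u x')) \<le> (\<integral>\<^sup>+y. ennreal (w y * norm (f y)) \<partial>M)" .
        have w0: "0 \<le> w y" for y using K d by (simp add: w_def)
        have wm [measurable]: "w \<in> borel_measurable M" unfolding w_def by measurable
        have "(\<integral>\<^sup>+y. ennreal (w y) \<partial>M) = ennreal (K * d) * ((\<integral>\<^sup>+y. ennreal (norm (x - y) powr (- b)) \<partial>M) + (\<integral>\<^sup>+y. ennreal (norm (x' - y) powr (- b)) \<partial>M))"
          using K d by (simp add: w_def ennreal_mult nn_integral_cmult nn_integral_add)
        also have "\<dots> \<le> ennreal (K * d) * (ennreal C0 + ennreal C0)"
          by (intro mult_left_mono add_mono C0 x x') auto
        also have "\<dots> = ennreal (2 * K * C0 * d)"
          using K d C0 by (simp flip: ennreal_mult ennreal_plus add: algebra_simps)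
        finally have wc: "(\<integral>\<^sup>+y. ennreal (w y) \<partial>M) \<le> ennreal (2 * K * C0 * d)" .
        have "ennreal (norm (u x - u x') powr q) \<le> ennreal ((2 * K * C0 * d) powr (q - 1)) * (\<integral>\<^sup>+y. ennreal (w y * norm (f y) powr q) \<partial>M)"
          using q K C0 d w0 U wc by (intro nn_integral_jensen_powr) auto
        also have "(\<integral>\<^sup>+y. ennreal (w y * norm (f y) powr q) \<partial>M) = ennreal (K * d) * (V x + V x')"
        proof -
          have "ennreal (w y * norm (f y) powr q) = ennreal (K * d) * (ennreal (norm (x - y) powr (- b)) * ennreal (norm (f y) powr q) + ennreal (norm (x' - y) powr (- b)) * ennreal (norm (f y) powr q))" for y
            using K d by (simp add: w_def flip: ennreal_mult ennreal_plus) (simp add: algebra_simps)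
          then show ?thesis by (simp add: V_def nn_integral_cmult nn_integral_add)
        qed
        also have "ennreal ((2 * K * C0 * d) powr (q - 1)) * (ennreal (K * d) * (V x + V x'))
            = ennreal ((2 * K * C0 * d) powr (q - 1) * (K * d)) * (V x + V x')"
          using K d by (simp add: ennreal_mult mult.assoc)
        also have "(2 * K * C0 * d) powr (q - 1) * (K * d) = Cp * d powr q"
          using d K C0 by (simp add: Cp_def powr_mult powr_diff)
        also have "d powr q = norm (x - x') powr (\<theta> * q)" by (simp add: d_def powr_powr)
        finally show ?thesis .
      qed
    qed (use q in auto)
    have L: "(\<integral>\<^sup>+x. ennreal (norm (u x) powr q) \<partial>M) \<le> ennreal (CL * C1) * (\<integral>\<^sup>+y. ennreal (norm (f y) powr q) \<partial>M)"
    proof -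
      have "(\<integral>\<^sup>+x. ennreal (norm (u x) powr q) \<partial>M) \<le> (\<integral>\<^sup>+x. ennreal CL * V x \<partial>M)"
        by (rule nn_integral_mono) (rule uV)
      also have "\<dots> = ennreal CL * (\<integral>\<^sup>+x. V x \<partial>M)" by (rule nn_integral_cmult) measurable
      also have "\<dots> \<le> ennreal CL * (ennreal C1 * (\<integral>\<^sup>+y. ennreal (norm (f y) powr q) \<partial>M))"
        by (intro mult_left_mono IV) simp
      finally show ?thesis using CL C1 by (simp add: ennreal_mult mult.assoc)
    qed
    have S: "(\<integral>\<^sup>+x. (\<integral>\<^sup>+y. ennreal (norm (u x - u y) powr q / norm (x - y) powr (n + \<sigma> * q)) \<partial>M) \<partial>M)
        \<le> ennreal (2 * Cp * C2 * C1) * (\<integral>\<^sup>+y. ennreal (norm (f y) powr q) \<partial>M)"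
    proof -
      have "(\<integral>\<^sup>+x. (\<integral>\<^sup>+y. ennreal (norm (u x - u y) powr q / norm (x - y) powr (n + \<sigma> * q)) \<partial>M) \<partial>M)
        \<le> (\<integral>\<^sup>+x. (\<integral>\<^sup>+y. ennreal (norm (x - y) powr (- \<beta>)) * (ennreal Cp * V x) + ennreal (norm (x - y) powr (- \<beta>)) * (ennreal Cp * V y) \<partial>M) \<partial>M)"
      proof (intro nn_integral_mono)
        fix x y assume x: "x \<in> space M" and y: "y \<in> space M"
        have "ennreal (norm (u x - u y) powr q / norm (x - y) powr (n + \<sigma> * q))
            = ennreal (norm (u x - u y) powr q) * ennreal (norm (x - y) powr (- (n + \<sigma> * q)))"
          by (simp add: ennreal_mult[symmetric] powr_minus divide_inverse del: minus_add_distrib)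
        also have "\<dots> \<le> ennreal (Cp * norm (x - y) powr (\<theta> * q)) * (V x + V y) * ennreal (norm (x - y) powr (- (n + \<sigma> * q)))"
          by (intro mult_right_mono diff x y) auto
        also have "\<dots> = ennreal (Cp * (norm (x - y) powr (\<theta> * q) * norm (x - y) powr (- (n + \<sigma> * q)))) * (V x + V y)"
          using Cp by (simp add: ennreal_mult mult_ac)
        also have "norm (x - y) powr (\<theta> * q) * norm (x - y) powr (- (n + \<sigma> * q)) = norm (x - y) powr (- \<beta>)"
          by (simp add: powr_add[symmetric] \<beta>_def algebra_simps)
        finally show "ennreal (norm (u x - u y) powr q / norm (x - y) powr (n + \<sigma> * q)) \<le>
            ennreal (norm (x - y) powr (- \<beta>)) * (ennreal Cp * V x) + ennreal (norm (x - y) powr (- \<beta>)) * (ennreal Cp * V y)"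
          using Cp by (simp add: ennreal_mult distrib_left distrib_right mult_ac)
      qed
      also have "\<dots> = (\<integral>\<^sup>+x. (\<integral>\<^sup>+y. ennreal (norm (x - y) powr (- \<beta>)) * (ennreal Cp * V x) \<partial>M) \<partial>M)
          + (\<integral>\<^sup>+x. (\<integral>\<^sup>+y. ennreal (norm (x - y) powr (- \<beta>)) * (ennreal Cp * V y) \<partial>M) \<partial>M)"
        by (subst nn_integral_add[symmetric]) (auto intro!: nn_integral_cong nn_integral_add)
      also have "(\<integral>\<^sup>+x. (\<integral>\<^sup>+y. ennreal (norm (x - y) powr (- \<beta>)) * (ennreal Cp * V y) \<partial>M) \<partial>M)
          = (\<integral>\<^sup>+y. (\<integral>\<^sup>+x. ennreal (norm (x - y) powr (- \<beta>)) * (ennreal Cp * V y) \<partial>M) \<partial>M)"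
        by (rule Fubini'[symmetric]) measurable
      also have "\<dots> = (\<integral>\<^sup>+x. (\<integral>\<^sup>+y. ennreal (norm (x - y) powr (- \<beta>)) * (ennreal Cp * V x) \<partial>M) \<partial>M)"
        by (simp add: norm_minus_commute)
      also have "(\<integral>\<^sup>+x. (\<integral>\<^sup>+y. ennreal (norm (x - y) powr (- \<beta>)) * (ennreal Cp * V x) \<partial>M) \<partial>M)
          = (\<integral>\<^sup>+x. (\<integral>\<^sup>+y. ennreal (norm (x - y) powr (- \<beta>)) \<partial>M) * (ennreal Cp * V x) \<partial>M)"
        by (intro nn_integral_cong nn_integral_multc) measurable
      also have "\<dots> \<le> (\<integral>\<^sup>+x. ennreal C2 * (ennreal Cp * V x) \<partial>M)"
        by (intro nn_integral_mono mult_right_mono C2) auto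
      also have "\<dots> = ennreal (C2 * Cp) * (\<integral>\<^sup>+x. V x \<partial>M)"
        using C2 Cp by (simp add: nn_integral_cmult ennreal_mult mult.assoc)
      finally have "(\<integral>\<^sup>+x. (\<integral>\<^sup>+y. ennreal (norm (u x - u y) powr q / norm (x - y) powr (n + \<sigma> * q)) \<partial>M) \<partial>M)
          \<le> 2 * (ennreal (C2 * Cp) * (\<integral>\<^sup>+x. V x \<partial>M))"
        by (auto simp: mult_2 intro: order_trans add_mono)
      also have "\<dots> \<le> 2 * (ennreal (C2 * Cp) * (ennreal C1 * (\<integral>\<^sup>+y. ennreal (norm (f y) powr q) \<partial>M)))"
        by (intro mult_left_mono IV) auto
      also have "\<dots> = ennreal (2 * Cp * C2 * C1) * (\<integral>\<^sup>+y. ennreal (norm (f y) powr q) \<partial>M)"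
        using C2 Cp C1 by (simp add: ennreal_mult mult_ac)
      finally show ?thesis .
    qed
    have "energy \<sigma> q u \<le> ennreal (CL * C1) * (\<integral>\<^sup>+y. ennreal (norm (f y) powr q) \<partial>M) + ennreal (2 * Cp * C2 * C1) * (\<integral>\<^sup>+y. ennreal (norm (f y) powr q) \<partial>M)"
      unfolding energy_def by (intro add_mono L) (use S in simp)
    also have "\<dots> = ennreal (CL * C1 + 2 * Cp * C2 * C1) * (\<integral>\<^sup>+y. ennreal (norm (f y) powr q) \<partial>M)"
      using CL C1 Cp C2 by (simp add: distrib_right)
    finally show ?thesis by (simp add: u_def[abs_def])
  qed
  have "0 \<le> CL * C1 + 2 * Cp * C2 * C1" using CL C1 Cp C2 by simp
  then show ?thesis using main by blast
qed

text \<open>The Lipschitz bound cancels the order \<open>q\<close> in the energy weight, and because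
  \<open>\<sigma> < 1\<close> the remaining singularity is integrable. The constant depends on
  \<open>h\<close> through \<open>B\<close> only.\<close>

lemma lipschitz_energy:
  assumes q: "1 < q" and \<sigma>: "0 \<le> \<sigma>" "\<sigma> < 1"
  shows "\<exists>C\<ge>0. \<forall>h B. 0 \<le> B \<longrightarrow> (\<forall>x\<in>space M. norm (h x) \<le> B) \<longrightarrow>
     (\<forall>x\<in>space M. \<forall>y\<in>space M. norm (h x - h y) \<le> B * norm (x - y)) \<longrightarrow>
     energy \<sigma> q h \<le> ennreal (C * B powr q)"
proof -
  define \<beta> where "\<beta> = n - (1 - \<sigma>) * q"
  have "\<beta> < n" using q \<sigma> by (simp add: \<beta>_def)
  then obtain C2 where C2: "0 < C2" "\<And>x. x \<in> space M \<Longrightarrow> (\<integral>\<^sup>+y. ennreal (norm (x - y) powr (- \<beta>)) \<partial>M) \<le> ennreal C2"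
    using riesz_near by blast
  define m where "m = measure M (space M)"
  have m: "emeasure M (space M) = ennreal m" "0 \<le> m" by (auto simp: m_def emeasure_eq_measure)
  have "energy \<sigma> q h \<le> ennreal ((m + C2 * m) * B powr q)"
    if B: "0 \<le> B" and h1: "\<And>x. x\<in>space M \<Longrightarrow> norm (h x) \<le> B"
      and h2: "\<And>x y. x\<in>space M \<Longrightarrow> y\<in>space M \<Longrightarrow> norm (h x - h y) \<le> B * norm (x - y)" for h :: "'a \<Rightarrow> complex" and B
  proof -
    have "(\<integral>\<^sup>+x. ennreal (norm (h x) powr q) \<partial>M) \<le> (\<integral>\<^sup>+x. ennreal (B powr q) \<partial>M)"
      using q h1 by (intro nn_integral_mono ennreal_leI powr_mono2) auto
    then have 1: "(\<integral>\<^sup>+x. ennreal (norm (h x) powr q) \<partial>M) \<le> ennreal (m * B powr q)"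
      using m by (simp add: ennreal_mult[symmetric] mult.commute)
    have "(\<integral>\<^sup>+x. (\<integral>\<^sup>+y. ennreal (norm (h x - h y) powr q / norm (x - y) powr (n + \<sigma> * q)) \<partial>M) \<partial>M)
        \<le> (\<integral>\<^sup>+x. (\<integral>\<^sup>+y. ennreal (B powr q) * ennreal (norm (x - y) powr (- \<beta>)) \<partial>M) \<partial>M)"
    proof (intro nn_integral_mono)
      fix x y assume x: "x \<in> space M" and y: "y \<in> space M"
      have "norm (h x - h y) powr q / norm (x - y) powr (n + \<sigma> * q) \<le> (B * norm (x - y)) powr q / norm (x - y) powr (n + \<sigma> * q)"
        using h2[OF x y] q by (intro divide_right_mono powr_mono2) auto
      also have "\<dots> = B powr q * (norm (x - y) powr q * norm (x - y) powr (- (n + \<sigma> * q)))"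
        using B by (simp add: powr_mult powr_minus divide_inverse del: minus_add_distrib)
      also have "norm (x - y) powr q * norm (x - y) powr (- (n + \<sigma> * q)) = norm (x - y) powr (- \<beta>)"
        by (simp add: powr_add[symmetric] \<beta>_def algebra_simps)
      finally show "ennreal (norm (h x - h y) powr q / norm (x - y) powr (n + \<sigma> * q)) \<le> ennreal (B powr q) * ennreal (norm (x - y) powr (- \<beta>))"
        by (simp add: ennreal_mult[symmetric] ennreal_leI)
    qed
    also have "\<dots> = (\<integral>\<^sup>+x. ennreal (B powr q) * (\<integral>\<^sup>+y. ennreal (norm (x - y) powr (- \<beta>)) \<partial>M) \<partial>M)"
      by (intro nn_integral_cong nn_integral_cmult) measurable
    also have "\<dots> \<le> (\<integral>\<^sup>+x. ennreal (B powr q) * ennreal C2 \<partial>M)"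
      by (intro nn_integral_mono mult_left_mono C2) auto
    also have "\<dots> = ennreal (C2 * m * B powr q)"
      using m C2 by (simp add: ennreal_mult[symmetric] mult_ac)
    finally have 2: "(\<integral>\<^sup>+x. (\<integral>\<^sup>+y. ennreal (norm (h x - h y) powr q / norm (x - y) powr (n + \<sigma> * q)) \<partial>M) \<partial>M) \<le> ennreal (C2 * m * B powr q)" .
    have "energy \<sigma> q h \<le> ennreal (m * B powr q) + ennreal (C2 * m * B powr q)"
      unfolding energy_def by (intro add_mono 1) (use 2 in simp)
    also have "\<dots> = ennreal ((m + C2 * m) * B powr q)"
      using m C2 by (simp add: distrib_right)
    finally show ?thesis .
  qed
  moreover have "0 \<le> m + C2 * m" using m C2 by simp
  ultimately show ?thesis by blast
qed

text \<open>Constants cancel in the double integral, so only the integral of the \<open>q\<close>-th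
  power changes, and there the mean is controlled by Jensen's inequality.\<close>

lemma mean_free_energy:
  assumes q: "1 < q"
  shows "\<exists>C\<ge>0. \<forall>\<phi>\<in>borel_measurable M.
    energy \<sigma> q (\<lambda>x. \<phi> x - (1 / measure M (space M)) *\<^sub>R (LINT y|M. \<phi> y)) \<le> ennreal C * energy \<sigma> q \<phi>"
proof -
  define m where "m = measure M (space M)"
  have m: "emeasure M (space M) = ennreal m" "0 \<le> m" by (auto simp: m_def emeasure_eq_measure)
  \<comment> \<open>An upper bound of the total mass that stays positive when the mass vanishes; in
    that case \<open>1 / m\<close> is 0 and so is the subtracted term.\<close>
  define c where "c = m + 1"
  define C where "C = 2 powr q * (1 + m * ((1 / m) powr q * c powr (q - 1))) + 1"
  have C: "1 \<le> C" using m by (simp add: C_def)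
  have "energy \<sigma> q (\<lambda>x. \<phi> x - (1 / m) *\<^sub>R (LINT y|M. \<phi> y)) \<le> ennreal C * energy \<sigma> q \<phi>"
    if \<phi> [measurable]: "\<phi> \<in> borel_measurable M" for \<phi> :: "'a \<Rightarrow> complex"
  proof -
    let ?I = "\<integral>\<^sup>+x. ennreal (norm (\<phi> x) powr q) \<partial>M"
    define a where "a = (1 / m) *\<^sub>R (LINT y|M. \<phi> y)"
    have "ennreal (norm (LINT y|M. \<phi> y)) \<le> (\<integral>\<^sup>+y. ennreal (1 * norm (\<phi> y)) \<partial>M)"
      by (cases "integrable M \<phi>") (auto simp: not_integrable_integral_eq integral_norm_bound_ennreal)
    then have "ennreal (norm (LINT y|M. \<phi> y) powr q) \<le> ennreal (c powr (q - 1)) * (\<integral>\<^sup>+y. ennreal (1 * norm (\<phi> y) powr q) \<partial>M)"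
      using q m by (intro nn_integral_jensen_powr) (auto simp: c_def intro!: ennreal_leI)
    then have "ennreal ((1 / m) powr q) * ennreal (norm (LINT y|M. \<phi> y) powr q) \<le> ennreal ((1 / m) powr q) * (ennreal (c powr (q - 1)) * ?I)"
      by (intro mult_left_mono) auto
    moreover have "norm a powr q = (1 / m) powr q * norm (LINT y|M. \<phi> y) powr q"
      using m by (simp add: a_def powr_divide)
    ultimately have a: "ennreal (norm a powr q) \<le> ennreal ((1 / m) powr q * c powr (q - 1)) * ?I"
      by (simp only: ennreal_mult[OF powr_ge_zero powr_ge_zero] mult.assoc)
    have "(\<integral>\<^sup>+x. ennreal (norm (\<phi> x - a) powr q) \<partial>M) \<le> (\<integral>\<^sup>+x. ennreal (2 powr q) * (ennreal (norm (\<phi> x) powr q) + ennreal (norm a powr q)) \<partial>M)"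
      using q norm_diff_powr_le[of q] by (intro nn_integral_mono) (auto simp flip: ennreal_mult ennreal_plus intro!: ennreal_leI)
    also have "\<dots> = ennreal (2 powr q) * (?I + ennreal m * ennreal (norm a powr q))"
      by (simp add: nn_integral_cmult nn_integral_add m mult.commute)
    also have "\<dots> \<le> ennreal (2 powr q) * (?I + ennreal m * (ennreal ((1 / m) powr q * c powr (q - 1)) * ?I))"
      by (intro mult_left_mono add_left_mono a) auto
    also have "\<dots> = ennreal (2 powr q * (1 + m * ((1 / m) powr q * c powr (q - 1)))) * ?I"
      using m by (simp add: ennreal_mult distrib_right distrib_left mult_ac)
    also have "\<dots> \<le> ennreal C * ?I" by (intro mult_right_mono ennreal_leI) (auto simp: C_def)
    finally have 1: "(\<integral>\<^sup>+x. ennreal (norm (\<phi> x - a) powr q) \<partial>M) \<le> ennreal C * ?I" .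
    have 2: "x \<le> ennreal C * x" for x
      using mult_right_mono[of 1 "ennreal C" x] C by simp
    show ?thesis
      unfolding energy_def distrib_left a_def[symmetric] using 1
      by (intro add_mono) (auto intro: 2)
  qed
  then show ?thesis using C unfolding m_def by (intro exI[of _ C]) auto
qed

end

subsection \<open>Smooth boundaries\<close>

lemma GDERIV_unique:
  assumes "GDERIV f x :> D" "GDERIV f x :> D'"
  shows "D = D'"
proof -
  have "(\<lambda>h. h \<bullet> D) = (\<lambda>h. h \<bullet> D')"
    using assms unfolding gderiv_def by (rule has_derivative_unique)
  then show ?thesis by (metis vector_eq_ldot)
qed

lemma grad_eqI: "GDERIV f x :> D \<Longrightarrow> grad f x = D"
  unfolding grad_def by (rule the_equality) (auto intro: GDERIV_unique)

text \<open>The vector representing the derivative is assembled from its values on the basis, so the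
  definite description behind \<open>grad\<close> is met.\<close>

lemma differentiable_imp_GDERIV_grad:
  fixes f :: "'a::euclidean_space \<Rightarrow> real"
  assumes "f differentiable (at x)"
  shows "GDERIV f x :> grad f x"
proof -
  let ?f' = "frechet_derivative f (at x)"
  let ?D = "\<Sum>b\<in>Basis. ?f' b *\<^sub>R b"
  have d: "(f has_derivative ?f') (at x)" using assms frechet_derivative_works by blast
  then interpret bounded_linear ?f' by (rule has_derivative_bounded_linear)
  have "?f' h = h \<bullet> ?D" for h
  proof -
    have "?f' h = ?f' (\<Sum>b\<in>Basis. (h \<bullet> b) *\<^sub>R b)" by (simp add: euclidean_representation)
    also have "\<dots> = (\<Sum>b\<in>Basis. (h \<bullet> b) * ?f' b)" by (simp add: sum scaleR)
    also have "\<dots> = h \<bullet> ?D" by (simp add: inner_sum_right mult.commute)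
    finally show ?thesis .
  qed
  then have "GDERIV f x :> ?D" using d unfolding gderiv_def by (metis (no_types, lifting) ext)
  then show ?thesis using grad_eqI by metis
qed

lemma frechet_derivative_eq_grad:
  fixes f :: "'a::euclidean_space \<Rightarrow> real"
  assumes "f differentiable (at x)"
  shows "frechet_derivative f (at x) h = h \<bullet> grad f x"
  using differentiable_imp_GDERIV_grad[OF assms] unfolding gderiv_def
  by (metis frechet_derivative_at)

lemma Ck_on_cong:
  fixes f g :: "'a::euclidean_space \<Rightarrow> real"
  assumes "open U" "\<And>x. x \<in> U \<Longrightarrow> f x = g x"
  shows "Ck_on k f U \<Longrightarrow> Ck_on k g U"
  using assms(2)
proof (induction k arbitrary: f g)
  case 0
  then show ?case using continuous_on_cong[of U U f g] by simp
next
  case (Suc k)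
  have d: "g differentiable (at x)" if "x \<in> U" for x
    using Suc.prems that differentiable_transform_within[of f x UNIV]
    by (metis Ck_on.simps(2) assms(1) differentiable_def has_derivative_transform_within_open)
  have "frechet_derivative f (at x) b = frechet_derivative g (at x) b" if "x \<in> U" for x b
  proof -
    have "f differentiable (at x)" using Suc.prems(1) that by simp
    from frechet_derivative_transform_within_open[OF this assms(1) that Suc.prems(2)] show ?thesis by simp
  qed
  then show ?case using Suc d by auto
qed

text \<open>Each derivative brings out a factor \<open>c\<close>; keeping an arbitrary prefactor
  \<open>a\<close> lets the induction absorb it.\<close>

lemma Ck_on_scale:
  fixes f :: "'a::euclidean_space \<Rightarrow> real"
  assumes U: "open U" and c: "c \<noteq> 0"
  shows "Ck_on k f U \<Longrightarrow> Ck_on k (\<lambda>x. a * f (c *\<^sub>R x)) ((*\<^sub>R) c -` U)"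
proof (induction k arbitrary: f a)
  case 0
  then show ?case
    by (auto intro!: continuous_intros continuous_on_compose2[of U f])
next
  case (Suc k)
  have oV: "open ((*\<^sub>R) c -` U)"
    by (rule open_vimage[OF U]) (intro continuous_intros)
  have D: "((\<lambda>x. a * f (c *\<^sub>R x)) has_derivative (\<lambda>h. a * frechet_derivative f (at (c *\<^sub>R x)) (c *\<^sub>R h))) (at x)"
    if "c *\<^sub>R x \<in> U" for x
  proof -
    have "(f has_derivative frechet_derivative f (at (c *\<^sub>R x))) (at (c *\<^sub>R x))"
      using Suc.prems that frechet_derivative_works by auto
    moreover have "((\<lambda>x. c *\<^sub>R x) has_derivative (\<lambda>h. c *\<^sub>R h)) (at x)" by (intro derivative_eq_intros) auto
    ultimately have "((\<lambda>x. f (c *\<^sub>R x)) has_derivative (\<lambda>h. frechet_derivative f (at (c *\<^sub>R x)) (c *\<^sub>R h))) (at x)"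
      using has_derivative_compose by blast
    then show ?thesis by (rule has_derivative_mult_right)
  qed
  have fd: "frechet_derivative (\<lambda>x. a * f (c *\<^sub>R x)) (at x) b = (a * c) * frechet_derivative f (at (c *\<^sub>R x)) b"
    if "c *\<^sub>R x \<in> U" for x b
  proof -
    have "linear (frechet_derivative f (at (c *\<^sub>R x)))"
      using Suc.prems that by (auto intro: linear_frechet_derivative)
    then show ?thesis
      using frechet_derivative_at[OF D[OF that]] by (metis linear_scale mult.assoc real_scaleR_def)
  qed
  show ?case
    unfolding Ck_on.simps
  proof (intro conjI ballI)
    fix x assume "x \<in> (*\<^sub>R) c -` U"
    then have "c *\<^sub>R x \<in> U" by simp
    from D[OF this] show "(\<lambda>x. a * f (c *\<^sub>R x)) differentiable (at x)" by (rule differentiableI)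
  next
    fix b :: 'a assume b: "b \<in> Basis"
    have "Ck_on k (\<lambda>x. (a * c) * frechet_derivative f (at (c *\<^sub>R x)) b) ((*\<^sub>R) c -` U)"
      using Suc.IH[of "\<lambda>x. frechet_derivative f (at x) b" "a * c"] Suc.prems b by simp
    then show "Ck_on k (\<lambda>x. frechet_derivative (\<lambda>x. a * f (c *\<^sub>R x)) (at x) b) ((*\<^sub>R) c -` U)"
      by (rule Ck_on_cong[OF oV, rotated]) (simp add: fd)
  qed
qed

text \<open>The second partial derivatives are continuous, hence bounded on the compact ball, and
  the ball is convex, so the mean value inequality applies to each first partial derivative.\<close>

lemma Ck_on_grad_lipschitz:
  fixes \<rho> :: "'a::euclidean_space \<Rightarrow> real"
  assumes C: "\<And>k. Ck_on k \<rho> U" and d: "cball p \<delta> \<subseteq> U"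
  shows "\<exists>L\<ge>0. \<forall>x\<in>cball p \<delta>. \<forall>y\<in>cball p \<delta>. norm (grad \<rho> x - grad \<rho> y) \<le> L * norm (x - y)"
proof -
  define D where "D b x = frechet_derivative \<rho> (at x) b" for b x
  have rd: "x \<in> U \<Longrightarrow> \<rho> differentiable (at x)" for x using C[of 1] by auto
  have C2: "Ck_on (Suc (Suc 0)) \<rho> U" by (rule C)
  have Dd: "D b differentiable (at x)" if "x \<in> U" "b \<in> Basis" for b x
    using C2 that unfolding D_def[abs_def] by auto
  have Dc: "continuous_on U (\<lambda>x. frechet_derivative (D b) (at x) b')" if "b \<in> Basis" "b' \<in> Basis" for b b'
    using C2 that unfolding D_def[abs_def] by auto
  define B where "B b b' = (SOME B. \<forall>x\<in>cball p \<delta>. \<bar>frechet_derivative (D b) (at x) b'\<bar> \<le> B)" for b b'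
  have B: "\<bar>frechet_derivative (D b) (at x) b'\<bar> \<le> B b b'"
    if "b \<in> Basis" "b' \<in> Basis" "x \<in> cball p \<delta>" for b b' x
  proof -
    have "continuous_on (cball p \<delta>) (\<lambda>x. frechet_derivative (D b) (at x) b')"
      using Dc[OF that(1,2)] d by (rule continuous_on_subset)
    then have "bounded ((\<lambda>x. frechet_derivative (D b) (at x) b') ` cball p \<delta>)"
      by (intro compact_imp_bounded compact_continuous_image compact_cball)
    then have "\<exists>B. \<forall>x\<in>cball p \<delta>. \<bar>frechet_derivative (D b) (at x) b'\<bar> \<le> B"
      unfolding bounded_iff by auto
    from someI_ex[OF this] show ?thesis using that(3) unfolding B_def by blast
  qed
  define M where "M b = (\<Sum>b'\<in>Basis. \<bar>B b b'\<bar>)" for b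
  have M0: "0 \<le> M b" for b by (simp add: M_def sum_nonneg)
  have lip: "norm (D b x - D b y) \<le> M b * norm (x - y)" if b: "b \<in> Basis" and xy: "x \<in> cball p \<delta>" "y \<in> cball p \<delta>" for b x y
  proof (rule differentiable_bound[OF convex_cball[of p \<delta>] _ _ xy])
    fix z assume z: "z \<in> cball p \<delta>"
    then have "D b differentiable (at z)" using Dd b d by auto
    then show "(D b has_derivative frechet_derivative (D b) (at z)) (at z within cball p \<delta>)"
      using frechet_derivative_works has_derivative_at_withinI by blast
    have lin: "linear (frechet_derivative (D b) (at z))" using \<open>D b differentiable (at z)\<close> by (rule linear_frechet_derivative)
    show "onorm (frechet_derivative (D b) (at z)) \<le> M b"
    proof (rule onorm_le)
      fix h
      have "frechet_derivative (D b) (at z) h = frechet_derivative (D b) (at z) (\<Sum>b'\<in>Basis. (h \<bullet> b') *\<^sub>R b')"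
        by (simp add: euclidean_representation)
      also have "\<dots> = (\<Sum>b'\<in>Basis. (h \<bullet> b') * frechet_derivative (D b) (at z) b')"
        using lin by (simp add: linear_sum linear_scale)
      finally have "norm (frechet_derivative (D b) (at z) h) \<le> (\<Sum>b'\<in>Basis. \<bar>(h \<bullet> b') * frechet_derivative (D b) (at z) b'\<bar>)"
        by simp
      also have "\<dots> \<le> (\<Sum>b'\<in>Basis. norm h * \<bar>B b b'\<bar>)"
      proof (rule sum_mono)
        fix b' :: 'a assume "b' \<in> Basis"
        then show "\<bar>(h \<bullet> b') * frechet_derivative (D b) (at z) b'\<bar> \<le> norm h * \<bar>B b b'\<bar>"
          unfolding abs_mult using Basis_le_norm B[OF b _ z] by (intro mult_mono) (auto intro: order_trans[OF _ abs_ge_self])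
      qed
      finally show "norm (frechet_derivative (D b) (at z) h) \<le> M b * norm h"
        by (simp add: M_def sum_distrib_left mult.commute)
    qed
  qed
  have "norm (grad \<rho> x - grad \<rho> y) \<le> (\<Sum>b\<in>Basis. M b) * norm (x - y)" if xy: "x \<in> cball p \<delta>" "y \<in> cball p \<delta>" for x y
  proof -
    have "norm (grad \<rho> x - grad \<rho> y) \<le> (\<Sum>b\<in>Basis. \<bar>(grad \<rho> x - grad \<rho> y) \<bullet> b\<bar>)" by (rule norm_le_l1)
    also have "\<dots> \<le> (\<Sum>b\<in>Basis. M b * norm (x - y))"
    proof (rule sum_mono)
      fix b :: 'a assume b: "b \<in> Basis"
      have "(grad \<rho> x - grad \<rho> y) \<bullet> b = D b x - D b y"
        using xy d rd by (auto simp: D_def frechet_derivative_eq_grad inner_diff_left inner_diff_right inner_commute subset_iff)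
      then show "\<bar>(grad \<rho> x - grad \<rho> y) \<bullet> b\<bar> \<le> M b * norm (x - y)" using lip[OF b xy] by simp
    qed
    finally show ?thesis by (simp add: sum_distrib_right)
  qed
  then show ?thesis using M0 by (intro exI[of _ "\<Sum>b\<in>Basis. M b"]) (auto intro: sum_nonneg)
qed

lemma GDERIV_line:
  assumes "GDERIV f x :> g"
  shows "((\<lambda>t. f (x + t *\<^sub>R v)) has_real_derivative v \<bullet> g) (at 0)"
proof -
  have "(f has_derivative (\<lambda>h. h \<bullet> g)) (at (x + 0 *\<^sub>R v))" using assms by (simp add: gderiv_def)
  moreover have "((\<lambda>t. x + t *\<^sub>R v) has_derivative (\<lambda>t. t *\<^sub>R v)) (at 0)" by (intro derivative_eq_intros) auto
  ultimately have "((\<lambda>t. f (x + t *\<^sub>R v)) has_derivative (\<lambda>t. (t *\<^sub>R v) \<bullet> g)) (at 0)"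
    using has_derivative_compose by blast
  then show ?thesis by (simp add: has_field_derivative_def mult.commute[of "v \<bullet> g"] mult_commute_abs)
qed

section \<open>Defining functions and the outer normal\<close>

lemma local_defining_functionD:
  assumes "local_defining_function \<Omega> p U \<rho>"
  shows "open U" "p \<in> U" "Ck_on k \<rho> U" "continuous_on U \<rho>" "\<Omega> \<inter> U = {x \<in> U. \<rho> x < 0}"
    and "x \<in> U \<Longrightarrow> grad \<rho> x \<noteq> 0" "x \<in> U \<Longrightarrow> \<rho> differentiable (at x)"
proof -
  show C: "Ck_on k \<rho> U" for k using assms unfolding local_defining_function_def by blast
  show "continuous_on U \<rho>" using C[of 0] by simp
  show "x \<in> U \<Longrightarrow> \<rho> differentiable (at x)" using C[of 1] by simp
qed (use assms in \<open>auto simp only: local_defining_function_def\<close>)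

text \<open>Not negative, since an open set misses its frontier; not positive, since points of
  \<open>\<Omega>\<close> come arbitrarily close.\<close>

lemma local_defining_function_zero:
  assumes "open \<Omega>" "local_defining_function \<Omega> p U \<rho>" "x \<in> frontier \<Omega>" "x \<in> U"
  shows "\<rho> x = 0"
proof -
  have C: "continuous_on U \<rho>" and U: "open U" and eq: "\<Omega> \<inter> U = {x \<in> U. \<rho> x < 0}"
    by (rule local_defining_functionD[OF assms(2)])+
  have "x \<notin> \<Omega>" and cl: "x \<in> closure \<Omega>"
    using assms(1,3) by (simp_all add: frontier_def interior_open)
  have ge: "\<rho> x \<ge> 0"
  proof (rule ccontr)
    assume "\<not> ?thesis"
    then have "x \<in> {x \<in> U. \<rho> x < 0}" using assms(4) by simp
    then have "x \<in> \<Omega> \<inter> U" by (simp only: eq)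
    then show False using \<open>x \<notin> \<Omega>\<close> by simp
  qed
  have "\<not> \<rho> x > 0"
  proof
    assume "\<rho> x > 0"
    have "open (U \<inter> \<rho> -` {0<..})" by (rule continuous_open_preimage[OF C U]) simp
    moreover have "x \<in> U \<inter> \<rho> -` {0<..}" using \<open>\<rho> x > 0\<close> assms by auto
    ultimately have "\<Omega> \<inter> (U \<inter> \<rho> -` {0<..}) \<noteq> {}"
      using cl by (metis open_Int_closure_eq_empty Int_commute disjoint_iff)
    then obtain z where "z \<in> \<Omega> \<inter> U" "\<rho> z > 0" by auto
    then show False unfolding eq by simp
  qed
  then show ?thesis using ge by simp
qed

text \<open>The sign of a defining function is dictated by the domain, so no direction at
  \<open>x\<close> can strictly decrease one of them and strictly increase another. For distinct
  normalised gradients such a direction exists; hence they coincide and the definite description is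
  well posed.\<close>

lemma outer_normal_eq:
  assumes om: "open \<Omega>" and x: "x \<in> frontier \<Omega>" and ld: "local_defining_function \<Omega> x U \<rho>"
  shows "outer_normal \<Omega> x = grad \<rho> x /\<^sub>R norm (grad \<rho> x)"
proof -
  have half: "v \<bullet> grad \<rho>' x \<le> 0"
    if l: "local_defining_function \<Omega> x V \<rho>" and l': "local_defining_function \<Omega> x V' \<rho>'" and v: "v \<bullet> grad \<rho> x < 0" for V V' \<rho> \<rho>' v
  proof (rule ccontr)
    assume "\<not> ?thesis"
    then have v': "v \<bullet> grad \<rho>' x > 0" by simp
    have z: "\<rho> x = 0" "\<rho>' x = 0"
      using local_defining_function_zero[OF om l x local_defining_functionD(2)[OF l]]
        local_defining_function_zero[OF om l' x local_defining_functionD(2)[OF l']] .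
    have "\<rho> differentiable (at x)" "\<rho>' differentiable (at x)"
      using local_defining_functionD(2,7)[OF l] local_defining_functionD(2,7)[OF l'] by blast+
    then have g: "GDERIV \<rho> x :> grad \<rho> x" "GDERIV \<rho>' x :> grad \<rho>' x"
      by (auto intro: differentiable_imp_GDERIV_grad)
    obtain d where d: "d > 0" "\<And>h. h > 0 \<Longrightarrow> h < d \<Longrightarrow> \<rho> (x + h *\<^sub>R v) < 0"
      using DERIV_neg_dec_right[OF GDERIV_line[OF g(1)] v] z by auto
    obtain d' where d': "d' > 0" "\<And>h. h > 0 \<Longrightarrow> h < d' \<Longrightarrow> \<rho>' (x + h *\<^sub>R v) > 0"
      using DERIV_pos_inc_right[OF GDERIV_line[OF g(2)] v'] z by auto
    have "open (V \<inter> V')" "x \<in> V \<inter> V'" using local_defining_functionD(1,2)[OF l] local_defining_functionD(1,2)[OF l'] by blast+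
    then obtain e where e: "e > 0" "ball x e \<subseteq> V \<inter> V'" unfolding open_contains_ball by blast
    \<comment> \<open>Steps shorter than \<open>e0\<close> along \<open>v\<close> stay in both
      neighbourhoods; \<open>norm v + 1\<close> avoids a division by zero.\<close>
    define e0 where "e0 = e / (norm v + 1)"
    have e0: "0 < e0" unfolding e0_def using e by (intro divide_pos_pos add_nonneg_pos) auto
    define h where "h = min (min d d') e0 / 2"
    have "min (min d d') e0 \<le> d" "min (min d d') e0 \<le> d'" "min (min d d') e0 \<le> e0" "0 < min (min d d') e0"
      using e0 d(1) d'(1) by auto
    then have "0 < h \<and> h < d \<and> h < d' \<and> h < e0" unfolding h_def by (intro conjI) linarith+
    then have h: "0 < h" "h < d" "h < d'" "h < e0" by blast+
    have "norm (h *\<^sub>R v) \<le> h * (norm v + 1)" using h by simp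
    also have "\<dots> < e" using h(4) unfolding e0_def by (simp add: pos_less_divide_eq add_nonneg_pos)
    finally have "x + h *\<^sub>R v \<in> V \<inter> V'" using e by (intro subsetD[OF e(2)]) (simp add: dist_norm)
    moreover have "\<rho> (x + h *\<^sub>R v) < 0" "\<rho>' (x + h *\<^sub>R v) > 0" using d d' h by auto
    moreover have oV: "\<Omega> \<inter> V = {x \<in> V. \<rho> x < 0}" "\<Omega> \<inter> V' = {x \<in> V'. \<rho>' x < 0}"
      by (rule local_defining_functionD(5)[OF l] local_defining_functionD(5)[OF l'])+
    ultimately have "x + h *\<^sub>R v \<in> \<Omega> \<inter> V" "x + h *\<^sub>R v \<notin> \<Omega> \<inter> V'" by auto
    then show False using \<open>x + h *\<^sub>R v \<in> V \<inter> V'\<close> by auto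
  qed
  have uniq: "grad \<rho> x /\<^sub>R norm (grad \<rho> x) = grad \<rho>' x /\<^sub>R norm (grad \<rho>' x)"
    if l': "local_defining_function \<Omega> x V' \<rho>'" for V' \<rho>'
  proof (rule ccontr)
    define e where "e = grad \<rho> x /\<^sub>R norm (grad \<rho> x)"
    define e' where "e' = grad \<rho>' x /\<^sub>R norm (grad \<rho>' x)"
    assume "\<not> ?thesis"
    then have ne: "e \<noteq> e'" by (simp add: e_def e'_def)
    have nz: "grad \<rho> x \<noteq> 0" "grad \<rho>' x \<noteq> 0" using local_defining_functionD(2,6)[OF ld] local_defining_functionD(2,6)[OF l'] by blast+
    then have n1: "e \<bullet> e = 1" "e' \<bullet> e' = 1" by (auto simp: e_def e'_def dot_square_norm power2_eq_square)
    have "0 < (e - e') \<bullet> (e - e')" using ne by simp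
    then have lt: "e \<bullet> e' < 1" using n1 by (simp add: inner_diff_left inner_diff_right inner_commute)
    have ge: "grad \<rho> x = norm (grad \<rho> x) *\<^sub>R e" "grad \<rho>' x = norm (grad \<rho>' x) *\<^sub>R e'"
      using nz by (auto simp: e_def e'_def)
    \<comment> \<open>The direction \<open>e' - e\<close> has negative inner product with
      \<open>e\<close> and positive inner product with \<open>e'\<close>, because
      \<open>e \<bullet> e' < 1\<close>.\<close>
    have "(e' - e) \<bullet> grad \<rho> x < 0"
      by (subst ge(1)) (use nz lt n1 in \<open>auto simp: inner_diff_left inner_diff_right inner_commute mult_less_0_iff\<close>)
    then have "(e' - e) \<bullet> grad \<rho>' x \<le> 0" by (rule half[OF ld l'])
    moreover have "(e' - e) \<bullet> grad \<rho>' x > 0"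
      by (subst ge(2)) (use nz lt n1 in \<open>auto simp: inner_diff_left inner_diff_right inner_commute zero_less_mult_iff\<close>)
    ultimately show False by simp
  qed
  show ?thesis unfolding outer_normal_def
  proof (rule the_equality)
    fix n assume "\<exists>U \<rho>. local_defining_function \<Omega> x U \<rho> \<and> n = grad \<rho> x /\<^sub>R norm (grad \<rho> x)"
    then obtain V \<rho>' where "local_defining_function \<Omega> x V \<rho>'" "n = grad \<rho>' x /\<^sub>R norm (grad \<rho>' x)" by blast
    then show "n = grad \<rho> x /\<^sub>R norm (grad \<rho> x)" using uniq[of V \<rho>'] by simp
  qed (use ld in blast)
qed

lemma local_defining_function_at:
  "local_defining_function \<Omega> p U \<rho> \<Longrightarrow> x \<in> U \<Longrightarrow> local_defining_function \<Omega> x U \<rho>"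
  by (simp add: local_defining_function_def)

text \<open>Composing a defining function with the inverse dilation gives one for the dilated
  domain. Its gradient changes by the factor \<open>1 / c\<close>, which normalisation
  removes.\<close>

lemma outer_normal_scale:
  fixes \<Omega> :: "'a::euclidean_space set"
  assumes om: "open \<Omega>" and x: "x \<in> frontier \<Omega>" and sm: "smooth_boundary \<Omega>" and c: "0 < c"
  shows "outer_normal ((*\<^sub>R) c ` \<Omega>) (c *\<^sub>R x) = outer_normal \<Omega> x"
proof -
  obtain U \<rho> where ld: "local_defining_function \<Omega> x U \<rho>" using sm x unfolding smooth_boundary_def by blast
  define \<rho>' where "\<rho>' z = \<rho> ((1 / c) *\<^sub>R z)" for z
  define V where "V = (*\<^sub>R) (1 / c) -` U"
  have im: "(*\<^sub>R) c ` \<Omega> = (*\<^sub>R) (1 / c) -` \<Omega>"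
    using c by (auto simp: image_iff intro!: bexI[of _ "(1 / c) *\<^sub>R _"])
  have U: "open U" "x \<in> U" "\<And>k. Ck_on k \<rho> U" "\<And>x. x\<in>U \<Longrightarrow> grad \<rho> x \<noteq> 0" "\<Omega> \<inter> U = {x \<in> U. \<rho> x < 0}"
    by (rule local_defining_functionD(1,2,3,5)[OF ld] | erule local_defining_functionD(6)[OF ld])+
  have gr: "grad \<rho>' z = (1 / c) *\<^sub>R grad \<rho> ((1 / c) *\<^sub>R z)" if "z \<in> V" for z
  proof (rule grad_eqI)
    have "\<rho> differentiable (at ((1 / c) *\<^sub>R z))" using local_defining_functionD(7)[OF ld] that by (auto simp: V_def)
    then have "(\<rho> has_derivative (\<lambda>h. h \<bullet> grad \<rho> ((1 / c) *\<^sub>R z))) (at ((1 / c) *\<^sub>R z))"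
      using differentiable_imp_GDERIV_grad unfolding gderiv_def by blast
    moreover have "((\<lambda>x. (1 / c) *\<^sub>R x) has_derivative (\<lambda>h. (1 / c) *\<^sub>R h)) (at z)" by (intro derivative_eq_intros) auto
    ultimately have "((\<lambda>x. \<rho> ((1 / c) *\<^sub>R x)) has_derivative (\<lambda>h. ((1 / c) *\<^sub>R h) \<bullet> grad \<rho> ((1 / c) *\<^sub>R z))) (at z)"
      using has_derivative_compose by blast
    then show "GDERIV \<rho>' z :> (1 / c) *\<^sub>R grad \<rho> ((1 / c) *\<^sub>R z)"
      unfolding gderiv_def \<rho>'_def[abs_def] by (simp add: inner_commute)
  qed
  have xV: "c *\<^sub>R x \<in> V" using U(2) c by (simp add: V_def)
  have ld': "local_defining_function ((*\<^sub>R) c ` \<Omega>) (c *\<^sub>R x) V \<rho>'"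
    unfolding local_defining_function_def
  proof (intro conjI allI ballI)
    show "open V" unfolding V_def by (rule open_vimage[OF U(1)]) (intro continuous_intros)
    show "c *\<^sub>R x \<in> V" by (rule xV)
    show "Ck_on k \<rho>' V" for k
      using Ck_on_scale[OF U(1) _ U(3), of "1 / c" k 1] c by (simp add: \<rho>'_def[abs_def] V_def)
    show "grad \<rho>' z \<noteq> 0" if "z \<in> V" for z
      using gr[OF that] U(4)[of "(1 / c) *\<^sub>R z"] that c by (simp add: V_def)
    show "(*\<^sub>R) c ` \<Omega> \<inter> V = {x \<in> V. \<rho>' x < 0}"
      unfolding im V_def \<rho>'_def using U(5) by auto
  qed
  have "open ((*\<^sub>R) c ` \<Omega>)" using om c by (intro open_scaling) auto
  moreover have "c *\<^sub>R x \<in> frontier ((*\<^sub>R) c ` \<Omega>)"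
  proof -
    have "c *\<^sub>R x \<in> (*\<^sub>R) c ` closure \<Omega>" using x by (auto simp: frontier_def)
    then have "c *\<^sub>R x \<in> closure ((*\<^sub>R) c ` \<Omega>)" by (simp add: closure_scaleR)
    moreover have "c *\<^sub>R x \<notin> (*\<^sub>R) c ` \<Omega>" using x om c by (auto simp: frontier_def interior_open)
    ultimately show ?thesis using \<open>open ((*\<^sub>R) c ` \<Omega>)\<close> by (simp add: frontier_def interior_open)
  qed
  ultimately have "outer_normal ((*\<^sub>R) c ` \<Omega>) (c *\<^sub>R x) = grad \<rho>' (c *\<^sub>R x) /\<^sub>R norm (grad \<rho>' (c *\<^sub>R x))"
    using ld' by (rule outer_normal_eq)
  also have "\<dots> = grad \<rho> x /\<^sub>R norm (grad \<rho> x)" using gr[OF xV] c by (simp add: inverse_eq_divide)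
  also have "\<dots> = outer_normal \<Omega> x" by (rule outer_normal_eq[OF om x ld, symmetric])
  finally show ?thesis .
qed

lemma norm_outer_normal:
  assumes om: "open \<Omega>" and x: "x \<in> frontier \<Omega>" and sm: "smooth_boundary \<Omega>"
  shows "norm (outer_normal \<Omega> x) = 1"
proof -
  obtain U \<rho> where ld: "local_defining_function \<Omega> x U \<rho>" using sm x unfolding smooth_boundary_def by blast
  then have "grad \<rho> x \<noteq> 0" using local_defining_functionD(2,6) by blast
  then show ?thesis unfolding outer_normal_eq[OF om x ld] by simp
qed

text \<open>Two errors of equal size, one from the difference of the vectors and one from the
  difference of their lengths, give the factor 2.\<close>

lemma normalized_diff_le:
  fixes g h :: "'a::real_normed_vector"
  assumes "g \<noteq> 0" "h \<noteq> 0"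
  shows "norm (g /\<^sub>R norm g - h /\<^sub>R norm h) \<le> 2 * norm (g - h) / norm g"
proof -
  have "g /\<^sub>R norm g - h /\<^sub>R norm h = (g - h) /\<^sub>R norm g + (inverse (norm g) - inverse (norm h)) *\<^sub>R h"
    by (simp add: algebra_simps)
  then have "norm (g /\<^sub>R norm g - h /\<^sub>R norm h) \<le> norm ((g - h) /\<^sub>R norm g) + norm ((inverse (norm g) - inverse (norm h)) *\<^sub>R h)"
    by (metis norm_triangle_ineq)
  also have "norm ((inverse (norm g) - inverse (norm h)) *\<^sub>R h) = \<bar>norm h - norm g\<bar> / norm g"
  proof -
    have "inverse (norm g) - inverse (norm h) = (norm h - norm g) / (norm g * norm h)"
      using assms by (simp add: field_simps)
    then show ?thesis using assms by (simp add: abs_mult)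
  qed
  also have "\<dots> \<le> norm (g - h) / norm g"
    by (intro divide_right_mono) (metis norm_minus_commute norm_triangle_ineq3, simp)
  finally have "norm (g /\<^sub>R norm g - h /\<^sub>R norm h) \<le> norm ((g - h) /\<^sub>R norm g) + norm (g - h) / norm g"
    by simp
  also have "\<dots> = 2 * norm (g - h) / norm g" by (simp add: divide_inverse)
  finally show ?thesis .
qed

text \<open>Near \<open>p\<close> the boundary is a Lipschitz graph over the coordinates other than \<open>b\<close>, where \<open>b\<close> is a
  direction in which the gradient of the defining function does not vanish.\<close>

lemma boundary_local_estimates:
  fixes \<Omega> :: "'a::euclidean_space set"
  assumes om: "open \<Omega>" and sm: "smooth_boundary \<Omega>" and p: "p \<in> frontier \<Omega>"
  shows "\<exists>\<delta>>0. \<exists>L\<ge>0. \<exists>b\<in>Basis. \<forall>x\<in>frontier \<Omega> \<inter> ball p \<delta>. \<forall>y\<in>frontier \<Omega> \<inter> ball p \<delta>.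
    \<bar>outer_normal \<Omega> x \<bullet> (x - y)\<bar> \<le> L * norm (x - y) ^ 2 \<and>
    norm (outer_normal \<Omega> x - outer_normal \<Omega> y) \<le> L * norm (x - y) ^ 1 \<and>
    norm (x - y) \<le> L * (\<Sum>i\<in>Basis - {b}. \<bar>(x - y) \<bullet> i\<bar>)"
proof -
  obtain U \<rho> where ld: "local_defining_function \<Omega> p U \<rho>" using sm p unfolding smooth_boundary_def by blast
  have U: "open U" "p \<in> U" "\<And>k. Ck_on k \<rho> U" "\<And>x. x\<in>U \<Longrightarrow> grad \<rho> x \<noteq> 0"
    by (rule local_defining_functionD(1,2,3,5)[OF ld] | erule local_defining_functionD(6)[OF ld])+
  obtain \<delta>0 where \<delta>0: "\<delta>0 > 0" "cball p \<delta>0 \<subseteq> U" using U open_contains_cball by blast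
  obtain L where L: "L \<ge> 0" "\<And>x y. x \<in> cball p \<delta>0 \<Longrightarrow> y \<in> cball p \<delta>0 \<Longrightarrow> norm (grad \<rho> x - grad \<rho> y) \<le> L * norm (x - y)"
    using Ck_on_grad_lipschitz[OF U(3) \<delta>0(2)] by blast
  define g where "g = grad \<rho> p"
  have g: "g \<noteq> 0" using U by (simp add: g_def)
  then obtain b where b: "b \<in> Basis" "g \<bullet> b \<noteq> 0" using euclidean_eq_iff[of g 0] by auto
  define m where "m = \<bar>g \<bullet> b\<bar>"
  have m: "0 < m" "m \<le> norm g" using b Basis_le_norm by (auto simp: m_def)
  \<comment> \<open>With this radius the gradient moves by at most \<open>m / 2\<close>, half of the
    nonvanishing partial derivative; \<open>L + 1\<close> guards against
    \<open>L = 0\<close>.\<close>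
  define \<delta> where "\<delta> = min \<delta>0 (m / (2 * (L + 1)))"
  have \<delta>: "0 < \<delta>" "\<delta> \<le> \<delta>0" using \<delta>0 m L by (auto simp: \<delta>_def)
  have "L * \<delta> \<le> (L + 1) * (m / (2 * (L + 1)))" using L m \<delta> by (intro mult_mono) (auto simp: \<delta>_def)
  also have "\<dots> = m / 2" using L by (simp add: field_simps)
  finally have L\<delta>: "L * \<delta> \<le> m / 2" .
  have sub: "cball p \<delta> \<subseteq> cball p \<delta>0" using \<delta> by (simp add: subset_cball)
  have gp: "norm (grad \<rho> x - g) \<le> m / 2" if "x \<in> cball p \<delta>" for x
  proof -
    have "norm (grad \<rho> x - g) \<le> L * norm (x - p)" unfolding g_def using that sub \<delta>0 by (intro L) auto
    also have "\<dots> \<le> L * \<delta>" using that L by (intro mult_left_mono) (auto simp: dist_norm norm_minus_commute)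
    finally show ?thesis using L\<delta> by simp
  qed
  have gl: "norm g / 2 \<le> norm (grad \<rho> x)" if "x \<in> cball p \<delta>" for x
    using gp[OF that] m norm_triangle_ineq2[of g "g - grad \<rho> x"] by (simp add: norm_minus_commute)
  have der: "(\<rho> has_derivative (\<lambda>h. h \<bullet> grad \<rho> x)) (at x within S)" if "x \<in> U" for x S
  proof -
    have "\<rho> differentiable (at x)" using local_defining_functionD(7)[OF ld that] .
    then show ?thesis using differentiable_imp_GDERIV_grad has_derivative_at_withinI unfolding gderiv_def by blast
  qed
  have on: "onorm ((\<lambda>h. h \<bullet> u) - (\<lambda>h. h \<bullet> w)) \<le> norm (u - w)" for u w :: 'a
  proof (rule onorm_le)
    fix h show "norm (((\<lambda>h. h \<bullet> u) - (\<lambda>h. h \<bullet> w)) h) \<le> norm (u - w) * norm h"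
      using Cauchy_Schwarz_ineq2[of h "u - w"] by (simp add: inner_diff_right mult.commute)
  qed
  \<comment> \<open>A sum of the constants for the two estimates of the normal and for the graph
    estimate, so that one number serves all three.\<close>
  define L' where "L' = 2 * (L + 1) / norm g * 2 + (2 * norm g / m + 2)"
  have L'0: "2 * (L + 1) / norm g * 2 \<le> L'" "2 * norm g / m + 2 \<le> L'" using m L g by (auto simp: L'_def)
  have L'1: "0 \<le> L'" using m L g by (auto simp: L'_def)
  have inball: "x \<in> cball p \<delta>" "x \<in> U" if "x \<in> ball p \<delta>" for x using that sub \<delta>0 by (auto simp: subset_iff)
  have onm: "outer_normal \<Omega> x = grad \<rho> x /\<^sub>R norm (grad \<rho> x)" if "x \<in> frontier \<Omega>" "x \<in> ball p \<delta>" for x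
    using outer_normal_eq[OF om that(1) local_defining_function_at[OF ld inball(2)[OF that(2)]]] .
  have "\<bar>outer_normal \<Omega> x \<bullet> (x - y)\<bar> \<le> L' * norm (x - y) ^ 2 \<and>
    norm (outer_normal \<Omega> x - outer_normal \<Omega> y) \<le> L' * norm (x - y) ^ 1 \<and>
    norm (x - y) \<le> L' * (\<Sum>i\<in>Basis - {b}. \<bar>(x - y) \<bullet> i\<bar>)"
    if x: "x \<in> frontier \<Omega>" "x \<in> ball p \<delta>" and y: "y \<in> frontier \<Omega>" "y \<in> ball p \<delta>" for x y
  proof (intro conjI)
    have z: "\<rho> x = 0" "\<rho> y = 0"
      using local_defining_function_zero[OF om ld] x y inball by auto
    have seg: "closed_segment x y \<subseteq> cball p \<delta>"
      using inball(1)[OF x(2)] inball(1)[OF y(2)] by (intro closed_segment_subset convex_cball)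
    \<comment> \<open>Linearisation at \<open>x\<close>: since \<open>\<rho>\<close> vanishes at
      both points, the first-order term equals the remainder up to sign and is quadratically
      small.\<close>
    have "norm (\<rho> y - \<rho> x - (y - x) \<bullet> grad \<rho> x) \<le> norm (y - x) * (L * norm (x - y))"
    proof (rule differentiable_bound_linearization[where S = "closed_segment x y" and f' = "\<lambda>x h. h \<bullet> grad \<rho> x"])
      show "x + t *\<^sub>R (y - x) \<in> closed_segment x y" if "t \<in> {0..1}" for t
        using that by (auto simp: closed_segment_def algebra_simps intro!: exI[of _ t])
      show "(\<rho> has_derivative (\<lambda>h. h \<bullet> grad \<rho> z)) (at z within closed_segment x y)" if "z \<in> closed_segment x y" for z
        using that seg sub \<delta>0 by (intro der) (auto simp: subset_iff)
      show "onorm ((\<lambda>h. h \<bullet> grad \<rho> z) - (\<lambda>h. h \<bullet> grad \<rho> x)) \<le> L * norm (x - y)" if zs: "z \<in> closed_segment x y" for z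
      proof -
        have "onorm ((\<lambda>h. h \<bullet> grad \<rho> z) - (\<lambda>h. h \<bullet> grad \<rho> x)) \<le> norm (grad \<rho> z - grad \<rho> x)" by (rule on)
        also have "\<dots> \<le> L * norm (z - x)" using zs seg sub inball(1)[OF x(2)] by (intro L) auto
        also have "\<dots> \<le> L * norm (x - y)"
          using segment_bound1[OF zs] L by (intro mult_left_mono) (auto simp: norm_minus_commute)
        finally show ?thesis .
      qed
    qed auto
    then have tay: "\<bar>(x - y) \<bullet> grad \<rho> x\<bar> \<le> L * norm (x - y) ^ 2"
      using z by (simp add: norm_minus_commute power2_eq_square inner_diff_left abs_minus_commute mult_ac)
    have gx: "norm g / 2 \<le> norm (grad \<rho> x)" "0 < norm g" using gl inball x g by auto
    have "\<bar>outer_normal \<Omega> x \<bullet> (x - y)\<bar> = \<bar>(x - y) \<bullet> grad \<rho> x\<bar> / norm (grad \<rho> x)"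
      using onm[OF x] by (simp add: inner_commute abs_mult divide_inverse)
    also have "\<dots> \<le> L * norm (x - y) ^ 2 / (norm g / 2)"
      using tay gx L by (intro frac_le) auto
    also have "\<dots> = (2 * L / norm g) * norm (x - y) ^ 2" by simp
    also have "\<dots> \<le> (2 * (L + 1) / norm g * 2) * norm (x - y) ^ 2"
      using L gx by (intro mult_right_mono) (auto simp: field_simps)
    also have "\<dots> \<le> L' * norm (x - y) ^ 2" using L'0 by (intro mult_right_mono) auto
    finally show "\<bar>outer_normal \<Omega> x \<bullet> (x - y)\<bar> \<le> L' * norm (x - y) ^ 2" .
    have "norm (outer_normal \<Omega> x - outer_normal \<Omega> y) \<le> 2 * norm (grad \<rho> x - grad \<rho> y) / norm (grad \<rho> x)"
      unfolding onm[OF x] onm[OF y] using U(4) inball x y by (intro normalized_diff_le) auto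
    also have "\<dots> \<le> 2 * (L * norm (x - y)) / (norm g / 2)"
      using gx L inball(1)[OF x(2)] inball(1)[OF y(2)] sub by (intro frac_le mult_left_mono L) auto
    also have "\<dots> = (2 * L / norm g * 2) * norm (x - y)" by simp
    also have "\<dots> \<le> (2 * (L + 1) / norm g * 2) * norm (x - y)"
      using L gx by (intro mult_right_mono) (auto simp: field_simps)
    also have "\<dots> \<le> L' * norm (x - y)" using L'0 by (intro mult_right_mono) auto
    finally show "norm (outer_normal \<Omega> x - outer_normal \<Omega> y) \<le> L' * norm (x - y) ^ 1" by simp
    \<comment> \<open>Linearisation with the gradient at the fixed centre \<open>p\<close>. The
      error is only linear, but small enough for the coordinate along \<open>b\<close> to be
      absorbed into the others.\<close>
    have "norm (\<rho> y - \<rho> x - (y - x) \<bullet> g) \<le> norm (y - x) * (m / 2)"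
      unfolding g_def
    proof (rule differentiable_bound_linearization[where S = "cball p \<delta>" and f' = "\<lambda>x h. h \<bullet> grad \<rho> x"])
      show "x + t *\<^sub>R (y - x) \<in> cball p \<delta>" if "t \<in> {0..1}" for t
        using that by (intro subsetD[OF seg]) (auto simp: closed_segment_def algebra_simps intro!: exI[of _ t])
      show "(\<rho> has_derivative (\<lambda>h. h \<bullet> grad \<rho> z)) (at z within cball p \<delta>)" if "z \<in> cball p \<delta>" for z
        using that sub \<delta>0 by (intro der) (auto simp: subset_iff)
      show "onorm ((\<lambda>h. h \<bullet> grad \<rho> z) - (\<lambda>h. h \<bullet> grad \<rho> p)) \<le> m / 2" if "z \<in> cball p \<delta>" for z
        using on[of "grad \<rho> z" "grad \<rho> p"] gp[OF that] by (simp add: g_def)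
    qed (use \<delta> in auto)
    then have A: "\<bar>(x - y) \<bullet> g\<bar> \<le> m / 2 * norm (x - y)"
      using z by (simp add: norm_minus_commute inner_diff_left abs_minus_commute mult_ac)
    define s where "s = (\<Sum>i\<in>Basis - {b}. \<bar>(x - y) \<bullet> i\<bar>)"
    define t where "t = \<bar>(x - y) \<bullet> b\<bar>"
    have s0: "0 \<le> s" by (simp add: s_def sum_nonneg)
    have nle: "norm (x - y) \<le> t + s"
      using norm_le_l1[of "x - y"] b(1) by (simp add: s_def t_def sum.remove[of Basis b])
    have split: "(x - y) \<bullet> g = ((x - y) \<bullet> b) * (g \<bullet> b) + (\<Sum>i\<in>Basis - {b}. ((x - y) \<bullet> i) * (g \<bullet> i))"
      by (subst euclidean_inner) (use b in \<open>simp add: sum.remove[of Basis b]\<close>)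
    have rest: "\<bar>\<Sum>i\<in>Basis - {b}. ((x - y) \<bullet> i) * (g \<bullet> i)\<bar> \<le> norm g * s"
    proof -
      have "\<bar>\<Sum>i\<in>Basis - {b}. ((x - y) \<bullet> i) * (g \<bullet> i)\<bar> \<le> (\<Sum>i\<in>Basis - {b}. \<bar>((x - y) \<bullet> i) * (g \<bullet> i)\<bar>)"
        by (rule sum_abs)
      also have "\<dots> \<le> (\<Sum>i\<in>Basis - {b}. norm g * \<bar>(x - y) \<bullet> i\<bar>)"
        by (rule sum_mono) (auto simp: abs_mult mult.commute intro!: mult_right_mono Basis_le_norm)
      finally show ?thesis by (simp add: s_def sum_distrib_left)
    qed
    have "m * t = \<bar>((x - y) \<bullet> b) * (g \<bullet> b)\<bar>" by (simp add: m_def t_def abs_mult)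
    also have "\<dots> \<le> \<bar>(x - y) \<bullet> g\<bar> + \<bar>\<Sum>i\<in>Basis - {b}. ((x - y) \<bullet> i) * (g \<bullet> i)\<bar>" using split by linarith
    also have "\<dots> \<le> m / 2 * (t + s) + norm g * s"
      using A rest mult_left_mono[OF nle, of "m / 2"] m by linarith
    \<comment> \<open>Half of \<open>m * t\<close> absorbs the part of the error that contains
      \<open>t\<close>.\<close>
    finally have "m / 2 * t \<le> (m / 2 + norm g) * s" unfolding distrib_left distrib_right by linarith
    then have "t \<le> (1 + 2 * norm g / m) * s" using m by (simp add: field_simps)
    then have "norm (x - y) \<le> (2 * norm g / m + 2) * s" using nle by (simp add: algebra_simps)
    also have "\<dots> \<le> L' * s" using L'0 s0 by (intro mult_right_mono) auto
    finally show "norm (x - y) \<le> L' * (\<Sum>i\<in>Basis - {b}. \<bar>(x - y) \<bullet> i\<bar>)" by (simp add: s_def)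
  qed
  then show ?thesis using \<delta> L'1 b by blast
qed

text \<open>A Lebesgue number argument: pairs closer than \<open>\<epsilon>\<close> lie in one of
  finitely many good balls, and for all other pairs the crude bound \<open>M\<close> is at most
  \<open>M / \<epsilon> ^ k\<close> times the power of the distance.\<close>

lemma compact_local_bound:
  fixes K :: "'a::real_normed_vector set" and f :: "'a \<Rightarrow> 'a \<Rightarrow> real"
  assumes K: "compact K" and M: "0 \<le> M" "\<And>x y. x \<in> K \<Longrightarrow> y \<in> K \<Longrightarrow> f x y \<le> M"
    and loc: "\<And>p. p \<in> K \<Longrightarrow> \<exists>\<delta>>0. \<exists>L\<ge>0. \<forall>x\<in>K \<inter> ball p \<delta>. \<forall>y\<in>K \<inter> ball p \<delta>. f x y \<le> L * norm (x - y) ^ k"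
  shows "\<exists>L\<ge>0. \<forall>x\<in>K. \<forall>y\<in>K. f x y \<le> L * norm (x - y) ^ k"
proof (cases "K = {}")
  case False
  obtain \<delta> L where \<delta>: "\<And>p. p \<in> K \<Longrightarrow> \<delta> p > 0" and L: "\<And>p. p \<in> K \<Longrightarrow> L p \<ge> (0::real)"
    and f: "\<And>p x y. p \<in> K \<Longrightarrow> x \<in> K \<inter> ball p (\<delta> p) \<Longrightarrow> y \<in> K \<inter> ball p (\<delta> p) \<Longrightarrow> f x y \<le> L p * norm (x - y) ^ k"
    using loc by metis
  have "K \<subseteq> (\<Union>p\<in>K. ball p (\<delta> p / 2))" using \<delta> by force
  then obtain P where P: "P \<subseteq> K" "finite P" "K \<subseteq> (\<Union>p\<in>P. ball p (\<delta> p / 2))"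
    using compactE_image[OF K, of K "\<lambda>p. ball p (\<delta> p / 2)"] by auto
  have Pne: "P \<noteq> {}" using P False by auto
  define \<epsilon> where "\<epsilon> = Min ((\<lambda>p. \<delta> p / 2) ` P)"
  have \<epsilon>: "0 < \<epsilon>" "\<And>p. p \<in> P \<Longrightarrow> \<epsilon> \<le> \<delta> p / 2"
  proof -
    show "0 < \<epsilon>" unfolding \<epsilon>_def using P Pne \<delta> by (subst Min_gr_iff) auto
    show "\<epsilon> \<le> \<delta> p / 2" if "p \<in> P" for p unfolding \<epsilon>_def using P that by (intro Min_le) auto
  qed
  define B where "B = (\<Sum>p\<in>P. L p) + M / \<epsilon> ^ k"
  have SL: "0 \<le> (\<Sum>p\<in>P. L p)" using P L by (intro sum_nonneg) auto
  have B0: "0 \<le> M / \<epsilon> ^ k" using M \<epsilon> by simp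
  have "f x y \<le> B * norm (x - y) ^ k" if x: "x \<in> K" and y: "y \<in> K" for x y
  proof (cases "norm (x - y) < \<epsilon>")
    case True
    obtain p where p: "p \<in> P" "x \<in> ball p (\<delta> p / 2)" using P x by blast
    have "dist p y \<le> dist p x + dist x y" by (rule dist_triangle)
    also have "\<dots> < \<delta> p / 2 + \<delta> p / 2" using p True \<epsilon>(2)[OF p(1)] by (intro add_strict_mono) (auto simp: dist_norm)
    finally have "y \<in> ball p (\<delta> p)" by simp
    moreover have "x \<in> ball p (\<delta> p)" using p \<delta> P by fastforce
    ultimately have "f x y \<le> L p * norm (x - y) ^ k" using p P x y by (intro f) auto
    also have "\<dots> \<le> B * norm (x - y) ^ k"
      using member_le_sum[of p P L] p P L B0 by (intro mult_right_mono) (auto simp: B_def subset_iff)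
    finally show ?thesis .
  next
    case False
    have "f x y \<le> M / \<epsilon> ^ k * \<epsilon> ^ k" using M(2)[OF x y] \<epsilon> by simp
    also have "\<dots> \<le> B * norm (x - y) ^ k"
      using False \<epsilon> SL B0 by (intro mult_mono power_mono) (auto simp: B_def)
    finally show ?thesis .
  qed
  then show ?thesis using SL B0 by (intro exI[of _ B]) (auto simp: B_def)
qed auto

lemma hausdorff_outer_finite_UN:
  assumes "0 < n" "finite P"
  shows "hausdorff_outer n (\<Union>p\<in>P. T p) \<le> (\<Sum>p\<in>P. hausdorff_outer n (T p))"
  using assms(2)
proof (induction P)
  case (insert p P)
  have "hausdorff_outer n (\<Union>p\<in>insert p P. T p) \<le> hausdorff_outer n (T p) + hausdorff_outer n (\<Union>p\<in>P. T p)"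
    using hausdorff_outer_Un[OF assms(1)] by simp
  then show ?case using insert by (auto intro: order_trans add_left_mono)
qed (simp add: hausdorff_outer_empty assms)

text \<open>The bounds on the normal follow by compactness from the local ones and from trivial
  global bounds; the measure bound adds the finitely many graph pieces of a subcover. The exponent 1
  is written out to fit the form of \<open>compact_local_bound\<close>.\<close>

lemma boundary_estimates:
  fixes \<Omega> :: "'a::euclidean_space set"
  assumes dim: "2 \<le> DIM('a)" and om: "open \<Omega>" and bd: "bounded \<Omega>" and sm: "smooth_boundary \<Omega>"
  shows "\<exists>L\<ge>0. \<forall>x\<in>frontier \<Omega>. \<forall>y\<in>frontier \<Omega>. \<bar>outer_normal \<Omega> x \<bullet> (x - y)\<bar> \<le> L * norm (x - y) ^ 2"
    and "\<exists>L\<ge>0. \<forall>x\<in>frontier \<Omega>. \<forall>y\<in>frontier \<Omega>. norm (outer_normal \<Omega> x - outer_normal \<Omega> y) \<le> L * norm (x - y) ^ 1"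
    and "\<exists>A\<ge>0. \<forall>z. \<forall>R>0. hausdorff_outer (DIM('a) - 1) (frontier \<Omega> \<inter> cball z R) \<le> ennreal (A * R ^ (DIM('a) - 1))"
proof -
  have K: "compact (frontier \<Omega>)" using bd by (simp add: compact_frontier_bounded)
  then obtain B where B: "\<And>x. x \<in> frontier \<Omega> \<Longrightarrow> norm x \<le> B" "0 < B"
    using compact_imp_bounded bounded_pos by metis
  note N = norm_outer_normal[OF om _ sm]
  show "\<exists>L\<ge>0. \<forall>x\<in>frontier \<Omega>. \<forall>y\<in>frontier \<Omega>. \<bar>outer_normal \<Omega> x \<bullet> (x - y)\<bar> \<le> L * norm (x - y) ^ 2"
  proof (rule compact_local_bound[OF K])
    show "\<bar>outer_normal \<Omega> x \<bullet> (x - y)\<bar> \<le> 2 * B" if "x \<in> frontier \<Omega>" "y \<in> frontier \<Omega>" for x y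
      using Cauchy_Schwarz_ineq2[of "outer_normal \<Omega> x" "x - y"] N[OF that(1)] B(1)[OF that(1)] B(1)[OF that(2)] norm_triangle_ineq4[of x y]
      by simp
    fix p assume "p \<in> frontier \<Omega>"
    from boundary_local_estimates[OF om sm this] show "\<exists>\<delta>>0. \<exists>L\<ge>0. \<forall>x\<in>frontier \<Omega> \<inter> ball p \<delta>. \<forall>y\<in>frontier \<Omega> \<inter> ball p \<delta>.
      \<bar>outer_normal \<Omega> x \<bullet> (x - y)\<bar> \<le> L * norm (x - y) ^ 2" by blast
  qed (use B in auto)
  show "\<exists>L\<ge>0. \<forall>x\<in>frontier \<Omega>. \<forall>y\<in>frontier \<Omega>. norm (outer_normal \<Omega> x - outer_normal \<Omega> y) \<le> L * norm (x - y) ^ 1"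
  proof (rule compact_local_bound[OF K])
    show "norm (outer_normal \<Omega> x - outer_normal \<Omega> y) \<le> 2" if "x \<in> frontier \<Omega>" "y \<in> frontier \<Omega>" for x y
      using N[OF that(1)] N[OF that(2)] norm_triangle_ineq4[of "outer_normal \<Omega> x" "outer_normal \<Omega> y"] by simp
    fix p assume "p \<in> frontier \<Omega>"
    from boundary_local_estimates[OF om sm this] show "\<exists>\<delta>>0. \<exists>L\<ge>0. \<forall>x\<in>frontier \<Omega> \<inter> ball p \<delta>. \<forall>y\<in>frontier \<Omega> \<inter> ball p \<delta>.
      norm (outer_normal \<Omega> x - outer_normal \<Omega> y) \<le> L * norm (x - y) ^ 1" by blast
  qed auto
  let ?n = "DIM('a) - 1"
  have n: "0 < ?n" using dim by simp
  have "\<exists>\<delta> A. \<forall>p\<in>frontier \<Omega>. \<delta> p > 0 \<and> A p \<ge> 0 \<and>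
    (\<forall>z. \<forall>R>0. hausdorff_outer ?n (frontier \<Omega> \<inter> ball p (\<delta> p) \<inter> cball z R) \<le> ennreal (A p * R ^ ?n))"
  proof -
    have "\<exists>\<delta> A. \<delta> > 0 \<and> A \<ge> 0 \<and> (\<forall>z. \<forall>R>0. hausdorff_outer ?n (frontier \<Omega> \<inter> ball p \<delta> \<inter> cball z R) \<le> ennreal (A * R ^ ?n))"
      if p: "p \<in> frontier \<Omega>" for p
    proof -
      obtain \<delta> L b where "\<delta> > 0" and L: "L \<ge> 0" "b \<in> Basis" "\<And>x y. x \<in> frontier \<Omega> \<inter> ball p \<delta> \<Longrightarrow> y \<in> frontier \<Omega> \<inter> ball p \<delta> \<Longrightarrow>
          norm (x - y) \<le> L * (\<Sum>i\<in>Basis - {b}. \<bar>(x - y) \<bullet> i\<bar>)"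
        using boundary_local_estimates[OF om sm p] by blast
      then show ?thesis using hausdorff_outer_graph_ball[OF dim L(2,1), of "frontier \<Omega> \<inter> ball p \<delta>"] by blast
    qed
    then show ?thesis by metis
  qed
  then obtain \<delta> A where \<delta>: "\<And>p. p \<in> frontier \<Omega> \<Longrightarrow> \<delta> p > 0" and A: "\<And>p. p \<in> frontier \<Omega> \<Longrightarrow> A p \<ge> 0"
    and H: "\<And>p z R. p \<in> frontier \<Omega> \<Longrightarrow> R > 0 \<Longrightarrow> hausdorff_outer ?n (frontier \<Omega> \<inter> ball p (\<delta> p) \<inter> cball z R) \<le> ennreal (A p * R ^ ?n)"
    by blast
  have "frontier \<Omega> \<subseteq> (\<Union>p\<in>frontier \<Omega>. ball p (\<delta> p))" using \<delta> by force
  then obtain P where P: "P \<subseteq> frontier \<Omega>" "finite P" "frontier \<Omega> \<subseteq> (\<Union>p\<in>P. ball p (\<delta> p))"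
    using compactE_image[OF K, of "frontier \<Omega>" "\<lambda>p. ball p (\<delta> p)"] by auto
  have "hausdorff_outer ?n (frontier \<Omega> \<inter> cball z R) \<le> ennreal ((\<Sum>p\<in>P. A p) * R ^ ?n)" if R: "0 < R" for z R
  proof -
    have "hausdorff_outer ?n (frontier \<Omega> \<inter> cball z R) \<le> hausdorff_outer ?n (\<Union>p\<in>P. frontier \<Omega> \<inter> ball p (\<delta> p) \<inter> cball z R)"
      by (rule hausdorff_outer_mono) (use P in blast)
    also have "\<dots> \<le> (\<Sum>p\<in>P. hausdorff_outer ?n (frontier \<Omega> \<inter> ball p (\<delta> p) \<inter> cball z R))"
      by (rule hausdorff_outer_finite_UN[OF n P(2)])
    also have "\<dots> \<le> (\<Sum>p\<in>P. ennreal (A p * R ^ ?n))" using P R by (intro sum_mono H) auto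
    also have "\<dots> = ennreal ((\<Sum>p\<in>P. A p) * R ^ ?n)"
      using P A R by (subst sum_ennreal) (auto simp: sum_distrib_right)
    finally show ?thesis .
  qed
  moreover have "0 \<le> (\<Sum>p\<in>P. A p)" using P A by (intro sum_nonneg) auto
  ultimately show "\<exists>A\<ge>0. \<forall>z. \<forall>R>0. hausdorff_outer ?n (frontier \<Omega> \<inter> cball z R) \<le> ennreal (A * R ^ ?n)" by blast
qed

subsection \<open>Kernels of double layer type\<close>

text \<open>The factor \<open>t ^ 2\<close> is the size of the numerator of a double layer kernel at
  the second point. With it the difference of the inverse powers is of order
  \<open>\<bar>s - t\<bar> / s ^ (d - 1)\<close>, by the factorisation of a difference of
  powers.\<close>

lemma power_inverse_diff_le:
  fixes s t :: real
  assumes s: "0 < s" and t: "s / 2 \<le> t" "t \<le> 3 * s / 2" and d: "2 \<le> d"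
  shows "t ^ 2 * \<bar>1 / s ^ d - 1 / t ^ d\<bar> \<le> \<bar>s - t\<bar> * (real d * (3/2) ^ (d - 1) * 2 ^ (d - 2)) / s ^ (d - 1)"
proof -
  have tp: "0 < t" using s t by simp
  have pd: "\<bar>t ^ d - s ^ d\<bar> \<le> \<bar>s - t\<bar> * (real d * (3 * s / 2) ^ (d - 1))"
  proof -
    have "t ^ d - s ^ d = (t - s) * (\<Sum>i<d. s ^ (d - Suc i) * t ^ i)"
      by (rule power_diff_sumr2)
    then have "\<bar>t ^ d - s ^ d\<bar> = \<bar>s - t\<bar> * \<bar>\<Sum>i<d. s ^ (d - Suc i) * t ^ i\<bar>"
      by (simp add: abs_mult abs_minus_commute)
    also have "\<bar>\<Sum>i<d. s ^ (d - Suc i) * t ^ i\<bar> \<le> (\<Sum>i<d. (3 * s / 2) ^ (d - 1))"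
    proof (rule order_trans[OF sum_abs], rule sum_mono)
      fix i assume i: "i \<in> {..<d}"
      have "\<bar>s ^ (d - Suc i) * t ^ i\<bar> = s ^ (d - Suc i) * t ^ i" using s tp by simp
      also have "\<dots> \<le> (3 * s / 2) ^ (d - Suc i) * (3 * s / 2) ^ i"
        using s tp t by (intro mult_mono power_mono) auto
      also have "\<dots> = (3 * s / 2) ^ (d - 1)" using i by (simp flip: power_add)
      finally show "\<bar>s ^ (d - Suc i) * t ^ i\<bar> \<le> (3 * s / 2) ^ (d - 1)" .
    qed
    finally show ?thesis by (simp add: mult_left_mono)
  qed
  obtain e where e: "d = e + 2" using d by (metis add.commute le_Suc_ex)
  have "t ^ 2 * \<bar>1 / s ^ d - 1 / t ^ d\<bar> = t ^ 2 * \<bar>t ^ d - s ^ d\<bar> / (s ^ d * t ^ d)"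
  proof -
    have "1 / s ^ d - 1 / t ^ d = (t ^ d - s ^ d) / (s ^ d * t ^ d)" using s tp by (simp add: field_simps)
    then show ?thesis using s tp by (simp add: abs_mult)
  qed
  also have "\<dots> = \<bar>t ^ d - s ^ d\<bar> / (s ^ d * t ^ e)" using tp by (simp add: e power_add power2_eq_square)
  also have "\<dots> \<le> (\<bar>s - t\<bar> * (real d * (3 * s / 2) ^ (d - 1))) / (s ^ d * (s / 2) ^ e)"
    using pd s tp t by (intro frac_le mult_left_mono power_mono) auto
  also have "\<dots> = \<bar>s - t\<bar> * (real d * (3/2) ^ (d - 1) * 2 ^ (d - 2)) / s ^ (d - 1)"
    using s by (simp add: e power_divide power_mult_distrib power_add field_simps)
  finally show ?thesis .
qed

context upper_regular
begin

lemma integrable_powr: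
  fixes f :: "'a \<Rightarrow> complex"
  assumes q: "1 < q" and f [measurable]: "f \<in> borel_measurable M"
    and fin: "(\<integral>\<^sup>+x. ennreal (norm (f x) powr q) \<partial>M) < \<infinity>"
  shows "integrable M f"
proof (rule integrableI_bounded[OF f])
  have pt: "t \<le> 1 + t powr q" if "0 \<le> t" for t :: real
  proof (cases "t \<le> 1")
    case False
    then have "t powr 1 \<le> t powr q" using q by (intro powr_mono) auto
    then show ?thesis using False by simp
  qed (use that in \<open>auto intro: add_increasing2\<close>)
  have "(\<integral>\<^sup>+x. ennreal (norm (f x)) \<partial>M) \<le> (\<integral>\<^sup>+x. 1 + ennreal (norm (f x) powr q) \<partial>M)"
    using pt by (intro nn_integral_mono) (simp flip: ennreal_1 ennreal_plus)
  also have "\<dots> = emeasure M (space M) + (\<integral>\<^sup>+x. ennreal (norm (f x) powr q) \<partial>M)"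
    by (simp add: nn_integral_add)
  also have "\<dots> < \<infinity>" using fin finite_emeasure_space by (simp add: less_top[symmetric])
  finally show "(\<integral>\<^sup>+x. ennreal (norm (f x)) \<partial>M) < \<infinity>" .
qed

lemma integrable_of_energy:
  "1 < q \<Longrightarrow> f \<in> borel_measurable M \<Longrightarrow> energy \<sigma> q f < \<infinity> \<Longrightarrow> integrable M f"
  unfolding energy_def by (rule integrable_powr) (auto simp: ennreal_add_less_top)

text \<open>By \<open>N1\<close> the kernel has order \<open>2 - d\<close>, one better than the
  critical order \<open>- n\<close>. Trading part of this gain, together with the increment
  condition \<open>N2\<close>, yields a Hoelder condition with an exponent below 1. Two regimes
  occur, according to whether \<open>y\<close> is close to \<open>x\<close> on the scale of
  \<open>norm (x - x')\<close>.\<close>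

lemma normal_kernel_energy:
  fixes N :: "'a \<Rightarrow> 'a \<Rightarrow> real" and d :: nat
  assumes q: "1 < q" and \<sigma>: "0 \<le> \<sigma>" "\<sigma> < 1" and d: "2 \<le> d" "n = real d - 1" and L: "0 \<le> L"
    and N [measurable]: "(\<lambda>(x, y). N x y) \<in> borel_measurable (M \<Otimes>\<^sub>M M)"
    and N1: "\<And>x y. x \<in> space M \<Longrightarrow> y \<in> space M \<Longrightarrow> \<bar>N x y\<bar> \<le> L * norm (x - y) ^ 2"
    and N2: "\<And>x x' y. x \<in> space M \<Longrightarrow> x' \<in> space M \<Longrightarrow> y \<in> space M \<Longrightarrow>
      \<bar>N x y - N x' y\<bar> \<le> L * norm (x - x') * (norm (x - y) + norm (x - x'))"
  shows "\<exists>C\<ge>0. \<forall>f\<in>borel_measurable M.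
    energy \<sigma> q (\<lambda>x. LINT y|M. (N x y / norm (x - y) ^ d) *\<^sub>R f y) \<le> ennreal C * (\<integral>\<^sup>+y. ennreal (norm (f y) powr q) \<partial>M)"
proof -
  \<comment> \<open>Any exponent strictly between \<open>\<sigma>\<close> and 1 would do.\<close>
  define \<theta> where "\<theta> = (1 + \<sigma>) / 2"
  have \<theta>: "0 < \<theta>" "\<theta> < 1" "\<sigma> < \<theta>" using \<sigma> by (auto simp: \<theta>_def)
  \<comment> \<open>This makes \<open>\<theta> - b\<close> equal to \<open>2 - d\<close>: the order
    of the kernel is split into the Hoelder gain \<open>\<theta>\<close> and a singularity of order
    \<open>b < n\<close>.\<close>
  define b where "b = n - 1 + \<theta>"
  have b: "b < n" using \<theta> by (simp add: b_def)
  \<comment> \<open>The summand \<open>3 / 2\<close> stems from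
    \<open>s + h \<le> 3 / 2 * s\<close>, the other one from
    \<open>power_inverse_diff_le\<close>.\<close>
  define K1 where "K1 = 3 / 2 + real d * (3/2) ^ (d - 1) * 2 ^ (d - 2)"
  have K1: "1 \<le> K1" by (simp add: K1_def add_increasing2)
  define K where "K = (L + 1) * (3 * D powr \<theta> + K1 + 3)"
  define k where "k x y = N x y / norm (x - y) ^ d" for x y
  have K: "0 < K" using L K1 by (simp add: K_def add_nonneg_pos)
  have L3: "L * 3 \<le> K" "L * K1 \<le> K" "L * D powr \<theta> \<le> K"
    unfolding K_def using L K1 by (intro mult_mono; simp)+
  have kb: "\<bar>k x y\<bar> \<le> L * norm (x - y) powr (\<theta> - b)" if x: "x \<in> space M" and y: "y \<in> space M" for x y
  proof (cases "x = y")
    case True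
    then show ?thesis using L N1[OF x y] by (simp add: k_def)
  next
    case False
    then have s: "0 < norm (x - y)" by simp
    have "\<bar>k x y\<bar> \<le> L * norm (x - y) ^ 2 / norm (x - y) ^ d"
      using N1[OF x y] s by (simp add: k_def divide_right_mono)
    also have "\<dots> = L * norm (x - y) powr (real 2 - real d)"
      using s by (simp add: powr_diff powr_realpow)
    also have "real 2 - real d = \<theta> - b" using d by (simp add: b_def)
    finally show ?thesis .
  qed
  have diffb: "\<bar>k x y - k x' y\<bar> \<le> K * norm (x - x') powr \<theta> * (norm (x - y) powr (- b) + norm (x' - y) powr (- b))"
    if x: "x \<in> space M" and x': "x' \<in> space M" and y: "y \<in> space M" for x x' y
  proof (cases "x = x'")
    case False
    define h where "h = norm (x - x')"
    define s where "s = norm (x - y)"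
    define t where "t = norm (x' - y)"
    have h: "0 < h" using False by (simp add: h_def)
    have st: "0 \<le> s" "0 \<le> t" by (auto simp: s_def t_def)
    have tri: "\<bar>s - t\<bar> \<le> h" unfolding s_def t_def h_def
      using norm_triangle_ineq3[of "x - y" "x' - y"] by simp
    show ?thesis
    \<comment> \<open>Close to the singularity cancellation gives nothing, so each kernel value is
      estimated alone, both distances being at most \<open>3 * h\<close>. In the other case
      \<open>s\<close> and \<open>t\<close> are comparable.\<close>
    proof (cases "s < 2 * h")
      case True
      have *: "L * u powr (\<theta> - b) \<le> K * h powr \<theta> * u powr (- b)" if u: "0 \<le> u" "u \<le> 3 * h" for u
      proof -
        have "u powr (\<theta> - b) = u powr \<theta> * u powr (- b)" by (simp add: powr_add[symmetric])
        also have "\<dots> \<le> (3 * h powr \<theta>) * u powr (- b)"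
        proof (rule mult_right_mono)
          have "u powr \<theta> \<le> (3 * h) powr \<theta>" using u \<theta> by (intro powr_mono2) auto
          also have "\<dots> = 3 powr \<theta> * h powr \<theta>" using h by (simp add: powr_mult)
          also have "\<dots> \<le> 3 powr 1 * h powr \<theta>" using \<theta> by (intro mult_right_mono powr_mono) auto
          finally show "u powr \<theta> \<le> 3 * h powr \<theta>" by simp
        qed simp
        finally have "L * u powr (\<theta> - b) \<le> L * (3 * h powr \<theta> * u powr (- b))"
          using L by (intro mult_left_mono) auto
        also have "\<dots> = (L * 3) * (h powr \<theta> * u powr (- b))" by simp
        also have "\<dots> \<le> K * (h powr \<theta> * u powr (- b))" using L3 by (intro mult_right_mono) auto
        finally show ?thesis by simp
      qed
      have "\<bar>k x y - k x' y\<bar> \<le> \<bar>k x y\<bar> + \<bar>k x' y\<bar>" by simp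
      also have "\<dots> \<le> K * h powr \<theta> * s powr (- b) + K * h powr \<theta> * t powr (- b)"
      proof (intro add_mono)
        have "s \<le> 3 * h" "t \<le> 3 * h" using True tri h by linarith+
        then show "\<bar>k x y\<bar> \<le> K * h powr \<theta> * s powr (- b)" "\<bar>k x' y\<bar> \<le> K * h powr \<theta> * t powr (- b)"
          using order_trans[OF kb[OF x y, folded s_def] *[OF st(1)]]
            order_trans[OF kb[OF x' y, folded t_def] *[OF st(2)]] by blast+
      qed
      finally show ?thesis by (simp add: h_def s_def t_def distrib_left)
    next
      case False
      have s: "0 < s" "s / 2 \<le> t" "t \<le> 3 * s / 2" using h False tri by auto
      have t: "0 < t" using s by simp
      have "k x y - k x' y = (N x y - N x' y) / s ^ d + N x' y * (1 / s ^ d - 1 / t ^ d)"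
        using s t by (simp add: k_def s_def t_def field_simps)
      then have "\<bar>k x y - k x' y\<bar> \<le> \<bar>(N x y - N x' y) / s ^ d\<bar> + \<bar>N x' y * (1 / s ^ d - 1 / t ^ d)\<bar>"
        by (metis abs_triangle_ineq)
      also have "\<bar>(N x y - N x' y) / s ^ d\<bar> \<le> L * h * (s + h) / s ^ d"
        using N2[OF x x' y] s by (simp add: h_def s_def divide_right_mono abs_divide)
      also have "\<dots> \<le> L * h * (3 / 2 * s) / s ^ d"
        using False L h s by (intro divide_right_mono mult_left_mono) auto
      also have "\<dots> = L * h * (3 / 2) / s ^ (d - 1)"
        using s d by (cases d) (auto simp: field_simps)
      also have "\<bar>N x' y * (1 / s ^ d - 1 / t ^ d)\<bar> \<le> (L * t ^ 2) * \<bar>1 / s ^ d - 1 / t ^ d\<bar>"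
        using N1[OF x' y] by (simp add: abs_mult t_def mult_right_mono)
      also have "\<dots> \<le> L * (\<bar>s - t\<bar> * (real d * (3/2) ^ (d - 1) * 2 ^ (d - 2)) / s ^ (d - 1))"
        unfolding mult.assoc using L power_inverse_diff_le[OF s d(1)] by (intro mult_left_mono) (auto simp: mult.assoc)
      also have "\<dots> \<le> L * (h * (real d * (3/2) ^ (d - 1) * 2 ^ (d - 2)) / s ^ (d - 1))"
        using L tri s by (intro mult_left_mono divide_right_mono mult_right_mono) auto
      also have "L * h * (3 / 2) / s ^ (d - 1) + L * (h * (real d * (3/2) ^ (d - 1) * 2 ^ (d - 2)) / s ^ (d - 1)) = L * K1 * (h * (1 / s ^ (d - 1)))"
        by (simp add: K1_def algebra_simps add_divide_distrib)
      also have "1 / s ^ (d - 1) = s powr (- n)"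
      proof -
        have "s ^ (d - 1) = s powr n" using s d powr_realpow[of s "d - 1"] by (simp add: of_nat_diff)
        then show ?thesis by (simp only: powr_minus inverse_eq_divide)
      qed
      also have "L * K1 * (h * s powr (- n)) \<le> K * (h powr \<theta> * s powr (- b))"
      proof (rule mult_mono)
        \<comment> \<open>Since \<open>h \<le> s\<close>, the surplus
          \<open>h powr (1 - \<theta>)\<close> of the Lipschitz gain may be replaced by a power of
          \<open>s\<close>, which weakens the singularity to order \<open>b\<close>.\<close>
        have "h * s powr (- n) = h powr \<theta> * h powr (1 - \<theta>) * s powr (- n)"
          using h by (simp add: powr_add[symmetric])
        also have "\<dots> \<le> h powr \<theta> * s powr (1 - \<theta>) * s powr (- n)"
          using False h \<theta> by (intro mult_right_mono mult_left_mono powr_mono2) auto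
        also have "\<dots> = h powr \<theta> * s powr (- b)"
          by (simp add: b_def powr_add[symmetric] mult.assoc algebra_simps)
        finally show "h * s powr (- n) \<le> h powr \<theta> * s powr (- b)" .
      qed (use L3 L K h in auto)
      also have "\<dots> \<le> K * h powr \<theta> * (s powr (- b) + t powr (- b))"
        unfolding mult.assoc using K by (intro mult_left_mono) auto
      finally show ?thesis by (simp add: h_def s_def t_def)
    qed
  qed (use K in simp)
  have "\<exists>C\<ge>0. \<forall>f\<in>borel_measurable M. energy \<sigma> q (\<lambda>x. LINT y|M. k x y *\<^sub>R f y) \<le> ennreal C * (\<integral>\<^sup>+y. ennreal (norm (f y) powr q) \<partial>M)"
  proof (rule weakly_singular_energy[OF q \<sigma>(1) \<theta>(3) b K])
    show "(\<lambda>(x, y). k x y) \<in> borel_measurable (M \<Otimes>\<^sub>M M)" unfolding k_def by measurable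
    fix x y assume x: "x \<in> space M" and y: "y \<in> space M"
    have "\<bar>k x y\<bar> \<le> L * norm (x - y) powr (\<theta> - b)" by (rule kb[OF x y])
    also have "\<dots> = L * (norm (x - y) powr \<theta> * norm (x - y) powr (- b))" by (simp add: powr_add[symmetric])
    also have "\<dots> \<le> L * (D powr \<theta> * norm (x - y) powr (- b))"
      using L \<theta> diam[OF x y] by (intro mult_left_mono mult_right_mono powr_mono2) auto
    also have "\<dots> \<le> K * norm (x - y) powr (- b)" using mult_right_mono[OF L3(3), of "norm (x - y) powr (- b)"] by simp
    finally show "\<bar>k x y\<bar> \<le> K * norm (x - y) powr (- b)" .
  qed (rule diffb)
  then show ?thesis by (simp add: k_def)
qed

text \<open>For the interaction of different components, whose kernel is regular: the image is
  Lipschitz with constant \<open>B\<close> times the integral of \<open>norm (f y)\<close>, and on a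
  finite measure space this is controlled by the \<open>q\<close>-th power.\<close>

lemma lipschitz_kernel_energy:
  fixes k :: "'a \<Rightarrow> 'a \<Rightarrow> real"
  assumes q: "1 < q" and \<sigma>: "0 \<le> \<sigma>" "\<sigma> < 1" and B: "0 \<le> B"
    and k [measurable]: "(\<lambda>(x, y). k x y) \<in> borel_measurable (M \<Otimes>\<^sub>M M)"
    and k1: "\<And>x y. x \<in> space M \<Longrightarrow> y \<in> space M \<Longrightarrow> \<bar>k x y\<bar> \<le> B"
    and k2: "\<And>x x' y. x \<in> space M \<Longrightarrow> x' \<in> space M \<Longrightarrow> y \<in> space M \<Longrightarrow> \<bar>k x y - k x' y\<bar> \<le> B * norm (x - x')"
  shows "\<exists>C\<ge>0. \<forall>f\<in>borel_measurable M.
    energy \<sigma> q (\<lambda>x. LINT y|M. k x y *\<^sub>R f y) \<le> ennreal C * (\<integral>\<^sup>+y. ennreal (norm (f y) powr q) \<partial>M)"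
proof -
  obtain C where C: "C \<ge> 0" and lip: "\<And>h B. 0 \<le> B \<Longrightarrow> (\<forall>x\<in>space M. norm (h x) \<le> B) \<Longrightarrow>
     (\<forall>x\<in>space M. \<forall>y\<in>space M. norm (h x - h y) \<le> B * norm (x - y)) \<Longrightarrow> energy \<sigma> q h \<le> ennreal (C * B powr q)"
    using lipschitz_energy[OF q \<sigma>] by blast
  define m where "m = measure M (space M) + 1"
  have m: "0 < m" "emeasure M (space M) \<le> ennreal m"
    by (auto simp: m_def emeasure_eq_measure add_nonneg_pos intro!: ennreal_leI)
  have "energy \<sigma> q (\<lambda>x. LINT y|M. k x y *\<^sub>R f y) \<le> ennreal (C * B powr q * m powr (q - 1) + 1) * (\<integral>\<^sup>+y. ennreal (norm (f y) powr q) \<partial>M)"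
    if f [measurable]: "f \<in> borel_measurable M" for f :: "'a \<Rightarrow> complex"
  \<comment> \<open>In \<open>ennreal\<close> the product of 0 and infinity is 0, so the constant
    must be positive here; this is the purpose of the added 1.\<close>
  proof (cases "(\<integral>\<^sup>+y. ennreal (norm (f y) powr q) \<partial>M) = \<infinity>")
    case True
    have "0 < C * B powr q * m powr (q - 1) + 1" using C by (simp add: add_nonneg_pos)
    then show ?thesis unfolding True by (simp add: ennreal_mult_top)
  next
    case False
    then have int: "integrable M f" by (intro integrable_powr[OF q]) (auto simp: less_top)
    define F where "F = (LINT y|M. norm (f y))"
    have F: "0 \<le> F" by (simp add: F_def)
    have kx [measurable]: "x \<in> space M \<Longrightarrow> k x \<in> borel_measurable M" for x
      using measurable_Pair2[OF k] by simp
    have ik: "integrable M (\<lambda>y. k x y *\<^sub>R f y)" if "x \<in> space M" for x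
      using k1[OF that] that B
      by (intro Bochner_Integration.integrable_bound[OF integrable_scaleR_right[OF int, of B]]) (auto intro!: mult_right_mono)
    have "energy \<sigma> q (\<lambda>x. LINT y|M. k x y *\<^sub>R f y) \<le> ennreal (C * (B * F) powr q)"
    proof (rule lip; (intro ballI)?)
      show "0 \<le> B * F" using B F by simp
    next
      fix x assume x: "x \<in> space M"
      have "norm (LINT y|M. k x y *\<^sub>R f y) \<le> (LINT y|M. norm (k x y *\<^sub>R f y))" by (rule integral_norm_bound)
      also have "\<dots> \<le> (LINT y|M. B * norm (f y))"
        using k1[OF x]
        by (intro integral_mono[OF integrable_norm[OF ik[OF x]] integrable_mult_right[OF integrable_norm[OF int]]])
           (auto intro!: mult_right_mono)
      finally show "norm (LINT y|M. k x y *\<^sub>R f y) \<le> B * F" by (simp add: F_def)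
    next
      fix x x' assume x: "x \<in> space M" and x': "x' \<in> space M"
      have "norm ((LINT y|M. k x y *\<^sub>R f y) - (LINT y|M. k x' y *\<^sub>R f y)) = norm (LINT y|M. (k x y - k x' y) *\<^sub>R f y)"
        by (subst Bochner_Integration.integral_diff[symmetric, OF ik[OF x] ik[OF x']]) (simp add: scaleR_left_diff_distrib)
      also have "\<dots> \<le> (LINT y|M. norm ((k x y - k x' y) *\<^sub>R f y))" by (rule integral_norm_bound)
      also have "\<dots> \<le> (LINT y|M. (B * norm (x - x')) * norm (f y))"
      proof (intro integral_mono integrable_norm integrable_mult_right int)
        show "integrable M (\<lambda>y. (k x y - k x' y) *\<^sub>R f y)"
          unfolding scaleR_left_diff_distrib by (intro Bochner_Integration.integrable_diff ik x x')
      qed (use k2[OF x x'] in \<open>auto intro!: mult_right_mono\<close>)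
      finally show "norm ((LINT y|M. k x y *\<^sub>R f y) - (LINT y|M. k x' y *\<^sub>R f y)) \<le> B * F * norm (x - x')"
        by (simp add: F_def mult_ac)
    qed
    also have "ennreal (C * (B * F) powr q) = ennreal (C * B powr q) * ennreal (F powr q)"
      using C B F by (simp add: powr_mult ennreal_mult[symmetric] mult.assoc)
    also have "ennreal (F powr q) \<le> ennreal (m powr (q - 1)) * (\<integral>\<^sup>+y. ennreal (1 * norm (f y) powr q) \<partial>M)"
    proof (rule nn_integral_jensen_powr[OF q m(1) F])
      show "ennreal F \<le> (\<integral>\<^sup>+y. ennreal (1 * norm (f y)) \<partial>M)"
        unfolding F_def using int by (simp add: nn_integral_eq_integral)
    qed (use m in auto)
    also have "ennreal (C * B powr q) * (ennreal (m powr (q - 1)) * (\<integral>\<^sup>+y. ennreal (1 * norm (f y) powr q) \<partial>M))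
        = ennreal (C * B powr q * m powr (q - 1)) * (\<integral>\<^sup>+y. ennreal (norm (f y) powr q) \<partial>M)"
      using C by (simp add: ennreal_mult mult.assoc)
    also have "\<dots> \<le> ennreal (C * B powr q * m powr (q - 1) + 1) * (\<integral>\<^sup>+y. ennreal (norm (f y) powr q) \<partial>M)"
      by (intro mult_right_mono ennreal_leI) auto
    finally show ?thesis by (simp add: mult_left_mono)
  qed
  moreover have "0 \<le> C * B powr q * m powr (q - 1) + 1" using C by simp
  ultimately show ?thesis by blast
qed

end

text \<open>The factor agrees with \<open>1 / (2 * pi)\<close> in dimension 2 and with \<open>1 / (4 * pi)\<close> in dimension 3.
  At \<open>v = 0\<close> the value is \<open>0\<close>.\<close>

definition newton_field :: "'a::euclidean_space \<Rightarrow> 'a" where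
  "newton_field v = (1 / (2 * (real DIM('a) - 1) * pi) / norm v ^ DIM('a)) *\<^sub>R v"

text \<open>Both cases of \<open>G\<close> are radial, so the chain rule through the norm yields one
  formula with a constant depending on the dimension. On the diagonal \<open>grad1_G\<close> carries
  no information, whereas the field is 0 there.\<close>

lemma grad1_G_eq:
  fixes x y :: "'a::euclidean_space"
  assumes dim: "DIM('a) = 2 \<or> DIM('a) = 3" and xy: "x \<noteq> y"
  shows "grad1_G x y = newton_field (x - y)"
  unfolding grad1_G_def
proof (rule grad_eqI)
  have n0: "0 < norm (x - y)" using xy by simp
  have "((\<lambda>z. norm z) has_derivative (\<lambda>h. h \<bullet> sgn (x - y))) (at (x - y))"
    using GDERIV_norm[of "x - y"] xy by (simp add: gderiv_def)
  moreover have "((\<lambda>z. z - y) has_derivative (\<lambda>h. h)) (at x)" by (auto intro!: derivative_eq_intros)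
  ultimately have "((\<lambda>z. norm (z - y)) has_derivative (\<lambda>h. h \<bullet> sgn (x - y))) (at x)"
    using has_derivative_compose[of "\<lambda>z. z - y" "\<lambda>h. h" x UNIV norm "\<lambda>h. h \<bullet> sgn (x - y)"] by simp
  then have gn: "GDERIV (\<lambda>z. norm (z - y)) x :> sgn (x - y)" by (simp add: gderiv_def)
  show "GDERIV (\<lambda>z. G z y) x :> newton_field (x - y)"
  proof (cases "DIM('a) = 2")
    case True
    have "DERIV (\<lambda>t. 1 / (2 * pi) * ln t) (norm (x - y)) :> 1 / (2 * pi) * (1 / norm (x - y))"
      using n0 by (auto intro!: derivative_eq_intros)
    from GDERIV_DERIV_compose[OF gn this] show ?thesis
      using True by (simp add: G_def newton_field_def sgn_div_norm power2_eq_square inverse_eq_divide mult_ac)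
  next
    case False
    then have d3: "DIM('a) = 3" using dim by simp
    have "DERIV (\<lambda>t. - 1 / (4 * pi) * inverse t) (norm (x - y)) :> - 1 / (4 * pi) * (- (inverse (norm (x - y)) ^ 2))"
      using n0 by (auto intro!: derivative_eq_intros simp: power2_eq_square)
    from GDERIV_DERIV_compose[OF gn this] show ?thesis
      using d3 False by (simp add: G_def newton_field_def sgn_div_norm power2_eq_square power3_eq_cube inverse_eq_divide mult_ac)
  qed
qed

lemma newton_field_scale:
  fixes v :: "'a::euclidean_space"
  assumes "0 < c"
  shows "newton_field (c *\<^sub>R v) = (1 / c ^ (DIM('a) - 1)) *\<^sub>R newton_field v"
proof -
  have "c ^ DIM('a) = c * c ^ (DIM('a) - 1)" using power_Suc[of c "DIM('a) - 1"] by simp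
  then show ?thesis using assms by (simp add: newton_field_def power_mult_distrib)
qed

lemma newton_field_measurable [measurable]: "newton_field \<in> borel_measurable borel"
  unfolding newton_field_def by measurable

text \<open>The exterior of a ball is not convex, so direct algebra takes the place of a mean value
  argument along the segment.\<close>

lemma newton_field_diff:
  fixes v w :: "'a::euclidean_space"
  assumes dim: "2 \<le> DIM('a)" and \<rho>: "0 < \<rho>" "\<rho> \<le> norm v" "\<rho> \<le> norm w"
  shows "norm (newton_field v - newton_field w) \<le> (real DIM('a) + 1) / \<rho> ^ DIM('a) * norm (v - w)"
proof -
  let ?d = "DIM('a)"
  define c where "c = 1 / (2 * (real ?d - 1) * pi)"
  have "1 \<le> 2 * (real ?d - 1) * pi"
    using mult_mono[of 1 "2 * (real ?d - 1)" 1 pi] dim pi_gt3 by simp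
  then have c: "0 \<le> c" "c \<le> 1" by (auto simp: c_def divide_le_eq_1)
  \<comment> \<open>By symmetry the second vector may be taken as the shorter one; its length then
    governs the difference of the inverse powers.\<close>
  have main: "norm ((1 / norm v ^ ?d) *\<^sub>R v - (1 / norm w ^ ?d) *\<^sub>R w) \<le> (real ?d + 1) / \<rho> ^ ?d * norm (v - w)"
    if \<rho>: "\<rho> \<le> norm w" and le: "norm w \<le> norm v" for v w :: 'a
  proof -
    define a where "a = norm v" define b where "b = norm w"
    have ab: "0 < b" "b \<le> a" "\<rho> \<le> b" "0 < a" using \<rho> le \<open>0 < \<rho>\<close> by (auto simp: a_def b_def)
    have "(1 / a ^ ?d) *\<^sub>R v - (1 / b ^ ?d) *\<^sub>R w = (1 / a ^ ?d) *\<^sub>R (v - w) + (1 / a ^ ?d - 1 / b ^ ?d) *\<^sub>R w"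
      by (simp add: algebra_simps)
    then have "norm ((1 / a ^ ?d) *\<^sub>R v - (1 / b ^ ?d) *\<^sub>R w) \<le> norm ((1 / a ^ ?d) *\<^sub>R (v - w)) + norm ((1 / a ^ ?d - 1 / b ^ ?d) *\<^sub>R w)"
      by (metis norm_triangle_ineq)
    also have "norm ((1 / a ^ ?d) *\<^sub>R (v - w)) \<le> 1 / \<rho> ^ ?d * norm (v - w)"
      using ab \<open>0 < \<rho>\<close> by (auto intro!: divide_left_mono power_mono simp: divide_left_mono)
    also have "norm ((1 / a ^ ?d - 1 / b ^ ?d) *\<^sub>R w) \<le> real ?d / \<rho> ^ ?d * norm (v - w)"
    proof -
      have pd: "a ^ ?d - b ^ ?d \<le> (a - b) * (real ?d * a ^ (?d - 1))"
      proof -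
        have "a ^ ?d - b ^ ?d = (a - b) * (\<Sum>i<?d. b ^ (?d - Suc i) * a ^ i)" by (rule power_diff_sumr2)
        also have "\<dots> \<le> (a - b) * (\<Sum>i<?d. a ^ (?d - 1))"
        proof (intro mult_left_mono sum_mono)
          fix i assume i: "i \<in> {..<?d}"
          have "b ^ (?d - Suc i) * a ^ i \<le> a ^ (?d - Suc i) * a ^ i" using ab by (intro mult_right_mono power_mono) auto
          also have "\<dots> = a ^ (?d - 1)" using i by (simp flip: power_add)
          finally show "b ^ (?d - Suc i) * a ^ i \<le> a ^ (?d - 1)" .
        qed (use ab in auto)
        finally show ?thesis by simp
      qed
      have "norm ((1 / a ^ ?d - 1 / b ^ ?d) *\<^sub>R w) = (a ^ ?d - b ^ ?d) / (a ^ ?d * b ^ ?d) * b"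
      proof -
        have "1 / a ^ ?d - 1 / b ^ ?d = - ((a ^ ?d - b ^ ?d) / (a ^ ?d * b ^ ?d))" using ab by (simp add: field_simps)
        moreover have "0 \<le> (a ^ ?d - b ^ ?d) / (a ^ ?d * b ^ ?d)" using ab by (auto intro!: power_mono)
        ultimately show ?thesis by (simp only: norm_scaleR abs_minus_cancel abs_of_nonneg b_def)
      qed
      also have "\<dots> \<le> (a - b) * (real ?d * a ^ (?d - 1)) / (a ^ ?d * b ^ ?d) * b"
        using pd ab by (intro mult_right_mono divide_right_mono) auto
      also have "\<dots> = (a - b) * real ?d / b ^ ?d * (b / a)"
      proof -
        have "a ^ ?d = a * a ^ (?d - 1)" using power_Suc[of a "?d - 1"] by simp
        then show ?thesis using ab by (simp add: field_simps)
      qed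
      also have "\<dots> \<le> (a - b) * real ?d / b ^ ?d * 1"
        using ab by (intro mult_left_mono) auto
      also have "\<dots> \<le> norm (v - w) * real ?d / \<rho> ^ ?d * 1"
        using ab \<open>0 < \<rho>\<close> norm_triangle_ineq2[of v w] unfolding a_def b_def
        by (intro mult_right_mono frac_le mult_right_mono power_mono) auto
      finally show ?thesis by (simp add: mult.commute)
    qed
    finally show ?thesis by (simp add: a_def b_def algebra_simps add_divide_distrib)
  qed
  have eq: "newton_field v = c *\<^sub>R ((1 / norm v ^ ?d) *\<^sub>R v)" for v :: 'a
    by (simp add: newton_field_def c_def)
  have "norm (newton_field v - newton_field w) = c * norm ((1 / norm v ^ ?d) *\<^sub>R v - (1 / norm w ^ ?d) *\<^sub>R w)"
    unfolding eq scaleR_diff_right[symmetric] norm_scaleR using c by simp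
  also have "\<dots> \<le> 1 * norm ((1 / norm v ^ ?d) *\<^sub>R v - (1 / norm w ^ ?d) *\<^sub>R w)"
    using c by (intro mult_right_mono) auto
  also have "\<dots> \<le> (real ?d + 1) / \<rho> ^ ?d * norm (v - w)"
    using main[of w v] main[of v w] \<rho> by (cases "norm w \<le> norm v") (auto simp: norm_minus_commute)
  finally show ?thesis .
qed

lemma newton_field_bound:
  fixes v :: "'a::euclidean_space"
  assumes dim: "2 \<le> DIM('a)" and \<rho>: "0 < \<rho>" "\<rho> \<le> norm v"
  shows "norm (newton_field v) \<le> 1 / \<rho> ^ (DIM('a) - 1)"
proof -
  let ?d = "DIM('a)"
  define c where "c = 1 / (2 * (real ?d - 1) * pi)"
  have "1 \<le> 2 * (real ?d - 1) * pi"
    using mult_mono[of 1 "2 * (real ?d - 1)" 1 pi] dim pi_gt3 by simp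
  then have c: "0 \<le> c" "c \<le> 1" by (auto simp: c_def divide_le_eq_1)
  have "norm v ^ ?d = norm v * norm v ^ (?d - 1)" using power_Suc[of "norm v" "?d - 1"] by simp
  moreover have "norm (newton_field v) = c / norm v ^ ?d * norm v"
    unfolding newton_field_def c_def[symmetric] norm_scaleR using c by simp
  moreover have v: "0 < norm v" using \<rho> by linarith
  ultimately have "norm (newton_field v) = c * (1 / norm v ^ (?d - 1))"
    by simp
  also have "\<dots> \<le> 1 * (1 / \<rho> ^ (?d - 1))"
    using \<rho> c v by (intro mult_mono divide_left_mono power_mono) auto
  finally show ?thesis by simp
qed

subsection \<open>The self-similar family of boundaries\<close>

locale self_similar_boundary =
  fixes r :: real and \<Omega>\<^sub>0 :: "'a::euclidean_space set" and n :: nat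
  assumes dim: "DIM('a) = 2 \<or> DIM('a) = 3" and n_eq: "n = DIM('a) - 1" and geom: "admissible_geometry r \<Omega>\<^sub>0"
begin

abbreviation "\<Gamma>\<^sub>0 \<equiv> frontier \<Omega>\<^sub>0"
abbreviation "\<Gamma> \<equiv> Gam r \<Omega>\<^sub>0"
abbreviation "\<Gamma>U \<equiv> Gamma_union r \<Omega>\<^sub>0"
abbreviation "M\<^sub>0 \<equiv> restrict_space (surf :: 'a measure) \<Gamma>\<^sub>0"
abbreviation "MU \<equiv> restrict_space (surf :: 'a measure) \<Gamma>U"

lemma r: "0 < r" "r < 1" and open_\<Omega>: "open \<Omega>\<^sub>0" and bounded_\<Omega>: "bounded \<Omega>\<^sub>0" and smooth: "smooth_boundary \<Omega>\<^sub>0"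
  and zero_notin: "0 \<notin> closure \<Omega>\<^sub>0"
  and closures_disjoint: "j \<noteq> k \<Longrightarrow> closure (Omega r \<Omega>\<^sub>0 j) \<inter> closure (Omega r \<Omega>\<^sub>0 k) = {}"
  using geom by (auto simp: admissible_geometry_def)

lemma r_neq_0 [simp]: "r \<noteq> 0" using r by simp

lemma dim2: "2 \<le> DIM('a)" using dim by auto

lemma n_pos: "0 < n" and real_n: "real n = real DIM('a) - 1" using dim2 by (auto simp: of_nat_diff n_eq)

lemma eta_nat: "eta r (int j) x = r ^ j *\<^sub>R x"
  by (simp add: eta_def power_int_def)

lemma eta_minus_nat: "eta r (- int j) x = (1 / r ^ j) *\<^sub>R x"
  using r by (simp add: eta_def power_int_minus inverse_eq_divide)

lemma rj: "0 < r ^ j" "r ^ j \<le> 1" using r by (auto intro: power_le_one)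

lemma Gam_eq: "\<Gamma> j = (*\<^sub>R) (r ^ j) ` \<Gamma>\<^sub>0"
  by (simp add: Gam_def eta_nat[abs_def])

lemma Omega_eq: "Omega r \<Omega>\<^sub>0 j = (*\<^sub>R) (r ^ j) ` \<Omega>\<^sub>0"
  by (simp add: Omega_def eta_nat[abs_def])

lemma Gam_0: "\<Gamma> 0 = \<Gamma>\<^sub>0" by (simp add: Gam_eq)

lemma scale_Gam_iff: "r ^ j *\<^sub>R x \<in> \<Gamma> j \<longleftrightarrow> x \<in> \<Gamma>\<^sub>0"
  using rj[of j] by (auto simp: Gam_eq)

lemma unscale_Gam: "x \<in> \<Gamma> j \<Longrightarrow> (1 / r ^ j) *\<^sub>R x \<in> \<Gamma>\<^sub>0"
  using rj[of j] by (auto simp: Gam_eq)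

lemma compact_\<Gamma>\<^sub>0: "compact \<Gamma>\<^sub>0" using bounded_\<Omega> by (simp add: compact_frontier_bounded)

lemma compact_Gam: "compact (\<Gamma> j)" unfolding Gam_eq by (rule compact_scaling[OF compact_\<Gamma>\<^sub>0])

lemma closed_Gam: "closed (\<Gamma> j)" by (rule compact_imp_closed[OF compact_Gam])

lemma Gam_sets [measurable]: "\<Gamma> j \<in> sets borel" using closed_Gam by simp

lemma \<Gamma>\<^sub>0_sets [measurable]: "\<Gamma>\<^sub>0 \<in> sets borel" by simp

lemma \<Gamma>U_eq: "\<Gamma>U = (\<Union>j. \<Gamma> j)" by (simp add: Gamma_union_def)

lemma \<Gamma>U_sets [measurable]: "\<Gamma>U \<in> sets borel" unfolding \<Gamma>U_eq by measurable

lemma Gam_subset: "\<Gamma> j \<subseteq> \<Gamma>U" by (auto simp: \<Gamma>U_eq)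

lemma Gam_closure: "\<Gamma> j \<subseteq> closure (Omega r \<Omega>\<^sub>0 j)"
  by (auto simp: Gam_eq Omega_eq closure_scaleR[symmetric] frontier_def)

lemma Gam_disjoint: "x \<in> \<Gamma> j \<Longrightarrow> x \<in> \<Gamma> k \<Longrightarrow> j = k"
  using closures_disjoint[of j k] Gam_closure[of j] Gam_closure[of k] by blast

lemma disjoint_family_Gam: "disjoint_family \<Gamma>"
  using Gam_disjoint by (auto simp: disjoint_family_on_def)

lemma component_index_eq: "x \<in> \<Gamma> j \<Longrightarrow> component_index r \<Omega>\<^sub>0 x = j"
  unfolding component_index_def using Gam_disjoint by blast

lemma nu_eq: "x \<in> \<Gamma>\<^sub>0 \<Longrightarrow> nu r \<Omega>\<^sub>0 (r ^ j *\<^sub>R x) = outer_normal \<Omega>\<^sub>0 x"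
  unfolding nu_def component_index_eq[OF iffD2[OF scale_Gam_iff]] Omega_eq
  by (rule outer_normal_scale[OF open_\<Omega> _ smooth rj(1)])

section \<open>Radii and separation of the components\<close>

lemma norm_bounds: "\<exists>a b. 0 < a \<and> 0 < b \<and> (\<forall>x\<in>\<Gamma>\<^sub>0. a \<le> norm x \<and> norm x \<le> b)"
proof -
  have "open (- closure \<Omega>\<^sub>0)" by auto
  then obtain a where a: "0 < a" "ball 0 a \<subseteq> - closure \<Omega>\<^sub>0"
    using zero_notin unfolding open_contains_ball by blast
  obtain b where b: "0 < b" "\<And>x. x \<in> \<Gamma>\<^sub>0 \<Longrightarrow> norm x \<le> b"
    using compact_imp_bounded[OF compact_\<Gamma>\<^sub>0] bounded_pos by metis
  have "a \<le> norm x" if "x \<in> \<Gamma>\<^sub>0" for x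
  proof (rule ccontr)
    assume "\<not> ?thesis"
    then have "x \<in> ball 0 a" by simp
    then show False using a that by (auto simp: frontier_def)
  qed
  then show ?thesis using a b by blast
qed

text \<open>Fixed by choice, so that the radii are constants of the locale and can enter the
  parameters of sublocales.\<close>

definition inrad :: real where "inrad = fst (SOME p. 0 < fst p \<and> 0 < snd p \<and> (\<forall>x\<in>\<Gamma>\<^sub>0. fst p \<le> norm x \<and> norm x \<le> snd p))"
definition outrad :: real where "outrad = snd (SOME p. 0 < fst p \<and> 0 < snd p \<and> (\<forall>x\<in>\<Gamma>\<^sub>0. fst p \<le> norm x \<and> norm x \<le> snd p))"

lemma inrad: "0 < inrad" and outrad: "0 < outrad"
  and norm_\<Gamma>\<^sub>0: "x \<in> \<Gamma>\<^sub>0 \<Longrightarrow> inrad \<le> norm x" "x \<in> \<Gamma>\<^sub>0 \<Longrightarrow> norm x \<le> outrad"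
proof -
  have "\<exists>p. 0 < fst p \<and> 0 < snd p \<and> (\<forall>x\<in>\<Gamma>\<^sub>0. fst p \<le> norm x \<and> norm x \<le> snd p)"
    using norm_bounds by (metis fst_conv snd_conv)
  from someI_ex[OF this] show "0 < inrad" "0 < outrad"
    "x \<in> \<Gamma>\<^sub>0 \<Longrightarrow> inrad \<le> norm x" "x \<in> \<Gamma>\<^sub>0 \<Longrightarrow> norm x \<le> outrad"
    unfolding inrad_def outrad_def by auto
qed

lemma norm_Gam: "x \<in> \<Gamma> j \<Longrightarrow> r ^ j * inrad \<le> norm x" "x \<in> \<Gamma> j \<Longrightarrow> norm x \<le> r ^ j * outrad"
  using norm_\<Gamma>\<^sub>0 r by (auto simp: Gam_eq)

lemma norm_\<Gamma>U: "x \<in> \<Gamma>U \<Longrightarrow> norm x \<le> outrad"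
proof -
  assume "x \<in> \<Gamma>U"
  then obtain j where "x \<in> \<Gamma> j" by (auto simp: \<Gamma>U_eq)
  then have "norm x \<le> r ^ j * outrad" by (rule norm_Gam)
  also have "\<dots> \<le> 1 * outrad" using rj outrad by (intro mult_right_mono) auto
  finally show ?thesis by simp
qed

text \<open>Finitely many components are handled by compactness; all later ones lie in the ball
  around 0 of half the inner radius.\<close>

lemma separation_base: "\<exists>c>0. \<forall>m\<ge>1. \<forall>x\<in>\<Gamma>\<^sub>0. \<forall>y\<in>\<Gamma> m. c \<le> norm (x - y)"
proof -
  have "(\<lambda>m. r ^ m * outrad) \<longlonglongrightarrow> 0 * outrad"
    using r by (intro tendsto_mult LIMSEQ_power_zero tendsto_const) auto
  then have "\<forall>\<^sub>F m in sequentially. r ^ m * outrad < inrad / 2"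
    using inrad by (auto dest: order_tendstoD(2)[of _ _ _ "inrad / 2"])
  then obtain N where N: "\<And>m. N \<le> m \<Longrightarrow> r ^ m * outrad < inrad / 2" unfolding eventually_sequentially by blast
  have "\<exists>c>0. \<forall>x\<in>\<Gamma>\<^sub>0. \<forall>y\<in>\<Gamma> m. c \<le> norm (x - y)" if "1 \<le> m" for m
  proof -
    have "\<Gamma>\<^sub>0 \<inter> \<Gamma> m = {}" using that Gam_disjoint[of _ 0 m] by (auto simp: Gam_0)
    then show ?thesis using separate_compact_closed[OF compact_\<Gamma>\<^sub>0 closed_Gam[of m]] by (simp add: dist_norm)
  qed
  then obtain c where c: "\<And>m. 1 \<le> m \<Longrightarrow> c m > 0" "\<And>m x y. 1 \<le> m \<Longrightarrow> x \<in> \<Gamma>\<^sub>0 \<Longrightarrow> y \<in> \<Gamma> m \<Longrightarrow> c m \<le> norm (x - y)"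
    by metis
  define C where "C = Min (insert (inrad / 2) (c ` {1..N}))"
  have C0: "0 < C" unfolding C_def using c inrad by (subst Min_gr_iff) auto
  have "C \<le> norm (x - y)" if m: "1 \<le> m" and x: "x \<in> \<Gamma>\<^sub>0" and y: "y \<in> \<Gamma> m" for m x y
  proof (cases "m \<le> N")
    case True
    have "C \<le> c m" unfolding C_def using True m by (intro Min_le) auto
    then show ?thesis using c(2)[OF m x y] by simp
  next
    case False
    have "C \<le> inrad / 2" unfolding C_def by (intro Min_le) auto
    also have "\<dots> \<le> norm x - norm y" using norm_\<Gamma>\<^sub>0(1)[OF x] norm_Gam(2)[OF y] N[of m] False by linarith
    also have "\<dots> \<le> norm (x - y)" by (rule norm_triangle_ineq2)
    finally show ?thesis .
  qed
  then show ?thesis using C0 by blast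
qed

text \<open>Dilating by \<open>1 / r ^ i\<close> for the smaller of the two indices reduces to
  \<open>separation_base\<close>. The bound is relative to \<open>norm x\<close> and therefore scale
  invariant.\<close>

lemma separation_ex: "\<exists>c>0. \<forall>i j. i \<noteq> j \<longrightarrow> (\<forall>x\<in>\<Gamma> i. \<forall>y\<in>\<Gamma> j. c * norm x \<le> norm (x - y))"
proof -
  obtain c where c: "0 < c" "\<And>m x y. 1 \<le> m \<Longrightarrow> x \<in> \<Gamma>\<^sub>0 \<Longrightarrow> y \<in> \<Gamma> m \<Longrightarrow> c \<le> norm (x - y)"
    using separation_base by metis
  \<comment> \<open>The auxiliary point \<open>z\<close> stands for either of the two points, so
    that one estimate covers both orders of the indices.\<close>
  have low: "c / outrad * norm z \<le> norm (x - y)"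
    if ij: "i < j" and x: "x \<in> \<Gamma> i" and y: "y \<in> \<Gamma> j" and z: "norm z \<le> r ^ i * outrad" for i j x y z
  proof -
    have y': "(1 / r ^ i) *\<^sub>R y \<in> \<Gamma> (j - i)"
    proof -
      obtain y0 where y0: "y0 \<in> \<Gamma>\<^sub>0" "y = r ^ j *\<^sub>R y0" using y by (auto simp: Gam_eq)
      have "r ^ j = r ^ i * r ^ (j - i)" using ij by (simp flip: power_add)
      then have "(1 / r ^ i) *\<^sub>R y = r ^ (j - i) *\<^sub>R y0" using y0 r by simp
      then show ?thesis using y0 by (auto simp: Gam_eq)
    qed
    have "c / outrad * norm z \<le> c / outrad * (r ^ i * outrad)" using c outrad z by (intro mult_left_mono) auto
    also have "\<dots> = r ^ i * c" using outrad by simp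
    also have "\<dots> \<le> r ^ i * norm ((1 / r ^ i) *\<^sub>R x - (1 / r ^ i) *\<^sub>R y)"
      using ij r by (intro mult_left_mono c(2)[OF _ unscale_Gam[OF x] y']) auto
    also have "\<dots> = norm (x - y)" using rj[of i] by (simp flip: scaleR_diff_right)
    finally show ?thesis .
  qed
  have "c / outrad * norm x \<le> norm (x - y)" if ij: "i \<noteq> j" and x: "x \<in> \<Gamma> i" and y: "y \<in> \<Gamma> j" for i j x y
  proof (cases "i < j")
    case True
    then show ?thesis using low[OF _ x y norm_Gam(2)[OF x]] by simp
  next
    case False
    then have ji: "j < i" using ij by simp
    have "norm x \<le> r ^ i * outrad" by (rule norm_Gam(2)[OF x])
    also have "\<dots> \<le> r ^ j * outrad" using ji r outrad by (intro mult_right_mono power_decreasing) auto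
    finally show ?thesis using low[OF ji y x] by (simp add: norm_minus_commute)
  qed
  moreover have "0 < c / outrad" using c outrad by simp
  ultimately show ?thesis by blast
qed

definition sepc :: real where "sepc = (SOME c. 0 < c \<and> (\<forall>i j. i \<noteq> j \<longrightarrow> (\<forall>x\<in>\<Gamma> i. \<forall>y\<in>\<Gamma> j. c * norm x \<le> norm (x - y))))"

lemma sepc: "0 < sepc" and separation: "i \<noteq> j \<Longrightarrow> x \<in> \<Gamma> i \<Longrightarrow> y \<in> \<Gamma> j \<Longrightarrow> sepc * norm x \<le> norm (x - y)"
  using someI_ex[OF separation_ex] unfolding sepc_def by blast+

lemma separation_power: "i \<noteq> j \<Longrightarrow> x \<in> \<Gamma> i \<Longrightarrow> y \<in> \<Gamma> j \<Longrightarrow> sepc * inrad * r ^ i \<le> norm (x - y)"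
proof -
  assume *: "i \<noteq> j" "x \<in> \<Gamma> i" "y \<in> \<Gamma> j"
  have "sepc * inrad * r ^ i = sepc * (r ^ i * inrad)" by simp
  also have "\<dots> \<le> sepc * norm x" using sepc * by (intro mult_left_mono norm_Gam) auto
  also have "\<dots> \<le> norm (x - y)" by (rule separation[OF *])
  finally show ?thesis .
qed

section \<open>Growth of the surface measure on the components and on their union\<close>

lemma emeasure_surf_mono: "A \<subseteq> B \<Longrightarrow> B \<in> sets borel \<Longrightarrow> emeasure surf A \<le> emeasure (surf :: 'a measure) B"
  by (rule emeasure_mono) auto

lemma regular_\<Gamma>\<^sub>0: "\<exists>A\<ge>0. \<forall>z. \<forall>R>0. emeasure surf (\<Gamma>\<^sub>0 \<inter> cball z R) \<le> ennreal (A * R ^ n)"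
  using boundary_estimates(3)[OF dim2 open_\<Omega> bounded_\<Omega> smooth]
  by (simp add: emeasure_surf[OF dim2] n_eq)

text \<open>Both sides scale with the \<open>n\<close>-th power of the dilation factor, so one
  constant serves every component.\<close>

lemma regular_Gam: "\<exists>A\<ge>0. \<forall>j z. \<forall>R>0. emeasure surf (\<Gamma> j \<inter> cball z R) \<le> ennreal (A * R ^ n)"
proof -
  obtain A where A: "0 \<le> A" "\<And>z R. 0 < R \<Longrightarrow> emeasure surf (\<Gamma>\<^sub>0 \<inter> cball z R) \<le> ennreal (A * R ^ n)"
    using regular_\<Gamma>\<^sub>0 by blast
  have "emeasure surf (\<Gamma> j \<inter> cball z R) \<le> ennreal (A * R ^ n)" if R: "0 < R" for j z R
  proof -
    define c where "c = r ^ j"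
    have c: "0 < c" using r by (simp add: c_def)
    have eq: "\<Gamma> j \<inter> cball z R = (*\<^sub>R) c ` (\<Gamma>\<^sub>0 \<inter> cball ((1 / c) *\<^sub>R z) (R / c))"
    proof -
      have "cball z R = (*\<^sub>R) c ` cball ((1 / c) *\<^sub>R z) (R / c)"
        using c cball_scale[of c "(1 / c) *\<^sub>R z" "R / c"] by simp
      moreover have "inj ((*\<^sub>R) c :: 'a \<Rightarrow> 'a)" using c by (auto simp: inj_on_def)
      ultimately show ?thesis by (simp add: Gam_eq c_def[symmetric] image_Int)
    qed
    have "emeasure surf (\<Gamma> j \<inter> cball z R) = ennreal (c ^ n) * emeasure surf (\<Gamma>\<^sub>0 \<inter> cball ((1 / c) *\<^sub>R z) (R / c))"
    proof -
      have "emeasure surf (\<Gamma> j \<inter> cball z R) = hausdorff_outer n (\<Gamma> j \<inter> cball z R)"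
        unfolding n_eq by (rule emeasure_surf[OF dim2]) auto
      also have "\<dots> = ennreal (c ^ n) * hausdorff_outer n (\<Gamma>\<^sub>0 \<inter> cball ((1 / c) *\<^sub>R z) (R / c))"
        unfolding eq by (rule hausdorff_outer_scale[OF c])
      also have "hausdorff_outer n (\<Gamma>\<^sub>0 \<inter> cball ((1 / c) *\<^sub>R z) (R / c)) = emeasure surf (\<Gamma>\<^sub>0 \<inter> cball ((1 / c) *\<^sub>R z) (R / c))"
        unfolding n_eq by (rule emeasure_surf[OF dim2, symmetric]) auto
      finally show ?thesis .
    qed
    also have "\<dots> \<le> ennreal (c ^ n) * ennreal (A * (R / c) ^ n)" using R c by (intro mult_left_mono A) auto
    also have "\<dots> = ennreal (A * R ^ n)"
      using A R c by (simp add: ennreal_mult[symmetric] power_divide)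
    finally show ?thesis .
  qed
  then show ?thesis using A by blast
qed

text \<open>A ball that meets a single component is covered by \<open>regular_Gam\<close>. If it
  meets two, its radius is at least a multiple of \<open>r ^ i\<close>, where \<open>i\<close> is
  the smallest index met, and the components from \<open>i\<close> on have total measure at most a
  multiple of \<open>(r ^ i) ^ n\<close>.\<close>

lemma regular_\<Gamma>U: "\<exists>A\<ge>0. \<forall>z. \<forall>R>0. emeasure surf (\<Gamma>U \<inter> cball z R) \<le> ennreal (A * R ^ n)"
proof -
  obtain A where A: "0 \<le> A" "\<And>j z R. 0 < R \<Longrightarrow> emeasure surf (\<Gamma> j \<inter> cball z R) \<le> ennreal (A * R ^ n)"
    using regular_Gam by blast
  have tot: "emeasure surf (\<Gamma> j) \<le> ennreal (A * outrad ^ n * (r ^ n) ^ j)" for j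
  proof -
    have "\<Gamma> j = \<Gamma> j \<inter> cball 0 (r ^ j * outrad)" using norm_Gam(2) by auto
    then have "emeasure surf (\<Gamma> j) \<le> ennreal (A * (r ^ j * outrad) ^ n)"
      using A(2)[of "r ^ j * outrad" j 0] outrad rj[of j] by simp
    then show ?thesis by (simp add: power_mult_distrib mult_ac flip: power_mult)
  qed
  define \<kappa> where "\<kappa> = sepc * inrad"
  have \<kappa>: "0 < \<kappa>" using sepc inrad by (simp add: \<kappa>_def)
  have rn: "0 < r ^ n" "r ^ n < 1" using r n_pos by (auto simp: power_less_one_iff)
  \<comment> \<open>The denominator sums the geometric series of the measures, and
    \<open>2 / \<kappa>\<close> converts \<open>r ^ i\<close> into the radius.\<close>
  define B where "B = A * outrad ^ n / (1 - r ^ n) * (2 / \<kappa>) ^ n"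
  have B: "0 \<le> B" using A outrad rn \<kappa> by (simp add: B_def)
  have "emeasure surf (\<Gamma>U \<inter> cball z R) \<le> ennreal ((A + B) * R ^ n)" if R: "0 < R" for z R
  proof (cases "\<exists>i l. i < l \<and> \<Gamma> i \<inter> cball z R \<noteq> {} \<and> \<Gamma> l \<inter> cball z R \<noteq> {}")
    case False
    have "\<exists>i. \<Gamma>U \<inter> cball z R \<subseteq> \<Gamma> i \<inter> cball z R"
    proof (cases "\<Gamma>U \<inter> cball z R = {}")
      case ne: False
      then obtain x i where x: "x \<in> \<Gamma> i" "x \<in> cball z R" by (auto simp: \<Gamma>U_eq)
      have "y \<in> \<Gamma> i" if y: "y \<in> \<Gamma>U \<inter> cball z R" for y
      proof -
        obtain l where l: "y \<in> \<Gamma> l" using y by (auto simp: \<Gamma>U_eq)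
        have "l = i" using False x l y by (metis IntE IntI empty_iff linorder_neqE_nat)
        then show ?thesis using l by simp
      qed
      then show ?thesis by blast
    qed auto
    then obtain i where "\<Gamma>U \<inter> cball z R \<subseteq> \<Gamma> i \<inter> cball z R" by blast
    then have "emeasure surf (\<Gamma>U \<inter> cball z R) \<le> emeasure surf (\<Gamma> i \<inter> cball z R)"
      by (rule emeasure_surf_mono) auto
    also have "\<dots> \<le> ennreal (A * R ^ n)" by (rule A(2)[OF R])
    also have "\<dots> \<le> ennreal ((A + B) * R ^ n)" using B R by (intro ennreal_leI mult_right_mono) auto
    finally show ?thesis .
  next
    case True
    define i where "i = (LEAST i. \<Gamma> i \<inter> cball z R \<noteq> {})"
    obtain i' l where il: "i' < l" "\<Gamma> i' \<inter> cball z R \<noteq> {}" "\<Gamma> l \<inter> cball z R \<noteq> {}" using True by blast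
    have i: "\<Gamma> i \<inter> cball z R \<noteq> {}" unfolding i_def by (rule LeastI[of _ l]) (rule il(3))
    have least: "\<And>k. \<Gamma> k \<inter> cball z R \<noteq> {} \<Longrightarrow> i \<le> k" unfolding i_def by (rule Least_le)
    have "i < l" using least[OF il(2)] il(1) by simp
    obtain x y where xy: "x \<in> \<Gamma> i" "x \<in> cball z R" "y \<in> \<Gamma> l" "y \<in> cball z R" using i il by blast
    have "\<kappa> * r ^ i \<le> norm (x - y)" unfolding \<kappa>_def
      using \<open>i < l\<close> xy by (intro separation_power) auto
    also have "\<dots> \<le> 2 * R" using xy dist_triangle3[of x y z] by (simp add: dist_norm)
    finally have ri: "r ^ i \<le> 2 / \<kappa> * R" using \<kappa> by (simp add: field_simps)
    have "\<Gamma>U \<inter> cball z R \<subseteq> (\<Union>k. \<Gamma> (k + i))"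
    proof
      fix w assume w: "w \<in> \<Gamma>U \<inter> cball z R"
      then obtain k where k: "w \<in> \<Gamma> k" by (auto simp: \<Gamma>U_eq)
      then have "i \<le> k" using w least by blast
      then show "w \<in> (\<Union>k. \<Gamma> (k + i))" using k by (intro UN_I[of "k - i"]) auto
    qed
    then have "emeasure surf (\<Gamma>U \<inter> cball z R) \<le> emeasure surf (\<Union>k. \<Gamma> (k + i))"
      by (rule emeasure_surf_mono) measurable
    also have "\<dots> \<le> (\<Sum>k. emeasure surf (\<Gamma> (k + i)))"
      by (rule emeasure_subadditive_countably) auto
    also have "\<dots> \<le> (\<Sum>k. ennreal (A * outrad ^ n * (r ^ n) ^ (k + i)))"
      by (intro suminf_le tot) auto
    also have "\<dots> = (\<Sum>k. ennreal (A * outrad ^ n * (r ^ n) ^ i * (r ^ n) ^ k))"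
      by (simp add: power_add mult_ac)
    also have "\<dots> = ennreal (\<Sum>k. A * outrad ^ n * (r ^ n) ^ i * (r ^ n) ^ k)"
      using A outrad rn r by (intro suminf_ennreal2 summable_mult summable_geometric) auto
    also have "(\<Sum>k. A * outrad ^ n * (r ^ n) ^ i * (r ^ n) ^ k) = A * outrad ^ n / (1 - r ^ n) * (r ^ i) ^ n"
      using rn r by (subst suminf_mult) (auto simp: suminf_geometric mult.commute simp flip: power_mult)
    also have "ennreal \<dots> \<le> ennreal (A * outrad ^ n / (1 - r ^ n) * (2 / \<kappa> * R) ^ n)"
      using A outrad rn ri rj[of i] by (intro ennreal_leI mult_left_mono power_mono) auto
    also have "\<dots> \<le> ennreal ((A + B) * R ^ n)"
    proof (rule ennreal_leI)
      have "A * outrad ^ n / (1 - r ^ n) * (2 / \<kappa> * R) ^ n = B * R ^ n"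
        unfolding B_def power_mult_distrib by (simp only: mult.assoc)
      then show "A * outrad ^ n / (1 - r ^ n) * (2 / \<kappa> * R) ^ n \<le> (A + B) * R ^ n"
        using A R by (simp add: distrib_right)
    qed
    finally show ?thesis .
  qed
  then show ?thesis using A B by (intro exI[of _ "A + B"]) auto
qed

lemma upper_regular_restrict:
  fixes S :: "'a set"
  assumes S: "S \<in> sets borel" and A: "0 \<le> A" and bd: "\<And>x. x \<in> S \<Longrightarrow> norm x \<le> outrad"
    and reg: "\<And>z R. 0 < R \<Longrightarrow> emeasure surf (S \<inter> cball z R) \<le> ennreal (A * R ^ n)"
  shows "upper_regular (restrict_space surf S) (real n) A (2 * outrad)"
proof (intro upper_regular.intro finite_measureI upper_regular_axioms.intro)
  have "S = S \<inter> cball 0 outrad" using bd by auto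
  then have "emeasure surf S \<le> ennreal (A * outrad ^ n)" using reg[OF outrad, of 0] by simp
  then have "emeasure surf S < \<infinity>" by (rule le_less_trans) simp
  then show "emeasure (restrict_space surf S) (space (restrict_space surf S)) \<noteq> \<infinity>"
    using S by (simp add: space_restrict_space emeasure_restrict_space)
  show "0 < real n" using n_pos by simp
  show "0 \<le> A" by (rule A)
  show "0 < 2 * outrad" using outrad by simp
  show "(\<lambda>x. x) \<in> borel_measurable (restrict_space surf S)"
    by (rule measurable_restrict_space1) simp
  fix x :: 'a and R :: real assume R: "0 < R"
  have "{y \<in> space (restrict_space surf S). norm (x - y) \<le> R} = S \<inter> cball x R"
    by (auto simp: space_restrict_space dist_norm)
  then show "emeasure (restrict_space surf S) {y \<in> space (restrict_space surf S). norm (x - y) \<le> R} \<le> ennreal (A * R powr real n)"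
    using reg[OF R, of x] S R by (simp add: emeasure_restrict_space powr_realpow)
next
  fix x y assume "x \<in> space (restrict_space surf S)" "y \<in> space (restrict_space surf S)"
  then have "norm x \<le> outrad" "norm y \<le> outrad" using bd by (auto simp: space_restrict_space)
  then show "norm (x - y) \<le> 2 * outrad" using norm_triangle_ineq4[of x y] by linarith
qed

text \<open>The sublocales below take a closed term as growth constant, hence the choice.\<close>

definition regc\<^sub>0 :: real where "regc\<^sub>0 = (SOME A. upper_regular M\<^sub>0 (real n) A (2 * outrad))"
definition regcU :: real where "regcU = (SOME A. upper_regular MU (real n) A (2 * outrad))"

sublocale B: upper_regular M\<^sub>0 "real n" regc\<^sub>0 "2 * outrad"
proof -
  obtain A where A: "0 \<le> A" "\<And>z R. 0 < R \<Longrightarrow> emeasure surf (\<Gamma>\<^sub>0 \<inter> cball z R) \<le> ennreal (A * R ^ n)"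
    using regular_\<Gamma>\<^sub>0 by blast
  have "upper_regular M\<^sub>0 (real n) A (2 * outrad)"
    by (rule upper_regular_restrict) (use A norm_\<Gamma>\<^sub>0 in auto)
  then show "upper_regular M\<^sub>0 (real n) regc\<^sub>0 (2 * outrad)" unfolding regc\<^sub>0_def by (rule someI)
qed

sublocale U: upper_regular MU "real n" regcU "2 * outrad"
proof -
  obtain A where A: "0 \<le> A" "\<And>z R. 0 < R \<Longrightarrow> emeasure surf (\<Gamma>U \<inter> cball z R) \<le> ennreal (A * R ^ n)"
    using regular_\<Gamma>U by blast
  have "upper_regular MU (real n) A (2 * outrad)"
    by (rule upper_regular_restrict) (use A norm_\<Gamma>U in auto)
  then show "upper_regular MU (real n) regcU (2 * outrad)" unfolding regcU_def by (rule someI)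
qed

lemma space_M\<^sub>0 [simp]: "space M\<^sub>0 = \<Gamma>\<^sub>0" and space_MU [simp]: "space MU = \<Gamma>U"
  by (auto simp: space_restrict_space)

lemma borel_measurable_M: "f \<in> borel_measurable borel \<Longrightarrow> f \<in> borel_measurable (restrict_space surf S)"
  by (rule measurable_restrict_space1) (simp cong: measurable_cong_sets)

lemma nn_integral_M: "S \<in> sets borel \<Longrightarrow> nn_integral (restrict_space surf S) f = (\<integral>\<^sup>+x\<in>S. f x \<partial>(surf :: 'a measure))"
  by (rule nn_integral_restrict_space) simp

lemma integral_M: "S \<in> sets borel \<Longrightarrow> integral\<^sup>L (restrict_space surf S) f = (LINT x:S|(surf :: 'a measure). f x)"
  for f :: "'a \<Rightarrow> 'b::{banach, second_countable_topology}"
  unfolding set_lebesgue_integral_def by (rule integral_restrict_space) simp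

lemma sobolev_energy_\<Gamma>\<^sub>0: "sobolev_energy \<sigma> q \<Gamma>\<^sub>0 \<phi> = B.energy \<sigma> q \<phi>"
  unfolding B.energy_def sobolev_energy_def by (simp add: nn_integral_M real_n)

lemma sobolev_energy_\<Gamma>U: "sobolev_energy \<sigma> q \<Gamma>U \<phi> = U.energy \<sigma> q \<phi>"
  unfolding U.energy_def sobolev_energy_def by (simp add: nn_integral_M real_n)

lemma nn_integral_MU:
  assumes f [measurable]: "f \<in> borel_measurable borel"
  shows "(\<integral>\<^sup>+x. f x \<partial>MU) = (\<Sum>i. ennreal ((r ^ i) ^ n) * (\<integral>\<^sup>+x. f (r ^ i *\<^sub>R x) \<partial>M\<^sub>0))"
proof -
  have [measurable]: "f \<in> borel_measurable surf" using f by (simp cong: measurable_cong_sets)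
  have "(\<integral>\<^sup>+x. f x \<partial>MU) = (\<integral>\<^sup>+x\<in>(\<Union>i. \<Gamma> i). f x \<partial>surf)"
    by (simp add: nn_integral_M flip: \<Gamma>U_eq)
  also have "\<dots> = (\<Sum>i. (\<integral>\<^sup>+x\<in>\<Gamma> i. f x \<partial>surf))"
    by (rule nn_integral_disjoint_family) (auto simp: disjoint_family_Gam)
  finally show ?thesis
    unfolding Gam_eq nn_integral_M[OF \<Gamma>\<^sub>0_sets] n_eq nn_integral_surf_scale[OF dim2 rj(1) \<Gamma>\<^sub>0_sets f] .
qed

end

subsection \<open>Restriction and gluing of Sobolev functions\<close>

lemma surf_singleton:
  assumes dim: "2 \<le> DIM('a::euclidean_space)"
  shows "emeasure surf {z :: 'a} = 0"
proof -
  have "hausdorff_premeasure (DIM('a) - 1) \<delta> {z} \<le> 0" if "0 < \<delta>" for \<delta>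
  proof -
    have "(\<lambda>_. {z}) \<in> covers_below \<delta> {z}" using that by (auto simp: covers_below_def)
    then have "hausdorff_premeasure (DIM('a) - 1) \<delta> {z} \<le> (\<Sum>i::nat. hcost (DIM('a) - 1) {z})"
      by (rule hausdorff_premeasure_le)
    also have "hcost (DIM('a) - 1) {z} = 0"
      unfolding hcost_def using dim by (cases "DIM('a) - 1") auto
    finally show ?thesis by simp
  qed
  then have "hausdorff_outer (DIM('a) - 1) {z} \<le> 0" by (rule hausdorff_outer_least)
  then show ?thesis using emeasure_surf[OF dim, of "{z}"] by simp
qed

text \<open>Made for kernels with an unspecified value at one point. Measurability is assumed for
  \<open>g\<close> and passes to \<open>f\<close>, because a singleton is Borel; the integrals agree
  because it is null.\<close>

lemma set_integral_surf_cong_except: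
  fixes f g :: "'a::euclidean_space \<Rightarrow> complex"
  assumes dim: "2 \<le> DIM('a)" and S: "S \<in> sets borel" and g: "g \<in> borel_measurable borel"
    and eq: "\<And>y. y \<in> S \<Longrightarrow> y \<noteq> z \<Longrightarrow> f y = g y"
  shows "(LINT y:S|surf. f y) = (LINT y:S|surf. g y)"
  unfolding set_lebesgue_integral_def
proof (rule integral_cong_AE)
  note [measurable] = S g
  have "(\<lambda>y. indicator S y *\<^sub>R g y) \<in> borel_measurable borel" by measurable
  then show gm: "(\<lambda>y. indicator S y *\<^sub>R g y) \<in> borel_measurable surf" by (simp cong: measurable_cong_sets)
  have "(\<lambda>y. if y = z then indicator S z *\<^sub>R f z else indicator S y *\<^sub>R g y) \<in> borel_measurable borel"
    by measurable
  moreover have "(\<lambda>y. indicator S y *\<^sub>R f y) = (\<lambda>y. if y = z then indicator S z *\<^sub>R f z else indicator S y *\<^sub>R g y)"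
    using eq by (auto simp: fun_eq_iff indicator_def)
  ultimately show "(\<lambda>y. indicator S y *\<^sub>R f y) \<in> borel_measurable surf" by (simp cong: measurable_cong_sets)
  have "AE y in surf. y \<noteq> z"
    by (rule AE_I[of _ _ "{z}"]) (auto simp: surf_singleton[OF dim])
  then show "AE y in surf. indicator S y *\<^sub>R f y = indicator S y *\<^sub>R g y"
    using eq by (auto simp: indicator_def)
qed

context self_similar_boundary
begin

lemma energy_cong: "(\<And>x. x \<in> \<Gamma>\<^sub>0 \<Longrightarrow> \<phi> x = \<psi> x) \<Longrightarrow> B.energy \<sigma> q \<phi> = B.energy \<sigma> q \<psi>"
  unfolding B.energy_def by (intro arg_cong2[where f = "(+)"] if_cong nn_integral_cong refl) auto

lemma energy_congU: "(\<And>x. x \<in> \<Gamma>U \<Longrightarrow> \<phi> x = \<psi> x) \<Longrightarrow> U.energy \<sigma> q \<phi> = U.energy \<sigma> q \<psi>"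
  unfolding U.energy_def by (intro arg_cong2[where f = "(+)"] if_cong nn_integral_cong refl) auto

lemma scale_measurable: "w \<in> borel_measurable borel \<Longrightarrow> (\<lambda>x::'a. w (c *\<^sub>R x)) \<in> borel_measurable borel"
  by (rule measurable_compose[of "\<lambda>x. c *\<^sub>R x" borel borel]) measurable

lemma nn_integral_M\<^sub>0_le_MU:
  assumes "f \<in> borel_measurable borel"
  shows "(\<integral>\<^sup>+x. f (r ^ i *\<^sub>R x) \<partial>M\<^sub>0) \<le> ennreal ((1 / r ^ i) ^ n) * (\<integral>\<^sup>+x. f x \<partial>MU)"
proof -
  have "ennreal ((r ^ i) ^ n) * (\<integral>\<^sup>+x. f (r ^ i *\<^sub>R x) \<partial>M\<^sub>0) \<le> (\<integral>\<^sup>+x. f x \<partial>MU)"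
    unfolding nn_integral_MU[OF assms] by (rule ennreal_le_suminf)
  then have "ennreal ((1 / r ^ i) ^ n) * (ennreal ((r ^ i) ^ n) * (\<integral>\<^sup>+x. f (r ^ i *\<^sub>R x) \<partial>M\<^sub>0)) \<le> ennreal ((1 / r ^ i) ^ n) * (\<integral>\<^sup>+x. f x \<partial>MU)"
    by (rule mult_left_mono) simp
  then show ?thesis
    using rj[of i] by (simp add: mult.assoc[symmetric] ennreal_mult[symmetric] power_mult_distrib[symmetric])
qed

text \<open>The energy of one component is part of the energy of the union; the dilation only costs
  constants depending on \<open>i\<close>.\<close>

lemma restrict_energy:
  fixes \<sigma> q :: real
  assumes q: "1 < q" and \<sigma>: "0 \<le> \<sigma>"
  shows "\<exists>C\<ge>0. \<forall>w\<in>borel_measurable borel. B.energy \<sigma> q (\<lambda>x. w (r ^ i *\<^sub>R x)) \<le> ennreal C * U.energy \<sigma> q w"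
proof -
  \<comment> \<open>\<open>a\<close> is the inverse Jacobian, used once per integration, and
    \<open>c\<close> comes from the dilation of the distance in the weight.\<close>
  define a where "a = (1 / r ^ i) ^ n"
  define c where "c = (r ^ i) powr (n + \<sigma> * q)"
  have a: "0 \<le> a" using r by (simp add: a_def)
  have c: "0 \<le> c" by (simp add: c_def)
  have "B.energy \<sigma> q (\<lambda>x. w (r ^ i *\<^sub>R x)) \<le> ennreal (a + c * a * a) * U.energy \<sigma> q w"
    if w [measurable]: "w \<in> borel_measurable borel" for w :: "'a \<Rightarrow> complex"
  proof -
    let ?L = "\<integral>\<^sup>+x. ennreal (norm (w x) powr q) \<partial>MU"
    let ?g = "\<lambda>x y. ennreal (norm (w x - w y) powr q / norm (x - y) powr (n + \<sigma> * q))"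
    let ?S = "\<integral>\<^sup>+x. (\<integral>\<^sup>+y. ?g x y \<partial>MU) \<partial>MU"
    have 1: "(\<integral>\<^sup>+x. ennreal (norm (w (r ^ i *\<^sub>R x)) powr q) \<partial>M\<^sub>0) \<le> ennreal a * ?L"
      unfolding a_def by (rule nn_integral_M\<^sub>0_le_MU[where f = "\<lambda>x. ennreal (norm (w x) powr q)"]) measurable
    have "(\<integral>\<^sup>+x. (\<integral>\<^sup>+y. ennreal (norm (w (r ^ i *\<^sub>R x) - w (r ^ i *\<^sub>R y)) powr q / norm (x - y) powr (n + \<sigma> * q)) \<partial>M\<^sub>0) \<partial>M\<^sub>0)
      = (\<integral>\<^sup>+x. (\<integral>\<^sup>+y. ennreal c * ?g (r ^ i *\<^sub>R x) (r ^ i *\<^sub>R y) \<partial>M\<^sub>0) \<partial>M\<^sub>0)"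
    proof (intro nn_integral_cong)
      fix x y :: 'a
      have "norm (r ^ i *\<^sub>R x - r ^ i *\<^sub>R y) powr (n + \<sigma> * q) = c * norm (x - y) powr (n + \<sigma> * q)"
        using rj[of i] by (simp add: c_def powr_mult flip: scaleR_diff_right)
      moreover have "0 < c" using rj[of i] by (simp add: c_def)
      ultimately show "ennreal (norm (w (r ^ i *\<^sub>R x) - w (r ^ i *\<^sub>R y)) powr q / norm (x - y) powr (n + \<sigma> * q)) = ennreal c * ?g (r ^ i *\<^sub>R x) (r ^ i *\<^sub>R y)"
        by (simp add: ennreal_mult[symmetric])
    qed
    also have "\<dots> = ennreal c * (\<integral>\<^sup>+x. (\<integral>\<^sup>+y. ?g (r ^ i *\<^sub>R x) (r ^ i *\<^sub>R y) \<partial>M\<^sub>0) \<partial>M\<^sub>0)"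
    proof -
      have m [measurable]: "(\<lambda>x. w (r ^ i *\<^sub>R x)) \<in> borel_measurable M\<^sub>0"
        by (intro borel_measurable_M scale_measurable w)
      show ?thesis
        by (subst nn_integral_cmult[symmetric], measurable)
           (intro nn_integral_cong nn_integral_cmult, measurable)
    qed
    also have "\<dots> \<le> ennreal c * (\<integral>\<^sup>+x. ennreal a * (\<integral>\<^sup>+y. ?g (r ^ i *\<^sub>R x) y \<partial>MU) \<partial>M\<^sub>0)"
    proof (rule mult_left_mono[OF nn_integral_mono])
      fix x
      show "(\<integral>\<^sup>+y. ?g (r ^ i *\<^sub>R x) (r ^ i *\<^sub>R y) \<partial>M\<^sub>0) \<le> ennreal a * (\<integral>\<^sup>+y. ?g (r ^ i *\<^sub>R x) y \<partial>MU)"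
        unfolding a_def by (rule nn_integral_M\<^sub>0_le_MU[where f = "\<lambda>y. ?g (r ^ i *\<^sub>R x) y"]) measurable
    qed simp
    also have "(\<integral>\<^sup>+x. ennreal a * (\<integral>\<^sup>+y. ?g (r ^ i *\<^sub>R x) y \<partial>MU) \<partial>M\<^sub>0) \<le> ennreal a * (ennreal a * ?S)"
    proof -
      have [measurable]: "w \<in> borel_measurable MU" by (rule borel_measurable_M[OF w])
      have m [measurable]: "(\<lambda>x. \<integral>\<^sup>+y. ?g x y \<partial>MU) \<in> borel_measurable borel"
        by measurable
      have "(\<integral>\<^sup>+x. ennreal a * (\<integral>\<^sup>+y. ?g (r ^ i *\<^sub>R x) y \<partial>MU) \<partial>M\<^sub>0) = ennreal a * (\<integral>\<^sup>+x. (\<integral>\<^sup>+y. ?g (r ^ i *\<^sub>R x) y \<partial>MU) \<partial>M\<^sub>0)"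
        by (rule nn_integral_cmult, rule borel_measurable_M, rule scale_measurable[OF m])
      then show ?thesis
        using nn_integral_M\<^sub>0_le_MU[OF m, of i] by (simp add: a_def mult_left_mono)
    qed
    finally have 2: "(\<integral>\<^sup>+x. (\<integral>\<^sup>+y. ennreal (norm (w (r ^ i *\<^sub>R x) - w (r ^ i *\<^sub>R y)) powr q / norm (x - y) powr (n + \<sigma> * q)) \<partial>M\<^sub>0) \<partial>M\<^sub>0)
        \<le> ennreal (c * a * a) * ?S"
      using a c by (simp add: ennreal_mult mult.assoc mult_left_mono)
    show ?thesis
    proof (cases "\<sigma> = 0")
      case True
      have "ennreal a * ?L \<le> ennreal (a + c * a * a) * ?L" using a c by (intro mult_right_mono ennreal_leI) auto
      moreover have "B.energy \<sigma> q (\<lambda>x. w (r ^ i *\<^sub>R x)) \<le> ennreal a * ?L" using 1 True by (simp add: B.energy_def)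
      moreover have "U.energy \<sigma> q w = ?L" using True by (simp add: U.energy_def)
      ultimately show ?thesis by (simp only:)
    next
      case False
      have "B.energy \<sigma> q (\<lambda>x. w (r ^ i *\<^sub>R x)) \<le> ennreal a * ?L + ennreal (c * a * a) * ?S"
        using add_mono[OF 1 2] False by (simp add: B.energy_def)
      also have "\<dots> \<le> ennreal (a + c * a * a) * ?L + ennreal (a + c * a * a) * ?S"
        using a c by (intro add_mono mult_right_mono ennreal_leI) auto
      also have "\<dots> = ennreal (a + c * a * a) * U.energy \<sigma> q w"
        using False by (simp add: U.energy_def distrib_left)
      finally show ?thesis .
    qed
  qed
  moreover have "0 \<le> a + c * a * a" using a c by simp
  ultimately show ?thesis by blast
qed

text \<open>Since \<open>|x - y|\<close> is comparable with \<open>|x| + |y|\<close> for points on different components, the interaction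
  of different components only costs the Hardy type term \<open>\<integral> |w|\<^sup>q |x|\<^sup>-\<^sup>\<sigma>\<^sup>q\<close>.\<close>

lemma glue_energy:
  fixes \<sigma> q :: real
  assumes q: "1 < q" and \<sigma>: "0 \<le> \<sigma>"
  shows "\<exists>C\<ge>0. \<forall>w\<in>borel_measurable borel. U.energy \<sigma> q w \<le>
    ennreal C * (\<Sum>i. ennreal ((r ^ i) powr (n - \<sigma> * q)) * B.energy \<sigma> q (\<lambda>x. w (r ^ i *\<^sub>R x)))"
proof (cases "\<sigma> = 0")
  case True
  have "U.energy \<sigma> q w \<le> ennreal 1 * (\<Sum>i. ennreal ((r ^ i) powr (n - \<sigma> * q)) * B.energy \<sigma> q (\<lambda>x. w (r ^ i *\<^sub>R x)))"
    if [measurable]: "w \<in> borel_measurable borel" for w :: "'a \<Rightarrow> complex"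
  proof -
    have "U.energy \<sigma> q w = (\<integral>\<^sup>+x. ennreal (norm (w x) powr q) \<partial>MU)" using True by (simp add: U.energy_def)
    also have "\<dots> = (\<Sum>i. ennreal ((r ^ i) ^ n) * (\<integral>\<^sup>+x. ennreal (norm (w (r ^ i *\<^sub>R x)) powr q) \<partial>M\<^sub>0))"
      by (rule nn_integral_MU) measurable
    also have "\<dots> = (\<Sum>i. ennreal ((r ^ i) powr (n - \<sigma> * q)) * B.energy \<sigma> q (\<lambda>x. w (r ^ i *\<^sub>R x)))"
      using True rj by (simp add: B.energy_def powr_realpow)
    finally show ?thesis by simp
  qed
  then show ?thesis by (intro exI[of _ 1]) simp
next
  case False
  then have \<sigma>q: "0 < \<sigma> * q" using \<sigma> q by simp
  obtain C1 where C1: "0 \<le> C1" "\<And>x \<rho>. 0 < \<rho> \<Longrightarrow>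
     (\<integral>\<^sup>+y. ennreal (norm (x - y) powr (- (n + \<sigma> * q))) * indicator {y. \<rho> \<le> norm (x - y)} y \<partial>MU) \<le> ennreal (C1 * \<rho> powr (- (\<sigma> * q)))"
    using U.riesz_far[OF \<sigma>q] by blast
  define C2 where "C2 = 2 * (2 powr q * (C1 * (sepc * inrad) powr (- (\<sigma> * q))))"
  have C2: "0 \<le> C2" using C1 by (simp add: C2_def)
  have "U.energy \<sigma> q w \<le> ennreal (1 + C2) * (\<Sum>i. ennreal ((r ^ i) powr (n - \<sigma> * q)) * B.energy \<sigma> q (\<lambda>x. w (r ^ i *\<^sub>R x)))"
    if w [measurable]: "w \<in> borel_measurable borel" for w :: "'a \<Rightarrow> complex"
  proof -
    have wU [measurable]: "w \<in> borel_measurable MU" by (rule borel_measurable_M[OF w])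
    have idU [measurable]: "(\<lambda>x. x) \<in> borel_measurable MU" by (rule borel_measurable_M) simp
    define g where "g x y = ennreal (norm (w x - w y) powr q / norm (x - y) powr (n + \<sigma> * q))" for x y
    define L where "L i = (\<integral>\<^sup>+x. ennreal (norm (w (r ^ i *\<^sub>R x)) powr q) \<partial>M\<^sub>0)" for i
    define S where "S i = (\<integral>\<^sup>+x. (\<integral>\<^sup>+y. ennreal (norm (w (r ^ i *\<^sub>R x) - w (r ^ i *\<^sub>R y)) powr q / norm (x - y) powr (n + \<sigma> * q)) \<partial>M\<^sub>0) \<partial>M\<^sub>0)" for i
    \<comment> \<open>Two Jacobians against an energy weight of order
      \<open>n + \<sigma> * q\<close> leave the exponent \<open>n - \<sigma> * q\<close>.\<close>
    define \<kappa> where "\<kappa> i = (r ^ i) powr (n - \<sigma> * q)" for i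
    have \<kappa>0: "0 \<le> \<kappa> i" for i by (simp add: \<kappa>_def)
    have \<kappa>L: "(r ^ i) ^ n \<le> \<kappa> i" for i
    proof -
      have "(r ^ i) powr n \<le> (r ^ i) powr (n - \<sigma> * q)"
        using rj[of i] \<sigma>q by (intro powr_mono') auto
      then show ?thesis using rj[of i] by (simp add: \<kappa>_def powr_realpow)
    qed
    have BE: "B.energy \<sigma> q (\<lambda>x. w (r ^ i *\<^sub>R x)) = L i + S i" for i
      using False by (simp add: B.energy_def L_def S_def)
    have gm1 [measurable]: "(\<lambda>(x, y). g x y) \<in> borel_measurable (borel \<Otimes>\<^sub>M borel)"
      unfolding g_def by measurable
    have gm2 [measurable]: "(\<lambda>(x, y). g x y) \<in> borel_measurable (borel \<Otimes>\<^sub>M MU)"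
      unfolding g_def by measurable
    have gm3 [measurable]: "(\<lambda>(x, y). g x y) \<in> borel_measurable (MU \<Otimes>\<^sub>M MU)"
      unfolding g_def by measurable
    \<comment> \<open>\<open>A\<close> collects the pairs on a common component. The function
      \<open>X\<close> below bounds all other pairs by the size of \<open>w\<close> at one of the
      points and a kernel cut off near that point.\<close>
    define A where "A x y = (\<Sum>i. indicator (\<Gamma> i) x * indicator (\<Gamma> i) y * g x y)" for x y
    define X where "X x y = ennreal (2 powr q * norm (w x) powr q) * (ennreal (norm (x - y) powr (- (n + \<sigma> * q))) * indicator {y. sepc * norm x \<le> norm (x - y)} y)" for x y
    have Xm [measurable]: "(\<lambda>(x, y). X x y) \<in> borel_measurable (MU \<Otimes>\<^sub>M MU)"
      unfolding X_def indicator_def by measurable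
    have Am2 [measurable]: "(\<lambda>(x, y). A x y) \<in> borel_measurable (borel \<Otimes>\<^sub>M MU)"
    proof -
      have [measurable]: "(\<lambda>y. indicator (\<Gamma> i) y :: ennreal) \<in> borel_measurable MU" for i by (rule borel_measurable_M) measurable
      show ?thesis unfolding A_def by measurable
    qed
    have Am3 [measurable]: "(\<lambda>(x, y). A x y) \<in> borel_measurable (MU \<Otimes>\<^sub>M MU)"
    proof -
      have [measurable]: "(\<lambda>y. indicator (\<Gamma> i) y :: ennreal) \<in> borel_measurable MU" for i by (rule borel_measurable_M) measurable
      show ?thesis unfolding A_def by measurable
    qed
    have Am1 [measurable]: "A x \<in> borel_measurable borel" for x
      unfolding A_def[abs_def] g_def by measurable
    have pt: "g x y \<le> A x y + (X x y + X y x)" if x: "x \<in> \<Gamma>U" and y: "y \<in> \<Gamma>U" for x y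
    proof -
      obtain i j where ij: "x \<in> \<Gamma> i" "y \<in> \<Gamma> j" using x y by (auto simp: \<Gamma>U_eq)
      show ?thesis
      proof (cases "i = j")
        case True
        have "g x y = indicator (\<Gamma> i) x * indicator (\<Gamma> i) y * g x y" using ij True by simp
        also have "\<dots> \<le> A x y" unfolding A_def by (rule ennreal_le_suminf)
        finally show ?thesis by (simp add: add_increasing2)
      next
        case False
        have s: "sepc * norm x \<le> norm (x - y)" "sepc * norm y \<le> norm (y - x)"
          using separation[OF False ij] separation[OF False[symmetric] ij(2,1)] by auto
        have "norm (w x - w y) powr q / norm (x - y) powr (n + \<sigma> * q) \<le>
          2 powr q * norm (w x) powr q * norm (x - y) powr (- (n + \<sigma> * q)) + 2 powr q * norm (w y) powr q * norm (y - x) powr (- (n + \<sigma> * q))"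
          using mult_right_mono[OF norm_diff_powr_le[of q "w x" "w y"], of "norm (x - y) powr (- (n + \<sigma> * q))"] q
          by (simp add: powr_minus divide_inverse norm_minus_commute algebra_simps del: minus_add_distrib)
        then have "g x y \<le> X x y + X y x"
          using s unfolding g_def X_def by (simp flip: ennreal_mult ennreal_plus add: ennreal_leI)
        then show ?thesis by (simp add: add_increasing)
      qed
    qed
    have split: "(\<integral>\<^sup>+x. (\<integral>\<^sup>+y. g x y \<partial>MU) \<partial>MU) \<le> (\<integral>\<^sup>+x. (\<integral>\<^sup>+y. A x y \<partial>MU) \<partial>MU) + 2 * (\<integral>\<^sup>+x. (\<integral>\<^sup>+y. X x y \<partial>MU) \<partial>MU)"
    proof -
      have "(\<integral>\<^sup>+x. (\<integral>\<^sup>+y. g x y \<partial>MU) \<partial>MU) \<le> (\<integral>\<^sup>+x. (\<integral>\<^sup>+y. A x y + (X x y + X y x) \<partial>MU) \<partial>MU)"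
        using pt by (intro nn_integral_mono) simp
      also have "\<dots> = (\<integral>\<^sup>+x. (\<integral>\<^sup>+y. A x y \<partial>MU) \<partial>MU) + ((\<integral>\<^sup>+x. (\<integral>\<^sup>+y. X x y \<partial>MU) \<partial>MU) + (\<integral>\<^sup>+x. (\<integral>\<^sup>+y. X y x \<partial>MU) \<partial>MU))"
        by (simp add: nn_integral_add cong: nn_integral_cong)
      also have "(\<integral>\<^sup>+x. (\<integral>\<^sup>+y. X y x \<partial>MU) \<partial>MU) = (\<integral>\<^sup>+x. (\<integral>\<^sup>+y. X x y \<partial>MU) \<partial>MU)"
        by (rule U.Fubini'[OF Xm])
      finally show ?thesis by (simp add: mult_2)
    qed
    have AS: "(\<integral>\<^sup>+x. (\<integral>\<^sup>+y. A x y \<partial>MU) \<partial>MU) = (\<Sum>i. ennreal (\<kappa> i) * S i)"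
    proof -
      have inner: "(\<integral>\<^sup>+y. A (r ^ k *\<^sub>R x) y \<partial>MU) = ennreal ((r ^ k) ^ n) * (\<integral>\<^sup>+y. g (r ^ k *\<^sub>R x) (r ^ k *\<^sub>R y) \<partial>M\<^sub>0)"
        if x: "x \<in> \<Gamma>\<^sub>0" for x k
      proof -
        have Ax: "A (r ^ k *\<^sub>R x) (r ^ l *\<^sub>R y) = (if l = k then g (r ^ k *\<^sub>R x) (r ^ l *\<^sub>R y) else 0)"
          if y: "y \<in> \<Gamma>\<^sub>0" for y l
        proof -
          have xk: "r ^ k *\<^sub>R x \<in> \<Gamma> i \<longleftrightarrow> i = k" "r ^ l *\<^sub>R y \<in> \<Gamma> i \<longleftrightarrow> i = l" for i
            using x y scale_Gam_iff Gam_disjoint by blast+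
          have "A (r ^ k *\<^sub>R x) (r ^ l *\<^sub>R y) = (\<Sum>i\<in>{k}. indicator (\<Gamma> i) (r ^ k *\<^sub>R x) * indicator (\<Gamma> i) (r ^ l *\<^sub>R y) * g (r ^ k *\<^sub>R x) (r ^ l *\<^sub>R y))"
            unfolding A_def by (rule suminf_finite) (auto simp: xk)
          then show ?thesis by (simp add: xk indicator_def)
        qed
        have "(\<integral>\<^sup>+y. A (r ^ k *\<^sub>R x) y \<partial>MU) = (\<Sum>l. ennreal ((r ^ l) ^ n) * (\<integral>\<^sup>+y. A (r ^ k *\<^sub>R x) (r ^ l *\<^sub>R y) \<partial>M\<^sub>0))"
          by (rule nn_integral_MU) simp
        also have "\<dots> = (\<Sum>l. ennreal ((r ^ l) ^ n) * (\<integral>\<^sup>+y. (if l = k then g (r ^ k *\<^sub>R x) (r ^ l *\<^sub>R y) else 0) \<partial>M\<^sub>0))"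
          by (intro suminf_cong arg_cong2[where f = "(*)"] nn_integral_cong refl Ax) simp
        also have "\<dots> = (\<Sum>l\<in>{k}. ennreal ((r ^ l) ^ n) * (\<integral>\<^sup>+y. (if l = k then g (r ^ k *\<^sub>R x) (r ^ l *\<^sub>R y) else 0) \<partial>M\<^sub>0))"
          by (rule suminf_finite) auto
        finally show ?thesis by simp
      qed
      have "(\<integral>\<^sup>+x. (\<integral>\<^sup>+y. A x y \<partial>MU) \<partial>MU) = (\<Sum>k. ennreal ((r ^ k) ^ n) * (\<integral>\<^sup>+x. (\<integral>\<^sup>+y. A (r ^ k *\<^sub>R x) y \<partial>MU) \<partial>M\<^sub>0))"
        by (rule nn_integral_MU) measurable
      also have "\<dots> = (\<Sum>k. ennreal (\<kappa> k) * S k)"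
      proof (rule suminf_cong)
        fix k
        have [measurable]: "(\<lambda>x. w (r ^ k *\<^sub>R x)) \<in> borel_measurable M\<^sub>0"
          by (intro borel_measurable_M scale_measurable w)
        have g_eq: "g (r ^ k *\<^sub>R x) (r ^ k *\<^sub>R y) = ennreal (1 / (r ^ k) powr (n + \<sigma> * q)) * ennreal (norm (w (r ^ k *\<^sub>R x) - w (r ^ k *\<^sub>R y)) powr q / norm (x - y) powr (n + \<sigma> * q))" for x y
        proof -
          have "norm (r ^ k *\<^sub>R x - r ^ k *\<^sub>R y) powr (n + \<sigma> * q) = (r ^ k) powr (n + \<sigma> * q) * norm (x - y) powr (n + \<sigma> * q)"
            using rj[of k] by (simp add: powr_mult flip: scaleR_diff_right)
          then show ?thesis by (simp add: g_def ennreal_mult[symmetric])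
        qed
        have "(\<integral>\<^sup>+x. (\<integral>\<^sup>+y. A (r ^ k *\<^sub>R x) y \<partial>MU) \<partial>M\<^sub>0) = (\<integral>\<^sup>+x. ennreal ((r ^ k) ^ n) * (\<integral>\<^sup>+y. g (r ^ k *\<^sub>R x) (r ^ k *\<^sub>R y) \<partial>M\<^sub>0) \<partial>M\<^sub>0)"
          by (intro nn_integral_cong inner) simp
        also have "\<dots> = (\<integral>\<^sup>+x. ennreal ((r ^ k) ^ n / (r ^ k) powr (n + \<sigma> * q)) * (\<integral>\<^sup>+y. ennreal (norm (w (r ^ k *\<^sub>R x) - w (r ^ k *\<^sub>R y)) powr q / norm (x - y) powr (n + \<sigma> * q)) \<partial>M\<^sub>0) \<partial>M\<^sub>0)"
          unfolding g_eq using rj[of k] by (intro nn_integral_cong) (subst nn_integral_cmult, measurable, simp add: mult.assoc[symmetric] ennreal_mult[symmetric])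
        also have "\<dots> = ennreal ((r ^ k) ^ n / (r ^ k) powr (n + \<sigma> * q)) * S k"
          unfolding S_def by (rule nn_integral_cmult) measurable
        finally have AkS: "(\<integral>\<^sup>+x. (\<integral>\<^sup>+y. A (r ^ k *\<^sub>R x) y \<partial>MU) \<partial>M\<^sub>0) = ennreal ((r ^ k) ^ n / (r ^ k) powr (n + \<sigma> * q)) * S k" .
        have "ennreal ((r ^ k) ^ n) * (\<integral>\<^sup>+x. (\<integral>\<^sup>+y. A (r ^ k *\<^sub>R x) y \<partial>MU) \<partial>M\<^sub>0) = ennreal ((r ^ k) ^ n * ((r ^ k) ^ n / (r ^ k) powr (n + \<sigma> * q))) * S k"
        proof -
          have "0 \<le> (r ^ k) ^ n" "0 \<le> (r ^ k) ^ n / (r ^ k) powr (n + \<sigma> * q)" using rj[of k] by auto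
          then show ?thesis by (simp only: AkS ennreal_mult mult.assoc)
        qed
        also have "(r ^ k) ^ n * ((r ^ k) ^ n / (r ^ k) powr (n + \<sigma> * q)) = \<kappa> k"
          using rj[of k] by (simp add: \<kappa>_def powr_add powr_diff powr_realpow)
        finally show "ennreal ((r ^ k) ^ n) * (\<integral>\<^sup>+x. (\<integral>\<^sup>+y. A (r ^ k *\<^sub>R x) y \<partial>MU) \<partial>M\<^sub>0) = ennreal (\<kappa> k) * S k" .
      qed
      finally show ?thesis .
    qed
    \<comment> \<open>With the cutoff \<open>sepc * norm x\<close>, \<open>riesz_far\<close>
      produces the Hardy weight, which on component \<open>i\<close> is comparable to
      \<open>(r ^ i) powr (- (\<sigma> * q))\<close>. Together with one Jacobian this is again
      \<open>\<kappa> i\<close>.\<close>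
    have XL: "2 * (\<integral>\<^sup>+x. (\<integral>\<^sup>+y. X x y \<partial>MU) \<partial>MU) \<le> ennreal C2 * (\<Sum>i. ennreal (\<kappa> i) * L i)"
    proof -
      have "(\<integral>\<^sup>+x. (\<integral>\<^sup>+y. X x y \<partial>MU) \<partial>MU) \<le> (\<integral>\<^sup>+x. ennreal (2 powr q * norm (w x) powr q) * ennreal (C1 * (sepc * norm x) powr (- (\<sigma> * q))) \<partial>MU)"
      proof (rule nn_integral_mono)
        fix x assume "x \<in> space MU"
        then obtain i where "x \<in> \<Gamma> i" by (auto simp: \<Gamma>U_eq)
        then have "0 < norm x" using norm_Gam(1)[of x i] inrad rj[of i] mult_pos_pos[of "r ^ i" inrad] by linarith
        then have "0 < sepc * norm x" using sepc by simp
        have "(\<integral>\<^sup>+y. X x y \<partial>MU) = ennreal (2 powr q * norm (w x) powr q) * (\<integral>\<^sup>+y. ennreal (norm (x - y) powr (- (n + \<sigma> * q))) * indicator {y. sepc * norm x \<le> norm (x - y)} y \<partial>MU)"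
          unfolding X_def indicator_def by (rule nn_integral_cmult) measurable
        also have "\<dots> \<le> ennreal (2 powr q * norm (w x) powr q) * ennreal (C1 * (sepc * norm x) powr (- (\<sigma> * q)))"
          by (intro mult_left_mono C1(2)) (use \<open>0 < sepc * norm x\<close> in auto)
        finally show "(\<integral>\<^sup>+y. X x y \<partial>MU) \<le> ennreal (2 powr q * norm (w x) powr q) * ennreal (C1 * (sepc * norm x) powr (- (\<sigma> * q)))" .
      qed
      also have "\<dots> = (\<Sum>i. ennreal ((r ^ i) ^ n) * (\<integral>\<^sup>+x. ennreal (2 powr q * norm (w (r ^ i *\<^sub>R x)) powr q) * ennreal (C1 * (sepc * norm (r ^ i *\<^sub>R x)) powr (- (\<sigma> * q))) \<partial>M\<^sub>0))"
        by (rule nn_integral_MU) measurable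
      also have "\<dots> \<le> (\<Sum>i. ennreal (2 powr q * (C1 * (sepc * inrad) powr (- (\<sigma> * q)))) * (ennreal (\<kappa> i) * L i))"
      proof (rule suminf_le)
        fix i
        have [measurable]: "(\<lambda>x. w (r ^ i *\<^sub>R x)) \<in> borel_measurable M\<^sub>0"
          by (intro borel_measurable_M scale_measurable w)
        let ?c = "2 powr q * (C1 * (sepc * inrad * r ^ i) powr (- (\<sigma> * q)))"
        have "(\<integral>\<^sup>+x. ennreal (2 powr q * norm (w (r ^ i *\<^sub>R x)) powr q) * ennreal (C1 * (sepc * norm (r ^ i *\<^sub>R x)) powr (- (\<sigma> * q))) \<partial>M\<^sub>0)
           \<le> (\<integral>\<^sup>+x. ennreal ?c * ennreal (norm (w (r ^ i *\<^sub>R x)) powr q) \<partial>M\<^sub>0)"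
        proof (rule nn_integral_mono)
          fix x assume "x \<in> space M\<^sub>0"
          then have x: "x \<in> \<Gamma>\<^sub>0" by simp
          have "sepc * inrad * r ^ i \<le> sepc * norm (r ^ i *\<^sub>R x)"
            using norm_\<Gamma>\<^sub>0(1)[OF x] sepc rj[of i] by (simp add: mult_ac mult_left_mono)
          then have "(sepc * norm (r ^ i *\<^sub>R x)) powr (- (\<sigma> * q)) \<le> (sepc * inrad * r ^ i) powr (- (\<sigma> * q))"
            using sepc inrad rj[of i] \<sigma>q by (intro powr_mono2') auto
          then have "(2 powr q * norm (w (r ^ i *\<^sub>R x)) powr q) * (C1 * (sepc * norm (r ^ i *\<^sub>R x)) powr (- (\<sigma> * q)))
              \<le> (2 powr q * norm (w (r ^ i *\<^sub>R x)) powr q) * (C1 * (sepc * inrad * r ^ i) powr (- (\<sigma> * q)))"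
            using C1(1) by (intro mult_left_mono) auto
          also have "\<dots> = ?c * norm (w (r ^ i *\<^sub>R x)) powr q" by (simp only: mult_ac)
          finally show "ennreal (2 powr q * norm (w (r ^ i *\<^sub>R x)) powr q) * ennreal (C1 * (sepc * norm (r ^ i *\<^sub>R x)) powr (- (\<sigma> * q)))
              \<le> ennreal ?c * ennreal (norm (w (r ^ i *\<^sub>R x)) powr q)"
            using C1(1) by (simp add: ennreal_mult[symmetric] ennreal_leI del: mult_le_cancel_left norm_scaleR)
        qed
        also have "\<dots> = ennreal ?c * L i" unfolding L_def by (rule nn_integral_cmult) measurable
        finally have "ennreal ((r ^ i) ^ n) * (\<integral>\<^sup>+x. ennreal (2 powr q * norm (w (r ^ i *\<^sub>R x)) powr q) * ennreal (C1 * (sepc * norm (r ^ i *\<^sub>R x)) powr (- (\<sigma> * q))) \<partial>M\<^sub>0)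
          \<le> ennreal ((r ^ i) ^ n) * (ennreal ?c * L i)" by (rule mult_left_mono) simp
        also have "\<dots> = ennreal ((r ^ i) ^ n * ?c) * L i"
          using C1(1) rj[of i] by (simp add: ennreal_mult mult.assoc)
        also have "(r ^ i) ^ n * ?c = 2 powr q * (C1 * (sepc * inrad) powr (- (\<sigma> * q))) * \<kappa> i"
        proof -
          have e1: "(sepc * inrad * r ^ i) powr (- (\<sigma> * q)) = (sepc * inrad) powr (- (\<sigma> * q)) * (r ^ i) powr (- (\<sigma> * q))"
            by (rule powr_mult)
          have e2: "(r ^ i) ^ n * (r ^ i) powr (- (\<sigma> * q)) = \<kappa> i"
            using rj[of i] by (simp add: \<kappa>_def powr_diff powr_minus powr_realpow divide_inverse)
          show ?thesis unfolding e1 e2[symmetric] by (simp only: mult_ac)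
        qed
        also have "ennreal (2 powr q * (C1 * (sepc * inrad) powr (- (\<sigma> * q))) * \<kappa> i) * L i = ennreal (2 powr q * (C1 * (sepc * inrad) powr (- (\<sigma> * q)))) * (ennreal (\<kappa> i) * L i)"
          using C1(1) \<kappa>0 by (simp add: ennreal_mult mult.assoc)
        finally show "ennreal ((r ^ i) ^ n) * (\<integral>\<^sup>+x. ennreal (2 powr q * norm (w (r ^ i *\<^sub>R x)) powr q) * ennreal (C1 * (sepc * norm (r ^ i *\<^sub>R x)) powr (- (\<sigma> * q))) \<partial>M\<^sub>0)
          \<le> ennreal (2 powr q * (C1 * (sepc * inrad) powr (- (\<sigma> * q)))) * (ennreal (\<kappa> i) * L i)" .
      qed auto
      also have "\<dots> = ennreal (2 powr q * (C1 * (sepc * inrad) powr (- (\<sigma> * q)))) * (\<Sum>i. ennreal (\<kappa> i) * L i)"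
        by (rule ennreal_suminf_cmult)
      finally have "2 * (\<integral>\<^sup>+x. (\<integral>\<^sup>+y. X x y \<partial>MU) \<partial>MU) \<le> 2 * (ennreal (2 powr q * (C1 * (sepc * inrad) powr (- (\<sigma> * q)))) * (\<Sum>i. ennreal (\<kappa> i) * L i))"
        by (rule mult_left_mono) simp
      also have "\<dots> = ennreal C2 * (\<Sum>i. ennreal (\<kappa> i) * L i)"
        using C1(1) by (simp add: C2_def ennreal_mult mult.assoc)
      finally show ?thesis .
    qed
    have LU: "(\<integral>\<^sup>+x. ennreal (norm (w x) powr q) \<partial>MU) \<le> (\<Sum>i. ennreal (\<kappa> i) * L i)"
    proof -
      have "(\<integral>\<^sup>+x. ennreal (norm (w x) powr q) \<partial>MU) = (\<Sum>i. ennreal ((r ^ i) ^ n) * L i)"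
        unfolding L_def by (rule nn_integral_MU) measurable
      also have "\<dots> \<le> (\<Sum>i. ennreal (\<kappa> i) * L i)"
        using \<kappa>L by (intro suminf_le mult_right_mono ennreal_leI) auto
      finally show ?thesis .
    qed
    have "U.energy \<sigma> q w = (\<integral>\<^sup>+x. ennreal (norm (w x) powr q) \<partial>MU) + (\<integral>\<^sup>+x. (\<integral>\<^sup>+y. g x y \<partial>MU) \<partial>MU)"
      using False by (simp add: U.energy_def g_def)
    also have "\<dots> \<le> (\<Sum>i. ennreal (\<kappa> i) * L i) + ((\<Sum>i. ennreal (\<kappa> i) * S i) + ennreal C2 * (\<Sum>i. ennreal (\<kappa> i) * L i))"
      unfolding AS[symmetric] by (rule add_mono[OF LU order_trans[OF split add_left_mono[OF XL]]])
    also have "\<dots> \<le> (1 + ennreal C2) * ((\<Sum>i. ennreal (\<kappa> i) * L i) + (\<Sum>i. ennreal (\<kappa> i) * S i))"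
    proof -
      have *: "l + (s + c * l) \<le> (1 + c) * (l + s)" for l s c :: ennreal
      proof -
        have "(1 + c) * (l + s) = l + (s + c * l) + c * s" by (simp add: distrib_left distrib_right add_ac)
        then show ?thesis by (simp add: add_increasing2)
      qed
      show ?thesis by (rule *)
    qed
    also have "(\<Sum>i. ennreal (\<kappa> i) * L i) + (\<Sum>i. ennreal (\<kappa> i) * S i) = (\<Sum>i. ennreal (\<kappa> i) * (L i + S i))"
      by (subst suminf_add) (auto simp: distrib_left)
    also have "1 + ennreal C2 = ennreal (1 + C2)" using C2 by simp
    finally show ?thesis by (simp add: BE \<kappa>_def)
  qed
  then show ?thesis using C2 by (intro exI[of _ "1 + C2"]) auto
qed

end

subsection \<open>The Neumann--Poincare kernels\<close>

context upper_regular
begin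

section \<open>Algebra of energies and functions of mean zero\<close>

lemma energy_add:
  assumes q: "1 < q" and [measurable]: "f \<in> borel_measurable M" "g \<in> borel_measurable M"
  shows "energy \<sigma> q (\<lambda>x. f x + g x) \<le> ennreal (2 powr q) * (energy \<sigma> q f + energy \<sigma> q g)"
proof -
  have pt: "norm (a + b) powr q \<le> 2 powr q * (norm a powr q + norm b powr q)" for a b :: complex
    using norm_diff_powr_le[of q a "- b"] q by simp
  have 1: "(\<integral>\<^sup>+x. ennreal (norm (f x + g x) powr q) \<partial>M) \<le> ennreal (2 powr q) * ((\<integral>\<^sup>+x. ennreal (norm (f x) powr q) \<partial>M) + (\<integral>\<^sup>+x. ennreal (norm (g x) powr q) \<partial>M))"
  proof -
    have "(\<integral>\<^sup>+x. ennreal (norm (f x + g x) powr q) \<partial>M) \<le> (\<integral>\<^sup>+x. ennreal (2 powr q) * (ennreal (norm (f x) powr q) + ennreal (norm (g x) powr q)) \<partial>M)"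
      using pt by (intro nn_integral_mono) (simp flip: ennreal_mult ennreal_plus add: ennreal_leI)
    then show ?thesis by (simp add: nn_integral_cmult nn_integral_add)
  qed
  let ?S = "\<lambda>\<phi>. \<integral>\<^sup>+x. (\<integral>\<^sup>+y. ennreal (norm (\<phi> x - \<phi> y :: complex) powr q / norm (x - y) powr (n + \<sigma> * q)) \<partial>M) \<partial>M"
  have 2: "?S (\<lambda>x. f x + g x) \<le> ennreal (2 powr q) * (?S f + ?S g)"
  proof -
    have "?S (\<lambda>x. f x + g x) \<le> (\<integral>\<^sup>+x. (\<integral>\<^sup>+y. ennreal (2 powr q) * (ennreal (norm (f x - f y) powr q / norm (x - y) powr (n + \<sigma> * q)) + ennreal (norm (g x - g y) powr q / norm (x - y) powr (n + \<sigma> * q))) \<partial>M) \<partial>M)"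
    proof (intro nn_integral_mono)
      fix x y
      have e: "f x + g x - (f y + g y) = (f x - f y) + (g x - g y)" by simp
      have "norm (f x + g x - (f y + g y)) powr q / norm (x - y) powr (n + \<sigma> * q) \<le>
          2 powr q * (norm (f x - f y) powr q + norm (g x - g y) powr q) / norm (x - y) powr (n + \<sigma> * q)"
        unfolding e by (intro divide_right_mono pt) auto
      also have "\<dots> = 2 powr q * (norm (f x - f y) powr q / norm (x - y) powr (n + \<sigma> * q) + norm (g x - g y) powr q / norm (x - y) powr (n + \<sigma> * q))"
        by (simp add: add_divide_distrib distrib_left)
      finally show "ennreal (norm (f x + g x - (f y + g y)) powr q / norm (x - y) powr (n + \<sigma> * q)) \<le>
        ennreal (2 powr q) * (ennreal (norm (f x - f y) powr q / norm (x - y) powr (n + \<sigma> * q)) + ennreal (norm (g x - g y) powr q / norm (x - y) powr (n + \<sigma> * q)))"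
        by (simp flip: ennreal_mult ennreal_plus add: ennreal_leI)
    qed
    also have "\<dots> = ennreal (2 powr q) * (?S f + ?S g)"
      by (simp add: nn_integral_cmult nn_integral_add)
    finally show ?thesis .
  qed
  show ?thesis
  proof (cases "\<sigma> = 0")
    case True
    then show ?thesis using 1 by (simp add: energy_def)
  next
    case False
    have "energy \<sigma> q (\<lambda>x. f x + g x) \<le> ennreal (2 powr q) * ((\<integral>\<^sup>+x. ennreal (norm (f x) powr q) \<partial>M) + (\<integral>\<^sup>+x. ennreal (norm (g x) powr q) \<partial>M)) + ennreal (2 powr q) * (?S f + ?S g)"
      using add_mono[OF 1 2] False by (simp add: energy_def)
    also have "\<dots> = ennreal (2 powr q) * (energy \<sigma> q f + energy \<sigma> q g)"
      using False by (simp add: energy_def distrib_left add_ac)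
    finally show ?thesis .
  qed
qed

lemma energy_cmult:
  assumes [measurable]: "f \<in> borel_measurable M"
  shows "energy \<sigma> q (\<lambda>x. c * f x) = ennreal (norm c powr q) * energy \<sigma> q f"
proof -
  have "norm (c * f x - c * f y) powr q = norm c powr q * norm (f x - f y) powr q" for x y
    by (simp add: right_diff_distrib[symmetric] norm_mult powr_mult)
  then have e: "ennreal (norm (c * f x - c * f y) powr q / norm (x - y) powr (n + \<sigma> * q)) =
      ennreal (norm c powr q) * ennreal (norm (f x - f y) powr q / norm (x - y) powr (n + \<sigma> * q))" for x y
    by (simp add: ennreal_mult[symmetric])
  have "(\<integral>\<^sup>+x. (\<integral>\<^sup>+y. ennreal (norm (c * f x - c * f y) powr q / norm (x - y) powr (n + \<sigma> * q)) \<partial>M) \<partial>M) =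
      ennreal (norm c powr q) * (\<integral>\<^sup>+x. (\<integral>\<^sup>+y. ennreal (norm (f x - f y) powr q / norm (x - y) powr (n + \<sigma> * q)) \<partial>M) \<partial>M)"
    unfolding e by (simp add: nn_integral_cmult)
  moreover have "(\<integral>\<^sup>+x. ennreal (norm (c * f x) powr q) \<partial>M) = ennreal (norm c powr q) * (\<integral>\<^sup>+x. ennreal (norm (f x) powr q) \<partial>M)"
    by (simp add: norm_mult powr_mult ennreal_mult nn_integral_cmult)
  ultimately show ?thesis by (simp add: energy_def distrib_left)
qed

text \<open>Covers the degenerate case in which the total mass is 0 and division by it is only a
  convention.\<close>

lemma energy_null:
  assumes "measure M (space M) = 0"
  shows "energy \<sigma> q f = 0"
proof -
  have "emeasure M (space M) = 0" using assms by (simp add: emeasure_eq_measure)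
  then have "AE x in M. False" by (intro AE_I[of _ _ "space M"]) auto
  then have "nn_integral M g = (\<integral>\<^sup>+x. 0 \<partial>M)" for g :: "'a \<Rightarrow> ennreal"
    by (intro nn_integral_cong_AE) (auto elim!: eventually_mono)
  then show ?thesis by (simp add: energy_def)
qed

text \<open>Once the mean is subtracted, the supremum is bounded by the Lipschitz constant times the
  diameter. The size of \<open>h\<close> itself does not enter, and this lets the energy of a
  projected potential decay.\<close>

lemma lipschitz_mean_free_energy:
  assumes q: "1 < q" and \<sigma>: "0 \<le> \<sigma>" "\<sigma> < 1"
  shows "\<exists>C\<ge>0. \<forall>h\<in>borel_measurable M. \<forall>b\<ge>0. (\<forall>x\<in>space M. \<forall>y\<in>space M. norm (h x - h y) \<le> b * norm (x - y)) \<longrightarrow>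
     energy \<sigma> q (\<lambda>x. h x - (1 / measure M (space M)) *\<^sub>R (LINT y|M. h y)) \<le> ennreal (C * b powr q)"
proof -
  obtain C where C: "C \<ge> 0" and lip: "\<And>h B. 0 \<le> B \<Longrightarrow> (\<forall>x\<in>space M. norm (h x) \<le> B) \<Longrightarrow>
     (\<forall>x\<in>space M. \<forall>y\<in>space M. norm (h x - h y) \<le> B * norm (x - y)) \<Longrightarrow> energy \<sigma> q h \<le> ennreal (C * B powr q)"
    using lipschitz_energy[OF q \<sigma>] by blast
  let ?m = "measure M (space M)"
  have "energy \<sigma> q (\<lambda>x. h x - (1 / ?m) *\<^sub>R (LINT y|M. h y)) \<le> ennreal (C * (D + 1) powr q * b powr q)"
    if h [measurable]: "h \<in> borel_measurable M" and b: "0 \<le> b" and hl: "\<And>x y. x\<in>space M \<Longrightarrow> y\<in>space M \<Longrightarrow> norm (h x - h y) \<le> b * norm (x - y)" for h b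
  proof (cases "?m = 0")
    case True
    then show ?thesis by (simp add: energy_null)
  next
    case False
    then have mp: "0 < ?m" using measure_nonneg[of M "space M"] by linarith
    have hb: "norm (h x - h y) \<le> b * D" if "x \<in> space M" "y \<in> space M" for x y
      using hl[OF that] mult_left_mono[OF diam[OF that] b] by linarith
    have ih: "integrable M h"
    proof (cases "space M = {}")
      case False
      then obtain x0 where x0: "x0 \<in> space M" by blast
      have "norm (h y) \<le> norm (h x0) + b * D" if "y \<in> space M" for y
        using hb[OF that x0] norm_triangle_ineq2[of "h y" "h x0"] by linarith
      then show ?thesis by (intro integrable_const_bound[where B = "norm (h x0) + b * D"]) auto
    qed (use mp in simp)
    have sup: "norm (h x - (1 / ?m) *\<^sub>R (LINT y|M. h y)) \<le> b * D" if x: "x \<in> space M" for x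
    proof -
      have "h x - (1 / ?m) *\<^sub>R (LINT y|M. h y) = (1 / ?m) *\<^sub>R (LINT y|M. h x - h y)"
        using ih mp by (subst Bochner_Integration.integral_diff) (auto simp: scaleR_diff_right)
      also have "norm \<dots> \<le> (1 / ?m) * (LINT y|M. norm (h x - h y))"
        using mp by (simp add: divide_right_mono)
      also have "\<dots> \<le> (1 / ?m) * (LINT y|M. b * D)"
        using mp ih by (intro mult_left_mono integral_mono hb x) auto
      finally show ?thesis using mp by simp
    qed
    \<comment> \<open>The number \<open>b * (D + 1)\<close> dominates both the bound
      \<open>b * D\<close> on the values and the Lipschitz constant \<open>b\<close>.\<close>
    have "energy \<sigma> q (\<lambda>x. h x - (1 / ?m) *\<^sub>R (LINT y|M. h y)) \<le> ennreal (C * (b * (D + 1)) powr q)"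
    proof (rule lip; (intro ballI)?)
      show "0 \<le> b * (D + 1)" using b D by simp
      show "norm (h x - (1 / ?m) *\<^sub>R (LINT y|M. h y)) \<le> b * (D + 1)" if "x \<in> space M" for x
        using sup[OF that] b by (simp add: distrib_left)
      show "norm (h x - (1 / ?m) *\<^sub>R (LINT y|M. h y) - (h y - (1 / ?m) *\<^sub>R (LINT y|M. h y))) \<le> b * (D + 1) * norm (x - y)"
        if "x \<in> space M" "y \<in> space M" for x y
      proof -
        have "b * norm (x - y) \<le> b * (D + 1) * norm (x - y)"
          using b D by (intro mult_right_mono) (auto simp: distrib_left)
        then show ?thesis using hl[OF that] by simp
      qed
    qed
    then show ?thesis using b D by (simp add: powr_mult mult_ac)
  qed
  moreover have "0 \<le> C * (D + 1) powr q" using C by simp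
  ultimately show ?thesis by blast
qed

end

lemma borel_pair_imp_restrict_pair:
  fixes f :: "'a::euclidean_space \<times> 'a \<Rightarrow> 'b::topological_space"
  assumes f: "f \<in> borel_measurable (borel \<Otimes>\<^sub>M borel)"
    and M: "(\<lambda>x. x) \<in> measurable M borel" and N: "(\<lambda>x. x) \<in> measurable N borel"
  shows "f \<in> borel_measurable (M \<Otimes>\<^sub>M N)"
proof -
  have "(\<lambda>p. (fst p, snd p)) \<in> measurable (M \<Otimes>\<^sub>M N) (borel \<Otimes>\<^sub>M borel)"
    by (intro measurable_Pair measurable_compose[OF measurable_fst M] measurable_compose[OF measurable_snd N])
  from measurable_compose[OF this f] show ?thesis by simp
qed

context self_similar_boundary
begin

text \<open>The normal is set to 0 off the boundary, which makes it a Borel function on the whole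
  space; \<open>outer_normal\<close> has no useful value there.\<close>

definition nhat :: "'a \<Rightarrow> 'a" where
  "nhat x = indicator \<Gamma>\<^sub>0 x *\<^sub>R outer_normal \<Omega>\<^sub>0 x"

definition kK :: "int \<Rightarrow> 'a \<Rightarrow> 'a \<Rightarrow> real" where
  "kK m x y = nhat x \<bullet> newton_field (eta r m x - y)"

text \<open>The kernel of \<open>NP\<close> for sources on component \<open>j\<close>, with the
  target as first argument. It vanishes for \<open>x\<close> off that component, so integrating over
  the whole union changes nothing.\<close>

definition kN :: "nat \<Rightarrow> 'a \<Rightarrow> 'a \<Rightarrow> real" where
  "kN j y x = nhat ((1 / r ^ j) *\<^sub>R x) \<bullet> newton_field (x - y)"

definition cd :: real where "cd = 1 / (2 * (real DIM('a) - 1) * pi)"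

lemma cd: "0 \<le> cd" "cd \<le> 1"
proof -
  have "1 \<le> 2 * (real DIM('a) - 1) * pi"
    using mult_mono[of 1 "2 * (real DIM('a) - 1)" 1 pi] dim2 pi_gt3 by simp
  then show "0 \<le> cd" "cd \<le> 1" by (auto simp: cd_def divide_le_eq_1)
qed

lemma newton_field_cd: "newton_field v = (cd / norm v ^ DIM('a)) *\<^sub>R v" for v :: 'a
  by (simp add: newton_field_def cd_def)

lemma nhat_eq: "x \<in> \<Gamma>\<^sub>0 \<Longrightarrow> nhat x = outer_normal \<Omega>\<^sub>0 x" by (simp add: nhat_def)

lemma nhat_zero: "x \<notin> \<Gamma>\<^sub>0 \<Longrightarrow> nhat x = 0" by (simp add: nhat_def)

lemma norm_nhat: "norm (nhat x) \<le> 1"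
  using norm_outer_normal[OF open_\<Omega> _ smooth, of x] by (cases "x \<in> \<Gamma>\<^sub>0") (auto simp: nhat_def)

lemma inner_nhat_le: "\<bar>nhat x \<bullet> v\<bar> \<le> norm v"
  using Cauchy_Schwarz_ineq2[of "nhat x" v] mult_right_mono[OF norm_nhat, of "norm v" x] by simp

lemma normal_bounds: "\<exists>L\<ge>0. \<forall>x\<in>\<Gamma>\<^sub>0. \<forall>y\<in>\<Gamma>\<^sub>0. \<bar>nhat x \<bullet> (x - y)\<bar> \<le> L * norm (x - y) ^ 2 \<and> norm (nhat x - nhat y) \<le> L * norm (x - y)"
proof -
  obtain L1 where L1: "L1 \<ge> 0" "\<And>x y. x \<in> \<Gamma>\<^sub>0 \<Longrightarrow> y \<in> \<Gamma>\<^sub>0 \<Longrightarrow> \<bar>outer_normal \<Omega>\<^sub>0 x \<bullet> (x - y)\<bar> \<le> L1 * norm (x - y) ^ 2"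
    using boundary_estimates(1)[OF dim2 open_\<Omega> bounded_\<Omega> smooth] by blast
  obtain L2 where L2: "L2 \<ge> 0" "\<And>x y. x \<in> \<Gamma>\<^sub>0 \<Longrightarrow> y \<in> \<Gamma>\<^sub>0 \<Longrightarrow> norm (outer_normal \<Omega>\<^sub>0 x - outer_normal \<Omega>\<^sub>0 y) \<le> L2 * norm (x - y) ^ 1"
    using boundary_estimates(2)[OF dim2 open_\<Omega> bounded_\<Omega> smooth] by blast
  show ?thesis
  proof (intro exI[of _ "max L1 L2"] conjI ballI)
    fix x y assume xy: "x \<in> \<Gamma>\<^sub>0" "y \<in> \<Gamma>\<^sub>0"
    have "L1 * norm (x - y) ^ 2 \<le> max L1 L2 * norm (x - y) ^ 2" by (intro mult_right_mono) auto
    then show "\<bar>nhat x \<bullet> (x - y)\<bar> \<le> max L1 L2 * norm (x - y) ^ 2" using L1(2)[OF xy] xy by (simp add: nhat_eq)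
    have "L2 * norm (x - y) \<le> max L1 L2 * norm (x - y)" by (intro mult_right_mono) auto
    then show "norm (nhat x - nhat y) \<le> max L1 L2 * norm (x - y)" using L2(2)[OF xy] xy by (simp add: nhat_eq)
  qed (use L1 in auto)
qed

definition Lc :: real where "Lc = (SOME L. L\<ge>0 \<and> (\<forall>x\<in>\<Gamma>\<^sub>0. \<forall>y\<in>\<Gamma>\<^sub>0. \<bar>nhat x \<bullet> (x - y)\<bar> \<le> L * norm (x - y) ^ 2 \<and> norm (nhat x - nhat y) \<le> L * norm (x - y)))"

lemma Lc: "0 \<le> Lc"
  and nhat_tangent: "x \<in> \<Gamma>\<^sub>0 \<Longrightarrow> y \<in> \<Gamma>\<^sub>0 \<Longrightarrow> \<bar>nhat x \<bullet> (x - y)\<bar> \<le> Lc * norm (x - y) ^ 2"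
  and nhat_lipschitz: "x \<in> \<Gamma>\<^sub>0 \<Longrightarrow> y \<in> \<Gamma>\<^sub>0 \<Longrightarrow> norm (nhat x - nhat y) \<le> Lc * norm (x - y)"
  using someI_ex[OF normal_bounds] unfolding Lc_def by blast+

lemma nhat_measurable [measurable]: "nhat \<in> borel_measurable borel"
proof -
  have "continuous_on \<Gamma>\<^sub>0 nhat"
  proof (rule lipschitz_on_continuous_on)
    show "Lc-lipschitz_on \<Gamma>\<^sub>0 nhat"
      using Lc nhat_lipschitz by (intro lipschitz_onI) (auto simp: dist_norm)
  qed
  then have "(\<lambda>x. indicator \<Gamma>\<^sub>0 x *\<^sub>R nhat x) \<in> borel_measurable borel"
    by (intro borel_measurable_continuous_on_indicator) auto
  moreover have "(\<lambda>x. indicator \<Gamma>\<^sub>0 x *\<^sub>R nhat x) = nhat" by (auto simp: nhat_def fun_eq_iff indicator_def)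
  ultimately show ?thesis by simp
qed

lemma eta_measurable [measurable]: "eta r m \<in> borel_measurable (borel :: 'a measure)"
  unfolding eta_def[abs_def] by measurable

text \<open>The integrands can differ only at the point \<open>y = eta r m x\<close>, which is null;
  elsewhere the gradient of \<open>G\<close> is the explicit field.\<close>

lemma K_int_eq:
  assumes [measurable]: "\<psi> \<in> borel_measurable borel" and x: "x \<in> \<Gamma>\<^sub>0"
  shows "K_int r \<Omega>\<^sub>0 m \<psi> x = (LINT y|M\<^sub>0. kK m x y *\<^sub>R \<psi> y)"
proof -
  have "K_int r \<Omega>\<^sub>0 m \<psi> x = (LINT y:\<Gamma>\<^sub>0|surf. (outer_normal \<Omega>\<^sub>0 x \<bullet> grad1_G (eta r m x) y) *\<^sub>R \<psi> y)"
    using x by (simp add: K_int_def)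
  also have "\<dots> = (LINT y:\<Gamma>\<^sub>0|surf. kK m x y *\<^sub>R \<psi> y)"
  proof (rule set_integral_surf_cong_except[OF dim2 \<Gamma>\<^sub>0_sets])
    show "(\<lambda>y. kK m x y *\<^sub>R \<psi> y) \<in> borel_measurable borel" unfolding kK_def by measurable
    show "(outer_normal \<Omega>\<^sub>0 x \<bullet> grad1_G (eta r m x) y) *\<^sub>R \<psi> y = kK m x y *\<^sub>R \<psi> y" if "y \<noteq> eta r m x" for y
      using that x by (simp add: grad1_G_eq[OF dim] kK_def nhat_eq)
  qed
  finally show ?thesis by (simp add: integral_M)
qed

lemma K_int_transpose_eq:
  assumes [measurable]: "h \<in> borel_measurable borel" and y: "y \<in> \<Gamma>\<^sub>0"
  shows "K_int_transpose r \<Omega>\<^sub>0 m h y = (LINT x|M\<^sub>0. kK m x y *\<^sub>R h x)"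
proof -
  have "K_int_transpose r \<Omega>\<^sub>0 m h y = (LINT x:\<Gamma>\<^sub>0|surf. (outer_normal \<Omega>\<^sub>0 x \<bullet> grad1_G (eta r m x) y) *\<^sub>R h x)"
    using y by (simp add: K_int_transpose_def)
  also have "\<dots> = (LINT x:\<Gamma>\<^sub>0|surf. kK m x y *\<^sub>R h x)"
  proof (rule set_integral_surf_cong_except[OF dim2 \<Gamma>\<^sub>0_sets])
    show "(\<lambda>x. kK m x y *\<^sub>R h x) \<in> borel_measurable borel" unfolding kK_def by measurable
    show "(outer_normal \<Omega>\<^sub>0 x \<bullet> grad1_G (eta r m x) y) *\<^sub>R h x = kK m x y *\<^sub>R h x" if x: "x \<in> \<Gamma>\<^sub>0" and ne: "x \<noteq> (1 / r powi m) *\<^sub>R y" for x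
    proof -
      have "r powi m \<noteq> 0" by simp
      then have "eta r m x \<noteq> y" using ne by (auto simp: eta_def)
      then show ?thesis using x by (simp add: grad1_G_eq[OF dim] kK_def nhat_eq)
    qed
  qed
  finally show ?thesis by (simp add: integral_M)
qed

lemma id_M: "(\<lambda>x. x) \<in> measurable (restrict_space surf S) (borel :: 'a measure)"
  by (rule measurable_restrict_space1) (simp cong: measurable_cong_sets)

lemma sigma_finite_M\<^sub>0: "sigma_finite_measure M\<^sub>0"
  using upper_regular.axioms(1)[OF B.upper_regular_axioms] by (rule finite_measure.axioms(1))

lemma K_int_measurable: "\<psi> \<in> borel_measurable borel \<Longrightarrow> K_int r \<Omega>\<^sub>0 m \<psi> \<in> borel_measurable borel"
proof -
  assume \<psi> [measurable]: "\<psi> \<in> borel_measurable borel"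
  have "(\<lambda>p. kK m (fst p) (snd p) *\<^sub>R \<psi> (snd p)) \<in> borel_measurable (borel \<Otimes>\<^sub>M borel)" unfolding kK_def by measurable
  then have "(\<lambda>p. kK m (fst p) (snd p) *\<^sub>R \<psi> (snd p)) \<in> borel_measurable (borel \<Otimes>\<^sub>M M\<^sub>0)"
    by (rule borel_pair_imp_restrict_pair) (auto simp: id_M)
  note m = this
  have [measurable]: "(\<lambda>x. LINT y|M\<^sub>0. kK m x y *\<^sub>R \<psi> y) \<in> borel_measurable borel"
    by (rule sigma_finite_measure.borel_measurable_lebesgue_integral[OF sigma_finite_M\<^sub>0]) (use m in \<open>simp add: case_prod_beta'\<close>)
  have "K_int r \<Omega>\<^sub>0 m \<psi> = (\<lambda>x. if x \<in> \<Gamma>\<^sub>0 then LINT y|M\<^sub>0. kK m x y *\<^sub>R \<psi> y else 0)"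
    using K_int_eq[OF \<psi>] by (auto simp: fun_eq_iff K_int_def)
  also have "\<dots> \<in> borel_measurable borel" by measurable
  finally show ?thesis .
qed

lemma K_int_transpose_measurable: "\<psi> \<in> borel_measurable borel \<Longrightarrow> K_int_transpose r \<Omega>\<^sub>0 m \<psi> \<in> borel_measurable borel"
proof -
  assume \<psi> [measurable]: "\<psi> \<in> borel_measurable borel"
  have "(\<lambda>p. kK m (snd p) (fst p) *\<^sub>R \<psi> (snd p)) \<in> borel_measurable (borel \<Otimes>\<^sub>M borel)" unfolding kK_def by measurable
  then have "(\<lambda>p. kK m (snd p) (fst p) *\<^sub>R \<psi> (snd p)) \<in> borel_measurable (borel \<Otimes>\<^sub>M M\<^sub>0)"
    by (rule borel_pair_imp_restrict_pair) (auto simp: id_M)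
  note m = this
  have [measurable]: "(\<lambda>y. LINT x|M\<^sub>0. kK m x y *\<^sub>R \<psi> x) \<in> borel_measurable borel"
    by (rule sigma_finite_measure.borel_measurable_lebesgue_integral[OF sigma_finite_M\<^sub>0]) (use m in \<open>simp add: case_prod_beta'\<close>)
  have "K_int_transpose r \<Omega>\<^sub>0 m \<psi> = (\<lambda>y. if y \<in> \<Gamma>\<^sub>0 then LINT x|M\<^sub>0. kK m x y *\<^sub>R \<psi> x else 0)"
    using K_int_transpose_eq[OF \<psi>] by (auto simp: fun_eq_iff K_int_transpose_def)
  also have "\<dots> \<in> borel_measurable borel" by measurable
  finally show ?thesis .
qed

text \<open>For \<open>m = - int k\<close> the difference is \<open>x - r ^ k *\<^sub>R y\<close>
  divided by \<open>r ^ k\<close>, so this case reduces to positive exponents and the division only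
  enlarges the distance.\<close>

lemma eta_separated:
  assumes m: "m \<noteq> 0"
  shows "\<exists>\<rho>>0. \<forall>x\<in>\<Gamma>\<^sub>0. \<forall>y\<in>\<Gamma>\<^sub>0. \<rho> \<le> norm (eta r m x - y)"
proof -
  define \<rho> where "\<rho> = sepc * inrad"
  have \<rho>: "0 < \<rho>" using sepc inrad by (simp add: \<rho>_def)
  have pos: "\<rho> \<le> norm (y - r ^ k *\<^sub>R x)" if "0 < k" "x \<in> \<Gamma>\<^sub>0" "y \<in> \<Gamma>\<^sub>0" for k x y
    using separation_power[of 0 k y "r ^ k *\<^sub>R x"] that by (simp add: Gam_0 scale_Gam_iff \<rho>_def)
  have "\<rho> \<le> norm (eta r m x - y)" if x: "x \<in> \<Gamma>\<^sub>0" and y: "y \<in> \<Gamma>\<^sub>0" for x y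
  proof (cases "0 < m")
    case True
    then obtain k where k: "m = int k" "0 < k" using pos_int_cases by blast
    then show ?thesis using pos[OF k(2) x y] by (simp add: eta_nat norm_minus_commute)
  next
    case False
    then have "m < 0" using m by simp
    then obtain k where k: "m = - int k" "0 < k" by (rule neg_int_cases)
    have "\<rho> \<le> norm (x - r ^ k *\<^sub>R y)" by (rule pos[OF k(2) y x])
    also have "\<dots> \<le> (1 / r ^ k) * norm (x - r ^ k *\<^sub>R y)"
      using rj[of k] mult_right_mono[of 1 "1 / r ^ k" "norm (x - r ^ k *\<^sub>R y)"] by simp
    also have "\<dots> = norm ((1 / r ^ k) *\<^sub>R (x - r ^ k *\<^sub>R y))" using rj[of k] by simp
    also have "(1 / r ^ k) *\<^sub>R (x - r ^ k *\<^sub>R y) = eta r m x - y"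
      using rj[of k] by (simp add: k(1) eta_minus_nat scaleR_diff_right)
    finally show ?thesis .
  qed
  then show ?thesis using \<rho> by blast
qed

lemma kK_0: "kK 0 x y = cd * (nhat x \<bullet> (x - y)) / norm (x - y) ^ DIM('a)"
  by (simp add: kK_def eta_def newton_field_cd)

lemma pairM:
  fixes f :: "'a \<Rightarrow> 'a \<Rightarrow> real"
  assumes "(\<lambda>p. f (fst p) (snd p)) \<in> borel_measurable (borel \<Otimes>\<^sub>M borel)"
  shows "(\<lambda>(x, y). f x y) \<in> borel_measurable (restrict_space surf S \<Otimes>\<^sub>M restrict_space (surf :: 'a measure) T)"
  unfolding case_prod_beta' by (rule borel_pair_imp_restrict_pair[OF assms id_M id_M])

text \<open>The increment \<open>y - x'\<close> is not based at \<open>x\<close>, so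
  \<open>nhat_tangent\<close> does not apply to it directly. Replacing the normal at
  \<open>x\<close> by the one at \<open>y\<close> costs a term controlled by the Lipschitz bound of
  the normal.\<close>

lemma nhat_increment:
  assumes "x \<in> \<Gamma>\<^sub>0" "x' \<in> \<Gamma>\<^sub>0" "y \<in> \<Gamma>\<^sub>0"
  shows "\<bar>nhat x \<bullet> (y - x')\<bar> \<le> Lc * norm (y - x') * (norm (y - x) + norm (y - x'))"
proof -
  have "nhat x \<bullet> (y - x') = nhat y \<bullet> (y - x') + (nhat x - nhat y) \<bullet> (y - x')" by (simp add: inner_diff_left)
  then have "\<bar>nhat x \<bullet> (y - x')\<bar> \<le> \<bar>nhat y \<bullet> (y - x')\<bar> + \<bar>(nhat x - nhat y) \<bullet> (y - x')\<bar>" by linarith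
  also have "\<dots> \<le> Lc * norm (y - x') ^ 2 + (Lc * norm (x - y)) * norm (y - x')"
    using nhat_tangent[OF assms(3,2)] Cauchy_Schwarz_ineq2[of "nhat x - nhat y" "y - x'"]
      mult_right_mono[OF nhat_lipschitz[OF assms(1,3)], of "norm (y - x')"]
    by (intro add_mono) auto
  finally show ?thesis by (simp add: power2_eq_square norm_minus_commute algebra_simps)
qed

text \<open>The block with \<open>m = 0\<close> has a singular kernel whose numerator vanishes to
  second order; for all others \<open>eta_separated\<close> keeps the argument away from the
  singularity. Only the integral of the \<open>q\<close>-th power appears on the right: the
  smoothness is gained by the operator.\<close>

lemma K_int_energy:
  fixes \<sigma> q :: real
  assumes q: "1 < q" and \<sigma>: "0 \<le> \<sigma>" "\<sigma> < 1"
  shows "\<exists>C\<ge>0. \<forall>\<psi>\<in>borel_measurable borel. B.energy \<sigma> q (K_int r \<Omega>\<^sub>0 m \<psi>) \<le> ennreal C * (\<integral>\<^sup>+y. ennreal (norm (\<psi> y) powr q) \<partial>M\<^sub>0)"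
proof -
  have "\<exists>C\<ge>0. \<forall>f\<in>borel_measurable M\<^sub>0. B.energy \<sigma> q (\<lambda>x. LINT y|M\<^sub>0. kK m x y *\<^sub>R f y) \<le> ennreal C * (\<integral>\<^sup>+y. ennreal (norm (f y) powr q) \<partial>M\<^sub>0)"
  proof (cases "m = 0")
    case True
    have "\<exists>C\<ge>0. \<forall>f\<in>borel_measurable M\<^sub>0. B.energy \<sigma> q (\<lambda>x. LINT y|M\<^sub>0. (cd * (nhat x \<bullet> (x - y)) / norm (x - y) ^ DIM('a)) *\<^sub>R f y) \<le> ennreal C * (\<integral>\<^sup>+y. ennreal (norm (f y) powr q) \<partial>M\<^sub>0)"
    proof (rule B.normal_kernel_energy[OF q \<sigma> dim2 real_n])
      show "0 \<le> 2 * Lc" using Lc by simp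
      show "(\<lambda>(x, y). cd * (nhat x \<bullet> (x - y))) \<in> borel_measurable (M\<^sub>0 \<Otimes>\<^sub>M M\<^sub>0)"
        by (rule pairM) measurable
      fix x y assume "x \<in> space M\<^sub>0" "y \<in> space M\<^sub>0"
      then have "\<bar>nhat x \<bullet> (x - y)\<bar> \<le> Lc * norm (x - y) ^ 2" by (auto intro: nhat_tangent)
      then have "cd * \<bar>nhat x \<bullet> (x - y)\<bar> \<le> 1 * (Lc * norm (x - y) ^ 2)" using cd Lc by (intro mult_mono) auto
      moreover have "Lc * norm (x - y) ^ 2 \<le> 2 * Lc * norm (x - y) ^ 2" using Lc by (intro mult_right_mono) auto
      ultimately show "\<bar>cd * (nhat x \<bullet> (x - y))\<bar> \<le> 2 * Lc * norm (x - y) ^ 2" using cd by (simp add: abs_mult)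
    next
      fix x x' y assume "x \<in> space M\<^sub>0" "x' \<in> space M\<^sub>0" "y \<in> space M\<^sub>0"
      then have xy: "x \<in> \<Gamma>\<^sub>0" "x' \<in> \<Gamma>\<^sub>0" "y \<in> \<Gamma>\<^sub>0" by auto
      \<comment> \<open>One part is the change of the normal, of first order and multiplied by
        \<open>x - y\<close>; the other is the increment \<open>x' - x\<close> seen from
        \<open>x'\<close>, which is tangential up to second order.\<close>
      have "nhat x \<bullet> (x - y) - nhat x' \<bullet> (x' - y) = (nhat x - nhat x') \<bullet> (x - y) + (- (nhat x' \<bullet> (x' - x)))"
        by (simp add: inner_diff_left inner_diff_right)
      then have "\<bar>nhat x \<bullet> (x - y) - nhat x' \<bullet> (x' - y)\<bar> \<le> \<bar>(nhat x - nhat x') \<bullet> (x - y)\<bar> + \<bar>nhat x' \<bullet> (x' - x)\<bar>" by linarith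
      also have "\<dots> \<le> (Lc * norm (x - x')) * norm (x - y) + Lc * norm (x' - x) ^ 2"
        using nhat_tangent[OF xy(2,1)] Cauchy_Schwarz_ineq2[of "nhat x - nhat x'" "x - y"]
          mult_right_mono[OF nhat_lipschitz[OF xy(1,2)], of "norm (x - y)"]
        by (intro add_mono) auto
      also have "\<dots> = Lc * norm (x - x') * (norm (x - y) + norm (x - x'))"
        by (simp add: power2_eq_square norm_minus_commute algebra_simps)
      finally have "cd * \<bar>nhat x \<bullet> (x - y) - nhat x' \<bullet> (x' - y)\<bar> \<le> 1 * (Lc * norm (x - x') * (norm (x - y) + norm (x - x')))"
        using cd Lc by (intro mult_mono) auto
      moreover have "Lc * norm (x - x') * (norm (x - y) + norm (x - x')) \<le> 2 * Lc * norm (x - x') * (norm (x - y) + norm (x - x'))"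
        using Lc by (intro mult_right_mono) auto
      ultimately show "\<bar>cd * (nhat x \<bullet> (x - y)) - cd * (nhat x' \<bullet> (x' - y))\<bar> \<le> 2 * Lc * norm (x - x') * (norm (x - y) + norm (x - x'))"
        using cd by (simp add: abs_mult right_diff_distrib[symmetric])
    qed
    then show ?thesis by (simp add: True kK_0)
  next
    case False
    obtain \<rho> where \<rho>: "0 < \<rho>" "\<And>x y. x \<in> \<Gamma>\<^sub>0 \<Longrightarrow> y \<in> \<Gamma>\<^sub>0 \<Longrightarrow> \<rho> \<le> norm (eta r m x - y)" using eta_separated[OF False] by blast
    define c where "c = r powi m"
    have c: "0 < c" using r by (simp add: c_def)
    define a where "a = 1 / \<rho> ^ (DIM('a) - 1)"
    define e where "e = (real DIM('a) + 1) / \<rho> ^ DIM('a)"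
    have ae: "0 \<le> a" "0 \<le> e" using \<rho> by (auto simp: a_def e_def)
    define K where "K = a + Lc * a + e * c"
    have K: "a \<le> K" "Lc * a + e * c \<le> K" "0 \<le> K" using ae c Lc by (auto simp: K_def)
    show ?thesis
    proof (rule B.lipschitz_kernel_energy[OF q \<sigma> K(3)])
      show "(\<lambda>(x, y). kK m x y) \<in> borel_measurable (M\<^sub>0 \<Otimes>\<^sub>M M\<^sub>0)" by (rule pairM) (unfold kK_def, measurable)
      fix x y assume "x \<in> space M\<^sub>0" "y \<in> space M\<^sub>0"
      then have "norm (newton_field (eta r m x - y)) \<le> a" unfolding a_def by (intro newton_field_bound dim2 \<rho>) auto
      then show "\<bar>kK m x y\<bar> \<le> K" using inner_nhat_le[of x "newton_field (eta r m x - y)"] K(1) by (simp add: kK_def)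
    next
      fix x x' y assume "x \<in> space M\<^sub>0" "x' \<in> space M\<^sub>0" "y \<in> space M\<^sub>0"
      then have xy: "x \<in> \<Gamma>\<^sub>0" "x' \<in> \<Gamma>\<^sub>0" "y \<in> \<Gamma>\<^sub>0" by auto
      define v where "v = newton_field (eta r m x - y)"
      define v' where "v' = newton_field (eta r m x' - y)"
      have va: "norm v \<le> a" unfolding v_def a_def by (intro newton_field_bound dim2 \<rho> xy)
      have "norm (v - v') \<le> e * norm ((eta r m x - y) - (eta r m x' - y))"
        unfolding v_def v'_def e_def by (intro newton_field_diff dim2 \<rho> xy)
      also have "(eta r m x - y) - (eta r m x' - y) = c *\<^sub>R (x - x')" by (simp add: eta_def c_def scaleR_diff_right)
      finally have vv: "norm (v - v') \<le> e * c * norm (x - x')" using c by simp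
      have "kK m x y - kK m x' y = (nhat x - nhat x') \<bullet> v + nhat x' \<bullet> (v - v')"
        by (simp add: kK_def v_def v'_def inner_diff_left inner_diff_right)
      then have "\<bar>kK m x y - kK m x' y\<bar> \<le> \<bar>(nhat x - nhat x') \<bullet> v\<bar> + \<bar>nhat x' \<bullet> (v - v')\<bar>" by linarith
      also have "\<dots> \<le> (Lc * norm (x - x')) * a + e * c * norm (x - x')"
      proof (rule add_mono)
        have "\<bar>(nhat x - nhat x') \<bullet> v\<bar> \<le> norm (nhat x - nhat x') * norm v" by (rule Cauchy_Schwarz_ineq2)
        also have "\<dots> \<le> (Lc * norm (x - x')) * a" using va nhat_lipschitz[OF xy(1,2)] Lc by (intro mult_mono) auto
        finally show "\<bar>(nhat x - nhat x') \<bullet> v\<bar> \<le> (Lc * norm (x - x')) * a" .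
        show "\<bar>nhat x' \<bullet> (v - v')\<bar> \<le> e * c * norm (x - x')" using inner_nhat_le[of x' "v - v'"] vv by linarith
      qed
      also have "\<dots> = (Lc * a + e * c) * norm (x - x')" by (simp add: algebra_simps)
      also have "\<dots> \<le> K * norm (x - x')" using K by (intro mult_right_mono) auto
      finally show "\<bar>kK m x y - kK m x' y\<bar> \<le> K * norm (x - x')" .
    qed
  qed
  then obtain C where C: "0 \<le> C" "\<And>f. f\<in>borel_measurable M\<^sub>0 \<Longrightarrow> B.energy \<sigma> q (\<lambda>x. LINT y|M\<^sub>0. kK m x y *\<^sub>R f y) \<le> ennreal C * (\<integral>\<^sup>+y. ennreal (norm (f y) powr q) \<partial>M\<^sub>0)"
    by blast
  have "B.energy \<sigma> q (K_int r \<Omega>\<^sub>0 m \<psi>) \<le> ennreal C * (\<integral>\<^sup>+y. ennreal (norm (\<psi> y) powr q) \<partial>M\<^sub>0)" if \<psi>: "\<psi> \<in> borel_measurable borel" for \<psi>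
  proof -
    have "B.energy \<sigma> q (K_int r \<Omega>\<^sub>0 m \<psi>) = B.energy \<sigma> q (\<lambda>x. LINT y|M\<^sub>0. kK m x y *\<^sub>R \<psi> y)"
      by (intro energy_cong K_int_eq \<psi>)
    then show ?thesis using C(2)[OF borel_measurable_M[OF \<psi>]] by simp
  qed
  then show ?thesis using C by blast
qed

text \<open>The variable in which smoothness is measured is now the one that does not carry the
  normal. For \<open>m = 0\<close> the increment condition is supplied by
  \<open>nhat_increment\<close>; otherwise only the field varies.\<close>

lemma K_int_transpose_energy:
  fixes \<sigma> q :: real
  assumes q: "1 < q" and \<sigma>: "0 \<le> \<sigma>" "\<sigma> < 1"
  shows "\<exists>C\<ge>0. \<forall>\<psi>\<in>borel_measurable borel. B.energy \<sigma> q (K_int_transpose r \<Omega>\<^sub>0 m \<psi>) \<le> ennreal C * (\<integral>\<^sup>+y. ennreal (norm (\<psi> y) powr q) \<partial>M\<^sub>0)"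
proof -
  have "\<exists>C\<ge>0. \<forall>f\<in>borel_measurable M\<^sub>0. B.energy \<sigma> q (\<lambda>y. LINT x|M\<^sub>0. kK m x y *\<^sub>R f x) \<le> ennreal C * (\<integral>\<^sup>+y. ennreal (norm (f y) powr q) \<partial>M\<^sub>0)"
  proof (cases "m = 0")
    case True
    have "\<exists>C\<ge>0. \<forall>f\<in>borel_measurable M\<^sub>0. B.energy \<sigma> q (\<lambda>y. LINT x|M\<^sub>0. (cd * (nhat x \<bullet> (x - y)) / norm (y - x) ^ DIM('a)) *\<^sub>R f x) \<le> ennreal C * (\<integral>\<^sup>+y. ennreal (norm (f y) powr q) \<partial>M\<^sub>0)"
    proof (rule B.normal_kernel_energy[OF q \<sigma> dim2 real_n])
      show "0 \<le> Lc" by (rule Lc)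
      show "(\<lambda>(y, x). cd * (nhat x \<bullet> (x - y))) \<in> borel_measurable (M\<^sub>0 \<Otimes>\<^sub>M M\<^sub>0)"
        by (rule pairM) measurable
      fix y x assume "y \<in> space M\<^sub>0" "x \<in> space M\<^sub>0"
      then have "\<bar>nhat x \<bullet> (x - y)\<bar> \<le> Lc * norm (x - y) ^ 2" by (auto intro: nhat_tangent)
      then have "cd * \<bar>nhat x \<bullet> (x - y)\<bar> \<le> 1 * (Lc * norm (x - y) ^ 2)" using cd Lc by (intro mult_mono) auto
      then show "\<bar>cd * (nhat x \<bullet> (x - y))\<bar> \<le> Lc * norm (y - x) ^ 2" using cd by (simp add: abs_mult norm_minus_commute)
    next
      fix y y' x assume "y \<in> space M\<^sub>0" "y' \<in> space M\<^sub>0" "x \<in> space M\<^sub>0"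
      then have xy: "x \<in> \<Gamma>\<^sub>0" "y' \<in> \<Gamma>\<^sub>0" "y \<in> \<Gamma>\<^sub>0" by auto
      have "cd * \<bar>nhat x \<bullet> (y - y')\<bar> \<le> 1 * (Lc * norm (y - y') * (norm (y - x) + norm (y - y')))"
        using cd Lc nhat_increment[OF xy] by (intro mult_mono) auto
      moreover have "\<bar>cd * (nhat x \<bullet> (x - y)) - cd * (nhat x \<bullet> (x - y'))\<bar> = cd * \<bar>nhat x \<bullet> (y - y')\<bar>"
        using cd by (simp add: right_diff_distrib[symmetric] abs_mult inner_diff_right abs_minus_commute)
      ultimately show "\<bar>cd * (nhat x \<bullet> (x - y)) - cd * (nhat x \<bullet> (x - y'))\<bar> \<le> Lc * norm (y - y') * (norm (y - x) + norm (y - y'))"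
        by simp
    qed
    then show ?thesis by (simp add: True kK_0 norm_minus_commute)
  next
    case False
    obtain \<rho> where \<rho>: "0 < \<rho>" "\<And>x y. x \<in> \<Gamma>\<^sub>0 \<Longrightarrow> y \<in> \<Gamma>\<^sub>0 \<Longrightarrow> \<rho> \<le> norm (eta r m x - y)" using eta_separated[OF False] by blast
    define a where "a = 1 / \<rho> ^ (DIM('a) - 1)"
    define e where "e = (real DIM('a) + 1) / \<rho> ^ DIM('a)"
    have ae: "0 \<le> a" "0 \<le> e" using \<rho> by (auto simp: a_def e_def)
    have K: "0 \<le> a + e" using ae by simp
    show ?thesis
    proof (rule B.lipschitz_kernel_energy[OF q \<sigma> K])
      show "(\<lambda>(y, x). kK m x y) \<in> borel_measurable (M\<^sub>0 \<Otimes>\<^sub>M M\<^sub>0)" by (rule pairM) (unfold kK_def, measurable)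
      fix y x assume "y \<in> space M\<^sub>0" "x \<in> space M\<^sub>0"
      then have "norm (newton_field (eta r m x - y)) \<le> a" unfolding a_def by (intro newton_field_bound dim2 \<rho>) auto
      then show "\<bar>kK m x y\<bar> \<le> a + e" using inner_nhat_le[of x "newton_field (eta r m x - y)"] ae by (simp add: kK_def)
    next
      fix y y' x assume "y \<in> space M\<^sub>0" "y' \<in> space M\<^sub>0" "x \<in> space M\<^sub>0"
      then have xy: "x \<in> \<Gamma>\<^sub>0" "y' \<in> \<Gamma>\<^sub>0" "y \<in> \<Gamma>\<^sub>0" by auto
      have "\<bar>kK m x y - kK m x y'\<bar> = \<bar>nhat x \<bullet> (newton_field (eta r m x - y) - newton_field (eta r m x - y'))\<bar>"
        by (simp add: kK_def inner_diff_right)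
      also have "\<dots> \<le> norm (newton_field (eta r m x - y) - newton_field (eta r m x - y'))" by (rule inner_nhat_le)
      also have "\<dots> \<le> e * norm ((eta r m x - y) - (eta r m x - y'))"
        unfolding e_def by (intro newton_field_diff dim2 \<rho> xy)
      also have "\<dots> \<le> (a + e) * norm (y - y')" using ae by (simp add: norm_minus_commute mult_right_mono)
      finally show "\<bar>kK m x y - kK m x y'\<bar> \<le> (a + e) * norm (y - y')" .
    qed
  qed
  then obtain C where C: "0 \<le> C" "\<And>f. f\<in>borel_measurable M\<^sub>0 \<Longrightarrow> B.energy \<sigma> q (\<lambda>y. LINT x|M\<^sub>0. kK m x y *\<^sub>R f x) \<le> ennreal C * (\<integral>\<^sup>+y. ennreal (norm (f y) powr q) \<partial>M\<^sub>0)"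
    by blast
  have "B.energy \<sigma> q (K_int_transpose r \<Omega>\<^sub>0 m \<psi>) \<le> ennreal C * (\<integral>\<^sup>+y. ennreal (norm (\<psi> y) powr q) \<partial>M\<^sub>0)" if \<psi>: "\<psi> \<in> borel_measurable borel" for \<psi>
  proof -
    have "B.energy \<sigma> q (K_int_transpose r \<Omega>\<^sub>0 m \<psi>) = B.energy \<sigma> q (\<lambda>y. LINT x|M\<^sub>0. kK m x y *\<^sub>R \<psi> x)"
      by (intro energy_cong K_int_transpose_eq \<psi>)
    then show ?thesis using C(2)[OF borel_measurable_M[OF \<psi>]] by simp
  qed
  then show ?thesis using C by blast
qed

text \<open>Sources on one component, targets on the whole union: this puts the potential into the
  Sobolev space of the union at one stroke, without summing over blocks. Targets off component
  \<open>j\<close> keep the distance \<open>\<delta>\<close> from it, so there the required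
  quadratic bounds follow from linear ones.\<close>

lemma NP_kernel_energy:
  fixes \<sigma> q :: real
  assumes q: "1 < q" and \<sigma>: "0 \<le> \<sigma>" "\<sigma> < 1"
  shows "\<exists>C\<ge>0. \<forall>f\<in>borel_measurable MU. U.energy \<sigma> q (\<lambda>y. LINT x|MU. kN j y x *\<^sub>R f x) \<le> ennreal C * (\<integral>\<^sup>+y. ennreal (norm (f y) powr q) \<partial>MU)"
proof -
  define \<delta> where "\<delta> = sepc * inrad * r ^ j"
  have \<delta>: "0 < \<delta>" using sepc inrad r by (simp add: \<delta>_def)
  \<comment> \<open>\<open>Lc / r ^ j\<close> is the tangency constant of the dilated component, and
    \<open>1 / \<delta>\<close> pays for passing from a linear to a quadratic bound away from
    it.\<close>
  define L where "L = Lc / r ^ j + 1 / \<delta>"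
  have L: "0 \<le> L" "Lc / r ^ j \<le> L" "1 / \<delta> \<le> L" using \<delta> Lc rj[of j] by (auto simp: L_def)
  have kN_eq: "kN j y x = cd * (nhat ((1 / r ^ j) *\<^sub>R x) \<bullet> (x - y)) / norm (y - x) ^ DIM('a)" for x y
    by (simp add: kN_def newton_field_cd norm_minus_commute)
  have un: "(1 / r ^ j) *\<^sub>R x \<in> \<Gamma>\<^sub>0 \<longleftrightarrow> x \<in> \<Gamma> j" for x
    using scale_Gam_iff[of j "(1 / r ^ j) *\<^sub>R x"] by simp
  have nrm: "norm ((1 / r ^ j) *\<^sub>R x - (1 / r ^ j) *\<^sub>R y) = norm (x - y) / r ^ j" for x y :: 'a
    using rj[of j] by (simp flip: scaleR_diff_right)
  have N1: "\<bar>nhat ((1 / r ^ j) *\<^sub>R x) \<bullet> (x - y)\<bar> \<le> L * norm (y - x) ^ 2" if x: "x \<in> \<Gamma>U" and y: "y \<in> \<Gamma>U" for x y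
  proof (cases "x \<in> \<Gamma> j")
    case xj: True
    show ?thesis
    proof (cases "y \<in> \<Gamma> j")
      case True
      have "nhat ((1 / r ^ j) *\<^sub>R x) \<bullet> (x - y) = r ^ j * (nhat ((1 / r ^ j) *\<^sub>R x) \<bullet> ((1 / r ^ j) *\<^sub>R x - (1 / r ^ j) *\<^sub>R y))"
        using rj[of j] by (simp flip: scaleR_diff_right)
      then have "\<bar>nhat ((1 / r ^ j) *\<^sub>R x) \<bullet> (x - y)\<bar> = r ^ j * \<bar>nhat ((1 / r ^ j) *\<^sub>R x) \<bullet> ((1 / r ^ j) *\<^sub>R x - (1 / r ^ j) *\<^sub>R y)\<bar>"
        using rj[of j] by (simp only: abs_mult abs_of_pos)
      also have "\<dots> \<le> r ^ j * (Lc * norm ((1 / r ^ j) *\<^sub>R x - (1 / r ^ j) *\<^sub>R y) ^ 2)"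
        using xj True rj[of j] by (intro mult_left_mono nhat_tangent) (auto simp: un simp del: scaleR_right_diff_distrib)
      also have "\<dots> = Lc / r ^ j * norm (y - x) ^ 2"
        unfolding nrm using rj[of j] by (simp add: power2_eq_square norm_minus_commute)
      also have "\<dots> \<le> L * norm (y - x) ^ 2" using L by (intro mult_right_mono) auto
      finally show ?thesis .
    next
      case False
      obtain i where i: "y \<in> \<Gamma> i" using y by (auto simp: \<Gamma>U_eq)
      then have ij: "j \<noteq> i" using False by auto
      have d: "\<delta> \<le> norm (y - x)" unfolding \<delta>_def using separation_power[OF ij xj i] by (simp add: norm_minus_commute)
      have "\<bar>nhat ((1 / r ^ j) *\<^sub>R x) \<bullet> (x - y)\<bar> \<le> norm (y - x) * 1" using inner_nhat_le[of _ "x - y"] by (simp add: norm_minus_commute)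
      also have "\<dots> \<le> norm (y - x) * (norm (y - x) * (1 / \<delta>))" using d \<delta> by (intro mult_left_mono) auto
      also have "\<dots> = 1 / \<delta> * norm (y - x) ^ 2" by (simp add: power2_eq_square)
      also have "\<dots> \<le> L * norm (y - x) ^ 2" using L by (intro mult_right_mono) auto
      finally show ?thesis .
    qed
  next
    case False
    then have "nhat ((1 / r ^ j) *\<^sub>R x) = 0" using un nhat_zero by blast
    then show ?thesis using L by simp
  qed
  have N2: "\<bar>nhat ((1 / r ^ j) *\<^sub>R x) \<bullet> (y - y')\<bar> \<le> L * norm (y - y') * (norm (y - x) + norm (y - y'))"
    if x: "x \<in> \<Gamma>U" and y: "y \<in> \<Gamma>U" and y': "y' \<in> \<Gamma>U" for x y y'
  proof (cases "x \<in> \<Gamma> j")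
    case xj: True
    \<comment> \<open>If one of the two distances reaches \<open>\<delta>\<close>, the trivial bound
      by \<open>norm (y - y')\<close> is already good enough.\<close>
    have far: ?thesis if f: "\<delta> \<le> norm (y - x) + norm (y - y')"
    proof -
      have "\<bar>nhat ((1 / r ^ j) *\<^sub>R x) \<bullet> (y - y')\<bar> \<le> norm (y - y') * 1" using inner_nhat_le[of _ "y - y'"] by simp
      also have "\<dots> \<le> norm (y - y') * ((1 / \<delta>) * (norm (y - x) + norm (y - y')))" using f \<delta> by (intro mult_left_mono) auto
      also have "\<dots> = (1 / \<delta>) * (norm (y - y') * (norm (y - x) + norm (y - y')))" by simp
      also have "\<dots> \<le> L * (norm (y - y') * (norm (y - x) + norm (y - y')))" using L by (intro mult_right_mono) auto
      finally show ?thesis by simp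
    qed
    obtain i i' where i: "y \<in> \<Gamma> i" "y' \<in> \<Gamma> i'" using y y' by (auto simp: \<Gamma>U_eq)
    consider "i \<noteq> j" | "i = j" "i' \<noteq> j" | "i = j" "i' = j" by blast
    then show ?thesis
    proof cases
      case 1
      have "\<delta> \<le> norm (y - x)" unfolding \<delta>_def using separation_power[OF 1[symmetric] xj i(1)] by (simp add: norm_minus_commute)
      then show ?thesis by (intro far) (simp add: add_increasing2)
    next
      case 2
      have "\<delta> \<le> norm (y - y')" unfolding \<delta>_def using separation_power[OF 2(2)[symmetric], of y y'] i 2(1) by simp
      then show ?thesis by (intro far) (simp add: add_increasing)
    next
      case 3
      have "nhat ((1 / r ^ j) *\<^sub>R x) \<bullet> (y - y') = r ^ j * (nhat ((1 / r ^ j) *\<^sub>R x) \<bullet> ((1 / r ^ j) *\<^sub>R y - (1 / r ^ j) *\<^sub>R y'))"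
        using rj[of j] by (simp flip: scaleR_diff_right)
      then have "\<bar>nhat ((1 / r ^ j) *\<^sub>R x) \<bullet> (y - y')\<bar> = r ^ j * \<bar>nhat ((1 / r ^ j) *\<^sub>R x) \<bullet> ((1 / r ^ j) *\<^sub>R y - (1 / r ^ j) *\<^sub>R y')\<bar>"
        using rj[of j] by (simp only: abs_mult abs_of_pos)
      also have "\<dots> \<le> r ^ j * (Lc * norm ((1 / r ^ j) *\<^sub>R y - (1 / r ^ j) *\<^sub>R y') * (norm ((1 / r ^ j) *\<^sub>R y - (1 / r ^ j) *\<^sub>R x) + norm ((1 / r ^ j) *\<^sub>R y - (1 / r ^ j) *\<^sub>R y')))"
        using xj i 3 rj[of j] by (intro mult_left_mono nhat_increment) (auto simp: un)
      also have "\<dots> = Lc / r ^ j * (norm (y - y') * (norm (y - x) + norm (y - y')))"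
        unfolding nrm using rj[of j] by (simp add: field_simps)
      also have "\<dots> \<le> L * (norm (y - y') * (norm (y - x) + norm (y - y')))" using L by (intro mult_right_mono) auto
      finally show ?thesis by simp
    qed
  next
    case False
    then have "nhat ((1 / r ^ j) *\<^sub>R x) = 0" using un nhat_zero by blast
    then show ?thesis using L by simp
  qed
  show ?thesis unfolding kN_eq
  proof (rule U.normal_kernel_energy[OF q \<sigma> dim2 real_n L(1)])
    show "(\<lambda>(y, x). cd * (nhat ((1 / r ^ j) *\<^sub>R x) \<bullet> (x - y))) \<in> borel_measurable (MU \<Otimes>\<^sub>M MU)"
      by (rule pairM) measurable
    fix y x assume "y \<in> space MU" "x \<in> space MU"
    then have "\<bar>nhat ((1 / r ^ j) *\<^sub>R x) \<bullet> (x - y)\<bar> \<le> L * norm (y - x) ^ 2" by (intro N1) auto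
    then have "cd * \<bar>nhat ((1 / r ^ j) *\<^sub>R x) \<bullet> (x - y)\<bar> \<le> 1 * (L * norm (y - x) ^ 2)" using cd L by (intro mult_mono) auto
    then show "\<bar>cd * (nhat ((1 / r ^ j) *\<^sub>R x) \<bullet> (x - y))\<bar> \<le> L * norm (y - x) ^ 2" using cd by (simp add: abs_mult)
  next
    fix y y' x assume yx: "y \<in> space MU" "y' \<in> space MU" "x \<in> space MU"
    have "cd * \<bar>nhat ((1 / r ^ j) *\<^sub>R x) \<bullet> (y - y')\<bar> \<le> 1 * (L * norm (y - y') * (norm (y - x) + norm (y - y')))"
      using cd L yx by (intro mult_mono N2) auto
    moreover have "\<bar>cd * (nhat ((1 / r ^ j) *\<^sub>R x) \<bullet> (x - y)) - cd * (nhat ((1 / r ^ j) *\<^sub>R x) \<bullet> (x - y'))\<bar> = cd * \<bar>nhat ((1 / r ^ j) *\<^sub>R x) \<bullet> (y - y')\<bar>"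
      using cd by (simp add: right_diff_distrib[symmetric] abs_mult inner_diff_right abs_minus_commute)
    ultimately show "\<bar>cd * (nhat ((1 / r ^ j) *\<^sub>R x) \<bullet> (x - y)) - cd * (nhat ((1 / r ^ j) *\<^sub>R x) \<bullet> (x - y'))\<bar> \<le> L * norm (y - y') * (norm (y - x) + norm (y - y'))"
      by simp
  qed
qed

end

subsection \<open>Rescaling the operators\<close>

context self_similar_boundary
begin

lemma \<Gamma>U_cases:
  assumes "x \<in> \<Gamma>U"
  obtains j x0 where "x0 \<in> \<Gamma>\<^sub>0" "x = r ^ j *\<^sub>R x0" "x \<in> \<Gamma> j"
  using assms by (auto simp: \<Gamma>U_eq Gam_eq)

lemma scale_in_\<Gamma>U: "x \<in> \<Gamma>\<^sub>0 \<Longrightarrow> r ^ j *\<^sub>R x \<in> \<Gamma>U"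
  using scale_Gam_iff Gam_subset by blast

lemma scale_in_Gam: "x \<in> \<Gamma>\<^sub>0 \<Longrightarrow> r ^ j *\<^sub>R x \<in> \<Gamma> i \<longleftrightarrow> i = j"
  using scale_Gam_iff Gam_disjoint by blast

lemma W_iff: "\<phi> \<in> W \<sigma> q \<Gamma>\<^sub>0 \<longleftrightarrow> \<phi> \<in> borel_measurable borel \<and> (\<forall>x. x \<notin> \<Gamma>\<^sub>0 \<longrightarrow> \<phi> x = 0) \<and> B.energy \<sigma> q \<phi> < \<infinity>"
  by (simp add: W_def sobolev_energy_\<Gamma>\<^sub>0)

lemma WU_iff: "\<phi> \<in> W \<sigma> q \<Gamma>U \<longleftrightarrow> \<phi> \<in> borel_measurable borel \<and> (\<forall>x. x \<notin> \<Gamma>U \<longrightarrow> \<phi> x = 0) \<and> U.energy \<sigma> q \<phi> < \<infinity>"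
  by (simp add: W_def sobolev_energy_\<Gamma>U)

lemma measure_M\<^sub>0: "measure M\<^sub>0 (space M\<^sub>0) = measure surf \<Gamma>\<^sub>0"
  by (simp add: measure_restrict_space)

lemma P0_comp_eq: "x \<in> \<Gamma>\<^sub>0 \<Longrightarrow> P0_comp \<Gamma>\<^sub>0 \<phi> x = \<phi> x - (1 / measure M\<^sub>0 (space M\<^sub>0)) *\<^sub>R (LINT y|M\<^sub>0. \<phi> y)"
  unfolding measure_M\<^sub>0 by (simp add: P0_comp_def integral_M)

lemma P0_comp_off: "x \<notin> S \<Longrightarrow> P0_comp S \<phi> x = 0" by (simp add: P0_comp_def)

lemma P0_comp_measurable:
  assumes [measurable]: "\<phi> \<in> borel_measurable borel"
  shows "P0_comp \<Gamma>\<^sub>0 \<phi> \<in> borel_measurable borel"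
proof -
  have "P0_comp \<Gamma>\<^sub>0 \<phi> = (\<lambda>x. if x \<in> \<Gamma>\<^sub>0 then \<phi> x - (1 / measure surf \<Gamma>\<^sub>0) *\<^sub>R (LINT y:\<Gamma>\<^sub>0|surf. \<phi> y) else 0)"
    by (auto simp: P0_comp_def fun_eq_iff)
  then show ?thesis by simp
qed

lemma P0_comp_cong: "(\<And>x. x \<in> \<Gamma>\<^sub>0 \<Longrightarrow> \<phi> x = \<psi> x) \<Longrightarrow> P0_comp \<Gamma>\<^sub>0 \<phi> = P0_comp \<Gamma>\<^sub>0 \<psi>"
proof
  fix x assume eq: "\<And>x. x \<in> \<Gamma>\<^sub>0 \<Longrightarrow> \<phi> x = \<psi> x"
  have "(LINT y:\<Gamma>\<^sub>0|surf. \<phi> y) = (LINT y:\<Gamma>\<^sub>0|surf. \<psi> y)"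
    by (rule set_lebesgue_integral_cong) (auto simp: eq)
  then show "P0_comp \<Gamma>\<^sub>0 \<phi> x = P0_comp \<Gamma>\<^sub>0 \<psi> x" using eq by (simp add: P0_comp_def)
qed

lemma P0_comp_scaleR: "P0_comp \<Gamma>\<^sub>0 (\<lambda>x. c *\<^sub>R \<phi> x) = (\<lambda>x. c *\<^sub>R P0_comp \<Gamma>\<^sub>0 \<phi> x)"
proof
  fix x
  have "(LINT y:\<Gamma>\<^sub>0|surf. c *\<^sub>R \<phi> y) = c *\<^sub>R (LINT y:\<Gamma>\<^sub>0|surf. \<phi> y)"
    by (rule set_integral_scaleR_right)
  then show "P0_comp \<Gamma>\<^sub>0 (\<lambda>x. c *\<^sub>R \<phi> x) x = c *\<^sub>R P0_comp \<Gamma>\<^sub>0 \<phi> x"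
    by (simp add: P0_comp_def scaleR_diff_right mult.commute)
qed

lemma P0_comp_energy:
  assumes q: "1 < q"
  shows "\<exists>C\<ge>0. \<forall>\<phi>\<in>borel_measurable borel. B.energy \<sigma> q (P0_comp \<Gamma>\<^sub>0 \<phi>) \<le> ennreal C * B.energy \<sigma> q \<phi>"
proof -
  obtain C where C: "0 \<le> C" "\<And>\<phi>. \<phi>\<in>borel_measurable M\<^sub>0 \<Longrightarrow>
    B.energy \<sigma> q (\<lambda>x. \<phi> x - (1 / measure M\<^sub>0 (space M\<^sub>0)) *\<^sub>R (LINT y|M\<^sub>0. \<phi> y)) \<le> ennreal C * B.energy \<sigma> q \<phi>"
    using B.mean_free_energy[OF q] by blast
  have "B.energy \<sigma> q (P0_comp \<Gamma>\<^sub>0 \<phi>) = B.energy \<sigma> q (\<lambda>x. \<phi> x - (1 / measure M\<^sub>0 (space M\<^sub>0)) *\<^sub>R (LINT y|M\<^sub>0. \<phi> y))" for \<phi>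
    by (intro energy_cong P0_comp_eq)
  then show ?thesis using C borel_measurable_M by metis
qed

lemma integral_M\<^sub>0_null:
  fixes f :: "'a \<Rightarrow> complex"
  assumes "measure M\<^sub>0 (space M\<^sub>0) = 0"
  shows "(LINT x|M\<^sub>0. f x) = 0"
proof -
  have "emeasure M\<^sub>0 (space M\<^sub>0) = 0" using assms by (simp add: B.emeasure_eq_measure)
  then have "AE x in M\<^sub>0. False" by (intro AE_I[OF _ _ sets.top]) auto
  then have "AE x in M\<^sub>0. f x = 0" by (auto elim!: eventually_mono)
  then show ?thesis by (rule integral_eq_zero_AE)
qed

lemma P0_comp_integral:
  assumes int: "integrable M\<^sub>0 \<phi>"
  shows "(LINT x|M\<^sub>0. P0_comp \<Gamma>\<^sub>0 \<phi> x) = 0"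
proof (cases "measure M\<^sub>0 (space M\<^sub>0) = 0")
  case False
  let ?m = "measure M\<^sub>0 (space M\<^sub>0)"
  have "(LINT x|M\<^sub>0. P0_comp \<Gamma>\<^sub>0 \<phi> x) = (LINT x|M\<^sub>0. \<phi> x - (1 / ?m) *\<^sub>R (LINT y|M\<^sub>0. \<phi> y))"
    by (rule Bochner_Integration.integral_cong) (auto simp only: space_M\<^sub>0 P0_comp_eq)
  also have "\<dots> = (LINT x|M\<^sub>0. \<phi> x) - ?m *\<^sub>R ((1 / ?m) *\<^sub>R (LINT y|M\<^sub>0. \<phi> y))"
    using int by (subst Bochner_Integration.integral_diff) auto
  also have "\<dots> = 0" using False by simp
  finally show ?thesis .
qed (rule integral_M\<^sub>0_null)

section \<open>Dilation of mean values and of the kernel\<close>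

lemma measure_Gam: "measure surf (\<Gamma> j) = (r ^ j) ^ n * measure surf \<Gamma>\<^sub>0"
proof -
  have "emeasure surf (\<Gamma> j) = ennreal ((r ^ j) ^ n) * emeasure surf \<Gamma>\<^sub>0"
  proof -
    have "emeasure surf (\<Gamma> j) = hausdorff_outer n (\<Gamma> j)" unfolding n_eq by (rule emeasure_surf[OF dim2 Gam_sets])
    also have "\<dots> = ennreal ((r ^ j) ^ n) * hausdorff_outer n \<Gamma>\<^sub>0" unfolding Gam_eq by (rule hausdorff_outer_scale[OF rj(1)])
    also have "hausdorff_outer n \<Gamma>\<^sub>0 = emeasure surf \<Gamma>\<^sub>0" by (simp add: emeasure_surf[OF dim2] n_eq)
    finally show ?thesis .
  qed
  then show ?thesis using rj[of j] by (simp add: measure_def enn2real_mult)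
qed

lemma set_integral_Gam:
  fixes f :: "'a \<Rightarrow> complex"
  assumes f: "f \<in> borel_measurable borel"
  shows "(LINT x:\<Gamma> j|surf. f x) = ((r ^ j) ^ n) *\<^sub>R (LINT x:\<Gamma>\<^sub>0|surf. f (r ^ j *\<^sub>R x))"
  unfolding Gam_eq n_eq by (rule set_integral_surf_scale[OF dim2 rj(1) \<Gamma>\<^sub>0_sets f])

text \<open>The Jacobian cancels between the integral and the measure of the component, so mean
  values are dilation invariant. The pulled-back function is a separate \<open>v\<close> because
  measurability is known for it rather than for \<open>u\<close>.\<close>

lemma P0_scale:
  assumes v: "v \<in> borel_measurable borel" and uv: "\<And>x. x \<in> \<Gamma>\<^sub>0 \<Longrightarrow> u (r ^ j *\<^sub>R x) = v x" and x: "x \<in> \<Gamma>\<^sub>0"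
  shows "P0 r \<Omega>\<^sub>0 u (r ^ j *\<^sub>R x) = P0_comp \<Gamma>\<^sub>0 v x"
proof -
  have z: "r ^ j *\<^sub>R x \<in> \<Gamma> j" using x by (simp add: scale_Gam_iff)
  have "(LINT y:\<Gamma> j|surf. u y) = (LINT y:\<Gamma> j|surf. v ((1 / r ^ j) *\<^sub>R y))"
  proof (rule set_lebesgue_integral_cong)
    show "\<Gamma> j \<in> sets surf" using Gam_sets by simp
    show "\<forall>y. y \<in> \<Gamma> j \<longrightarrow> u y = v ((1 / r ^ j) *\<^sub>R y)" by (auto simp: Gam_eq uv)
  qed
  also have "\<dots> = ((r ^ j) ^ n) *\<^sub>R (LINT y:\<Gamma>\<^sub>0|surf. v y)"
    using set_integral_Gam[OF scale_measurable[OF v], of j] by simp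
  finally have "(1 / measure surf (\<Gamma> j)) *\<^sub>R (LINT y:\<Gamma> j|surf. u y) = (1 / measure surf \<Gamma>\<^sub>0) *\<^sub>R (LINT y:\<Gamma>\<^sub>0|surf. v y)"
    using rj[of j] by (simp add: measure_Gam)
  then show ?thesis
    using z x uv[OF x] scale_in_\<Gamma>U[OF x] by (simp add: P0_def component_index_eq[OF z] P0_comp_def)
qed

text \<open>The source of the Toeplitz structure: once \<open>r ^ k\<close> is factored out, the
  remaining difference depends on the indices through \<open>j - k\<close> alone.\<close>

lemma newton_field_eta:
  fixes x y :: 'a
  shows "newton_field (r ^ j *\<^sub>R x - r ^ k *\<^sub>R y) = (1 / (r ^ k) ^ n) *\<^sub>R newton_field (eta r (int j - int k) x - y)"
proof -
  have "r ^ j *\<^sub>R x - r ^ k *\<^sub>R y = r ^ k *\<^sub>R (eta r (int j - int k) x - y)"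
    using r by (simp add: eta_def power_int_diff scaleR_diff_right)
  then show ?thesis by (simp only: newton_field_scale[OF rj(1)] n_eq)
qed

text \<open>The Jacobian of the source component and the homogeneity factor of the field are inverse
  to each other, so no power of \<open>r\<close> remains.\<close>

lemma NP_adj_scale:
  assumes \<phi> [measurable]: "\<phi> \<in> borel_measurable borel" and supp: "\<And>x. x \<notin> \<Gamma> k \<Longrightarrow> \<phi> x = 0" and x: "x \<in> \<Gamma>\<^sub>0"
  shows "NP_adj r \<Omega>\<^sub>0 \<phi> (r ^ j *\<^sub>R x) = K_int r \<Omega>\<^sub>0 (int j - int k) (\<lambda>y. \<phi> (r ^ k *\<^sub>R y)) x"
proof -
  let ?z = "r ^ j *\<^sub>R x"
  let ?F = "\<lambda>i. LINT y:\<Gamma> i|surf. (nu r \<Omega>\<^sub>0 ?z \<bullet> grad1_G ?z y) *\<^sub>R \<phi> y"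
  have [measurable]: "(\<lambda>y. \<phi> (r ^ k *\<^sub>R y)) \<in> borel_measurable borel" by (rule scale_measurable[OF \<phi>])
  have zero: "?F i = 0" if "i \<noteq> k" for i
  proof -
    have "\<phi> y = 0" if "y \<in> \<Gamma> i" for y using supp Gam_disjoint \<open>i \<noteq> k\<close> that by blast
    then have "?F i = (LINT y:\<Gamma> i|surf. 0)" by (intro set_lebesgue_integral_cong) auto
    then show ?thesis by (simp add: set_lebesgue_integral_def)
  qed
  have "NP_adj r \<Omega>\<^sub>0 \<phi> ?z = (\<Sum>i. ?F i)" using scale_in_\<Gamma>U[OF x] by (simp add: NP_adj_def)
  also have "\<dots> = (\<Sum>i\<in>{k}. ?F i)" by (rule suminf_finite) (auto simp: zero)
  also have "\<dots> = ?F k" by simp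
  also have "\<dots> = (LINT y:\<Gamma> k|surf. (nhat x \<bullet> newton_field (?z - y)) *\<^sub>R \<phi> y)"
  proof (rule set_integral_surf_cong_except[OF dim2 Gam_sets])
    show "(\<lambda>y. (nhat x \<bullet> newton_field (?z - y)) *\<^sub>R \<phi> y) \<in> borel_measurable borel" by measurable
    show "(nu r \<Omega>\<^sub>0 ?z \<bullet> grad1_G ?z y) *\<^sub>R \<phi> y = (nhat x \<bullet> newton_field (?z - y)) *\<^sub>R \<phi> y" if "y \<noteq> ?z" for y
      using that x by (simp add: nu_eq nhat_eq grad1_G_eq[OF dim])
  qed
  also have "\<dots> = ((r ^ k) ^ n) *\<^sub>R (LINT y:\<Gamma>\<^sub>0|surf. (nhat x \<bullet> newton_field (?z - r ^ k *\<^sub>R y)) *\<^sub>R \<phi> (r ^ k *\<^sub>R y))"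
    by (rule set_integral_Gam) measurable
  also have "\<dots> = (LINT y:\<Gamma>\<^sub>0|surf. ((r ^ k) ^ n) *\<^sub>R ((nhat x \<bullet> newton_field (?z - r ^ k *\<^sub>R y)) *\<^sub>R \<phi> (r ^ k *\<^sub>R y)))"
    by (rule set_integral_scaleR_right[symmetric])
  also have "\<dots> = (LINT y:\<Gamma>\<^sub>0|surf. kK (int j - int k) x y *\<^sub>R \<phi> (r ^ k *\<^sub>R y))"
    using rj[of k] by (simp add: newton_field_eta kK_def)
  also have "\<dots> = K_int r \<Omega>\<^sub>0 (int j - int k) (\<lambda>y. \<phi> (r ^ k *\<^sub>R y)) x"
    by (subst K_int_eq) (auto simp: x integral_M)
  finally show ?thesis .
qed

lemma NP_supported:
  assumes g [measurable]: "g \<in> borel_measurable borel" and supp: "\<And>x. x \<notin> \<Gamma> j \<Longrightarrow> g x = 0" and y: "y \<in> \<Gamma>U"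
  shows "NP r \<Omega>\<^sub>0 g y = (LINT x:\<Gamma> j|surf. kN j y x *\<^sub>R g x)"
proof -
  let ?F = "\<lambda>i. LINT x:\<Gamma> i|surf. (nu r \<Omega>\<^sub>0 x \<bullet> grad1_G x y) *\<^sub>R g x"
  have zero: "?F i = 0" if "i \<noteq> j" for i
  proof -
    have "g x = 0" if "x \<in> \<Gamma> i" for x using supp Gam_disjoint \<open>i \<noteq> j\<close> that by blast
    then have "?F i = (LINT y:\<Gamma> i|surf. 0)" by (intro set_lebesgue_integral_cong) auto
    then show ?thesis by (simp add: set_lebesgue_integral_def)
  qed
  have "NP r \<Omega>\<^sub>0 g y = (\<Sum>i. ?F i)" using y by (simp add: NP_def)
  also have "\<dots> = (\<Sum>i\<in>{j}. ?F i)" by (rule suminf_finite) (auto simp: zero)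
  also have "\<dots> = ?F j" by simp
  also have "\<dots> = (LINT x:\<Gamma> j|surf. kN j y x *\<^sub>R g x)"
  proof (rule set_integral_surf_cong_except[OF dim2 Gam_sets])
    show "(\<lambda>x. kN j y x *\<^sub>R g x) \<in> borel_measurable borel" unfolding kN_def by measurable
    show "(nu r \<Omega>\<^sub>0 x \<bullet> grad1_G x y) *\<^sub>R g x = kN j y x *\<^sub>R g x" if x: "x \<in> \<Gamma> j" and "x \<noteq> y" for x
    proof -
      have "nu r \<Omega>\<^sub>0 (r ^ j *\<^sub>R ((1 / r ^ j) *\<^sub>R x)) = nhat ((1 / r ^ j) *\<^sub>R x)"
        using unscale_Gam[OF x] by (simp only: nu_eq nhat_eq)
      then show ?thesis using \<open>x \<noteq> y\<close> by (simp add: kN_def grad1_G_eq[OF dim])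
    qed
  qed
  finally show ?thesis .
qed

lemma NP_eq_integral_MU:
  assumes g: "g \<in> borel_measurable borel" and supp: "\<And>x. x \<notin> \<Gamma> j \<Longrightarrow> g x = 0" and y: "y \<in> \<Gamma>U"
  shows "NP r \<Omega>\<^sub>0 g y = (LINT x|MU. kN j y x *\<^sub>R g x)"
proof -
  have "(LINT x:\<Gamma> j|surf. kN j y x *\<^sub>R g x) = (LINT x:\<Gamma>U|surf. kN j y x *\<^sub>R g x)"
    unfolding set_lebesgue_integral_def
    by (rule Bochner_Integration.integral_cong) (use supp Gam_subset[of j] in \<open>auto simp: indicator_def\<close>)
  then show ?thesis using NP_supported[OF assms] by (simp add: integral_M)
qed

text \<open>For the transpose the Jacobian belongs to \<open>j\<close> but the homogeneity factor to
  \<open>k\<close>. Their quotient is compensated later by the Jacobians built into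
  \<open>rescale_neg\<close>.\<close>

lemma NP_scale:
  assumes g [measurable]: "g \<in> borel_measurable borel" and supp: "\<And>x. x \<notin> \<Gamma> j \<Longrightarrow> g x = 0" and y: "y \<in> \<Gamma>\<^sub>0"
  shows "NP r \<Omega>\<^sub>0 g (r ^ k *\<^sub>R y) = ((r ^ j) ^ n / (r ^ k) ^ n) *\<^sub>R K_int_transpose r \<Omega>\<^sub>0 (int j - int k) (\<lambda>x. g (r ^ j *\<^sub>R x)) y"
proof -
  have [measurable]: "(\<lambda>y. g (r ^ j *\<^sub>R y)) \<in> borel_measurable borel" by (rule scale_measurable[OF g])
  have "NP r \<Omega>\<^sub>0 g (r ^ k *\<^sub>R y) = (LINT x:\<Gamma> j|surf. kN j (r ^ k *\<^sub>R y) x *\<^sub>R g x)"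
    by (rule NP_supported[OF g supp scale_in_\<Gamma>U[OF y]])
  also have "\<dots> = ((r ^ j) ^ n) *\<^sub>R (LINT x:\<Gamma>\<^sub>0|surf. kN j (r ^ k *\<^sub>R y) (r ^ j *\<^sub>R x) *\<^sub>R g (r ^ j *\<^sub>R x))"
    by (rule set_integral_Gam) (unfold kN_def, measurable)
  also have "\<dots> = ((r ^ j) ^ n) *\<^sub>R (LINT x:\<Gamma>\<^sub>0|surf. (1 / (r ^ k) ^ n) *\<^sub>R (kK (int j - int k) x y *\<^sub>R g (r ^ j *\<^sub>R x)))"
    by (simp add: kN_def newton_field_eta kK_def)
  also have "\<dots> = ((r ^ j) ^ n / (r ^ k) ^ n) *\<^sub>R (LINT x:\<Gamma>\<^sub>0|surf. kK (int j - int k) x y *\<^sub>R g (r ^ j *\<^sub>R x))"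
    by (subst set_integral_scaleR_right) simp
  also have "(LINT x:\<Gamma>\<^sub>0|surf. kK (int j - int k) x y *\<^sub>R g (r ^ j *\<^sub>R x)) = K_int_transpose r \<Omega>\<^sub>0 (int j - int k) (\<lambda>x. g (r ^ j *\<^sub>R x)) y"
    by (subst K_int_transpose_eq) (auto simp: y integral_M)
  finally show ?thesis .
qed

section \<open>Extension by zero and mapping properties of the blocks\<close>

definition ext :: "nat \<Rightarrow> ('a \<Rightarrow> complex) \<Rightarrow> 'a \<Rightarrow> complex" where
  "ext k h x = (if x \<in> \<Gamma> k then h (eta r (- int k) x) else 0)"

lemma ext_scale: "x \<in> \<Gamma>\<^sub>0 \<Longrightarrow> ext k h (r ^ i *\<^sub>R x) = (if i = k then h x else 0)"
  by (auto simp: ext_def scale_in_Gam eta_minus_nat)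

lemma ext_off: "x \<notin> \<Gamma> k \<Longrightarrow> ext k h x = 0" by (simp add: ext_def)

lemma ext_measurable: "h \<in> borel_measurable borel \<Longrightarrow> ext k h \<in> borel_measurable borel"
proof -
  assume [measurable]: "h \<in> borel_measurable borel"
  have "(\<lambda>x. if x \<in> \<Gamma> k then h (eta r (- int k) x) else 0) \<in> borel_measurable borel" by measurable
  then show ?thesis by (simp add: ext_def[abs_def])
qed

lemma U_energy_finite:
  fixes \<sigma> q :: real
  assumes q: "1 < q" and \<sigma>: "0 \<le> \<sigma>" and w: "w \<in> borel_measurable borel"
    and s: "(\<Sum>i. ennreal ((r ^ i) powr (n - \<sigma> * q)) * B.energy \<sigma> q (\<lambda>x. w (r ^ i *\<^sub>R x))) < \<infinity>"
  shows "U.energy \<sigma> q w < \<infinity>"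
proof -
  obtain C where "0 \<le> C" "\<And>w. w\<in>borel_measurable borel \<Longrightarrow> U.energy \<sigma> q w \<le>
    ennreal C * (\<Sum>i. ennreal ((r ^ i) powr (n - \<sigma> * q)) * B.energy \<sigma> q (\<lambda>x. w (r ^ i *\<^sub>R x)))"
    using glue_energy[OF q \<sigma>] by blast
  then have "U.energy \<sigma> q w \<le> ennreal C * (\<Sum>i. ennreal ((r ^ i) powr (n - \<sigma> * q)) * B.energy \<sigma> q (\<lambda>x. w (r ^ i *\<^sub>R x)))"
    using w by blast
  also have "\<dots> < \<infinity>" using s by (simp add: ennreal_mult_less_top)
  finally show ?thesis .
qed

lemma energy_zero_fun: "0 < q \<Longrightarrow> B.energy \<sigma> q (\<lambda>x. 0) = 0"
  by (simp add: B.energy_def)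

text \<open>In the series of \<open>U_energy_finite\<close> only the term of component
  \<open>k\<close> is nonzero.\<close>

lemma ext_energy:
  fixes \<sigma> q :: real
  assumes q: "1 < q" and \<sigma>: "0 \<le> \<sigma>" and h: "h \<in> borel_measurable borel" and fin: "B.energy \<sigma> q h < \<infinity>"
  shows "U.energy \<sigma> q (ext k h) < \<infinity>"
proof (rule U_energy_finite[OF q \<sigma> ext_measurable[OF h]])
  have "B.energy \<sigma> q (\<lambda>x. ext k h (r ^ i *\<^sub>R x)) = B.energy \<sigma> q (\<lambda>x. if i = k then h x else 0)" for i
    by (rule energy_cong) (simp add: ext_scale)
  then have e: "B.energy \<sigma> q (\<lambda>x. ext k h (r ^ i *\<^sub>R x)) = (if i = k then B.energy \<sigma> q h else 0)" for i
    using q by (simp add: energy_zero_fun)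
  have "(\<Sum>i. ennreal ((r ^ i) powr (n - \<sigma> * q)) * B.energy \<sigma> q (\<lambda>x. ext k h (r ^ i *\<^sub>R x)))
     = (\<Sum>i\<in>{k}. ennreal ((r ^ i) powr (n - \<sigma> * q)) * B.energy \<sigma> q (\<lambda>x. ext k h (r ^ i *\<^sub>R x)))"
    by (rule suminf_finite) (auto simp: e)
  also have "\<dots> < \<infinity>" using fin by (simp add: e ennreal_mult_less_top)
  finally show "(\<Sum>i. ennreal ((r ^ i) powr (n - \<sigma> * q)) * B.energy \<sigma> q (\<lambda>x. ext k h (r ^ i *\<^sub>R x))) < \<infinity>" .
qed

lemma ext_W:
  assumes q: "1 < q" and \<sigma>: "0 \<le> \<sigma>" and h: "h \<in> W \<sigma> q \<Gamma>\<^sub>0"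
  shows "ext k h \<in> W \<sigma> q \<Gamma>U"
  using h ext_energy[OF q \<sigma>, of h k] ext_measurable[of h k] Gam_subset[of k]
  by (auto simp: WU_iff W_iff intro!: ext_off)

lemma P0_comp_W:
  assumes q: "1 < q" and h: "h \<in> W \<sigma> q \<Gamma>\<^sub>0"
  shows "P0_comp \<Gamma>\<^sub>0 h \<in> W \<sigma> q \<Gamma>\<^sub>0"
proof -
  obtain C where "0 \<le> C" "\<And>\<phi>. \<phi>\<in>borel_measurable borel \<Longrightarrow> B.energy \<sigma> q (P0_comp \<Gamma>\<^sub>0 \<phi>) \<le> ennreal C * B.energy \<sigma> q \<phi>"
    using P0_comp_energy[OF q] by blast
  then have "B.energy \<sigma> q (P0_comp \<Gamma>\<^sub>0 h) \<le> ennreal C * B.energy \<sigma> q h" using h by (simp add: W_iff)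
  also have "\<dots> < \<infinity>" using h by (simp add: W_iff ennreal_mult_less_top)
  finally show ?thesis using h by (simp add: W_iff P0_comp_measurable P0_comp_off)
qed

lemma Lq_le_energy: "(\<integral>\<^sup>+y. ennreal (norm (\<psi> y) powr q) \<partial>M\<^sub>0) \<le> B.energy \<sigma> q \<psi>"
  by (simp add: B.energy_def add_increasing2)

lemma K_int_W:
  assumes q: "1 < q" and \<sigma>: "0 \<le> \<sigma>" "\<sigma> < 1" and h: "h \<in> W \<sigma> q \<Gamma>\<^sub>0"
  shows "K_int r \<Omega>\<^sub>0 m h \<in> W \<sigma> q \<Gamma>\<^sub>0"
proof -
  obtain C where "0 \<le> C" "\<And>\<psi>. \<psi>\<in>borel_measurable borel \<Longrightarrow> B.energy \<sigma> q (K_int r \<Omega>\<^sub>0 m \<psi>) \<le> ennreal C * (\<integral>\<^sup>+y. ennreal (norm (\<psi> y) powr q) \<partial>M\<^sub>0)"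
    using K_int_energy[OF q \<sigma>] by blast
  then have "B.energy \<sigma> q (K_int r \<Omega>\<^sub>0 m h) \<le> ennreal C * (\<integral>\<^sup>+y. ennreal (norm (h y) powr q) \<partial>M\<^sub>0)" using h by (simp add: W_iff)
  also have "\<dots> \<le> ennreal C * B.energy \<sigma> q h" by (intro mult_left_mono Lq_le_energy) simp
  also have "\<dots> < \<infinity>" using h by (simp add: W_iff ennreal_mult_less_top)
  finally show ?thesis using h by (simp add: W_iff K_int_measurable) (simp add: K_int_def)
qed

lemma K_int_transpose_W:
  assumes q: "1 < q" and \<sigma>: "0 \<le> \<sigma>" "\<sigma> < 1" and h: "h \<in> W \<sigma> q \<Gamma>\<^sub>0"
  shows "K_int_transpose r \<Omega>\<^sub>0 m h \<in> W \<sigma> q \<Gamma>\<^sub>0"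
proof -
  obtain C where "0 \<le> C" "\<And>\<psi>. \<psi>\<in>borel_measurable borel \<Longrightarrow> B.energy \<sigma> q (K_int_transpose r \<Omega>\<^sub>0 m \<psi>) \<le> ennreal C * (\<integral>\<^sup>+y. ennreal (norm (\<psi> y) powr q) \<partial>M\<^sub>0)"
    using K_int_transpose_energy[OF q \<sigma>] by blast
  then have "B.energy \<sigma> q (K_int_transpose r \<Omega>\<^sub>0 m h) \<le> ennreal C * (\<integral>\<^sup>+y. ennreal (norm (h y) powr q) \<partial>M\<^sub>0)" using h by (simp add: W_iff)
  also have "\<dots> \<le> ennreal C * B.energy \<sigma> q h" by (intro mult_left_mono Lq_le_energy) simp
  also have "\<dots> < \<infinity>" using h by (simp add: W_iff ennreal_mult_less_top)
  finally show ?thesis using h by (simp add: W_iff K_int_transpose_measurable) (simp add: K_int_transpose_def)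
qed

lemma W_integrable: "1 < q \<Longrightarrow> h \<in> W \<sigma> q \<Gamma>\<^sub>0 \<Longrightarrow> integrable M\<^sub>0 h"
  by (rule B.integrable_of_energy) (auto simp: W_iff borel_measurable_M)

lemma W_zero: "0 < q \<Longrightarrow> (\<lambda>x. 0) \<in> W \<sigma> q \<Gamma>\<^sub>0"
  by (simp add: W_iff energy_zero_fun)

lemma W_cmult: assumes h: "h \<in> W \<sigma> q \<Gamma>\<^sub>0" shows "(\<lambda>x. c * h x) \<in> W \<sigma> q \<Gamma>\<^sub>0"
proof -
  have [measurable]: "h \<in> borel_measurable borel" using h by (simp add: W_iff)
  have "(\<lambda>x. c * h x) \<in> borel_measurable borel" by measurable
  then show ?thesis using h by (simp add: W_iff B.energy_cmult[OF borel_measurable_M] ennreal_mult_less_top)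
qed

lemma W_scaleR: "h \<in> W \<sigma> q \<Gamma>\<^sub>0 \<Longrightarrow> (\<lambda>x. c *\<^sub>R h x) \<in> W \<sigma> q \<Gamma>\<^sub>0"
  using W_cmult[of h \<sigma> q "of_real c"] by (simp add: scaleR_conv_of_real)

lemma W_add:
  assumes q: "1 < q" and gh: "g \<in> W \<sigma> q \<Gamma>\<^sub>0" "h \<in> W \<sigma> q \<Gamma>\<^sub>0"
  shows "(\<lambda>x. g x + h x) \<in> W \<sigma> q \<Gamma>\<^sub>0"
proof -
  have [measurable]: "g \<in> borel_measurable borel" "h \<in> borel_measurable borel" using gh by (simp_all add: W_iff)
  have m: "(\<lambda>x. g x + h x) \<in> borel_measurable borel" by measurable
  have "B.energy \<sigma> q (\<lambda>x. g x + h x) \<le> ennreal (2 powr q) * (B.energy \<sigma> q g + B.energy \<sigma> q h)"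
    by (intro B.energy_add q borel_measurable_M) measurable
  also have "\<dots> < \<infinity>" using gh by (simp add: W_iff ennreal_mult_less_top)
  finally show ?thesis using gh m by (simp add: W_iff)
qed

lemma WU_cmult: assumes h: "h \<in> W \<sigma> q \<Gamma>U" shows "(\<lambda>x. c * h x) \<in> W \<sigma> q \<Gamma>U"
proof -
  have [measurable]: "h \<in> borel_measurable borel" using h by (simp add: WU_iff)
  have "(\<lambda>x. c * h x) \<in> borel_measurable borel" by measurable
  then show ?thesis using h by (simp add: WU_iff U.energy_cmult[OF borel_measurable_M] ennreal_mult_less_top)
qed

lemma WU_add:
  assumes q: "1 < q" and gh: "g \<in> W \<sigma> q \<Gamma>U" "h \<in> W \<sigma> q \<Gamma>U"
  shows "(\<lambda>x. g x + h x) \<in> W \<sigma> q \<Gamma>U"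
proof -
  have [measurable]: "g \<in> borel_measurable borel" "h \<in> borel_measurable borel" using gh by (simp_all add: WU_iff)
  have m: "(\<lambda>x. g x + h x) \<in> borel_measurable borel" by measurable
  have "U.energy \<sigma> q (\<lambda>x. g x + h x) \<le> ennreal (2 powr q) * (U.energy \<sigma> q g + U.energy \<sigma> q h)"
    by (intro U.energy_add q borel_measurable_M) measurable
  also have "\<dots> < \<infinity>" using gh by (simp add: WU_iff ennreal_mult_less_top)
  finally show ?thesis using gh m by (simp add: WU_iff)
qed

lemma K_tilde_W0:
  assumes p: "1 < p" and s: "0 \<le> s" "s < 1" and \<psi>: "\<psi> \<in> W0_comp s p \<Gamma>\<^sub>0"
  shows "K_tilde r \<Omega>\<^sub>0 m \<psi> \<in> W0_comp s p \<Gamma>\<^sub>0"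
proof -
  have W: "K_int r \<Omega>\<^sub>0 m \<psi> \<in> W s p \<Gamma>\<^sub>0" using \<psi> by (intro K_int_W p s) (simp add: W0_comp_def)
  then have "(LINT x|M\<^sub>0. P0_comp \<Gamma>\<^sub>0 (K_int r \<Omega>\<^sub>0 m \<psi>) x) = 0"
    by (intro P0_comp_integral W_integrable[OF p])
  then show ?thesis using P0_comp_W[OF p W] by (simp add: W0_comp_def K_tilde_def integral_M)
qed

section \<open>Block representation for nonnegative order\<close>

lemma K_int_scaleR: "K_int r \<Omega>\<^sub>0 m (\<lambda>y. c *\<^sub>R \<psi> y) = (\<lambda>x. c *\<^sub>R K_int r \<Omega>\<^sub>0 m \<psi> x)"
proof
  fix x
  have "(LINT y:\<Gamma>\<^sub>0|surf. (outer_normal \<Omega>\<^sub>0 x \<bullet> grad1_G (eta r m x) y) *\<^sub>R (c *\<^sub>R \<psi> y)) =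
    c *\<^sub>R (LINT y:\<Gamma>\<^sub>0|surf. (outer_normal \<Omega>\<^sub>0 x \<bullet> grad1_G (eta r m x) y) *\<^sub>R \<psi> y)"
    by (subst set_integral_scaleR_right[symmetric]) (simp add: mult.commute)
  then show "K_int r \<Omega>\<^sub>0 m (\<lambda>y. c *\<^sub>R \<psi> y) x = c *\<^sub>R K_int r \<Omega>\<^sub>0 m \<psi> x"
    by (simp add: K_int_def)
qed

lemma K_int_cong: "(\<And>y. y \<in> \<Gamma>\<^sub>0 \<Longrightarrow> \<phi> y = \<psi> y) \<Longrightarrow> K_int r \<Omega>\<^sub>0 m \<phi> = K_int r \<Omega>\<^sub>0 m \<psi>"
  by (auto simp: K_int_def fun_eq_iff intro!: set_lebesgue_integral_cong)

lemma K_int_transpose_cong: "(\<And>y. y \<in> \<Gamma>\<^sub>0 \<Longrightarrow> \<phi> y = \<psi> y) \<Longrightarrow> K_int_transpose r \<Omega>\<^sub>0 m \<phi> = K_int_transpose r \<Omega>\<^sub>0 m \<psi>"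
  by (auto simp: K_int_transpose_def fun_eq_iff intro!: set_lebesgue_integral_cong)

text \<open>A sequence with one nonzero entry has an explicit preimage, the multiple
  \<open>c\<close> of \<open>\<psi>\<close> extended by 0, and injectivity identifies it with the
  value of \<open>inv_into\<close>. The powers of \<open>r\<close> from passing to component
  \<open>k\<close> and back from component \<open>j\<close> combine.\<close>

lemma block_positive:
  assumes p: "1 < p" and s: "0 \<le> s" "s < 1" and \<psi>: "\<psi> \<in> W0_comp s p \<Gamma>\<^sub>0"
  shows "block (\<lambda>x. 0) (scaled_NP s p \<alpha> r \<Omega>\<^sub>0) j k \<psi> =
    (\<lambda>x. (r powr ((real j - real k) * \<alpha>)) *\<^sub>R K_tilde r \<Omega>\<^sub>0 (int j - int k) \<psi> x)"
proof -
  define f where "f = (\<lambda>i. (\<lambda>x. 0) :: 'a \<Rightarrow> complex)(k := \<psi>)"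
  have \<psi>W: "\<psi> \<in> W s p \<Gamma>\<^sub>0" and \<psi>int: "(LINT x:\<Gamma>\<^sub>0|surf. \<psi> x) = 0" using \<psi> by (auto simp: W0_comp_def)
  then have \<psi>m [measurable]: "\<psi> \<in> borel_measurable borel" and \<psi>off: "\<And>x. x \<notin> \<Gamma>\<^sub>0 \<Longrightarrow> \<psi> x = 0" by (auto simp: W_iff)
  have f_ell: "f \<in> ell p (W0_comp s p \<Gamma>\<^sub>0) (sobolev_norm s p \<Gamma>\<^sub>0)"
  proof -
    have "(\<lambda>x. 0) \<in> W0_comp s p \<Gamma>\<^sub>0" using p W_zero[of p s] by (simp add: W0_comp_def set_lebesgue_integral_def)
    moreover have "summable (\<lambda>j. sobolev_norm s p \<Gamma>\<^sub>0 (f j) powr p)"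
    proof (rule summable_finite[of "{k}"])
      fix i assume "i \<notin> {k}"
      then show "sobolev_norm s p \<Gamma>\<^sub>0 (f i) powr p = 0"
        using p by (simp add: f_def sobolev_norm_def sobolev_energy_\<Gamma>\<^sub>0 energy_zero_fun)
    qed simp
    ultimately show ?thesis using \<psi> by (simp add: ell_def f_def)
  qed
  define c where "c = r powr (- real k * \<alpha>)"
  define h where "h x = c *\<^sub>R \<psi> x" for x
  have hW: "h \<in> W s p \<Gamma>\<^sub>0" unfolding h_def by (rule W_scaleR[OF \<psi>W])
  then have hm: "h \<in> borel_measurable borel" by (simp add: W_iff)
  define \<phi> where "\<phi> = ext k h"
  have \<phi>m: "\<phi> \<in> borel_measurable borel" unfolding \<phi>_def by (rule ext_measurable[OF hm])
  have \<phi>s: "\<phi> (r ^ i *\<^sub>R x) = (if i = k then h x else 0)" if "x \<in> \<Gamma>\<^sub>0" for i x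
    using that by (simp add: \<phi>_def ext_scale)
  have \<phi>int: "(LINT x:\<Gamma> i|surf. \<phi> x) = 0" for i
  proof -
    have "(LINT x:\<Gamma>\<^sub>0|surf. \<phi> (r ^ i *\<^sub>R x)) = (LINT x:\<Gamma>\<^sub>0|surf. if i = k then c *\<^sub>R \<psi> x else 0)"
      by (rule set_lebesgue_integral_cong) (auto simp: \<phi>s h_def)
    also have "\<dots> = 0"
    proof (cases "i = k")
      case True
      then show ?thesis using \<psi>int by simp
    qed (simp add: set_lebesgue_integral_def)
    finally show ?thesis by (simp add: set_integral_Gam[OF \<phi>m])
  qed
  have \<phi>W: "\<phi> \<in> W0 s p r \<Omega>\<^sub>0" using ext_W[OF p s(1) hW, of k] \<phi>int by (simp add: W0_def \<phi>_def)
  have resc: "rescale \<alpha> r \<Omega>\<^sub>0 \<phi> = f"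
  proof (intro ext)
    fix i x
    show "rescale \<alpha> r \<Omega>\<^sub>0 \<phi> i x = f i x"
    proof (cases "x \<in> \<Gamma>\<^sub>0")
      case True
      have "r powr (real k * \<alpha>) * c = 1" using r by (simp add: c_def powr_add[symmetric])
      then show ?thesis using True by (simp add: rescale_def eta_nat \<phi>s f_def h_def)
    next
      case False
      then show ?thesis using \<psi>off by (simp add: rescale_def f_def)
    qed
  qed
  \<comment> \<open>Elements are functions vanishing off the union, not classes, so injectivity can
    be checked point by point.\<close>
  have inj: "inj_on (rescale \<alpha> r \<Omega>\<^sub>0) (W0 s p r \<Omega>\<^sub>0)"
  proof (rule inj_onI)
    fix \<phi>1 \<phi>2 assume W: "\<phi>1 \<in> W0 s p r \<Omega>\<^sub>0" "\<phi>2 \<in> W0 s p r \<Omega>\<^sub>0" and eq: "rescale \<alpha> r \<Omega>\<^sub>0 \<phi>1 = rescale \<alpha> r \<Omega>\<^sub>0 \<phi>2"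
    show "\<phi>1 = \<phi>2"
    proof
      fix x
      show "\<phi>1 x = \<phi>2 x"
      proof (cases "x \<in> \<Gamma>U")
        case True
        then obtain i x0 where x0: "x0 \<in> \<Gamma>\<^sub>0" "x = r ^ i *\<^sub>R x0" by (rule \<Gamma>U_cases)
        have "r powr (real i * \<alpha>) \<noteq> 0" using r by simp
        then show ?thesis using fun_cong[OF fun_cong[OF eq, of i], of x0] x0 by (simp add: rescale_def eta_nat)
      next
        case False
        then show ?thesis using W by (simp add: W0_def WU_iff)
      qed
    qed
  qed
  have inv: "inv_into (W0 s p r \<Omega>\<^sub>0) (rescale \<alpha> r \<Omega>\<^sub>0) f = \<phi>"
    unfolding resc[symmetric] by (rule inv_into_f_f[OF inj \<phi>W])
  \<comment> \<open>All component integrals of \<open>\<phi>\<close> vanish, so the inner projection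
    acts as the identity here.\<close>
  have P\<phi>: "P0 r \<Omega>\<^sub>0 \<phi> = \<phi>"
  proof
    fix x
    show "P0 r \<Omega>\<^sub>0 \<phi> x = \<phi> x"
    proof (cases "x \<in> \<Gamma>U")
      case True
      then obtain i x0 where x0: "x \<in> \<Gamma> i" by (rule \<Gamma>U_cases)
      then show ?thesis using True by (simp add: P0_def component_index_eq[OF x0] P0_comp_def \<phi>int)
    next
      case False
      then show ?thesis using \<phi>W by (simp add: P0_def W0_def WU_iff)
    qed
  qed
  have NP: "NP_adj r \<Omega>\<^sub>0 \<phi> (r ^ j *\<^sub>R x) = c *\<^sub>R K_int r \<Omega>\<^sub>0 (int j - int k) \<psi> x" if x: "x \<in> \<Gamma>\<^sub>0" for x
  proof -
    have "NP_adj r \<Omega>\<^sub>0 \<phi> (r ^ j *\<^sub>R x) = K_int r \<Omega>\<^sub>0 (int j - int k) (\<lambda>y. \<phi> (r ^ k *\<^sub>R y)) x"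
      by (rule NP_adj_scale[OF \<phi>m _ x]) (simp add: \<phi>_def ext_off)
    also have "K_int r \<Omega>\<^sub>0 (int j - int k) (\<lambda>y. \<phi> (r ^ k *\<^sub>R y)) = K_int r \<Omega>\<^sub>0 (int j - int k) (\<lambda>y. c *\<^sub>R \<psi> y)"
      by (rule K_int_cong) (simp add: \<phi>s h_def)
    finally show ?thesis by (simp add: K_int_scaleR)
  qed
  have vm: "(\<lambda>x. c *\<^sub>R K_int r \<Omega>\<^sub>0 (int j - int k) \<psi> x) \<in> borel_measurable borel"
    using K_int_measurable[OF \<psi>m, of "int j - int k"] by measurable
  have "block (\<lambda>x. 0) (scaled_NP s p \<alpha> r \<Omega>\<^sub>0) j k \<psi> = rescale \<alpha> r \<Omega>\<^sub>0 (NP_adj_tilde r \<Omega>\<^sub>0 \<phi>) j"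
    using f_ell by (simp add: block_def scaled_NP_def f_def[symmetric] inv)
  also have "\<dots> = (\<lambda>x. (r powr ((real j - real k) * \<alpha>)) *\<^sub>R K_tilde r \<Omega>\<^sub>0 (int j - int k) \<psi> x)"
  proof
    fix x
    show "rescale \<alpha> r \<Omega>\<^sub>0 (NP_adj_tilde r \<Omega>\<^sub>0 \<phi>) j x = (r powr ((real j - real k) * \<alpha>)) *\<^sub>R K_tilde r \<Omega>\<^sub>0 (int j - int k) \<psi> x"
    proof (cases "x \<in> \<Gamma>\<^sub>0")
      case True
      have "NP_adj_tilde r \<Omega>\<^sub>0 \<phi> (r ^ j *\<^sub>R x) = P0_comp \<Gamma>\<^sub>0 (\<lambda>x. c *\<^sub>R K_int r \<Omega>\<^sub>0 (int j - int k) \<psi> x) x"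
        unfolding NP_adj_tilde_def P\<phi> by (rule P0_scale[OF vm NP True])
      also have "\<dots> = c *\<^sub>R K_tilde r \<Omega>\<^sub>0 (int j - int k) \<psi> x" by (simp add: P0_comp_scaleR K_tilde_def)
      finally have *: "NP_adj_tilde r \<Omega>\<^sub>0 \<phi> (r ^ j *\<^sub>R x) = c *\<^sub>R K_tilde r \<Omega>\<^sub>0 (int j - int k) \<psi> x" .
      have "r powr (real j * \<alpha>) * c = r powr ((real j - real k) * \<alpha>)"
        by (simp add: c_def powr_add[symmetric] left_diff_distrib)
      then show ?thesis using True by (simp add: rescale_def eta_nat *)
    next
      case False
      then show ?thesis by (simp add: rescale_def K_tilde_def P0_comp_off)
    qed
  qed
  finally show ?thesis .
qed

end

subsection \<open>The operators on functionals\<close>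

lemma root_energy_le:
  assumes le: "E1 \<le> ennreal C * E2" and fin: "E2 < \<infinity>" and C: "0 \<le> C" and q: "0 < q"
  shows "enn2real E1 powr (1 / q) \<le> C powr (1 / q) * enn2real E2 powr (1 / q)"
proof -
  have "enn2real E1 \<le> enn2real (ennreal C * E2)"
    using le fin by (intro enn2real_mono) (auto simp: ennreal_mult_less_top)
  also have "\<dots> = C * enn2real E2" using C by (simp add: enn2real_mult)
  finally have "enn2real E1 powr (1 / q) \<le> (C * enn2real E2) powr (1 / q)" using q by (intro powr_mono2) auto
  then show ?thesis using C by (simp add: powr_mult)
qed

lemma conj_exp_gt_1: "1 < p \<Longrightarrow> 1 < conj_exp p"
  by (simp add: conj_exp_def field_simps)

lemma W_negD:
  assumes "\<Phi> \<in> W_neg s p S"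
  shows "\<Phi> \<in> extensional (W_test s p S)"
    and "g \<in> W_test s p S \<Longrightarrow> h \<in> W_test s p S \<Longrightarrow> \<Phi> (\<lambda>x. g x + h x) = \<Phi> g + \<Phi> h"
    and "g \<in> W_test s p S \<Longrightarrow> \<Phi> (\<lambda>x. c * g x) = c * \<Phi> g"
  using assms by (auto simp: W_neg_def)

lemma W_neg_bound:
  assumes "\<Phi> \<in> W_neg s p S"
  obtains B where "0 \<le> B" "\<And>g. g \<in> W_test s p S \<Longrightarrow> norm (\<Phi> g) \<le> B * sobolev_norm (- s) (conj_exp p) S g"
proof -
  obtain B where B: "\<And>g. g \<in> W_test s p S \<Longrightarrow> norm (\<Phi> g) \<le> B * sobolev_norm (- s) (conj_exp p) S g"
    using assms unfolding W_neg_def by blast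
  have "norm (\<Phi> g) \<le> max B 0 * sobolev_norm (- s) (conj_exp p) S g" if "g \<in> W_test s p S" for g
    using B[OF that] mult_right_mono[of B "max B 0" "sobolev_norm (- s) (conj_exp p) S g"]
    by (simp add: sobolev_norm_def)
  then show thesis using that[of "max B 0"] by simp
qed

context self_similar_boundary
begin

lemma sobolev_norm_le_B:
  assumes "B.energy \<sigma> q f \<le> ennreal C * B.energy \<sigma> q g" "g \<in> W \<sigma> q \<Gamma>\<^sub>0" "0 \<le> C" "1 < q"
  shows "sobolev_norm \<sigma> q \<Gamma>\<^sub>0 f \<le> C powr (1 / q) * sobolev_norm \<sigma> q \<Gamma>\<^sub>0 g"
  unfolding sobolev_norm_def sobolev_energy_\<Gamma>\<^sub>0
  by (rule root_energy_le) (use assms in \<open>auto simp: W_iff\<close>)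

lemma P0_comp_add:
  assumes "integrable M\<^sub>0 g" "integrable M\<^sub>0 h"
  shows "P0_comp \<Gamma>\<^sub>0 (\<lambda>x. g x + h x) = (\<lambda>x. P0_comp \<Gamma>\<^sub>0 g x + P0_comp \<Gamma>\<^sub>0 h x)"
proof
  fix x
  show "P0_comp \<Gamma>\<^sub>0 (\<lambda>x. g x + h x) x = P0_comp \<Gamma>\<^sub>0 g x + P0_comp \<Gamma>\<^sub>0 h x"
    using assms by (cases "x \<in> \<Gamma>\<^sub>0") (simp_all add: P0_comp_eq P0_comp_off scaleR_add_right)
qed

lemma P0_comp_cmult: "P0_comp \<Gamma>\<^sub>0 (\<lambda>x. c * h x) = (\<lambda>x. c * P0_comp \<Gamma>\<^sub>0 h x)"
proof
  fix x
  show "P0_comp \<Gamma>\<^sub>0 (\<lambda>x. c * h x) x = c * P0_comp \<Gamma>\<^sub>0 h x"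
    by (cases "x \<in> \<Gamma>\<^sub>0") (simp_all add: P0_comp_eq P0_comp_off right_diff_distrib)
qed

lemma K_int_transpose_cmult: "K_int_transpose r \<Omega>\<^sub>0 m (\<lambda>x. c * h x) = (\<lambda>y. c * K_int_transpose r \<Omega>\<^sub>0 m h y)"
proof
  fix y
  have "(LINT x:\<Gamma>\<^sub>0|surf. (outer_normal \<Omega>\<^sub>0 x \<bullet> grad1_G (eta r m x) y) *\<^sub>R (c * h x)) =
      (LINT x:\<Gamma>\<^sub>0|surf. c * ((outer_normal \<Omega>\<^sub>0 x \<bullet> grad1_G (eta r m x) y) *\<^sub>R h x))"
    by (simp only: mult_scaleR_right)
  also have "\<dots> = c * (LINT x:\<Gamma>\<^sub>0|surf. (outer_normal \<Omega>\<^sub>0 x \<bullet> grad1_G (eta r m x) y) *\<^sub>R h x)"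
    by (rule set_integral_mult_right)
  finally show "K_int_transpose r \<Omega>\<^sub>0 m (\<lambda>x. c * h x) y = c * K_int_transpose r \<Omega>\<^sub>0 m h y"
    by (simp add: K_int_transpose_def)
qed

text \<open>The exponent \<open>- (real n - 1)\<close> is \<open>2 - d\<close>, the order of the
  kernel for \<open>m = 0\<close>; the added 1 accommodates the bounded kernels of the other
  blocks.\<close>

lemma kK_bound: "\<exists>C\<ge>0. \<forall>x\<in>\<Gamma>\<^sub>0. \<forall>y\<in>\<Gamma>\<^sub>0. \<bar>kK m x y\<bar> \<le> C * (norm (y - x) powr (- (real n - 1)) + 1)"
proof (cases "m = 0")
  case True
  have "\<bar>kK 0 x y\<bar> \<le> Lc * (norm (y - x) powr (- (real n - 1)) + 1)" if xy: "x \<in> \<Gamma>\<^sub>0" "y \<in> \<Gamma>\<^sub>0" for x y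
  proof (cases "x = y")
    case False
    then have s: "0 < norm (x - y)" by simp
    have d: "DIM('a) = n + 1" using dim2 n_eq by simp
    have "\<bar>nhat x \<bullet> (x - y)\<bar> / norm (x - y) ^ DIM('a) \<le> Lc * norm (x - y) ^ 2 / norm (x - y) ^ DIM('a)"
      using nhat_tangent[OF xy] by (intro divide_right_mono) auto
    also have "\<dots> = Lc * norm (x - y) powr (real 2 - real (n + 1))"
    proof -
      have "norm (x - y) ^ 2 / norm (x - y) ^ DIM('a) = norm (x - y) powr (real 2 - real (n + 1))"
        unfolding d powr_diff using s by (simp only: powr_realpow)
      then show ?thesis by (simp only: times_divide_eq_right[symmetric])
    qed
    also have "real 2 - real (n + 1) = - (real n - 1)" by simp
    finally have "\<bar>nhat x \<bullet> (x - y)\<bar> / norm (x - y) ^ DIM('a) \<le> Lc * norm (x - y) powr (- (real n - 1))" .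
    then have "cd * (\<bar>nhat x \<bullet> (x - y)\<bar> / norm (x - y) ^ DIM('a)) \<le> 1 * (Lc * norm (x - y) powr (- (real n - 1)))"
      using cd by (intro mult_mono) auto
    also have "\<dots> \<le> Lc * (norm (y - x) powr (- (real n - 1)) + 1)"
      using Lc by (simp add: norm_minus_commute distrib_left)
    finally show ?thesis using cd by (simp add: kK_0 abs_mult)
  qed (use Lc in \<open>simp add: kK_0\<close>)
  then show ?thesis using Lc True by blast
next
  case False
  obtain \<rho> where \<rho>: "0 < \<rho>" "\<And>x y. x \<in> \<Gamma>\<^sub>0 \<Longrightarrow> y \<in> \<Gamma>\<^sub>0 \<Longrightarrow> \<rho> \<le> norm (eta r m x - y)" using eta_separated[OF False] by blast
  define a where "a = 1 / \<rho> ^ (DIM('a) - 1)"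
  have a: "0 \<le> a" using \<rho> by (simp add: a_def)
  have "\<bar>kK m x y\<bar> \<le> a * (norm (y - x) powr (- (real n - 1)) + 1)" if "x \<in> \<Gamma>\<^sub>0" "y \<in> \<Gamma>\<^sub>0" for x y
  proof -
    have "norm (newton_field (eta r m x - y)) \<le> a" unfolding a_def by (intro newton_field_bound dim2 \<rho> that)
    then have "\<bar>kK m x y\<bar> \<le> a" using inner_nhat_le[of x "newton_field (eta r m x - y)"] by (simp add: kK_def)
    also have "\<dots> \<le> a * (norm (y - x) powr (- (real n - 1)) + 1)" using a by (simp add: distrib_left)
    finally show ?thesis .
  qed
  then show ?thesis using a by blast
qed

text \<open>Since \<open>h\<close> is integrable, Tonelli makes its Riesz potential integrable as
  well, hence finite almost everywhere; the bound on the kernel turns this into convergence of the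
  transposed integral.\<close>

lemma kK_integrable_AE:
  assumes q: "1 < q" and h: "h \<in> W \<sigma> q \<Gamma>\<^sub>0"
  shows "AE y in M\<^sub>0. integrable M\<^sub>0 (\<lambda>x. kK m x y *\<^sub>R h x)"
proof -
  have hm: "h \<in> borel_measurable borel" using h by (simp add: W_iff)
  have hM [measurable]: "h \<in> borel_measurable M\<^sub>0" by (rule borel_measurable_M[OF hm])
  have hi: "integrable M\<^sub>0 h" by (rule W_integrable[OF q h])
  obtain C where C: "0 \<le> C" "\<And>x y. x\<in>\<Gamma>\<^sub>0 \<Longrightarrow> y\<in>\<Gamma>\<^sub>0 \<Longrightarrow> \<bar>kK m x y\<bar> \<le> C * (norm (y - x) powr (- (real n - 1)) + 1)"
    using kK_bound by blast
  define I where "I y = (\<integral>\<^sup>+x. ennreal (norm (y - x) powr (- (real n - 1))) * ennreal (norm (h x)) \<partial>M\<^sub>0)" for y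
  obtain C1 where C1: "0 < C1" "\<And>g. g\<in>borel_measurable M\<^sub>0 \<Longrightarrow>
    (\<integral>\<^sup>+x. (\<integral>\<^sup>+y. ennreal (norm (x - y) powr (- (real n - 1))) * g y \<partial>M\<^sub>0) \<partial>M\<^sub>0) \<le> ennreal C1 * (\<integral>\<^sup>+y. g y \<partial>M\<^sub>0)"
    using B.riesz_potential_bound[of "real n - 1"] by auto
  have hfin: "(\<integral>\<^sup>+x. ennreal (norm (h x)) \<partial>M\<^sub>0) < \<infinity>" using hi by (simp add: integrable_iff_bounded)
  have "(\<integral>\<^sup>+y. I y \<partial>M\<^sub>0) \<le> ennreal C1 * (\<integral>\<^sup>+x. ennreal (norm (h x)) \<partial>M\<^sub>0)" unfolding I_def by (rule C1(2)) measurable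
  also have "\<dots> < \<infinity>" using hfin by (simp add: ennreal_mult_less_top)
  finally have "(\<integral>\<^sup>+y. I y \<partial>M\<^sub>0) \<noteq> \<infinity>" by simp
  moreover have "I \<in> borel_measurable M\<^sub>0"
    unfolding I_def by (rule sigma_finite_measure.borel_measurable_nn_integral[OF sigma_finite_M\<^sub>0]) measurable
  ultimately have "AE y in M\<^sub>0. I y \<noteq> \<infinity>" by (intro nn_integral_PInf_AE)
  then show ?thesis
  proof (rule AE_mp, intro AE_I2 impI)
    fix y assume y: "y \<in> space M\<^sub>0" and Iy: "I y \<noteq> \<infinity>"
    show "integrable M\<^sub>0 (\<lambda>x. kK m x y *\<^sub>R h x)"
    proof (rule integrableI_bounded)
      have "(\<lambda>x. kK m x y *\<^sub>R h x) \<in> borel_measurable borel" unfolding kK_def using hm by measurable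
      then show "(\<lambda>x. kK m x y *\<^sub>R h x) \<in> borel_measurable M\<^sub>0" by (rule borel_measurable_M)
      have "(\<integral>\<^sup>+x. ennreal (norm (kK m x y *\<^sub>R h x)) \<partial>M\<^sub>0) \<le> (\<integral>\<^sup>+x. ennreal C * (ennreal (norm (y - x) powr (- (real n - 1))) * ennreal (norm (h x)) + ennreal (norm (h x))) \<partial>M\<^sub>0)"
      proof (rule nn_integral_mono)
        fix x assume "x \<in> space M\<^sub>0"
        then have "norm (kK m x y *\<^sub>R h x) \<le> C * (norm (y - x) powr (- (real n - 1)) + 1) * norm (h x)"
          using C(2)[of x y] y by (auto intro: mult_right_mono)
        also have "\<dots> = C * (norm (y - x) powr (- (real n - 1)) * norm (h x) + norm (h x))" by (simp add: algebra_simps)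
        finally show "ennreal (norm (kK m x y *\<^sub>R h x)) \<le> ennreal C * (ennreal (norm (y - x) powr (- (real n - 1))) * ennreal (norm (h x)) + ennreal (norm (h x)))"
          using C(1) by (simp flip: ennreal_mult ennreal_plus add: ennreal_leI)
      qed
      also have "\<dots> = ennreal C * (I y + (\<integral>\<^sup>+x. ennreal (norm (h x)) \<partial>M\<^sub>0))"
        by (simp add: nn_integral_cmult nn_integral_add I_def)
      also have "\<dots> < \<infinity>" using Iy hfin by (simp add: ennreal_mult_less_top less_top)
      finally show "(\<integral>\<^sup>+x. ennreal (norm (kK m x y *\<^sub>R h x)) \<partial>M\<^sub>0) < \<infinity>" .
    qed
  qed
qed

text \<open>The exceptional set cannot be avoided by this argument: where one of the integrals
  diverges, its default value 0 may break additivity.\<close>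

lemma K_int_transpose_add_AE:
  assumes q: "1 < q" and g: "g \<in> W \<sigma> q \<Gamma>\<^sub>0" and h: "h \<in> W \<sigma> q \<Gamma>\<^sub>0"
  shows "AE y in M\<^sub>0. K_int_transpose r \<Omega>\<^sub>0 m (\<lambda>x. g x + h x) y = K_int_transpose r \<Omega>\<^sub>0 m g y + K_int_transpose r \<Omega>\<^sub>0 m h y"
proof -
  have m: "g \<in> borel_measurable borel" "h \<in> borel_measurable borel" "(\<lambda>x. g x + h x) \<in> borel_measurable borel"
    using g h W_add[OF q g h] by (auto simp: W_iff)
  from kK_integrable_AE[OF q g, of m] kK_integrable_AE[OF q h, of m] show ?thesis
  proof (eventually_elim)
    case (elim y)
    show ?case
    proof (cases "y \<in> \<Gamma>\<^sub>0")
      case True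
      then show ?thesis
        using Bochner_Integration.integral_add[OF elim] by (simp add: K_int_transpose_eq m scaleR_add_right)
    qed (simp add: K_int_transpose_def)
  qed
qed

text \<open>The difference of the two functions has energy 0, the double integral included, so a
  bounded functional annihilates it.\<close>

lemma W_neg_AE_cong:
  assumes p: "1 < p" and \<Psi>: "\<Psi> \<in> W_neg s p \<Gamma>\<^sub>0" and f: "f \<in> W_test s p \<Gamma>\<^sub>0" and g: "g \<in> W_test s p \<Gamma>\<^sub>0"
    and ae: "AE x in M\<^sub>0. f x = g x"
  shows "\<Psi> f = \<Psi> g"
proof -
  let ?q = "conj_exp p"
  have q: "1 < ?q" by (rule conj_exp_gt_1[OF p])
  define d where "d x = f x + (- 1) * g x" for x
  have mg: "(\<lambda>x. (- 1) * g x) \<in> W_test s p \<Gamma>\<^sub>0" by (rule W_cmult[OF g])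
  have dW: "d \<in> W_test s p \<Gamma>\<^sub>0" unfolding d_def by (rule W_add[OF q f mg])
  have d0: "AE x in M\<^sub>0. d x = 0" using ae by eventually_elim (simp add: d_def)
  have "B.energy (- s) ?q d = 0"
  proof -
    have "(\<integral>\<^sup>+x. ennreal (norm (d x) powr ?q) \<partial>M\<^sub>0) = (\<integral>\<^sup>+x. 0 \<partial>M\<^sub>0)"
      by (rule nn_integral_cong_AE) (use d0 in \<open>eventually_elim, simp\<close>)
    moreover have "(\<integral>\<^sup>+x. (\<integral>\<^sup>+y. ennreal (norm (d x - d y) powr ?q / norm (x - y) powr (real n + - s * ?q)) \<partial>M\<^sub>0) \<partial>M\<^sub>0) = (\<integral>\<^sup>+x. 0 \<partial>M\<^sub>0)"
    proof (rule nn_integral_cong_AE, use d0 in eventually_elim)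
      fix x assume dx: "d x = 0"
      have "(\<integral>\<^sup>+y. ennreal (norm (d x - d y) powr ?q / norm (x - y) powr (real n + - s * ?q)) \<partial>M\<^sub>0) = (\<integral>\<^sup>+y. 0 \<partial>M\<^sub>0)"
        by (rule nn_integral_cong_AE) (use d0 in \<open>eventually_elim, simp add: dx\<close>)
      then show "(\<integral>\<^sup>+y. ennreal (norm (d x - d y) powr ?q / norm (x - y) powr (real n + - s * ?q)) \<partial>M\<^sub>0) = 0" by simp
    qed
    ultimately show ?thesis by (simp add: B.energy_def)
  qed
  then have "sobolev_norm (- s) ?q \<Gamma>\<^sub>0 d = 0" by (simp add: sobolev_norm_def sobolev_energy_\<Gamma>\<^sub>0)
  moreover obtain B where "0 \<le> B" "\<And>g. g \<in> W_test s p \<Gamma>\<^sub>0 \<Longrightarrow> norm (\<Psi> g) \<le> B * sobolev_norm (- s) ?q \<Gamma>\<^sub>0 g"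
    using W_neg_bound[OF \<Psi>] by blast
  ultimately have "\<Psi> d = 0" using dW by (metis mult_zero_right norm_le_zero_iff)
  moreover have "\<Psi> d = \<Psi> f + (- 1) * \<Psi> g"
    unfolding d_def using W_negD(2)[OF \<Psi> f mg] W_negD(3)[OF \<Psi> g, of "- 1"] by simp
  ultimately show ?thesis by simp
qed

lemma W_neg_zero:
  assumes "\<Psi> \<in> W_neg s p \<Gamma>\<^sub>0" "1 < p"
  shows "\<Psi> (\<lambda>x. 0) = 0"
proof -
  have "(\<lambda>x. 0) \<in> W_test s p \<Gamma>\<^sub>0" using conj_exp_gt_1[OF assms(2)] by (intro W_zero) simp
  from W_negD(3)[OF assms(1) this, of 0] show ?thesis by simp
qed

lemma indicator_W:
  assumes q: "1 < q"
  shows "(indicator \<Gamma>\<^sub>0 :: 'a \<Rightarrow> complex) \<in> W \<sigma> q \<Gamma>\<^sub>0"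
proof -
  have "B.energy \<sigma> q (indicator \<Gamma>\<^sub>0) = B.energy \<sigma> q (\<lambda>x. 1)" by (rule energy_cong) simp
  also have "\<dots> = emeasure M\<^sub>0 (space M\<^sub>0)" using q by (simp add: B.energy_def)
  also have "\<dots> < \<infinity>" by (simp add: B.emeasure_eq_measure)
  finally show ?thesis by (simp add: W_iff)
qed

text \<open>The projection changes \<open>h\<close> by a multiple of the indicator, and
  \<open>\<Psi>\<close> annihilates the indicator.\<close>

lemma W0_neg_P0_comp:
  assumes p: "1 < p" and \<Psi>: "\<Psi> \<in> W0_neg_comp s p \<Gamma>\<^sub>0" and h: "h \<in> W_test s p \<Gamma>\<^sub>0"
  shows "\<Psi> (P0_comp \<Gamma>\<^sub>0 h) = \<Psi> h"
proof -
  let ?q = "conj_exp p"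
  have q: "1 < ?q" by (rule conj_exp_gt_1[OF p])
  have \<Psi>W: "\<Psi> \<in> W_neg s p \<Gamma>\<^sub>0" and \<Psi>1: "\<Psi> (indicator \<Gamma>\<^sub>0) = 0" using \<Psi> by (auto simp: W0_neg_comp_def)
  define a where "a = - ((1 / measure M\<^sub>0 (space M\<^sub>0)) *\<^sub>R (LINT y|M\<^sub>0. h y))"
  have iW: "(indicator \<Gamma>\<^sub>0 :: 'a \<Rightarrow> complex) \<in> W_test s p \<Gamma>\<^sub>0" by (rule indicator_W[OF q])
  have "P0_comp \<Gamma>\<^sub>0 h = (\<lambda>x. h x + a * indicator \<Gamma>\<^sub>0 x)"
  proof
    fix x show "P0_comp \<Gamma>\<^sub>0 h x = h x + a * indicator \<Gamma>\<^sub>0 x"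
      using h by (cases "x \<in> \<Gamma>\<^sub>0") (auto simp: P0_comp_eq P0_comp_off a_def W_iff)
  qed
  then have "\<Psi> (P0_comp \<Gamma>\<^sub>0 h) = \<Psi> h + a * \<Psi> (indicator \<Gamma>\<^sub>0)"
    using W_negD(2)[OF \<Psi>W h W_cmult[OF iW, of a]] W_negD(3)[OF \<Psi>W iW, of a] by simp
  then show ?thesis using \<Psi>1 by simp
qed

lemma K_tilde_neg_eq:
  assumes p: "1 < p" and h: "h \<in> W_test s p \<Gamma>\<^sub>0"
  shows "K_tilde_neg s p r \<Omega>\<^sub>0 m \<Psi> h = \<Psi> (K_int_transpose r \<Omega>\<^sub>0 m (P0_comp \<Gamma>\<^sub>0 h))"
  using h P0_comp_W[OF conj_exp_gt_1[OF p] h] by (simp add: K_tilde_neg_def P0_neg_comp_def K_int_neg_def)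

text \<open>Additivity passes through \<open>W_neg_AE_cong\<close>, because it is available for the
  transposed kernel operator only almost everywhere. The mean of the image vanishes since the
  indicator is sent to 0 before \<open>\<Psi>\<close> is applied.\<close>

lemma K_tilde_neg_W0:
  assumes p: "1 < p" and s: "- 1 < s" "s < 0" and \<Psi>: "\<Psi> \<in> W0_neg_comp s p \<Gamma>\<^sub>0"
  shows "K_tilde_neg s p r \<Omega>\<^sub>0 m \<Psi> \<in> W0_neg_comp s p \<Gamma>\<^sub>0"
proof -
  let ?q = "conj_exp p"
  let ?W = "W_test s p \<Gamma>\<^sub>0"
  let ?K = "\<lambda>h. K_int_transpose r \<Omega>\<^sub>0 m (P0_comp \<Gamma>\<^sub>0 h)"
  have q: "1 < ?q" by (rule conj_exp_gt_1[OF p])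
  have \<sigma>: "0 \<le> - s" "- s < 1" using s by auto
  have \<Psi>W: "\<Psi> \<in> W_neg s p \<Gamma>\<^sub>0" using \<Psi> by (simp add: W0_neg_comp_def)
  note eq = K_tilde_neg_eq[OF p]
  have KW: "?K h \<in> ?W" if "h \<in> ?W" for h
    by (intro K_int_transpose_W q \<sigma> P0_comp_W that)
  have add: "K_tilde_neg s p r \<Omega>\<^sub>0 m \<Psi> (\<lambda>x. g x + h x) = K_tilde_neg s p r \<Omega>\<^sub>0 m \<Psi> g + K_tilde_neg s p r \<Omega>\<^sub>0 m \<Psi> h"
    if g: "g \<in> ?W" and h: "h \<in> ?W" for g h
  proof -
    note gP = P0_comp_W[OF q g] and hP = P0_comp_W[OF q h]
    have "P0_comp \<Gamma>\<^sub>0 (\<lambda>x. g x + h x) = (\<lambda>x. P0_comp \<Gamma>\<^sub>0 g x + P0_comp \<Gamma>\<^sub>0 h x)"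
      by (rule P0_comp_add[OF W_integrable[OF q g] W_integrable[OF q h]])
    then have "\<Psi> (?K (\<lambda>x. g x + h x)) = \<Psi> (\<lambda>y. ?K g y + ?K h y)"
      using K_int_transpose_add_AE[OF q gP hP, of m] KW[OF W_add[OF q g h]]
      by (intro W_neg_AE_cong[OF p \<Psi>W] W_add[OF q] KW g h) auto
    then show ?thesis using W_negD(2)[OF \<Psi>W KW[OF g] KW[OF h]] by (simp add: eq g h W_add[OF q])
  qed
  have mult: "K_tilde_neg s p r \<Omega>\<^sub>0 m \<Psi> (\<lambda>x. c * g x) = c * K_tilde_neg s p r \<Omega>\<^sub>0 m \<Psi> g" if g: "g \<in> ?W" for c g
    using W_negD(3)[OF \<Psi>W KW[OF g], of c] by (simp add: eq g W_cmult P0_comp_cmult K_int_transpose_cmult)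
  have "\<exists>B. \<forall>g\<in>?W. norm (K_tilde_neg s p r \<Omega>\<^sub>0 m \<Psi> g) \<le> B * sobolev_norm (- s) ?q \<Gamma>\<^sub>0 g"
  proof -
    obtain B where B: "0 \<le> B" "\<And>g. g \<in> ?W \<Longrightarrow> norm (\<Psi> g) \<le> B * sobolev_norm (- s) ?q \<Gamma>\<^sub>0 g" using W_neg_bound[OF \<Psi>W] by blast
    obtain C1 where C1: "0 \<le> C1" "\<And>\<phi>. \<phi>\<in>borel_measurable borel \<Longrightarrow> B.energy (- s) ?q (P0_comp \<Gamma>\<^sub>0 \<phi>) \<le> ennreal C1 * B.energy (- s) ?q \<phi>"
      using P0_comp_energy[OF q] by blast
    obtain C2 where C2: "0 \<le> C2" "\<And>\<psi>. \<psi>\<in>borel_measurable borel \<Longrightarrow> B.energy (- s) ?q (K_int_transpose r \<Omega>\<^sub>0 m \<psi>) \<le> ennreal C2 * (\<integral>\<^sup>+y. ennreal (norm (\<psi> y) powr ?q) \<partial>M\<^sub>0)"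
      using K_int_transpose_energy[OF q \<sigma>] by blast
    have "norm (K_tilde_neg s p r \<Omega>\<^sub>0 m \<Psi> g) \<le> (B * (C2 * C1) powr (1 / ?q)) * sobolev_norm (- s) ?q \<Gamma>\<^sub>0 g" if g: "g \<in> ?W" for g
    proof -
      have gm: "g \<in> borel_measurable borel" using g by (simp add: W_iff)
      have "B.energy (- s) ?q (?K g) \<le> ennreal C2 * (\<integral>\<^sup>+y. ennreal (norm (P0_comp \<Gamma>\<^sub>0 g y) powr ?q) \<partial>M\<^sub>0)"
        by (rule C2(2)[OF P0_comp_measurable[OF gm]])
      also have "\<dots> \<le> ennreal C2 * B.energy (- s) ?q (P0_comp \<Gamma>\<^sub>0 g)" by (intro mult_left_mono Lq_le_energy) simp
      also have "\<dots> \<le> ennreal C2 * (ennreal C1 * B.energy (- s) ?q g)" by (intro mult_left_mono C1(2) gm) simp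
      also have "\<dots> = ennreal (C2 * C1) * B.energy (- s) ?q g" using C1 C2 by (simp add: ennreal_mult mult.assoc)
      finally have "sobolev_norm (- s) ?q \<Gamma>\<^sub>0 (?K g) \<le> (C2 * C1) powr (1 / ?q) * sobolev_norm (- s) ?q \<Gamma>\<^sub>0 g"
        by (rule sobolev_norm_le_B[OF _ g]) (use C1 C2 q in auto)
      then have "B * sobolev_norm (- s) ?q \<Gamma>\<^sub>0 (?K g) \<le> B * ((C2 * C1) powr (1 / ?q) * sobolev_norm (- s) ?q \<Gamma>\<^sub>0 g)"
        using B(1) by (rule mult_left_mono)
      then show ?thesis using B(2)[OF KW[OF g]] by (simp add: eq[OF g] mult.assoc)
    qed
    then show ?thesis by blast
  qed
  moreover have "K_tilde_neg s p r \<Omega>\<^sub>0 m \<Psi> (indicator \<Gamma>\<^sub>0) = 0"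
  proof -
    let ?i = "indicator \<Gamma>\<^sub>0 :: 'a \<Rightarrow> complex"
    have "?K ?i = (\<lambda>y. 0)"
    \<comment> \<open>If the total mass is 0, the quotient \<open>1 / 0 = 0\<close> leaves the
      indicator unchanged under the projection, but then every integral vanishes.\<close>
    proof (cases "measure M\<^sub>0 (space M\<^sub>0) = 0")
      case True
      have m: "P0_comp \<Gamma>\<^sub>0 ?i \<in> borel_measurable borel" by (rule P0_comp_measurable) simp
      show ?thesis
      proof
        fix y show "?K ?i y = 0"
          by (cases "y \<in> \<Gamma>\<^sub>0") (simp_all only: K_int_transpose_eq[OF m] integral_M\<^sub>0_null[OF True], simp add: K_int_transpose_def)
      qed
    next
      case False
      have "(LINT y|M\<^sub>0. ?i y) = (LINT y|M\<^sub>0. 1)"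
        by (rule Bochner_Integration.integral_cong) auto
      then have "P0_comp \<Gamma>\<^sub>0 ?i x = 0" for x
        using False by (cases "x \<in> \<Gamma>\<^sub>0") (simp_all add: P0_comp_eq P0_comp_off scaleR_conv_of_real)
      then have "P0_comp \<Gamma>\<^sub>0 ?i = (\<lambda>x. 0)" by auto
      then show ?thesis by (auto simp: K_int_transpose_def set_lebesgue_integral_def)
    qed
    then show ?thesis using W_neg_zero[OF \<Psi>W p] by (simp add: eq indicator_W[OF q])
  qed
  ultimately show ?thesis
    using add mult by (simp add: W0_neg_comp_def W_neg_def K_tilde_neg_def P0_neg_comp_def)
qed

section \<open>Splitting a test function into its components\<close>

definition res :: "nat \<Rightarrow> ('a \<Rightarrow> complex) \<Rightarrow> 'a \<Rightarrow> complex" where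
  "res k g x = (if x \<in> \<Gamma>\<^sub>0 then g (r ^ k *\<^sub>R x) else 0)"

lemma res_measurable: "g \<in> borel_measurable borel \<Longrightarrow> res k g \<in> borel_measurable borel"
proof -
  assume "g \<in> borel_measurable borel"
  then have [measurable]: "(\<lambda>x. g (r ^ k *\<^sub>R x)) \<in> borel_measurable borel" by (rule scale_measurable)
  have "(\<lambda>x. if x \<in> \<Gamma>\<^sub>0 then g (r ^ k *\<^sub>R x) else 0) \<in> borel_measurable borel" by measurable
  then show ?thesis by (simp add: res_def[abs_def])
qed

lemma energy_res: "B.energy \<sigma> q (res k g) = B.energy \<sigma> q (\<lambda>x. g (r ^ k *\<^sub>R x))"
  by (rule energy_cong) (simp add: res_def)

lemma res_energy:
  fixes \<sigma> q :: real
  assumes "1 < q" "0 \<le> \<sigma>"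
  shows "\<exists>C\<ge>0. \<forall>g\<in>borel_measurable borel. B.energy \<sigma> q (res k g) \<le> ennreal C * U.energy \<sigma> q g"
  using restrict_energy[OF assms, of k] by (simp add: energy_res)

lemma res_W:
  assumes q: "1 < q" and \<sigma>: "0 \<le> \<sigma>" and g: "g \<in> W \<sigma> q \<Gamma>U"
  shows "res k g \<in> W \<sigma> q \<Gamma>\<^sub>0"
proof -
  obtain C where "0 \<le> C" "\<And>g. g\<in>borel_measurable borel \<Longrightarrow> B.energy \<sigma> q (res k g) \<le> ennreal C * U.energy \<sigma> q g"
    using res_energy[OF q \<sigma>] by blast
  then have "B.energy \<sigma> q (res k g) \<le> ennreal C * U.energy \<sigma> q g" using g by (simp add: WU_iff)
  also have "\<dots> < \<infinity>" using g by (simp add: WU_iff ennreal_mult_less_top)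
  finally show ?thesis using g by (simp add: W_iff WU_iff res_measurable) (simp add: res_def)
qed

lemma res_ext: "(\<And>x. x \<notin> \<Gamma>\<^sub>0 \<Longrightarrow> h x = 0) \<Longrightarrow> res i (ext k h) = (if i = k then h else (\<lambda>x. 0))"
  by (auto simp: res_def ext_scale fun_eq_iff)

definition tail :: "nat \<Rightarrow> ('a \<Rightarrow> complex) \<Rightarrow> 'a \<Rightarrow> complex" where
  "tail N v x = (if x \<in> (\<Union>i\<in>{N..}. \<Gamma> i) then v x else 0)"

lemma tail_scale: "x \<in> \<Gamma>\<^sub>0 \<Longrightarrow> tail N v (r ^ i *\<^sub>R x) = (if N \<le> i then v (r ^ i *\<^sub>R x) else 0)"
  by (auto simp: tail_def scale_in_Gam)

lemma tail_measurable: "v \<in> borel_measurable borel \<Longrightarrow> tail N v \<in> borel_measurable borel"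
proof -
  assume [measurable]: "v \<in> borel_measurable borel"
  have "(\<Union>i\<in>{N..}. \<Gamma> i) \<in> sets borel" by (intro sets.countable_UN'') auto
  then have "(\<lambda>x. if x \<in> (\<Union>i\<in>{N..}. \<Gamma> i) then v x else 0) \<in> borel_measurable borel" by measurable
  then show ?thesis by (simp add: tail_def[abs_def])
qed

lemma tail_split: "tail N v = (\<lambda>x. ext N (res N v) x + tail (Suc N) v x)"
proof
  fix x
  show "tail N v x = ext N (res N v) x + tail (Suc N) v x"
  proof (cases "x \<in> \<Gamma>U")
    case True
    then obtain i x0 where x0: "x0 \<in> \<Gamma>\<^sub>0" "x = r ^ i *\<^sub>R x0" by (rule \<Gamma>U_cases)
    then show ?thesis by (cases "i = N") (auto simp: tail_scale ext_scale res_def)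
  next
    case False
    then have "x \<notin> \<Gamma> i" for i using Gam_subset by blast
    then show ?thesis by (simp add: tail_def ext_def)
  qed
qed

text \<open>Peeling off components one by one leaves a tail whose energy is bounded by a remainder
  of the series in \<open>sum\<close>, so its norm tends to 0 and the functional has no contribution
  from the accumulation point. Of the peeled components all but the one with index \<open>k\<close>
  are annihilated.\<close>

lemma component_of_functional:
  assumes p: "1 < p" and s: "- 1 < s" "s < 0" and \<Phi>: "\<Phi> \<in> W_neg s p \<Gamma>U"
    and v: "v \<in> borel_measurable borel" and off: "\<And>x. x \<notin> \<Gamma>U \<Longrightarrow> v x = 0"
    and sum: "(\<Sum>i. ennreal ((r ^ i) powr (n - (- s) * conj_exp p)) * B.energy (- s) (conj_exp p) (res i v)) < \<infinity>"
    and other: "\<And>i h. i \<noteq> k \<Longrightarrow> h \<in> W_test s p \<Gamma>\<^sub>0 \<Longrightarrow> \<Phi> (ext i h) = 0"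
  shows "v \<in> W_test s p \<Gamma>U" and "\<Phi> v = \<Phi> (ext k (res k v))"
proof -
  let ?q = "conj_exp p"
  have q: "1 < ?q" by (rule conj_exp_gt_1[OF p])
  have \<sigma>: "0 \<le> - s" using s by simp
  define F where "F i = ennreal ((r ^ i) powr (n - (- s) * ?q)) * B.energy (- s) ?q (res i v)" for i
  define f where "f i = enn2real (F i)" for i
  have Ffin: "F i < \<infinity>" for i
    using sum ennreal_le_suminf[of F i] unfolding F_def[symmetric] by (rule le_less_trans[rotated])
  have Ff: "F i = ennreal (f i)" "0 \<le> f i" for i using Ffin[of i] by (auto simp: f_def)
  have fs: "summable f"
  proof (rule summable_suminf_not_top)
    have "(\<Sum>i. F i) < \<infinity>" using sum unfolding F_def .
    then show "(\<Sum>i. ennreal (f i)) \<noteq> top" unfolding Ff(1)[symmetric] by simp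
  qed (rule Ff(2))
  \<comment> \<open>Each weight is positive, so finiteness of a single term of the series already
    gives finite energy of that component.\<close>
  have resW: "res i v \<in> W_test s p \<Gamma>\<^sub>0" for i
  proof -
    have "ennreal ((r ^ i) powr (n - (- s) * ?q)) \<noteq> 0" using rj[of i] by simp
    then have "B.energy (- s) ?q (res i v) < \<infinity>" using Ffin[of i] unfolding F_def
      by (auto simp: ennreal_mult_less_top)
    then show ?thesis using res_measurable[OF v, of i] by (simp add: W_iff) (simp add: res_def)
  qed
  obtain Cg where Cg: "0 \<le> Cg" "\<And>w. w\<in>borel_measurable borel \<Longrightarrow> U.energy (- s) ?q w \<le>
    ennreal Cg * (\<Sum>i. ennreal ((r ^ i) powr (n - (- s) * ?q)) * B.energy (- s) ?q (\<lambda>x. w (r ^ i *\<^sub>R x)))"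
    using glue_energy[OF q \<sigma>] by blast
  \<comment> \<open>\<open>glue_energy\<close> is applied to the tail; the components before
    \<open>N\<close> drop out, which leaves the shifted series.\<close>
  have tE: "U.energy (- s) ?q (tail N v) \<le> ennreal (Cg * (\<Sum>i. f (i + N)))" for N
  proof -
    define H where "H i = ennreal ((r ^ i) powr (n - (- s) * ?q)) * B.energy (- s) ?q (\<lambda>x. tail N v (r ^ i *\<^sub>R x))" for i
    have H: "H i = (if N \<le> i then F i else 0)" for i
    proof -
      have "B.energy (- s) ?q (\<lambda>x. tail N v (r ^ i *\<^sub>R x)) = B.energy (- s) ?q (if N \<le> i then res i v else (\<lambda>x. 0))"
        by (rule energy_cong) (simp add: tail_scale res_def)
      then show ?thesis using q by (simp add: H_def F_def energy_zero_fun)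
    qed
    have "(\<Sum>i. H i) = (\<Sum>i. ennreal (if N \<le> i then f i else 0))" by (intro suminf_cong) (simp add: H Ff)
    also have "\<dots> = ennreal (\<Sum>i. if N \<le> i then f i else 0)"
      by (rule suminf_ennreal2) (use Ff fs in \<open>auto intro: summable_comparison_test[OF _ fs]\<close>)
    also have "(\<Sum>i. if N \<le> i then f i else 0) = (\<Sum>i. f (i + N))"
    proof -
      have "summable (\<lambda>i. if N \<le> i then f i else 0)"
        by (rule summable_comparison_test[OF _ fs]) (use Ff in auto)
      from suminf_split_initial_segment[OF this, of N] show ?thesis by simp
    qed
    finally have "(\<Sum>i. H i) = ennreal (\<Sum>i. f (i + N))" .
    moreover have "U.energy (- s) ?q (tail N v) \<le> ennreal Cg * (\<Sum>i. H i)"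
      unfolding H_def by (rule Cg(2)[OF tail_measurable[OF v]])
    ultimately show ?thesis using Cg(1) by (simp add: ennreal_mult'[symmetric])
  qed
  have tW: "tail N v \<in> W_test s p \<Gamma>U" for N
  proof -
    have "U.energy (- s) ?q (tail N v) < \<infinity>" using tE[of N] by (rule le_less_trans) simp
    moreover have "tail N v x = 0" if "x \<notin> \<Gamma>U" for x using that off by (simp add: tail_def)
    ultimately show ?thesis using tail_measurable[OF v, of N] by (simp add: WU_iff)
  qed
  have t0: "tail 0 v = v"
    using off by (auto simp: tail_def fun_eq_iff \<Gamma>U_eq)
  show vW: "v \<in> W_test s p \<Gamma>U" using tW[of 0] by (simp add: t0)
  have eW: "ext i (res i v) \<in> W_test s p \<Gamma>U" for i by (rule ext_W[OF q \<sigma> resW])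
  have step: "\<Phi> (tail N v) = \<Phi> (ext N (res N v)) + \<Phi> (tail (Suc N) v)" for N
    using W_negD(2)[OF \<Phi> eW tW, of N "Suc N"] tail_split[of N v] by simp
  have ind: "\<Phi> v = (if k < N then \<Phi> (ext k (res k v)) else 0) + \<Phi> (tail N v)" for N
  proof (induction N)
    case 0
    then show ?case by (simp add: t0)
  next
    case (Suc N)
    show ?case
    proof (cases "N = k")
      case True
      then show ?thesis using Suc step[of N] by simp
    next
      case False
      then have "k < Suc N \<longleftrightarrow> k < N" by auto
      then show ?thesis using Suc step[of N] other[OF False resW] by simp
    qed
  qed
  obtain B where B: "0 \<le> B" "\<And>g. g \<in> W_test s p \<Gamma>U \<Longrightarrow> norm (\<Phi> g) \<le> B * sobolev_norm (- s) ?q \<Gamma>U g"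
    using W_neg_bound[OF \<Phi>] by blast
  have tends: "(\<lambda>N. B * (Cg * (\<Sum>i. f (i + N))) powr (1 / ?q)) \<longlonglongrightarrow> 0"
  proof -
    have "(\<lambda>N. \<Sum>i. f (i + N)) \<longlonglongrightarrow> 0" by (rule suminf_exist_split2[OF fs])
    then have "(\<lambda>N. Cg * (\<Sum>i. f (i + N))) \<longlonglongrightarrow> 0" by (rule tendsto_mult_right_zero)
    then have "(\<lambda>N. (Cg * (\<Sum>i. f (i + N))) powr (1 / ?q)) \<longlonglongrightarrow> 0"
    proof (rule tendsto_zero_powrI[OF _ tendsto_const])
      show "\<forall>\<^sub>F N in sequentially. 0 \<le> Cg * (\<Sum>i. f (i + N))"
        using Cg(1) Ff(2) fs by (intro always_eventually allI mult_nonneg_nonneg suminf_nonneg) (auto simp: summable_ignore_initial_segment)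
    qed (use q in auto)
    from tendsto_mult[OF tendsto_const this, of B] show ?thesis by simp
  qed
  have bd: "norm (\<Phi> (tail N v)) \<le> B * (Cg * (\<Sum>i. f (i + N))) powr (1 / ?q)" for N
  proof -
    have nn: "0 \<le> Cg * (\<Sum>i. f (i + N))"
      using Cg(1) Ff(2) fs by (intro mult_nonneg_nonneg suminf_nonneg) (auto simp: summable_ignore_initial_segment)
    have "enn2real (U.energy (- s) ?q (tail N v)) \<le> Cg * (\<Sum>i. f (i + N))"
      using enn2real_mono[OF tE[of N]] nn by simp
    then have "sobolev_norm (- s) ?q \<Gamma>U (tail N v) \<le> (Cg * (\<Sum>i. f (i + N))) powr (1 / ?q)"
      unfolding sobolev_norm_def sobolev_energy_\<Gamma>U using q by (intro powr_mono2) auto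
    then have "B * sobolev_norm (- s) ?q \<Gamma>U (tail N v) \<le> B * (Cg * (\<Sum>i. f (i + N))) powr (1 / ?q)"
      using B(1) by (rule mult_left_mono)
    then show ?thesis using B(2)[OF tW[of N]] by linarith
  qed
  have "(\<lambda>N. \<Phi> (tail N v)) \<longlonglongrightarrow> 0"
    by (rule tendsto_norm_zero_cancel, rule tendsto_sandwich[OF _ _ tendsto_const tends])
       (use bd in auto)
  moreover have "\<forall>\<^sub>F N in sequentially. \<Phi> (tail N v) = \<Phi> v - \<Phi> (ext k (res k v))"
    using eventually_gt_at_top[of k]
  proof eventually_elim
    case (elim N)
    then show ?case using ind[of N] by simp
  qed
  ultimately have "(\<lambda>N. \<Phi> v - \<Phi> (ext k (res k v))) \<longlonglongrightarrow> 0"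
    by (rule Lim_transform_eventually)
  then have "\<Phi> v - \<Phi> (ext k (res k v)) = 0" using LIMSEQ_const_iff by blast
  then show "\<Phi> v = \<Phi> (ext k (res k v))" by simp
qed

text \<open>Away from its sources the potential is Lipschitz, and pulling it back from component
  \<open>i\<close> multiplies the Lipschitz constant by \<open>r ^ i\<close>. The projection is
  essential: a merely bounded energy would leave the weights
  \<open>(r ^ i) powr (n - \<sigma> * q)\<close>, which are not summable if
  \<open>\<sigma> * q \<ge> n\<close>.\<close>

lemma NP_decay:
  fixes \<sigma> q :: real
  assumes q: "1 < q" and \<sigma>: "0 \<le> \<sigma>" "\<sigma> < 1" and h: "h \<in> W \<sigma> q \<Gamma>\<^sub>0"
  shows "\<exists>b\<ge>0. \<forall>i. i \<noteq> j \<longrightarrow>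
    B.energy \<sigma> q (P0_comp \<Gamma>\<^sub>0 (\<lambda>y. NP r \<Omega>\<^sub>0 (ext j h) (r ^ i *\<^sub>R y))) \<le> ennreal (b * (r ^ i) powr q)"
proof -
  define g where "g = ext j h"
  have hm: "h \<in> borel_measurable borel" using h by (simp add: W_iff)
  have gm: "g \<in> borel_measurable borel" unfolding g_def by (rule ext_measurable[OF hm])
  have gM [measurable]: "g \<in> borel_measurable MU" by (rule borel_measurable_M[OF gm])
  have supp: "\<And>x. x \<notin> \<Gamma> j \<Longrightarrow> g x = 0" by (simp add: g_def ext_off)
  have gi: "integrable MU g"
    by (rule U.integrable_of_energy[where \<sigma> = \<sigma>, OF q gM]) (use ext_W[OF q \<sigma>(1) h, of j] in \<open>simp add: WU_iff g_def\<close>)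
  define \<delta> where "\<delta> = sepc * inrad * r ^ j"
  have \<delta>: "0 < \<delta>" using sepc inrad r by (simp add: \<delta>_def)
  define a where "a = 1 / \<delta> ^ (DIM('a) - 1)"
  define e where "e = (real DIM('a) + 1) / \<delta> ^ DIM('a)"
  have ae: "0 \<le> a" "0 \<le> e" using \<delta> by (auto simp: a_def e_def)
  define GN where "GN = (LINT x|MU. norm (g x))"
  have GN: "0 \<le> GN" by (simp add: GN_def)
  obtain C where C: "0 \<le> C" "\<And>h b. h\<in>borel_measurable M\<^sub>0 \<Longrightarrow> 0 \<le> b \<Longrightarrow> (\<forall>x\<in>space M\<^sub>0. \<forall>y\<in>space M\<^sub>0. norm (h x - h y) \<le> b * norm (x - y)) \<Longrightarrow>
     B.energy \<sigma> q (\<lambda>x. h x - (1 / measure M\<^sub>0 (space M\<^sub>0)) *\<^sub>R (LINT y|M\<^sub>0. h y)) \<le> ennreal (C * b powr q)"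
    using B.lipschitz_mean_free_energy[OF q \<sigma>] by blast
  have "B.energy \<sigma> q (P0_comp \<Gamma>\<^sub>0 (\<lambda>y. NP r \<Omega>\<^sub>0 g (r ^ i *\<^sub>R y))) \<le> ennreal (C * (e * GN) powr q * (r ^ i) powr q)" if ij: "i \<noteq> j" for i
  proof -
    define hi where "hi y = ((r ^ j) ^ n / (r ^ i) ^ n) *\<^sub>R K_int_transpose r \<Omega>\<^sub>0 (int j - int i) (\<lambda>x. g (r ^ j *\<^sub>R x)) y" for y
    have NPhi: "NP r \<Omega>\<^sub>0 g (r ^ i *\<^sub>R y) = hi y" if "y \<in> \<Gamma>\<^sub>0" for y
      unfolding hi_def by (rule NP_scale[OF gm supp that])
    have [measurable]: "K_int_transpose r \<Omega>\<^sub>0 (int j - int i) (\<lambda>x. g (r ^ j *\<^sub>R x)) \<in> borel_measurable borel"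
      by (intro K_int_transpose_measurable scale_measurable gm)
    have him: "hi \<in> borel_measurable borel" unfolding hi_def by measurable
    have far: "\<delta> \<le> norm (x - r ^ i *\<^sub>R y)" if "x \<in> \<Gamma> j" "y \<in> \<Gamma>\<^sub>0" for x y
      unfolding \<delta>_def using ij that by (intro separation_power) (auto simp: scale_Gam_iff)
    have kNb: "\<bar>kN j (r ^ i *\<^sub>R y) x\<bar> \<le> a" if "x \<in> \<Gamma> j" "y \<in> \<Gamma>\<^sub>0" for x y
    proof -
      have "norm (newton_field (x - r ^ i *\<^sub>R y)) \<le> a" unfolding a_def by (rule newton_field_bound[OF dim2 \<delta> far[OF that]])
      then show ?thesis using inner_nhat_le[of "(1 / r ^ j) *\<^sub>R x" "newton_field (x - r ^ i *\<^sub>R y)"] by (simp add: kN_def)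
    qed
    have ik: "integrable MU (\<lambda>x. kN j (r ^ i *\<^sub>R y) x *\<^sub>R g x)" if y: "y \<in> \<Gamma>\<^sub>0" for y
    proof (rule Bochner_Integration.integrable_bound[OF integrable_scaleR_right[OF gi, of a]])
      have "(\<lambda>x. kN j (r ^ i *\<^sub>R y) x *\<^sub>R g x) \<in> borel_measurable borel" unfolding kN_def using gm by measurable
      then show "(\<lambda>x. kN j (r ^ i *\<^sub>R y) x *\<^sub>R g x) \<in> borel_measurable MU" by (rule borel_measurable_M)
      show "AE x in MU. norm (kN j (r ^ i *\<^sub>R y) x *\<^sub>R g x) \<le> norm (a *\<^sub>R g x)"
      proof (rule AE_I2)
        fix x show "norm (kN j (r ^ i *\<^sub>R y) x *\<^sub>R g x) \<le> norm (a *\<^sub>R g x)"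
          using kNb[OF _ y, of x] ae supp by (cases "x \<in> \<Gamma> j") (auto intro!: mult_right_mono)
      qed
    qed
    \<comment> \<open>The increment is computed before dilation, where the distance to the sources
      is at least \<open>\<delta>\<close> for every \<open>i\<close>; the factor
      \<open>r ^ i\<close> is the contraction of the increment in \<open>y\<close>.\<close>
    have lip: "norm (hi y - hi y') \<le> (e * r ^ i * GN) * norm (y - y')" if y: "y \<in> \<Gamma>\<^sub>0" and y': "y' \<in> \<Gamma>\<^sub>0" for y y'
    proof -
      have "hi y - hi y' = (LINT x|MU. kN j (r ^ i *\<^sub>R y) x *\<^sub>R g x) - (LINT x|MU. kN j (r ^ i *\<^sub>R y') x *\<^sub>R g x)"
        unfolding NPhi[OF y, symmetric] NPhi[OF y', symmetric]
        by (intro arg_cong2[where f = minus] NP_eq_integral_MU[OF gm supp] scale_in_\<Gamma>U y y')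
      also have "\<dots> = (LINT x|MU. kN j (r ^ i *\<^sub>R y) x *\<^sub>R g x - kN j (r ^ i *\<^sub>R y') x *\<^sub>R g x)"
        by (rule Bochner_Integration.integral_diff[symmetric, OF ik[OF y] ik[OF y']])
      finally have "norm (hi y - hi y') \<le> (LINT x|MU. norm (kN j (r ^ i *\<^sub>R y) x *\<^sub>R g x - kN j (r ^ i *\<^sub>R y') x *\<^sub>R g x))"
        using integral_norm_bound by metis
      also have "\<dots> \<le> (LINT x|MU. (e * r ^ i * norm (y - y')) * norm (g x))"
      proof (rule integral_mono[OF integrable_norm[OF Bochner_Integration.integrable_diff[OF ik[OF y] ik[OF y']]] integrable_mult_right[OF integrable_norm[OF gi]]])
        fix x
        show "norm (kN j (r ^ i *\<^sub>R y) x *\<^sub>R g x - kN j (r ^ i *\<^sub>R y') x *\<^sub>R g x) \<le> (e * r ^ i * norm (y - y')) * norm (g x)"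
        proof (cases "x \<in> \<Gamma> j")
          case True
          have "\<bar>kN j (r ^ i *\<^sub>R y) x - kN j (r ^ i *\<^sub>R y') x\<bar> \<le> norm (newton_field (x - r ^ i *\<^sub>R y) - newton_field (x - r ^ i *\<^sub>R y'))"
            unfolding kN_def inner_diff_right[symmetric] by (rule inner_nhat_le)
          also have "\<dots> \<le> e * norm ((x - r ^ i *\<^sub>R y) - (x - r ^ i *\<^sub>R y'))"
            unfolding e_def by (rule newton_field_diff[OF dim2 \<delta> far[OF True y] far[OF True y']])
          also have "norm ((x - r ^ i *\<^sub>R y) - (x - r ^ i *\<^sub>R y')) = r ^ i * norm (y - y')"
            using rj[of i] by (simp add: norm_minus_commute flip: scaleR_diff_right)
          finally have "\<bar>kN j (r ^ i *\<^sub>R y) x - kN j (r ^ i *\<^sub>R y') x\<bar> \<le> e * r ^ i * norm (y - y')" by simp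
          then have "\<bar>kN j (r ^ i *\<^sub>R y) x - kN j (r ^ i *\<^sub>R y') x\<bar> * norm (g x) \<le> (e * r ^ i * norm (y - y')) * norm (g x)"
            by (rule mult_right_mono) simp
          then show ?thesis by (simp flip: scaleR_diff_left)
        qed (simp add: supp)
      qed
      also have "\<dots> = (e * r ^ i * GN) * norm (y - y')" by (simp add: GN_def)
      finally show ?thesis .
    qed
    have "P0_comp \<Gamma>\<^sub>0 (\<lambda>y. NP r \<Omega>\<^sub>0 g (r ^ i *\<^sub>R y)) = P0_comp \<Gamma>\<^sub>0 hi" by (rule P0_comp_cong) (rule NPhi)
    moreover have "B.energy \<sigma> q (P0_comp \<Gamma>\<^sub>0 hi) = B.energy \<sigma> q (\<lambda>x. hi x - (1 / measure M\<^sub>0 (space M\<^sub>0)) *\<^sub>R (LINT y|M\<^sub>0. hi y))"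
      by (intro energy_cong P0_comp_eq)
    moreover have "\<dots> \<le> ennreal (C * (e * r ^ i * GN) powr q)"
      using ae GN rj[of i] lip by (intro C(2) borel_measurable_M[OF him]) auto
    moreover have "(e * r ^ i * GN) powr q = (e * GN) powr q * (r ^ i) powr q"
    proof -
      have "e * r ^ i * GN = (e * GN) * r ^ i" by simp
      then show ?thesis by (simp only: powr_mult)
    qed
    ultimately show ?thesis by (simp add: mult.assoc)
  qed
  moreover have "0 \<le> C * (e * GN) powr q" using C by simp
  ultimately show ?thesis unfolding g_def by blast
qed

section \<open>Block representation for negative order\<close>

lemma zero_neg_apply: "h \<in> W_test s p \<Gamma>\<^sub>0 \<Longrightarrow> zero_neg s p \<Gamma>\<^sub>0 h = 0"
  by (simp add: zero_neg_def)

lemma zero_neg_W0: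
  assumes p: "1 < p"
  shows "zero_neg s p \<Gamma>\<^sub>0 \<in> W0_neg_comp s p \<Gamma>\<^sub>0"
proof -
  have q: "1 < conj_exp p" by (rule conj_exp_gt_1[OF p])
  have "\<exists>B. \<forall>g\<in>W_test s p \<Gamma>\<^sub>0. norm (zero_neg s p \<Gamma>\<^sub>0 g) \<le> B * sobolev_norm (- s) (conj_exp p) \<Gamma>\<^sub>0 g"
    by (intro exI[of _ 0]) (simp add: zero_neg_apply)
  then show ?thesis
    using W_add[OF q, of _ "- s"] W_cmult[of _ "- s" "conj_exp p"] indicator_W[OF q, of "- s"]
    by (simp add: W0_neg_comp_def W_neg_def zero_neg_apply) (simp add: zero_neg_def)
qed

lemma dual_norm_zero_neg:
  assumes p: "1 < p"
  shows "dual_norm s p \<Gamma>\<^sub>0 (zero_neg s p \<Gamma>\<^sub>0) = 0"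
proof -
  have q: "1 < conj_exp p" by (rule conj_exp_gt_1[OF p])
  have "{norm (zero_neg s p \<Gamma>\<^sub>0 g) | g. g \<in> W_test s p \<Gamma>\<^sub>0 \<and> sobolev_norm (- s) (conj_exp p) \<Gamma>\<^sub>0 g \<le> 1} = {0}"
    (is "?A = _")
  proof
    show "?A \<subseteq> {0}" by (auto simp: zero_neg_apply)
    have "(\<lambda>x. 0) \<in> W_test s p \<Gamma>\<^sub>0" using q by (intro W_zero) simp
    moreover have "sobolev_norm (- s) (conj_exp p) \<Gamma>\<^sub>0 (\<lambda>x. 0) = 0"
      using q by (simp add: sobolev_norm_def sobolev_energy_\<Gamma>\<^sub>0 energy_zero_fun)
    ultimately show "{0} \<subseteq> ?A" using zero_neg_apply by fastforce
  qed
  then show ?thesis by (simp add: dual_norm_def)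
qed

lemma P0_ext:
  assumes h: "h \<in> borel_measurable borel"
  shows "P0 r \<Omega>\<^sub>0 (ext j h) = ext j (P0_comp \<Gamma>\<^sub>0 h)"
proof
  fix x
  show "P0 r \<Omega>\<^sub>0 (ext j h) x = ext j (P0_comp \<Gamma>\<^sub>0 h) x"
  proof (cases "x \<in> \<Gamma>U")
    case True
    then obtain i x0 where x0: "x0 \<in> \<Gamma>\<^sub>0" "x = r ^ i *\<^sub>R x0" by (rule \<Gamma>U_cases)
    have "P0 r \<Omega>\<^sub>0 (ext j h) x = P0_comp \<Gamma>\<^sub>0 (if i = j then h else (\<lambda>_. 0)) x0"
      unfolding x0(2) by (rule P0_scale[OF _ _ x0(1)]) (use h in \<open>auto simp: ext_scale\<close>)
    also have "\<dots> = ext j (P0_comp \<Gamma>\<^sub>0 h) x"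
      using x0 by (simp add: ext_scale P0_comp_def set_lebesgue_integral_def)
    finally show ?thesis .
  next
    case False
    then have "x \<notin> \<Gamma> j" using Gam_subset by blast
    then show ?thesis using False by (simp add: P0_def ext_off)
  qed
qed

lemma rescale_neg_apply:
  assumes h: "h \<in> W_test s p \<Gamma>\<^sub>0"
  shows "rescale_neg s p \<alpha> r \<Omega>\<^sub>0 \<Phi> j h = (r powr (real j * \<alpha>) * r powr (- real j * real n)) *\<^sub>R \<Phi> (ext j h)"
proof -
  have "ext j h = (\<lambda>x. if x \<in> \<Gamma> j then h (eta r (- int j) x) else 0)" by (auto simp: ext_def)
  then show ?thesis using h by (simp add: rescale_neg_def real_n)
qed

text \<open>A bounded functional on the space of order \<open>-s\<close> need not be determined by its restrictions to the
  components: evaluation at the accumulation point \<open>0\<close> is bounded if \<open>-s p' > d - 1\<close>. It is killed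
  by the projections, so the value of the operator does not depend on the chosen preimage.\<close>

lemma NP_adj_tilde_neg_component:
  assumes p: "1 < p" and s: "- 1 < s" "s < 0" and \<Phi>: "\<Phi> \<in> W0_neg s p r \<Omega>\<^sub>0"
    and \<Psi>: "\<Psi> \<in> W0_neg_comp s p \<Gamma>\<^sub>0" and h: "h \<in> W_test s p \<Gamma>\<^sub>0"
    and other: "\<And>i h. i \<noteq> k \<Longrightarrow> h \<in> W_test s p \<Gamma>\<^sub>0 \<Longrightarrow> \<Phi> (ext i h) = 0"
    and kcomp: "\<And>h. h \<in> W_test s p \<Gamma>\<^sub>0 \<Longrightarrow> \<Phi> (ext k h) = c * \<Psi> h"
  shows "NP_adj_tilde_neg s p r \<Omega>\<^sub>0 \<Phi> (ext j h) = ((r ^ j) ^ n / (r ^ k) ^ n) *\<^sub>R (c * K_tilde_neg s p r \<Omega>\<^sub>0 (int j - int k) \<Psi> h)"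
proof -
  let ?q = "conj_exp p"
  have q: "1 < ?q" by (rule conj_exp_gt_1[OF p])
  have \<sigma>: "0 \<le> - s" "- s < 1" using s by auto
  have \<Phi>W: "\<Phi> \<in> W_neg s p \<Gamma>U" using \<Phi> by (simp add: W0_neg_def)
  have \<Psi>W: "\<Psi> \<in> W_neg s p \<Gamma>\<^sub>0" using \<Psi> by (simp add: W0_neg_comp_def)
  define h' where "h' = P0_comp \<Gamma>\<^sub>0 h"
  have h'W: "h' \<in> W_test s p \<Gamma>\<^sub>0" unfolding h'_def by (rule P0_comp_W[OF q h])
  have h'm: "h' \<in> borel_measurable borel" using h'W by (simp add: W_iff)
  have gm: "ext j h' \<in> borel_measurable borel" by (rule ext_measurable[OF h'm])
  have gW: "ext j h' \<in> W_test s p \<Gamma>U" by (rule ext_W[OF q \<sigma>(1) h'W])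
  define u where "u = NP r \<Omega>\<^sub>0 (ext j h')"
  define Kt where "Kt i = K_int_transpose r \<Omega>\<^sub>0 (int j - int i) h'" for i
  have KtW: "Kt i \<in> W_test s p \<Gamma>\<^sub>0" for i unfolding Kt_def by (rule K_int_transpose_W[OF q \<sigma> h'W])
  then have Ktm [measurable]: "Kt i \<in> borel_measurable borel" for i by (simp add: W_iff)
  define c' where "c' i = (r ^ j) ^ n / (r ^ i) ^ n" for i
  have us: "u (r ^ i *\<^sub>R y) = c' i *\<^sub>R Kt i y" if y: "y \<in> \<Gamma>\<^sub>0" for i y
  proof -
    have "u (r ^ i *\<^sub>R y) = c' i *\<^sub>R K_int_transpose r \<Omega>\<^sub>0 (int j - int i) (\<lambda>x. ext j h' (r ^ j *\<^sub>R x)) y"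
      unfolding u_def c'_def by (rule NP_scale[OF gm ext_off y])
    also have "K_int_transpose r \<Omega>\<^sub>0 (int j - int i) (\<lambda>x. ext j h' (r ^ j *\<^sub>R x)) = Kt i"
      unfolding Kt_def by (rule K_int_transpose_cong) (simp add: ext_scale)
    finally show ?thesis .
  qed
  \<comment> \<open>A function glued from measurable pieces is measurable, being a series with at
    most one nonzero term at each point.\<close>
  have measurableU: "w \<in> borel_measurable borel"
    if w: "\<And>i y. y \<in> \<Gamma>\<^sub>0 \<Longrightarrow> w (r ^ i *\<^sub>R y) = V i y" and V [measurable]: "\<And>i. V i \<in> borel_measurable borel" and off: "\<And>x. x \<notin> \<Gamma>U \<Longrightarrow> w x = 0"
    for w :: "'a \<Rightarrow> complex" and V
  proof -
    have "w = (\<lambda>x. \<Sum>i. if x \<in> \<Gamma> i then V i ((1 / r ^ i) *\<^sub>R x) else 0)"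
    proof
      fix x
      show "w x = (\<Sum>i. if x \<in> \<Gamma> i then V i ((1 / r ^ i) *\<^sub>R x) else 0)"
      proof (cases "x \<in> \<Gamma>U")
        case True
        then obtain i x0 where x0: "x0 \<in> \<Gamma>\<^sub>0" "x = r ^ i *\<^sub>R x0" by (rule \<Gamma>U_cases)
        have "(\<Sum>l. if x \<in> \<Gamma> l then V l ((1 / r ^ l) *\<^sub>R x) else 0) = (\<Sum>l\<in>{i}. if x \<in> \<Gamma> l then V l ((1 / r ^ l) *\<^sub>R x) else 0)"
          by (rule suminf_finite) (auto simp: x0 scale_in_Gam)
        then show ?thesis using x0 w[OF x0(1), of i] by (simp add: scale_in_Gam)
      next
        case False
        then have "x \<notin> \<Gamma> i" for i using Gam_subset by blast
        then show ?thesis using off[OF False] by simp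
      qed
    qed
    also have "\<dots> \<in> borel_measurable borel"
    proof (rule borel_measurable_suminf)
      fix i
      have [measurable]: "(\<lambda>x. V i ((1 / r ^ i) *\<^sub>R x)) \<in> borel_measurable borel" by (rule scale_measurable[OF V])
      show "(\<lambda>x. if x \<in> \<Gamma> i then V i ((1 / r ^ i) *\<^sub>R x) else 0) \<in> borel_measurable borel" by measurable
    qed
    finally show ?thesis .
  qed
  have uoff: "u x = 0" if "x \<notin> \<Gamma>U" for x using that by (simp add: u_def NP_def)
  have um: "u \<in> borel_measurable borel" 
  proof (rule measurableU[where V = "\<lambda>i y. c' i *\<^sub>R Kt i y"])
    show "(\<lambda>y. c' i *\<^sub>R Kt i y) \<in> borel_measurable borel" for i by measurable
  qed (fact us uoff)+
  \<comment> \<open>Needed before the projection is applied: \<open>P0_neg\<close> is extensional,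
    so the functional it produces can be evaluated at \<open>u\<close> only inside the test
    space.\<close>
  have uW: "u \<in> W_test s p \<Gamma>U"
  proof -
    obtain C where C: "0 \<le> C" "\<And>f. f\<in>borel_measurable MU \<Longrightarrow> U.energy (- s) ?q (\<lambda>y. LINT x|MU. kN j y x *\<^sub>R f x) \<le> ennreal C * (\<integral>\<^sup>+y. ennreal (norm (f y) powr ?q) \<partial>MU)"
      using NP_kernel_energy[OF q \<sigma>] by blast
    have "U.energy (- s) ?q u = U.energy (- s) ?q (\<lambda>y. LINT x|MU. kN j y x *\<^sub>R ext j h' x)"
      unfolding u_def by (rule energy_congU) (rule NP_eq_integral_MU[OF gm ext_off])
    also have "\<dots> \<le> ennreal C * (\<integral>\<^sup>+y. ennreal (norm (ext j h' y) powr ?q) \<partial>MU)" by (rule C(2)[OF borel_measurable_M[OF gm]])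
    also have "\<dots> \<le> ennreal C * U.energy (- s) ?q (ext j h')"
      by (intro mult_left_mono) (simp_all add: U.energy_def add_increasing2)
    also have "\<dots> < \<infinity>" using gW by (simp add: WU_iff ennreal_mult_less_top)
    finally show ?thesis using um uoff by (simp add: WU_iff)
  qed
  define v where "v = P0 r \<Omega>\<^sub>0 u"
  have vs: "v (r ^ i *\<^sub>R y) = c' i *\<^sub>R P0_comp \<Gamma>\<^sub>0 (Kt i) y" if y: "y \<in> \<Gamma>\<^sub>0" for i y
  proof -
    have m: "(\<lambda>y. c' i *\<^sub>R Kt i y) \<in> borel_measurable borel" by measurable
    have "v (r ^ i *\<^sub>R y) = P0_comp \<Gamma>\<^sub>0 (\<lambda>y. c' i *\<^sub>R Kt i y) y" unfolding v_def by (rule P0_scale[OF m us y])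
    then show ?thesis by (simp add: P0_comp_scaleR)
  qed
  have PK: "P0_comp \<Gamma>\<^sub>0 (Kt i) \<in> W_test s p \<Gamma>\<^sub>0" for i by (rule P0_comp_W[OF q KtW])
  have voff: "v x = 0" if "x \<notin> \<Gamma>U" for x using that by (simp add: v_def P0_def)
  have vm: "v \<in> borel_measurable borel"
  proof (rule measurableU[where V = "\<lambda>i y. c' i *\<^sub>R P0_comp \<Gamma>\<^sub>0 (Kt i) y"])
    have [measurable]: "P0_comp \<Gamma>\<^sub>0 (Kt i) \<in> borel_measurable borel" for i using PK by (simp add: W_iff)
    show "(\<lambda>y. c' i *\<^sub>R P0_comp \<Gamma>\<^sub>0 (Kt i) y) \<in> borel_measurable borel" for i by measurable
  qed (fact vs voff)+
  have resv: "res i v = (\<lambda>y. c' i *\<^sub>R P0_comp \<Gamma>\<^sub>0 (Kt i) y)" for i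
    by (auto simp: res_def vs P0_comp_off fun_eq_iff)
  have sum: "(\<Sum>i. ennreal ((r ^ i) powr (n - (- s) * ?q)) * B.energy (- s) ?q (res i v)) < \<infinity>"
  proof -
    obtain b where b: "0 \<le> b" "\<And>i. i \<noteq> j \<Longrightarrow>
      B.energy (- s) ?q (P0_comp \<Gamma>\<^sub>0 (\<lambda>y. NP r \<Omega>\<^sub>0 (ext j h') (r ^ i *\<^sub>R y))) \<le> ennreal (b * (r ^ i) powr ?q)"
      using NP_decay[OF q \<sigma> h'W] by blast
    have Ei: "B.energy (- s) ?q (res i v) \<le> ennreal (b * (r ^ i) powr ?q)" if "i \<noteq> j" for i
    proof -
      have "P0_comp \<Gamma>\<^sub>0 (\<lambda>y. NP r \<Omega>\<^sub>0 (ext j h') (r ^ i *\<^sub>R y)) = P0_comp \<Gamma>\<^sub>0 (\<lambda>y. c' i *\<^sub>R Kt i y)"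
        by (rule P0_comp_cong) (simp add: us u_def[symmetric])
      then show ?thesis using b(2)[OF that] by (simp add: resv P0_comp_scaleR)
    qed
    have "res j v \<in> W_test s p \<Gamma>\<^sub>0" unfolding resv by (rule W_scaleR[OF PK])
    then have Ej: "B.energy (- s) ?q (res j v) < \<infinity>" by (simp add: W_iff)
    \<comment> \<open>The exponent adds the weight \<open>n - (- s) * conj_exp p\<close> and the
      decay \<open>conj_exp p\<close> from \<open>NP_decay\<close>; it is positive because
      \<open>s > - 1\<close>.\<close>
    define \<tau> where "\<tau> = r powr (n + (1 + s) * ?q)"
    have \<tau>: "0 \<le> \<tau>" "\<tau> < 1"
    proof -
      have "0 < (1 + s) * ?q" using s q by (intro mult_pos_pos) auto
      then have "0 < real n + (1 + s) * ?q" by simp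
      then show "0 \<le> \<tau>" "\<tau> < 1" using r powr_less_mono'[of r 0 "n + (1 + s) * ?q"] by (auto simp: \<tau>_def)
    qed
    \<comment> \<open>The term with \<open>i = j\<close>, to which the decay estimate does not
      apply, is added separately.\<close>
    define f where "f i = b * \<tau> ^ i + (if i = j then (r ^ j) powr (n - (- s) * ?q) * enn2real (B.energy (- s) ?q (res j v)) else 0)" for i
    have f0: "0 \<le> f i" for i using b(1) \<tau> by (simp add: f_def)
    have fsum: "summable f" unfolding f_def
      using \<tau> by (intro summable_add summable_mult summable_geometric summable_single) auto
    have "ennreal ((r ^ i) powr (n - (- s) * ?q)) * B.energy (- s) ?q (res i v) \<le> ennreal (f i)" for i
    proof (cases "i = j")
      case True
      have "ennreal ((r ^ i) powr (n - (- s) * ?q)) * B.energy (- s) ?q (res i v) = ennreal ((r ^ j) powr (n - (- s) * ?q) * enn2real (B.energy (- s) ?q (res j v)))"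
        using True Ej by (simp add: ennreal_mult)
      also have "\<dots> \<le> ennreal (f i)" using True b(1) \<tau> by (intro ennreal_leI) (simp add: f_def)
      finally show ?thesis .
    next
      case False
      have "ennreal ((r ^ i) powr (n - (- s) * ?q)) * B.energy (- s) ?q (res i v) \<le> ennreal ((r ^ i) powr (n - (- s) * ?q)) * ennreal (b * (r ^ i) powr ?q)"
        by (rule mult_left_mono[OF Ei[OF False]]) simp
      also have "\<dots> = ennreal (b * ((r ^ i) powr (n - (- s) * ?q) * (r ^ i) powr ?q))"
        using b(1) by (simp add: ennreal_mult[symmetric] mult_ac)
      also have "(r ^ i) powr (n - (- s) * ?q) * (r ^ i) powr ?q = (r ^ i) powr (n + (1 + s) * ?q)"
        by (simp add: powr_add[symmetric] algebra_simps)
      also have "\<dots> = \<tau> ^ i"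
        using r by (simp add: \<tau>_def powr_power powr_powr mult.commute flip: powr_realpow)
      also have "ennreal (b * \<tau> ^ i) \<le> ennreal (f i)" using False by (simp add: f_def)
      finally show ?thesis .
    qed
    then have "(\<Sum>i. ennreal ((r ^ i) powr (n - (- s) * ?q)) * B.energy (- s) ?q (res i v)) \<le> (\<Sum>i. ennreal (f i))"
      by (intro suminf_le) auto
    also have "\<dots> = ennreal (\<Sum>i. f i)" by (rule suminf_ennreal2[OF f0 fsum])
    also have "\<dots> < \<infinity>" by simp
    finally show ?thesis .
  qed
  note comp = component_of_functional[OF p s \<Phi>W vm voff sum other]
  have "NP_adj_tilde_neg s p r \<Omega>\<^sub>0 \<Phi> (ext j h) = NP_adj_neg s p r \<Omega>\<^sub>0 (P0_neg s p r \<Omega>\<^sub>0 \<Phi>) (P0 r \<Omega>\<^sub>0 (ext j h))"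
    using ext_W[OF q \<sigma>(1) h, of j] by (simp add: NP_adj_tilde_neg_def P0_neg_def[of s p r \<Omega>\<^sub>0 "NP_adj_neg s p r \<Omega>\<^sub>0 (P0_neg s p r \<Omega>\<^sub>0 \<Phi>)"])
  also have "P0 r \<Omega>\<^sub>0 (ext j h) = ext j h'" unfolding h'_def using h by (intro P0_ext) (simp add: W_iff)
  also have "NP_adj_neg s p r \<Omega>\<^sub>0 (P0_neg s p r \<Omega>\<^sub>0 \<Phi>) (ext j h') = \<Phi> v"
    using gW uW by (simp add: NP_adj_neg_def P0_neg_def u_def v_def)
  also have "\<Phi> v = \<Phi> (ext k (res k v))" by (rule comp(2))
  also have "\<dots> = c * \<Psi> (res k v)" unfolding resv by (rule kcomp[OF W_scaleR[OF PK]])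
  also have "\<Psi> (res k v) = of_real (c' k) * \<Psi> (P0_comp \<Gamma>\<^sub>0 (Kt k))"
    unfolding resv scaleR_conv_of_real by (rule W_negD(3)[OF \<Psi>W PK])
  \<comment> \<open>The remaining projection disappears because \<open>\<Psi>\<close> annihilates
    the indicator.\<close>
  also have "\<Psi> (P0_comp \<Gamma>\<^sub>0 (Kt k)) = \<Psi> (Kt k)" by (rule W0_neg_P0_comp[OF p \<Psi> KtW])
  also have "\<Psi> (Kt k) = K_tilde_neg s p r \<Omega>\<^sub>0 (int j - int k) \<Psi> h"
    by (simp add: K_tilde_neg_eq[OF p h] Kt_def h'_def)
  finally show ?thesis by (simp add: c'_def scaleR_conv_of_real)
qed

text \<open>\<open>inv_into\<close> may return any preimage. The explicit functional
  \<open>\<Phi>1\<close> only shows that the sequence lies in the image; the computation uses the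
  chosen \<open>\<Phi>\<close> through its values on extensions from single components, and these
  are determined by the sequence.\<close>

lemma block_negative:
  assumes p: "1 < p" and s: "- 1 < s" "s < 0" and \<Psi>: "\<Psi> \<in> W0_neg_comp s p \<Gamma>\<^sub>0"
  shows "block (zero_neg s p \<Gamma>\<^sub>0) (scaled_NP_neg s p \<alpha> r \<Omega>\<^sub>0) j k \<Psi> =
    (\<lambda>h \<in> W_test s p \<Gamma>\<^sub>0. (r powr ((real j - real k) * \<alpha>)) *\<^sub>R K_tilde_neg s p r \<Omega>\<^sub>0 (int j - int k) \<Psi> h)"
proof -
  let ?q = "conj_exp p"
  have q: "1 < ?q" by (rule conj_exp_gt_1[OF p])
  have \<sigma>: "0 \<le> - s" "- s < 1" using s by auto
  have \<Psi>W: "\<Psi> \<in> W_neg s p \<Gamma>\<^sub>0" and \<Psi>1: "\<Psi> (indicator \<Gamma>\<^sub>0) = 0" using \<Psi> by (auto simp: W0_neg_comp_def)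
  define f where "f = (\<lambda>i. zero_neg s p \<Gamma>\<^sub>0)(k := \<Psi>)"
  have f_ell: "f \<in> ell p (W0_neg_comp s p \<Gamma>\<^sub>0) (dual_norm s p \<Gamma>\<^sub>0)"
  proof -
    have "summable (\<lambda>j. dual_norm s p \<Gamma>\<^sub>0 (f j) powr p)"
      by (rule summable_finite[of "{k}"]) (auto simp: f_def dual_norm_zero_neg[OF p])
    then show ?thesis using \<Psi> zero_neg_W0[OF p] by (simp add: ell_def f_def)
  qed
  define a where "a i = r powr (real i * \<alpha>) * r powr (- real i * real n)" for i
  have a: "0 < a i" for i using r by (simp add: a_def)
  \<comment> \<open>Evaluation of \<open>\<Psi>\<close> on the pullback from component
    \<open>k\<close>, divided by the factor \<open>a k\<close> that the rescaling will bring
    in.\<close>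
  define \<Phi>1 where "\<Phi>1 = (\<lambda>g \<in> W_test s p \<Gamma>U. of_real (1 / a k) * \<Psi> (res k g))"
  have \<Phi>1W: "\<Phi>1 \<in> W_neg s p \<Gamma>U"
  proof -
    have radd: "res k (\<lambda>x. g x + h x) = (\<lambda>x. res k g x + res k h x)" for g h by (auto simp: res_def)
    have rmul: "res k (\<lambda>x. c * g x) = (\<lambda>x. c * res k g x)" for c g by (auto simp: res_def)
    note rW = res_W[OF q \<sigma>(1)]
    have "\<exists>B. \<forall>g\<in>W_test s p \<Gamma>U. norm (\<Phi>1 g) \<le> B * sobolev_norm (- s) ?q \<Gamma>U g"
    proof -
      obtain B where B: "0 \<le> B" "\<And>g. g \<in> W_test s p \<Gamma>\<^sub>0 \<Longrightarrow> norm (\<Psi> g) \<le> B * sobolev_norm (- s) ?q \<Gamma>\<^sub>0 g" using W_neg_bound[OF \<Psi>W] by blast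
      obtain C where C: "0 \<le> C" "\<And>g. g\<in>borel_measurable borel \<Longrightarrow> B.energy (- s) ?q (res k g) \<le> ennreal C * U.energy (- s) ?q g"
        using res_energy[OF q \<sigma>(1)] by blast
      have "norm (\<Phi>1 g) \<le> (1 / a k * (B * C powr (1 / ?q))) * sobolev_norm (- s) ?q \<Gamma>U g" if g: "g \<in> W_test s p \<Gamma>U" for g
      proof -
        have "sobolev_norm (- s) ?q \<Gamma>\<^sub>0 (res k g) \<le> C powr (1 / ?q) * sobolev_norm (- s) ?q \<Gamma>U g"
          unfolding sobolev_norm_def sobolev_energy_\<Gamma>\<^sub>0 sobolev_energy_\<Gamma>U
          by (rule root_energy_le) (use g C q in \<open>auto simp: WU_iff\<close>)
        then have "B * sobolev_norm (- s) ?q \<Gamma>\<^sub>0 (res k g) \<le> B * (C powr (1 / ?q) * sobolev_norm (- s) ?q \<Gamma>U g)"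
          using B(1) by (rule mult_left_mono)
        then have "norm (\<Psi> (res k g)) \<le> B * (C powr (1 / ?q) * sobolev_norm (- s) ?q \<Gamma>U g)"
          using B(2)[OF rW[OF g]] by (rule order_trans[rotated])
        then have "1 / a k * norm (\<Psi> (res k g)) \<le> 1 / a k * (B * (C powr (1 / ?q) * sobolev_norm (- s) ?q \<Gamma>U g))"
          using a[of k] by (intro mult_left_mono) auto
        moreover have "norm (\<Phi>1 g) = 1 / a k * norm (\<Psi> (res k g))"
          using g a[of k] by (simp add: \<Phi>1_def norm_divide)
        ultimately show ?thesis by (simp only: mult.assoc)
      qed
      then show ?thesis by blast
    qed
    moreover have "\<Phi>1 (\<lambda>x. g x + h x) = \<Phi>1 g + \<Phi>1 h" if "g \<in> W_test s p \<Gamma>U" "h \<in> W_test s p \<Gamma>U" for g h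
      using that WU_add[OF q that] W_negD(2)[OF \<Psi>W rW[OF that(1)] rW[OF that(2)]] by (simp add: \<Phi>1_def radd distrib_left add_divide_distrib)
    moreover have "\<Phi>1 (\<lambda>x. c * g x) = c * \<Phi>1 g" if "g \<in> W_test s p \<Gamma>U" for c g
      using that WU_cmult[OF that, of c] W_negD(3)[OF \<Psi>W rW[OF that], of c] by (simp add: \<Phi>1_def rmul)
    ultimately show ?thesis by (simp add: W_neg_def) (simp add: \<Phi>1_def)
  qed
  have \<Phi>1ext: "\<Phi>1 (ext i h) = (if i = k then of_real (1 / a k) * \<Psi> h else 0)" if h: "h \<in> W_test s p \<Gamma>\<^sub>0" for i h
  proof -
    have "res k (ext i h) = (if k = i then h else (\<lambda>x. 0))" using h by (intro res_ext) (simp add: W_iff)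
    then show ?thesis using ext_W[OF q \<sigma>(1) h, of i] W_neg_zero[OF \<Psi>W p] by (auto simp: \<Phi>1_def)
  qed
  \<comment> \<open>This turns the zero means on the components into values on extensions from the
    reference surface, where \<open>\<Psi>\<close> vanishes on the indicator.\<close>
  have ind: "(indicator (\<Gamma> i) :: 'a \<Rightarrow> complex) = ext i (indicator \<Gamma>\<^sub>0)" for i
  proof
    fix x show "indicator (\<Gamma> i) x = (ext i (indicator \<Gamma>\<^sub>0) x :: complex)"
      using unscale_Gam[of x i] by (auto simp: ext_def eta_minus_nat)
  qed
  have \<Phi>1W0: "\<Phi>1 \<in> W0_neg s p r \<Omega>\<^sub>0"
    using \<Phi>1W \<Phi>1ext[OF indicator_W[OF q]] \<Psi>1 by (simp add: W0_neg_def ind)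
  have resc1: "rescale_neg s p \<alpha> r \<Omega>\<^sub>0 \<Phi>1 = f"
  proof (intro HOL.ext)
    fix i h
    show "rescale_neg s p \<alpha> r \<Omega>\<^sub>0 \<Phi>1 i h = f i h"
    proof (cases "h \<in> W_test s p \<Gamma>\<^sub>0")
      case True
      have "rescale_neg s p \<alpha> r \<Omega>\<^sub>0 \<Phi>1 i h = a i *\<^sub>R \<Phi>1 (ext i h)" unfolding a_def by (rule rescale_neg_apply[OF True])
      also have "\<dots> = f i h" using a[of k] by (auto simp: \<Phi>1ext[OF True] f_def zero_neg_apply[OF True] scaleR_conv_of_real)
      finally show ?thesis .
    next
      case False
      \<comment> \<open>Off the test space both sides are \<open>undefined\<close>.\<close>
      have "f i \<in> extensional (W_test s p \<Gamma>\<^sub>0)" using W_negD(1)[OF \<Psi>W] by (simp add: f_def zero_neg_def)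
      then show ?thesis using False by (simp add: rescale_neg_def extensional_def)
    qed
  qed
  define \<Phi> where "\<Phi> = inv_into (W0_neg s p r \<Omega>\<^sub>0) (rescale_neg s p \<alpha> r \<Omega>\<^sub>0) f"
  have im: "f \<in> rescale_neg s p \<alpha> r \<Omega>\<^sub>0 ` W0_neg s p r \<Omega>\<^sub>0" using \<Phi>1W0 resc1 by (intro image_eqI[of f _ \<Phi>1]) auto
  have \<Phi>W0: "\<Phi> \<in> W0_neg s p r \<Omega>\<^sub>0" unfolding \<Phi>_def by (rule inv_into_into[OF im])
  have resc: "rescale_neg s p \<alpha> r \<Omega>\<^sub>0 \<Phi> = f" unfolding \<Phi>_def by (rule f_inv_into_f[OF im])
  \<comment> \<open>All that is known, and all that is used, about the chosen preimage.\<close>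
  have \<Phi>ext: "\<Phi> (ext i h) = of_real (1 / a i) * f i h" if h: "h \<in> W_test s p \<Gamma>\<^sub>0" for i h
  proof -
    have "f i h = a i *\<^sub>R \<Phi> (ext i h)" unfolding resc[symmetric] a_def by (rule rescale_neg_apply[OF h])
    then show ?thesis using a[of i] by (simp add: scaleR_conv_of_real)
  qed
  have val: "rescale_neg s p \<alpha> r \<Omega>\<^sub>0 (NP_adj_tilde_neg s p r \<Omega>\<^sub>0 \<Phi>) j h =
      (r powr ((real j - real k) * \<alpha>)) *\<^sub>R K_tilde_neg s p r \<Omega>\<^sub>0 (int j - int k) \<Psi> h" if h: "h \<in> W_test s p \<Gamma>\<^sub>0" for h
  proof -
    have "NP_adj_tilde_neg s p r \<Omega>\<^sub>0 \<Phi> (ext j h) = ((r ^ j) ^ n / (r ^ k) ^ n) *\<^sub>R (of_real (1 / a k) * K_tilde_neg s p r \<Omega>\<^sub>0 (int j - int k) \<Psi> h)"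
    proof (rule NP_adj_tilde_neg_component[OF p s \<Phi>W0 \<Psi> h])
      show "\<Phi> (ext i h) = 0" if "i \<noteq> k" "h \<in> W_test s p \<Gamma>\<^sub>0" for i h
        using \<Phi>ext[OF that(2), of i] that by (simp add: f_def zero_neg_apply)
      show "\<Phi> (ext k h) = of_real (1 / a k) * \<Psi> h" if "h \<in> W_test s p \<Gamma>\<^sub>0" for h
        using \<Phi>ext[OF that, of k] by (simp add: f_def)
    qed
    moreover have "rescale_neg s p \<alpha> r \<Omega>\<^sub>0 (NP_adj_tilde_neg s p r \<Omega>\<^sub>0 \<Phi>) j h = a j *\<^sub>R NP_adj_tilde_neg s p r \<Omega>\<^sub>0 \<Phi> (ext j h)"
      unfolding a_def by (rule rescale_neg_apply[OF h])
    ultimately have "rescale_neg s p \<alpha> r \<Omega>\<^sub>0 (NP_adj_tilde_neg s p r \<Omega>\<^sub>0 \<Phi>) j h =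
      (a j * ((r ^ j) ^ n / (r ^ k) ^ n) * (1 / a k)) *\<^sub>R K_tilde_neg s p r \<Omega>\<^sub>0 (int j - int k) \<Psi> h"
      by (simp add: scaleR_conv_of_real)
    \<comment> \<open>The powers \<open>r powr (- real i * real n)\<close> inside \<open>a\<close>
      cancel the quotient of Jacobians, so only the powers with \<open>\<alpha>\<close>
      remain.\<close>
    also have "a j * ((r ^ j) ^ n / (r ^ k) ^ n) * (1 / a k) = r powr ((real j - real k) * \<alpha>)"
    proof -
      have pw: "(r ^ i) ^ n = r powr (real i * real n)" for i
        using r by (simp add: powr_realpow[symmetric] powr_powr flip: power_mult of_nat_mult)
      show ?thesis unfolding a_def pw using r
        by (simp add: powr_add[symmetric] powr_diff[symmetric] powr_minus divide_inverse left_diff_distrib powr_diff)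
    qed
    finally show ?thesis .
  qed
  show ?thesis
  proof
    fix h
    show "block (zero_neg s p \<Gamma>\<^sub>0) (scaled_NP_neg s p \<alpha> r \<Omega>\<^sub>0) j k \<Psi> h =
      (\<lambda>h \<in> W_test s p \<Gamma>\<^sub>0. (r powr ((real j - real k) * \<alpha>)) *\<^sub>R K_tilde_neg s p r \<Omega>\<^sub>0 (int j - int k) \<Psi> h) h"
      using f_ell val[of h]
      by (cases "h \<in> W_test s p \<Gamma>\<^sub>0") (simp_all add: block_def scaled_NP_neg_def f_def[symmetric] \<Phi>_def[symmetric], simp add: rescale_neg_def)
  qed
qed

end

theorem lemma5:
  fixes \<Omega>\<^sub>0 :: "'a::euclidean_space set" and r p s \<alpha> :: real
  assumes dim: "DIM('a) = 2 \<or> DIM('a) = 3"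
    and geom: "admissible_geometry r \<Omega>\<^sub>0"
    and p: "1 < p"
    and s: "-1 < s" "s < 1"
    and \<alpha>: "\<alpha> = (real DIM('a) - 1) / p - s"
  shows "(0 \<le> s \<longrightarrow>
           (\<forall>m. K_tilde r \<Omega>\<^sub>0 m \<in> W0_comp s p (frontier \<Omega>\<^sub>0) \<rightarrow> W0_comp s p (frontier \<Omega>\<^sub>0)) \<and>
           (\<forall>j k. \<forall>\<psi> \<in> W0_comp s p (frontier \<Omega>\<^sub>0).
              block (\<lambda>x. 0) (scaled_NP s p \<alpha> r \<Omega>\<^sub>0) j k \<psi> =
              (\<lambda>x. (r powr ((real j - real k) * \<alpha>)) *\<^sub>R K_tilde r \<Omega>\<^sub>0 (int j - int k) \<psi> x))) \<and>
         (s < 0 \<longrightarrow>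
           (\<forall>m. K_tilde_neg s p r \<Omega>\<^sub>0 m \<in>
              W0_neg_comp s p (frontier \<Omega>\<^sub>0) \<rightarrow> W0_neg_comp s p (frontier \<Omega>\<^sub>0)) \<and>
           (\<forall>j k. \<forall>\<Psi> \<in> W0_neg_comp s p (frontier \<Omega>\<^sub>0).
              block (zero_neg s p (frontier \<Omega>\<^sub>0)) (scaled_NP_neg s p \<alpha> r \<Omega>\<^sub>0) j k \<Psi> =
              (\<lambda>h \<in> W_test s p (frontier \<Omega>\<^sub>0).
                (r powr ((real j - real k) * \<alpha>)) *\<^sub>R K_tilde_neg s p r \<Omega>\<^sub>0 (int j - int k) \<Psi> h)))"
proof -
  interpret self_similar_boundary r \<Omega>\<^sub>0 "DIM('a) - 1"
    using dim geom by unfold_locales auto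
  show ?thesis
    using K_tilde_W0[OF p] block_positive[OF p] K_tilde_neg_W0[OF p] block_negative[OF p] s by blast
qed

end
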